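(* Let $\gamma:[0,T]\to M$ be an ample geodesic of the affine optimal control problem, with $\gamma(0)=x_0$ and initial covector $\lambda\in T^*_{x_0}M$, and for small $t>0$ let $\mathcal Q_\lambda(t):\mathcal D_{x_0}\to\mathcal D_{x_0}$ be the operator, symmetric with respect to $\langle\cdot|\cdot\rangle_\lambda$, defined by $d^2_{x_0}\dot c_t(v)=\langle\mathcal Q_\lambda(t)v|v\rangle_\lambda$ for $v\in\mathcal D_{x_0}$. Then $t\mapsto t^2\mathcal Q_\lambda(t)$ can be extended to a smooth family of operators on $\mathcal D_{x_0}$ for small $t\ge 0$, symmetric with respect to $\langle\cdot|\cdot\rangle_\lambda$. Moreover $$\mathcal I_\lambda:=\lim_{t\to0^+}t^2\mathcal Q_\lambda(t)\ \ge\ \mathbb I\ >0$$ as operators on $(\mathcal D_{x_0},\langle\cdot|\cdot\rangle_\lambda)$ (where $\mathbb I$ is the identity). Finally $$\frac{d}{dt}\Big|_{t=0}t^2\mathcal Q_\lambda(t)=0 .$$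
   Context: Control system. $M$ is a connected smooth $n$-manifold. An affine control system is a pair $(\mathbb U,f)$, where $\mathbb U\to M$ is a smooth vector bundle of rank $r$ and $f:\mathbb U\to TM$ is a smooth bundle map over $\mathrm{id}_M$, affine on fibres. In a local trivialization $f(x,u)=f_0(x)+\sum_{i=1}^r u_if_i(x)$, with linear part $\bar f(x,u)=\sum_i u_if_i(x)$. Set $\mathcal D_x=\bar f(\mathbb U_x)\subset T_xM$ (the rank may depend on $x$), and let $\overline{\mathcal D}$ be the set of vector fields $\bar f\circ\sigma$, $\sigma$ a smooth section of $\mathbb U$. An admissible curve is a Lipschitz curve $\gamma$ with $\dot\gamma(t)=f(\gamma(t),u(t))$ for a.e. $t$, for a measurable essentially bounded control $u(t)\in\mathbb U_{\gamma(t)}$. $L:\mathbb U\to\mathbb R$ is a smooth Lagrangian, $J_T(u)=\int_0^TL(\gamma(t),u(t))\,dt$. Standing assumptions. (A1) The iterated brackets of the fields $(\mathrm{ad} f_0)^iX$, $i\ge0$, $X\in\overline{\mathcal D}$, span $T_xM$ at every $x$. (A2) $L$ is Tonelli: its restriction to each fibre has positive definite Hessian and superlinear growth. Geodesics. $H(\lambda)=\max_{u\in\mathbb U_x}(\langle\lambda,f(x,u)\rangle-L(x,u))$, $\lambda\in T_x^*M$, is a smooth function on $T^*M$, with Hamiltonian vector field $\vec H$ (assumed complete). A geodesic is a curve $\gamma(t)=\pi(e^{t\vec H}(\lambda))$, $\pi:T^*M\to M$ the projection; $\lambda$ is its initial covector; it is an admissible curve with control the (smooth) maximizer $u(t)$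 along $e^{t\vec H}(\lambda)$. Ample. Let $P_{0,t}$ be the flow from time $0$ to $t$ of the time-dependent field $f_0+\sum_iu_i(t)f_i$ and $C_i(t)=(P_{0,t})_*^{-1}f_i(\gamma(t))\in T_{x_0}M$. The flag of $\gamma$ is $\mathcal F^i_\gamma(t)=\mathrm{span}\{\frac{d^j}{dt^j}v(t):v(t)=\sum_la_l(t)C_l(t),\ a_l\text{ smooth},\ j\le i-1\}=\mathrm{span}\{C_l^{(j)}(t):j\le i-1,\ 1\le l\le r\}$ ($i\ge1$). $\gamma$ is ample at $t$ if $\mathcal F_\gamma^{m}(t)=T_{x_0}M$ for some $m$, and ample if this holds at every $t\in[0,T]$. Geodesic cost. Fix an open relatively compact $M'\subset M$ containing $\gamma$ and let $S_t(x,y)$ be the infimum of $J_t(u)$ over admissible pairs with $\gamma'(0)=x$, $\gamma'(t)=y$ and trajectory $\gamma'\subset M'$. Put $c_t(x)=-S_t(x,\gamma(t))$. For ample $\gamma$, $c_t(x)$ is smooth in $(t,x)$ for small $t>0$ and $x$ near $x_0$ and $\dot c_t=\partial_tc_t$ has a critical point at $x_0$, so that its second differential $d^2_{x_0}\dot c_t$ is a well-defined quadratic form on $T_{x_0}M$. Hamiltonian inner product. Let $H_x=H|_{T_x^*M}$. The second derivative $d_\lambda^2H_x:T_x^*M\to T_xM$ is a nonnegative self-adjoint linear map with image $\mathcal D_x$; $\langle w_1|w_2\rangle_\lambda:=\langle\eta_1,d^2_\lambda H_x(\eta_2)\rangle$ for $w_i=d^2_\lambda H_x(\eta_i)$ defines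 an inner product on $\mathcal D_x$. *)

theory Defs
  imports "HOL-Analysis.Analysis"
begin

section \<open>Smooth maps between open subsets of normed spaces\<close>

text \<open>Meant for open \<open>S\<close> and finite-dimensional domains, where being \<open>k\<close> times continuously
  differentiable is the same as having continuous iterated directional derivatives.\<close>

primrec Ck_on :: "nat \<Rightarrow> 'a::real_normed_vector set \<Rightarrow> ('a \<Rightarrow> 'b::real_normed_vector) \<Rightarrow> bool" where
  "Ck_on 0 S f \<longleftrightarrow> continuous_on S f"
| "Ck_on (Suc k) S f \<longleftrightarrow>
     (\<forall>x\<in>S. f differentiable (at x)) \<and> (\<forall>v. Ck_on k S (\<lambda>x. frechet_derivative f (at x) v))"

definition smooth_on :: "'a::real_normed_vector set \<Rightarrow> ('a \<Rightarrow> 'b::real_normed_vector) \<Rightarrow> bool" where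
  "smooth_on S f \<longleftrightarrow> (\<forall>k. Ck_on k S f)"

text \<open>Curves on an interval which need not be open; derivatives at an end point are one-sided.\<close>

definition smooth_curve_on :: "real set \<Rightarrow> (real \<Rightarrow> 'a::real_normed_vector) \<Rightarrow> bool" where
  "smooth_curve_on I g \<longleftrightarrow>
     (\<exists>D :: nat \<Rightarrow> real \<Rightarrow> 'a. D 0 = g \<and>
        (\<forall>k. \<forall>t\<in>I. (D k has_vector_derivative D (Suc k) t) (at t within I)))"

definition hessian :: "('a::real_normed_vector \<Rightarrow> real) \<Rightarrow> 'a \<Rightarrow> 'a \<Rightarrow> 'a \<Rightarrow> real" where
  "hessian h y v w = frechet_derivative (\<lambda>z. frechet_derivative h (at z) v) (at y) w"


section \<open>Manifold, vector bundle and control system\<close>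

type_synonym ('m, 'n) chart = "'m set \<times> ('m \<Rightarrow> real^'n)"

text \<open>The manifold \<open>M\<close> is the whole type \<open>'m\<close> and the total space of the bundle \<open>U\<close> is the whole
  type \<open>'u\<close>.  A local trivialization \<open>(V, \<tau>)\<close> gives the homeomorphism \<open>e \<mapsto> (proj e, \<tau> e)\<close> from
  \<open>proj -` V\<close> onto \<open>V \<times> \<real>\<^sup>r\<close>.

  The tangent space at \<open>x\<close> is identified with \<open>\<real>\<^sup>n\<close> through one chart at \<open>x\<close>, the chart
  \<open>chart_at S x\<close> below, and its dual with \<open>\<real>\<^sup>n\<close> through the pairing \<open>\<eta> \<bullet> v\<close>.  Thus
  \<open>dyn e\<close> stands for a vector of the tangent space at \<open>proj e\<close>, and a point of the cotangent bundle
  is a pair \<open>(x, \<eta>)\<close>.  The choice of \<open>chart_at S x\<close> is arbitrary in \<open>x\<close>, so smoothness of objects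
  with values in (co)tangent spaces is always expressed by components in a fixed chart
  (\<open>tcomp\<close>, \<open>ccomp\<close>).\<close>

record ('m, 'n::finite, 'u, 'r::finite) control_problem =
  atlas :: "('m, 'n) chart set"
  proj :: "'u \<Rightarrow> 'm"
  trivs :: "('m set \<times> ('u \<Rightarrow> real^'r)) set"
  dyn :: "'u \<Rightarrow> real^'n"
  lag :: "'u \<Rightarrow> real"

definition cinv :: "('m, 'n::finite) chart \<Rightarrow> real^'n \<Rightarrow> 'm" where
  "cinv c = inv_into (fst c) (snd c)"

definition smooth_atlas :: "('m::topological_space, 'n::finite) chart set \<Rightarrow> bool" where
  "smooth_atlas A \<longleftrightarrow>
     (\<Union>c\<in>A. fst c) = UNIV \<and>
     (\<forall>c\<in>A. open (fst c) \<and> open (snd c ` fst c) \<and>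
        homeomorphism (fst c) (snd c ` fst c) (snd c) (cinv c)) \<and>
     (\<forall>c\<in>A. \<forall>d\<in>A. smooth_on (snd c ` (fst c \<inter> fst d)) (snd d \<circ> cinv c))"

definition chart_at :: "('m, 'n::finite, 'u, 'r::finite) control_problem \<Rightarrow> 'm \<Rightarrow> ('m, 'n) chart" where
  "chart_at S x = (SOME c. c \<in> atlas S \<and> x \<in> fst c)"

text \<open>Components, in an arbitrary chart \<open>c\<close> at \<open>x\<close>, of a tangent vector and of a covector at \<open>x\<close>.\<close>

definition tcomp :: "('m, 'n::finite, 'u, 'r::finite) control_problem \<Rightarrow> ('m, 'n) chart
    \<Rightarrow> 'm \<Rightarrow> real^'n \<Rightarrow> real^'n" where
  "tcomp S c x = frechet_derivative (snd c \<circ> cinv (chart_at S x)) (at (snd (chart_at S x) x))"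

definition ccomp :: "('m, 'n::finite, 'u, 'r::finite) control_problem \<Rightarrow> ('m, 'n) chart
    \<Rightarrow> 'm \<Rightarrow> real^'n \<Rightarrow> real^'n" where
  "ccomp S c x \<eta> = (THE p. \<forall>v. p \<bullet> tcomp S c x v = \<eta> \<bullet> v)"

definition velocity :: "('m, 'n::finite, 'u, 'r::finite) control_problem \<Rightarrow> real set
    \<Rightarrow> (real \<Rightarrow> 'm) \<Rightarrow> real \<Rightarrow> real^'n \<Rightarrow> bool" where
  "velocity S I \<gamma> t v \<longleftrightarrow>
     ((\<lambda>s. snd (chart_at S (\<gamma> t)) (\<gamma> s)) has_vector_derivative v) (at t within I)"

text \<open>The differential at \<open>x\<close> of a map \<open>g\<close> from a neighbourhood of \<open>x\<close> to the manifold.\<close>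

definition tangent_map :: "('m, 'n::finite, 'u, 'r::finite) control_problem
    \<Rightarrow> ('m \<Rightarrow> 'm) \<Rightarrow> 'm \<Rightarrow> real^'n \<Rightarrow> real^'n" where
  "tangent_map S g x =
     frechet_derivative (snd (chart_at S (g x)) \<circ> g \<circ> cinv (chart_at S x)) (at (snd (chart_at S x) x))"

text \<open>The fibres carry the vector space structure transported by any of the trivializations; the
  transition condition makes it independent of the choice.\<close>

definition smooth_vector_bundle ::
    "('m::topological_space, 'n::finite, 'u::topological_space, 'r::finite) control_problem \<Rightarrow> bool" where
  "smooth_vector_bundle S \<longleftrightarrow>
     (\<Union>b\<in>trivs S. fst b) = UNIV \<and>
     (\<forall>b\<in>trivs S. open (fst b) \<and> open (proj S -` fst b) \<and>
        (\<exists>k. homeomorphism (proj S -` fst b) (fst b \<times> UNIV) (\<lambda>e. (proj S e, snd b e)) k)) \<and>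
     (\<forall>b\<in>trivs S. \<forall>b'\<in>trivs S. \<exists>G :: 'm \<Rightarrow> real^'r^'r.
        (\<forall>e. proj S e \<in> fst b \<inter> fst b' \<longrightarrow> snd b' e = G (proj S e) *v snd b e) \<and>
        (\<forall>c\<in>atlas S. smooth_on (snd c ` (fst c \<inter> fst b \<inter> fst b')) (G \<circ> cinv c)))"

definition fibre_point :: "('m, 'n::finite, 'u, 'r::finite) control_problem
    \<Rightarrow> 'm set \<times> ('u \<Rightarrow> real^'r) \<Rightarrow> 'm \<Rightarrow> real^'r \<Rightarrow> 'u" where
  "fibre_point S b x w = (THE e. proj S e = x \<and> snd b e = w)"

definition zero_section :: "('m, 'n::finite, 'u, 'r::finite) control_problem \<Rightarrow> 'm \<Rightarrow> 'u" where
  "zero_section S x = fibre_point S (SOME b. b \<in> trivs S \<and> x \<in> fst b) x 0"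

definition smooth_section ::
    "('m, 'n::finite, 'u, 'r::finite) control_problem \<Rightarrow> ('m \<Rightarrow> 'u) \<Rightarrow> bool" where
  "smooth_section S \<sigma> \<longleftrightarrow>
     (\<forall>x. proj S (\<sigma> x) = x) \<and>
     (\<forall>c\<in>atlas S. \<forall>b\<in>trivs S. smooth_on (snd c ` (fst c \<inter> fst b)) (\<lambda>y. snd b (\<sigma> (cinv c y))))"

definition smooth_affine_dynamics ::
    "('m, 'n::finite, 'u, 'r::finite) control_problem \<Rightarrow> bool" where
  "smooth_affine_dynamics S \<longleftrightarrow>
     (\<forall>c\<in>atlas S. \<forall>b\<in>trivs S.
        smooth_on ((snd c ` (fst c \<inter> fst b)) \<times> UNIV)
          (\<lambda>(y, w). tcomp S c (cinv c y) (dyn S (fibre_point S b (cinv c y) w)))) \<and>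
     (\<forall>b\<in>trivs S. \<forall>x\<in>fst b. \<exists>f0 l. linear l \<and> (\<forall>w. dyn S (fibre_point S b x w) = f0 + l w))"

definition smooth_lagrangian ::
    "('m, 'n::finite, 'u, 'r::finite) control_problem \<Rightarrow> bool" where
  "smooth_lagrangian S \<longleftrightarrow>
     (\<forall>c\<in>atlas S. \<forall>b\<in>trivs S.
        smooth_on ((snd c ` (fst c \<inter> fst b)) \<times> UNIV)
          (\<lambda>(y, w). lag S (fibre_point S b (cinv c y) w)))"

definition affine_control_problem ::
    "('m::{t2_space,second_countable_topology}, 'n::finite, 'u::topological_space, 'r::finite)
      control_problem \<Rightarrow> bool" where
  "affine_control_problem S \<longleftrightarrow>
     connected (UNIV :: 'm set) \<and> smooth_atlas (atlas S) \<and> smooth_vector_bundle S \<and>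
     smooth_affine_dynamics S \<and> smooth_lagrangian S"

definition drift :: "('m, 'n::finite, 'u, 'r::finite) control_problem \<Rightarrow> 'm \<Rightarrow> real^'n" where
  "drift S x = dyn S (zero_section S x)"

definition lin_dyn :: "('m, 'n::finite, 'u, 'r::finite) control_problem \<Rightarrow> 'u \<Rightarrow> real^'n" where
  "lin_dyn S e = dyn S e - drift S (proj S e)"

definition distribution :: "('m, 'n::finite, 'u, 'r::finite) control_problem \<Rightarrow> 'm \<Rightarrow> (real^'n) set" where
  "distribution S x = lin_dyn S ` {e. proj S e = x}"


section \<open>The standing assumptions\<close>

definition field_in_chart :: "('m, 'n::finite, 'u, 'r::finite) control_problem \<Rightarrow> ('m, 'n) chart
    \<Rightarrow> ('m \<Rightarrow> real^'n) \<Rightarrow> real^'n \<Rightarrow> real^'n" where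
  "field_in_chart S c X y = tcomp S c (cinv c y) (X (cinv c y))"

definition lie_bracket :: "('m, 'n::finite, 'u, 'r::finite) control_problem
    \<Rightarrow> ('m \<Rightarrow> real^'n) \<Rightarrow> ('m \<Rightarrow> real^'n) \<Rightarrow> 'm \<Rightarrow> real^'n" where
  "lie_bracket S X Y x =
     (let c = chart_at S x; y = snd c x in
        frechet_derivative (field_in_chart S c Y) (at y) (X x)
        - frechet_derivative (field_in_chart S c X) (at y) (Y x))"

inductive_set iterated_brackets ::
    "('m, 'n::finite, 'u, 'r::finite) control_problem \<Rightarrow> ('m \<Rightarrow> real^'n) set"
  for S :: "('m, 'n::finite, 'u, 'r::finite) control_problem" where
  ad: "smooth_section S \<sigma> \<Longrightarrow>
     (lie_bracket S (drift S) ^^ i) (\<lambda>x. lin_dyn S (\<sigma> x)) \<in> iterated_brackets S"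
| bracket: "X \<in> iterated_brackets S \<Longrightarrow> Y \<in> iterated_brackets S \<Longrightarrow>
     lie_bracket S X Y \<in> iterated_brackets S"

definition bracket_generating :: "('m, 'n::finite, 'u, 'r::finite) control_problem \<Rightarrow> bool" where
  "bracket_generating S \<longleftrightarrow> (\<forall>x. span {X x | X. X \<in> iterated_brackets S} = UNIV)"

definition tonelli :: "('m, 'n::finite, 'u, 'r::finite) control_problem \<Rightarrow> bool" where
  "tonelli S \<longleftrightarrow>
     (\<forall>b\<in>trivs S. \<forall>x\<in>fst b.
        (\<forall>w v. v \<noteq> 0 \<longrightarrow> hessian (\<lambda>w'. lag S (fibre_point S b x w')) w v v > 0) \<and>
        filterlim (\<lambda>w. lag S (fibre_point S b x w) / norm w) at_top at_infinity)"


section \<open>Hamiltonian and geodesics\<close>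

text \<open>The supremum is attained, by superlinear growth of the Lagrangian on the fibres.\<close>

definition ham :: "('m, 'n::finite, 'u, 'r::finite) control_problem \<Rightarrow> 'm \<Rightarrow> real^'n \<Rightarrow> real" where
  "ham S x \<eta> = (SUP e\<in>{e. proj S e = x}. \<eta> \<bullet> dyn S e - lag S e)"

definition maximizer :: "('m, 'n::finite, 'u, 'r::finite) control_problem \<Rightarrow> 'm \<Rightarrow> real^'n \<Rightarrow> 'u" where
  "maximizer S x \<eta> =
     (THE e. proj S e = x \<and>
        (\<forall>e'. proj S e' = x \<longrightarrow> \<eta> \<bullet> dyn S e' - lag S e' \<le> \<eta> \<bullet> dyn S e - lag S e))"

text \<open>The Hamiltonian in the canonical coordinates \<open>(y, p)\<close> of the cotangent bundle given by the
  chart \<open>c\<close>: the covector at \<open>x\<close> with components \<open>p\<close> is \<open>p \<circ> tcomp S c x\<close>.\<close>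

definition ham_in_chart :: "('m, 'n::finite, 'u, 'r::finite) control_problem \<Rightarrow> ('m, 'n) chart
    \<Rightarrow> real^'n \<Rightarrow> real^'n \<Rightarrow> real" where
  "ham_in_chart S c y p = ham S (cinv c y) (adjoint (tcomp S c (cinv c y)) p)"

text \<open>Integral curves, defined for all times, of the Hamiltonian vector field: Hamilton's equations
  \<open>y' = \<partial>H/\<partial>p\<close>, \<open>p' = -\<partial>H/\<partial>y\<close> in all canonical coordinates.\<close>

definition hamiltonian_curve ::
    "('m::topological_space, 'n::finite, 'u, 'r::finite) control_problem \<Rightarrow> (real \<Rightarrow> 'm \<times> (real^'n)) \<Rightarrow> bool" where
  "hamiltonian_curve S \<Lambda> \<longleftrightarrow>
     continuous_on UNIV (\<lambda>t. fst (\<Lambda> t)) \<and>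
     (\<forall>t. \<forall>c\<in>atlas S. fst (\<Lambda> t) \<in> fst c \<longrightarrow>
        (let q = (\<lambda>s. snd c (fst (\<Lambda> s))); p = (\<lambda>s. ccomp S c (fst (\<Lambda> s)) (snd (\<Lambda> s))) in
          \<exists>q' p'. (q has_vector_derivative q') (at t) \<and> (p has_vector_derivative p') (at t) \<and>
            (\<forall>\<zeta>. frechet_derivative (\<lambda>\<xi>. ham_in_chart S c (q t) \<xi>) (at (p t)) \<zeta> = \<zeta> \<bullet> q') \<and>
            (\<forall>v. frechet_derivative (\<lambda>y. ham_in_chart S c y (p t)) (at (q t)) v = - (p' \<bullet> v))))"

definition complete_hamiltonian_field ::
    "('m::topological_space, 'n::finite, 'u, 'r::finite) control_problem \<Rightarrow> bool" where
  "complete_hamiltonian_field S \<longleftrightarrow> (\<forall>z. \<exists>\<Lambda>. hamiltonian_curve S \<Lambda> \<and> \<Lambda> 0 = z)"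

text \<open>\<open>\<gamma>\<close>, on \<open>[0,T]\<close>, is the geodesic with initial covector \<open>\<eta>\<close> at \<open>x\<^sub>0\<close>, and \<open>u\<close> is its control.\<close>

definition geodesic :: "('m::topological_space, 'n::finite, 'u, 'r::finite) control_problem \<Rightarrow> real
    \<Rightarrow> 'm \<Rightarrow> real^'n \<Rightarrow> (real \<Rightarrow> 'm) \<Rightarrow> (real \<Rightarrow> 'u) \<Rightarrow> bool" where
  "geodesic S T x\<^sub>0 \<eta> \<gamma> u \<longleftrightarrow>
     (\<exists>\<Lambda>. hamiltonian_curve S \<Lambda> \<and> \<Lambda> 0 = (x\<^sub>0, \<eta>) \<and>
        (\<forall>t\<in>{0..T}. \<gamma> t = fst (\<Lambda> t) \<and> u t = maximizer S (fst (\<Lambda> t)) (snd (\<Lambda> t))))"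


section \<open>Ample geodesics\<close>

text \<open>A smooth frame \<open>E t x : \<real>\<^sup>r \<rightarrow> U\<^sub>x\<close> of the bundle over a neighbourhood \<open>W\<close> of the graph of
  \<open>\<gamma>\<close> in \<open>\<real> \<times> M\<close>.  If \<open>\<gamma>\<close> stays in one trivializing open set of \<open>M\<close>, the frame of that local
  trivialization is an instance, with \<open>E\<close> independent of \<open>t\<close>; the dependence on \<open>t\<close> is needed
  because in general no neighbourhood of the trace of \<open>\<gamma>\<close> in \<open>M\<close> trivializes the bundle.\<close>

definition frame_along :: "('m::topological_space, 'n::finite, 'u, 'r::finite) control_problem \<Rightarrow> real
    \<Rightarrow> (real \<Rightarrow> 'm) \<Rightarrow> (real \<times> 'm) set \<Rightarrow> (real \<Rightarrow> 'm \<Rightarrow> real^'r \<Rightarrow> 'u) \<Rightarrow> bool" where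
  "frame_along S T \<gamma> W E \<longleftrightarrow>
     open W \<and> (\<forall>t\<in>{0..T}. (t, \<gamma> t) \<in> W) \<and>
     (\<forall>(t, x)\<in>W. \<forall>w. proj S (E t x w) = x) \<and>
     (\<forall>(t, x)\<in>W. \<forall>b\<in>trivs S. x \<in> fst b \<longrightarrow>
        linear (\<lambda>w. snd b (E t x w)) \<and> bij (\<lambda>w. snd b (E t x w))) \<and>
     (\<forall>c\<in>atlas S. \<forall>b\<in>trivs S. \<forall>w.
        smooth_on {(t, y). y \<in> snd c ` (fst c \<inter> fst b) \<and> (t, cinv c y) \<in> W}
          (\<lambda>(t, y). snd b (E t (cinv c y) w)))"

text \<open>The time-dependent field \<open>f\<^sub>0 + \<Sum>\<^sub>i u\<^sub>i(t) f\<^sub>i\<close>, where the \<open>u\<^sub>i(t)\<close> are the coordinates of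
  \<open>u t\<close> in the frame at \<open>(t, \<gamma> t)\<close>.\<close>

definition control_field :: "('m, 'n::finite, 'u, 'r::finite) control_problem
    \<Rightarrow> (real \<Rightarrow> 'm) \<Rightarrow> (real \<Rightarrow> 'u) \<Rightarrow> (real \<Rightarrow> 'm \<Rightarrow> real^'r \<Rightarrow> 'u) \<Rightarrow> real \<Rightarrow> 'm \<Rightarrow> real^'n" where
  "control_field S \<gamma> u E t x = dyn S (E t x (THE w. E t (\<gamma> t) w = u t))"

text \<open>\<open>P t\<close> is the flow from time \<open>0\<close> to time \<open>t\<close> of the time-dependent field \<open>X\<close>, near \<open>x\<^sub>0\<close>.\<close>

definition local_flow :: "('m::topological_space, 'n::finite, 'u, 'r::finite) control_problem \<Rightarrow> real
    \<Rightarrow> 'm \<Rightarrow> (real \<times> 'm) set \<Rightarrow> (real \<Rightarrow> 'm \<Rightarrow> real^'n) \<Rightarrow> (real \<Rightarrow> 'm \<Rightarrow> 'm) \<Rightarrow> bool" where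
  "local_flow S T x\<^sub>0 W X P \<longleftrightarrow>
     (\<exists>N. open N \<and> x\<^sub>0 \<in> N \<and>
        (\<forall>x\<in>N. P 0 x = x \<and> continuous_on {0..T} (\<lambda>t. P t x) \<and>
           (\<forall>t\<in>{0..T}. (t, P t x) \<in> W \<and> velocity S {0..T} (\<lambda>s. P s x) t (X t (P t x)))))"

definition pulled_back_frame :: "('m, 'n::finite, 'u, 'r::finite) control_problem
    \<Rightarrow> (real \<Rightarrow> 'm) \<Rightarrow> (real \<Rightarrow> 'm \<Rightarrow> real^'r \<Rightarrow> 'u) \<Rightarrow> (real \<Rightarrow> 'm \<Rightarrow> 'm) \<Rightarrow> 'r \<Rightarrow> real \<Rightarrow> real^'n" where
  "pulled_back_frame S \<gamma> E P l t =
     inv (tangent_map S (P t) (\<gamma> 0)) (lin_dyn S (E t (\<gamma> t) (axis l 1)))"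

definition flag :: "('m, 'n::finite, 'u, 'r::finite) control_problem \<Rightarrow> real
    \<Rightarrow> (real \<Rightarrow> 'm) \<Rightarrow> (real \<Rightarrow> 'm \<Rightarrow> real^'r \<Rightarrow> 'u) \<Rightarrow> (real \<Rightarrow> 'm \<Rightarrow> 'm) \<Rightarrow> nat \<Rightarrow> real \<Rightarrow> (real^'n) set" where
  "flag S T \<gamma> E P i t =
     span {((\<lambda>g s. vector_derivative g (at s within {0..T})) ^^ j) (pulled_back_frame S \<gamma> E P l) t
           | j l. j < i}"

text \<open>The flag does not depend on the frame.\<close>

definition ample :: "('m::topological_space, 'n::finite, 'u, 'r::finite) control_problem \<Rightarrow> real
    \<Rightarrow> (real \<Rightarrow> 'm) \<Rightarrow> (real \<Rightarrow> 'u) \<Rightarrow> bool" where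
  "ample S T \<gamma> u \<longleftrightarrow>
     (\<exists>W E P. frame_along S T \<gamma> W E \<and> local_flow S T (\<gamma> 0) W (control_field S \<gamma> u E) P \<and>
        (\<forall>t\<in>{0..T}. \<exists>m. flag S T \<gamma> E P m t = UNIV))"


section \<open>Geodesic cost\<close>

definition lipschitz_curve :: "('m::topological_space, 'n::finite, 'u, 'r::finite) control_problem
    \<Rightarrow> real \<Rightarrow> (real \<Rightarrow> 'm) \<Rightarrow> bool" where
  "lipschitz_curve S T \<gamma> \<longleftrightarrow>
     continuous_on {0..T} \<gamma> \<and>
     (\<forall>t\<in>{0..T}. \<forall>c\<in>atlas S. \<gamma> t \<in> fst c \<longrightarrow>
        (\<exists>\<delta>>0. \<exists>K. K-lipschitz_on ({0..T} \<inter> ball t \<delta>) (\<lambda>s. snd c (\<gamma> s))))"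

definition admissible :: "('m::topological_space, 'n::finite, 'u::topological_space, 'r::finite) control_problem
    \<Rightarrow> real \<Rightarrow> (real \<Rightarrow> 'm) \<Rightarrow> (real \<Rightarrow> 'u) \<Rightarrow> bool" where
  "admissible S T \<gamma> u \<longleftrightarrow>
     lipschitz_curve S T \<gamma> \<and>
     u \<in> measurable (lebesgue_on {0..T}) borel \<and>
     (\<forall>t\<in>{0..T}. proj S (u t) = \<gamma> t) \<and>
     (\<exists>K. compact K \<and> (AE t in lebesgue_on {0..T}. u t \<in> K)) \<and>
     (AE t in lebesgue_on {0..T}. velocity S {0..T} \<gamma> t (dyn S (u t)))"

definition action :: "('m, 'n::finite, 'u, 'r::finite) control_problem \<Rightarrow> real \<Rightarrow> (real \<Rightarrow> 'u) \<Rightarrow> real" where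
  "action S T u = (LINT t:{0..T}|lebesgue. lag S (u t))"

definition value_fun :: "('m::topological_space, 'n::finite, 'u::topological_space, 'r::finite) control_problem
    \<Rightarrow> 'm set \<Rightarrow> real \<Rightarrow> 'm \<Rightarrow> 'm \<Rightarrow> ereal" where
  "value_fun S M' t x y =
     Inf {ereal (action S t u) | \<gamma> u.
            admissible S t \<gamma> u \<and> \<gamma> 0 = x \<and> \<gamma> t = y \<and> \<gamma> ` {0..t} \<subseteq> M'}"

definition cost :: "('m::topological_space, 'n::finite, 'u::topological_space, 'r::finite) control_problem
    \<Rightarrow> 'm set \<Rightarrow> (real \<Rightarrow> 'm) \<Rightarrow> real \<Rightarrow> 'm \<Rightarrow> ereal" where
  "cost S M' \<gamma> t x = - value_fun S M' t x (\<gamma> t)"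

text \<open>\<open>g\<close> is smooth near its critical point \<open>x\<close>, and \<open>q\<close> is its second differential there.\<close>

definition second_differential_at_critical ::
    "('m, 'n::finite, 'u, 'r::finite) control_problem \<Rightarrow> ('m \<Rightarrow> real) \<Rightarrow> 'm \<Rightarrow> (real^'n \<Rightarrow> real) \<Rightarrow> bool" where
  "second_differential_at_critical S g x q \<longleftrightarrow>
     (let c = chart_at S x; y = snd c x; h = g \<circ> cinv c in
        (\<exists>V. open V \<and> y \<in> V \<and> V \<subseteq> snd c ` fst c \<and> smooth_on V h) \<and>
        frechet_derivative h (at y) = (\<lambda>v. 0) \<and>
        q = (\<lambda>v. hessian h y v v))"

text \<open>\<open>q\<close> is the second differential at \<open>x\<^sub>0\<close> of the time derivative of the cost at time \<open>t\<close>,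
  including its existence.\<close>

definition cost_rate_second_differential ::
    "('m::topological_space, 'n::finite, 'u::topological_space, 'r::finite) control_problem
      \<Rightarrow> 'm set \<Rightarrow> (real \<Rightarrow> 'm) \<Rightarrow> 'm \<Rightarrow> real \<Rightarrow> (real^'n \<Rightarrow> real) \<Rightarrow> bool" where
  "cost_rate_second_differential S M' \<gamma> x\<^sub>0 t q \<longleftrightarrow>
     (\<exists>N g. open N \<and> x\<^sub>0 \<in> N \<and>
        (\<forall>x\<in>N. (\<forall>\<^sub>F s in nhds t. \<bar>cost S M' \<gamma> s x\<bar> \<noteq> \<infinity>) \<and>
           ((\<lambda>s. real_of_ereal (cost S M' \<gamma> s x)) has_real_derivative g x) (at t)) \<and>
        second_differential_at_critical S g x\<^sub>0 q)"


section \<open>Hamiltonian inner product and the operators \<open>\<Q>\<^sub>\<lambda>(t)\<close>\<close>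

definition ham_second_derivative :: "('m, 'n::finite, 'u, 'r::finite) control_problem
    \<Rightarrow> 'm \<Rightarrow> real^'n \<Rightarrow> real^'n \<Rightarrow> real^'n" where
  "ham_second_derivative S x \<eta> =
     frechet_derivative (\<lambda>\<zeta>. \<chi> i. frechet_derivative (ham S x) (at \<zeta>) (axis i 1)) (at \<eta>)"

definition ham_inner :: "('m, 'n::finite, 'u, 'r::finite) control_problem
    \<Rightarrow> 'm \<Rightarrow> real^'n \<Rightarrow> real^'n \<Rightarrow> real^'n \<Rightarrow> real" where
  "ham_inner S x \<eta> w1 w2 =
     (THE a. \<exists>\<zeta>1 \<zeta>2. w1 = ham_second_derivative S x \<eta> \<zeta>1 \<and> w2 = ham_second_derivative S x \<eta> \<zeta>2 \<and>
        a = \<zeta>1 \<bullet> ham_second_derivative S x \<eta> \<zeta>2)"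

text \<open>\<open>A\<close> restricts to a linear operator on the distribution at \<open>x\<close>, symmetric with respect to the
  Hamiltonian inner product; its values off the distribution are irrelevant.\<close>

definition symmetric_operator :: "('m, 'n::finite, 'u, 'r::finite) control_problem
    \<Rightarrow> 'm \<Rightarrow> real^'n \<Rightarrow> (real^'n \<Rightarrow> real^'n) \<Rightarrow> bool" where
  "symmetric_operator S x \<eta> A \<longleftrightarrow>
     (\<forall>v\<in>distribution S x. A v \<in> distribution S x) \<and>
     (\<forall>v\<in>distribution S x. \<forall>w\<in>distribution S x. \<forall>a b. A (a *\<^sub>R v + b *\<^sub>R w) = a *\<^sub>R A v + b *\<^sub>R A w) \<and>
     (\<forall>v\<in>distribution S x. \<forall>w\<in>distribution S x. ham_inner S x \<eta> (A v) w = ham_inner S x \<eta> v (A w))"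

definition is_cost_operator ::
    "('m::topological_space, 'n::finite, 'u::topological_space, 'r::finite) control_problem
      \<Rightarrow> 'm set \<Rightarrow> (real \<Rightarrow> 'm) \<Rightarrow> 'm \<Rightarrow> real^'n \<Rightarrow> real \<Rightarrow> (real^'n \<Rightarrow> real^'n) \<Rightarrow> bool" where
  "is_cost_operator S M' \<gamma> x\<^sub>0 \<eta> t A \<longleftrightarrow>
     symmetric_operator S x\<^sub>0 \<eta> A \<and>
     (\<exists>q. cost_rate_second_differential S M' \<gamma> x\<^sub>0 t q \<and>
        (\<forall>v\<in>distribution S x\<^sub>0. q v = ham_inner S x\<^sub>0 \<eta> (A v) v))"

text \<open>\<open>is_cost_operator\<close> determines the operator only on \<open>distribution S x\<^sub>0\<close>, hence \<open>SOME\<close>.\<close>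

definition cost_operator ::
    "('m::topological_space, 'n::finite, 'u::topological_space, 'r::finite) control_problem
      \<Rightarrow> 'm set \<Rightarrow> (real \<Rightarrow> 'm) \<Rightarrow> 'm \<Rightarrow> real^'n \<Rightarrow> real \<Rightarrow> real^'n \<Rightarrow> real^'n" where
  "cost_operator S M' \<gamma> x\<^sub>0 \<eta> t = (SOME A. is_cost_operator S M' \<gamma> x\<^sub>0 \<eta> t A)"

end

(* In a chart, embed the geodesic in a field of extremals: for small s, let a(s,x,p) = <p,y> + A,
where the extremal with initial covector p that reaches x at time s starts at y and has action A. This is
a complete integral of the Hamilton-Jacobi equation. By Fenchel's inequality a(s,.,p) calibrates the problem, and a
curve which leaves the chart is too expensive, so for small t the extremals are optimal and the cost c_t
is a Legendre-type transform of a(t,gamma(t),.). Put W(t) = - d^2_p a(t,gamma(t),.). Then W(0) = 0, and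
W'(t) is the Hessian of H in the fibre pulled back by a smooth linear map, in particular W' >= 0 and
W'(0) = G := d^2 H. Differentiating the cost twice gives t^2 Q(t) = F(t) - t F'(t) on the range of G, with
F(t) = t G W(t)^-1 G. If W(t) were flat in some direction, the pairings with the fields C_l(t) would be
flat too, so ampleness implies that det W vanishes to finite order and F is a Laurent series. Its values
are bounded: W is increasing, so the form p W(s) p at p = W(t)^-1 G v is at most its value for s = t; being
up to high order a polynomial in s/t, it controls its linear coefficient p G p, and Cauchy-Schwarz
closes the estimate. Hence F is smooth, F - t F' has derivative 0 at 0, and F(0) >= G because
W(t) = t G + o(t) and 2 <v,q> - <q,Wq> is maximal at q = W^-1 v. *)
theory Submission
 imports Defs
begin

text \<open>The obstacle is that \<open>G\<close> is degenerate unless the distribution is the whole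
  tangent space. Then \<open>W(t)^-1\<close> has a pole of unknown order at 0, and only its
  compression \<open>G W(t)^-1 G\<close> has a simple one. Ampleness makes the order finite, and
  compactness of the sphere gives one exponent for all directions; the simple pole of the
  compression then comes from an estimate, not from a normal form of \<open>W\<close>. The linear
  initial function \<open><p, y>\<close> keeps the field of extremals regular down to time 0, where
  the map from initial to final positions is the identity; the singularity appears only when
  \<open>p\<close> is eliminated to obtain the cost. The flow that defines the flag uses an
  arbitrary frame, hence a feedback other than that of the extremals. The two linearized flows
  differ by a term with values in the distribution, and in a flat direction its pairing is flat as
  well. Competitors are differentiable only almost everywhere, so comparing actions requires a
  fundamental theorem of calculus for Lipschitz functions.\<close>

abbreviation sym_interval :: "real => real set" ("{+-_}") where "{+-e} \<equiv> {-e<..<e}"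

section \<open>Calculus of smooth maps\<close>

lemma linear_Basis_expansion:
 fixes g :: "'a::euclidean_space => 'b::real_normed_vector"
 shows "linear g ==> g v = (\<Sum>i\<in>Basis. (v \<bullet> i) *\<^sub>R g i)"
 by (subst euclidean_representation[of v, symmetric]) (simp add: linear_sum linear_cmul del: euclidean_representation)

lemma Ck_SucD:
 "Ck_on (Suc k) S f ==> x \<in> S ==> (f has_derivative frechet_derivative f (at x)) (at x)"
 by (simp add: frechet_derivative_works)

text \<open>Openness of \<open>S\<close> is what lets values on \<open>S\<close> determine
  derivatives at points of \<open>S\<close>.\<close>

lemma Ck_cong:
 assumes "open S" "!!x. x \<in> S ==> f x = g x" "Ck_on k S f"
 shows "Ck_on k S g"
 using assms(2,3)
proof (induction k arbitrary: f g)
 case 0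
 then show ?case by (simp cong: continuous_on_cong)
next
 case (Suc k)
 have d: "(g has_derivative frechet_derivative f (at x)) (at x)" if "x \<in> S" for x
  using Ck_SucD[OF Suc.prems(2) that] assms(1) that
  by (rule has_derivative_transform_within_open) (use Suc.prems(1) in auto)
 then have "frechet_derivative f (at x) = frechet_derivative g (at x)" if "x \<in> S" for x
  using frechet_derivative_at that by blast
 then have "Ck_on k S (\<lambda>x. frechet_derivative g (at x) v)" for v
  using Suc.IH[of "\<lambda>x. frechet_derivative f (at x) v" "\<lambda>x. frechet_derivative g (at x) v"] Suc.prems(2)
  by simp
 with d show ?case by (auto simp: differentiable_def)
qed

lemma Ck_SucI:
 assumes "open S" "!!x. x \<in> S ==> (f has_derivative f' x) (at x)"
  and "!!v. Ck_on k S (\<lambda>x. f' x v)"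
 shows "Ck_on (Suc k) S f"
proof -
 have "Ck_on k S (\<lambda>x. frechet_derivative f (at x) v)" for v
  by (rule Ck_cong[OF assms(1) _ assms(3)[of v]]) (metis assms(2) frechet_derivative_at)
 then show ?thesis using assms(2) by (auto simp: differentiable_def)
qed

lemma Ck_continuous: "Ck_on k S f ==> continuous_on S f"
proof (cases k)
 case (Suc j)
 assume "Ck_on k S f"
 then have "continuous (at x) f" if "x \<in> S" for x
  using that Suc by (auto intro: differentiable_imp_continuous_within)
 then show ?thesis by (simp add: continuous_at_imp_continuous_on)
qed simp

lemma Ck_Suc_imp: "Ck_on (Suc k) S f ==> Ck_on k S f"
proof (induction k arbitrary: f)
 case 0
 then show ?case using Ck_continuous[OF 0] by simp
next
 case (Suc k)
 from Suc.prems show ?case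
  unfolding Ck_on.simps(2)[of "Suc k" S f] Ck_on.simps(2)[of k S f] using Suc.IH by blast
qed

lemma Ck_subset: "Ck_on k S f ==> T \<subseteq> S ==> Ck_on k T f"
 by (induction k arbitrary: f) (auto intro: continuous_on_subset)

lemma Ck_local:
 assumes "!!x. x \<in> S ==> \<exists>T. open T \<and> x \<in> T \<and> Ck_on k T f"
 shows "Ck_on k S f"
 using assms
proof (induction k arbitrary: f)
 case 0
 have "continuous (at x within S) f" if "x \<in> S" for x
  using 0[OF that] by (metis Ck_on.simps(1) continuous_at_imp_continuous_at_within continuous_on_eq_continuous_at)
 then show ?case by (simp add: continuous_on_eq_continuous_within)
next
 case (Suc k)
 have "f differentiable at x" if "x \<in> S" for x
  using Suc.prems[OF that] by auto
 moreover have "Ck_on k S (\<lambda>x. frechet_derivative f (at x) v)" for v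
  by (rule Suc.IH) (use Suc.prems in "metis Ck_on.simps(2)")
 ultimately show ?case by simp
qed

lemma Ck_const: "Ck_on k S (\<lambda>x. c)"
 by (induction k arbitrary: c) simp_all

lemma Ck_linear_compose:
 assumes "open S" "bounded_linear L" "Ck_on k S f"
 shows "Ck_on k S (\<lambda>x. L (f x))"
 using assms(3)
proof (induction k arbitrary: f)
 case 0
 then show ?case using assms(2) by (simp add: bounded_linear.continuous_on)
next
 case (Suc k)
 show ?case
  by (rule Ck_SucI[OF assms(1) bounded_linear.has_derivative[OF assms(2) Ck_SucD[OF Suc.prems]]])
   (use Suc in simp_all)
qed

lemma Ck_bounded_linear:
 assumes "open S" "bounded_linear L"
 shows "Ck_on k S L"
proof (cases k)
 case 0
 then show ?thesis using assms(2) by (simp add: linear_continuous_on)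
next
 case (Suc j)
 show ?thesis unfolding Suc
  by (rule Ck_SucI[OF assms(1) bounded_linear_imp_has_derivative[OF assms(2)] Ck_const])
qed

lemma Ck_add:
 assumes "open S" "Ck_on k S f" "Ck_on k S g"
 shows "Ck_on k S (\<lambda>x. f x + g x)"
 using assms(2,3)
proof (induction k arbitrary: f g)
 case 0
 then show ?case by (simp add: continuous_on_add)
next
 case (Suc k)
 show ?case
  by (rule Ck_SucI[OF assms(1) has_derivative_add[OF Ck_SucD[OF Suc.prems(1)] Ck_SucD[OF Suc.prems(2)]]])
   (use Suc in simp_all)
qed

lemma Ck_bilinear:
 assumes "open S" "bounded_bilinear B" "Ck_on k S f" "Ck_on k S g"
 shows "Ck_on k S (\<lambda>x. B (f x) (g x))"
 using assms(3,4)
proof (induction k arbitrary: f g)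
 case 0
 then show ?case by (simp add: assms(2) bounded_bilinear.continuous_on)
next
 case (Suc k)
 show ?case
  by (rule Ck_SucI[OF assms(1) bounded_bilinear.FDERIV[OF assms(2) Ck_SucD[OF Suc.prems(1)] Ck_SucD[OF Suc.prems(2)]]],
   assumption, assumption, intro Ck_add assms(1) Suc.IH Ck_Suc_imp[OF Suc.prems(1)] Ck_Suc_imp[OF Suc.prems(2)]
    Suc.prems(1)[unfolded Ck_on.simps(2), THEN conjunct2, rule_format]
    Suc.prems(2)[unfolded Ck_on.simps(2), THEN conjunct2, rule_format])
qed

lemma Ck_sum:
 assumes "open S" "!!i. i \<in> I ==> Ck_on k S (f i)"
 shows "Ck_on k S (\<lambda>x. \<Sum>i\<in>I. f i x)"
proof (cases "finite I")
 case True
 then show ?thesis using assms(2)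
  by (induction I rule: finite_induct) (auto intro!: Ck_const Ck_add assms(1))
next
 case False
 then show ?thesis by (simp add: Ck_const)
qed

text \<open>The chain rule gives a derivative of \<open>f\<close> in a direction that varies with
  \<open>x\<close>. Expanding that direction over \<open>Basis\<close> leaves derivatives of
  \<open>f\<close> in fixed directions, to which the induction hypothesis applies; the inner map
  \<open>g\<close> stays fixed.\<close>

lemma Ck_compose:
 fixes f :: "'b::euclidean_space => 'c::real_normed_vector"
 assumes "open S" "open T" "g ` S \<subseteq> T" "Ck_on k T f" "Ck_on k S g"
 shows "Ck_on k S (\<lambda>x. f (g x))"
 using assms(4,5)
proof (induction k arbitrary: f)
 case 0
 then show ?case using assms(3) by (auto intro: continuous_on_compose2)
next
 case (Suc k)
 have d: "((\<lambda>x. f (g x)) has_derivative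
   (\<lambda>v. \<Sum>i\<in>Basis. (frechet_derivative g (at x) v \<bullet> i) *\<^sub>R frechet_derivative f (at (g x)) i)) (at x)"
  if x: "x \<in> S" for x
 proof -
  have gx: "g x \<in> T" using x assms(3) by auto
  have l: "linear (frechet_derivative f (at (g x)))"
   using Ck_SucD[OF Suc.prems(1) gx] by (rule has_derivative_linear)
  have "frechet_derivative f (at (g x)) (frechet_derivative g (at x) v) =
   (\<Sum>i\<in>Basis. (frechet_derivative g (at x) v \<bullet> i) *\<^sub>R frechet_derivative f (at (g x)) i)" for v
   by (rule linear_Basis_expansion[OF l])
  then show ?thesis
   using has_derivative_compose[OF Ck_SucD[OF Suc.prems(2) x] Ck_SucD[OF Suc.prems(1) gx]]
   by simp
 qed
 show ?case
 proof (rule Ck_SucI[OF assms(1) d])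
  fix v
  show "Ck_on k S (\<lambda>x. \<Sum>i\<in>Basis. (frechet_derivative g (at x) v \<bullet> i) *\<^sub>R frechet_derivative f (at (g x)) i)"
  proof (intro Ck_sum Ck_bilinear[OF _ bounded_bilinear_scaleR] assms(1))
   fix i :: 'b
   show "Ck_on k S (\<lambda>x. frechet_derivative g (at x) v \<bullet> i)"
    by (rule Ck_linear_compose[OF assms(1) bounded_linear_inner_left]) (use Suc in simp)
   show "Ck_on k S (\<lambda>x. frechet_derivative f (at (g x)) i)"
    by (rule Suc.IH) (use Suc.prems Ck_Suc_imp[OF Suc.prems(2)] in auto)
  qed
 qed
qed

lemma Ck_Pair:
 assumes "open S" "Ck_on k S f" "Ck_on k S g"
 shows "Ck_on k S (\<lambda>x. (f x, g x))"
 using assms(2,3)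
proof (induction k arbitrary: f g)
 case 0
 then show ?case by (simp add: continuous_on_Pair)
next
 case (Suc k)
 show ?case
  by (rule Ck_SucI[OF assms(1) has_derivative_Pair[OF Ck_SucD[OF Suc.prems(1)] Ck_SucD[OF Suc.prems(2)]]])
   (use Suc in simp_all)
qed

lemma Ck_inverse:
 fixes f :: "'a::real_normed_vector => real"
 assumes "open S" "Ck_on k S f" "!!x. x \<in> S ==> f x \<noteq> 0"
 shows "Ck_on k S (\<lambda>x. inverse (f x))"
 using assms(2)
proof (induction k)
 case 0
 then show ?case using assms(3) by (simp add: continuous_on_inverse)
next
 case (Suc k)
 have i: "Ck_on k S (\<lambda>x. inverse (f x))"
  using Suc Ck_Suc_imp by blast
 show ?case
 proof (rule Ck_SucI[OF assms(1) Deriv.has_derivative_inverse[OF assms(3) Ck_SucD[OF Suc.prems]]])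
  fix v
  have "Ck_on k S (\<lambda>x. -1 * (inverse (f x) * frechet_derivative f (at x) v * inverse (f x)))"
   by (intro Ck_bilinear[OF assms(1) bounded_bilinear_mult] i Ck_const) (use Suc.prems in simp)
  then show "Ck_on k S (\<lambda>x. - (inverse (f x) * frechet_derivative f (at x) v * inverse (f x)))"
   by simp
 qed simp_all
qed

subsection \<open>Smoothness\<close>

abbreviation dd :: "'a::real_normed_vector => ('a => 'b::real_normed_vector) => 'a => 'b" where
 "dd v f x \<equiv> frechet_derivative f (at x) v"

lemma smooth_cong:
 "open S ==> smooth_on S f ==> (!!x. x \<in> S ==> f x = g x) ==> smooth_on S g"
 unfolding smooth_on_def using Ck_cong by blast

lemma smooth_deriv:
 "smooth_on S f ==> x \<in> S ==> (f has_derivative frechet_derivative f (at x)) (at x)"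
 unfolding smooth_on_def using Ck_SucD by blast

lemma smooth_diffble: "smooth_on S f ==> x \<in> S ==> f differentiable (at x)"
 using smooth_deriv differentiableI by blast

lemma linear_dd: "smooth_on S f ==> x \<in> S ==> linear (\<lambda>v. dd v f x)"
 using smooth_deriv has_derivative_linear by blast

lemma smooth_continuous: "smooth_on S f ==> continuous_on S f"
 unfolding smooth_on_def using Ck_continuous by blast

lemma smooth_isCont: "smooth_on S f ==> x \<in> S ==> isCont f x"
 using smooth_deriv has_derivative_continuous by blast

lemma smooth_subset: "smooth_on S f ==> T \<subseteq> S ==> smooth_on T f"
 unfolding smooth_on_def using Ck_subset by blast

lemma smooth_local:
 "(!!x. x \<in> S ==> \<exists>T. open T \<and> x \<in> T \<and> smooth_on T f) ==> smooth_on S f"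
 unfolding smooth_on_def using Ck_local by meson

lemma smooth_dd: "smooth_on S f ==> smooth_on S (dd v f)"
 unfolding smooth_on_def by (metis Ck_on.simps(2))

lemma smooth_const [simp]: "smooth_on S (\<lambda>x. c)"
 unfolding smooth_on_def by (simp add: Ck_const)

lemma smooth_linear_compose:
 "open S ==> bounded_linear L ==> smooth_on S f ==> smooth_on S (\<lambda>x. L (f x))"
 unfolding smooth_on_def using Ck_linear_compose by blast

lemma smooth_linear: "open S ==> bounded_linear L ==> smooth_on S L"
 unfolding smooth_on_def using Ck_bounded_linear by blast

lemma smooth_id: "open S ==> smooth_on S (\<lambda>x. x)"
 by (rule smooth_linear[OF _ bounded_linear_ident])

lemma smooth_fst: "open S ==> smooth_on S f ==> smooth_on S (\<lambda>x. fst (f x))"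
 by (rule smooth_linear_compose[OF _ bounded_linear_fst])

lemma smooth_snd: "open S ==> smooth_on S f ==> smooth_on S (\<lambda>x. snd (f x))"
 by (rule smooth_linear_compose[OF _ bounded_linear_snd])

lemma smooth_bilinear:
 "open S ==> bounded_bilinear B ==> smooth_on S f ==> smooth_on S g ==> smooth_on S (\<lambda>x. B (f x) (g x))"
 unfolding smooth_on_def using Ck_bilinear by blast

lemmas smooth_scaleR = smooth_bilinear[OF _ bounded_bilinear_scaleR]
lemmas smooth_inner = smooth_bilinear[OF _ bounded_bilinear_inner]

lemma smooth_mult:
 fixes f g :: "'a::real_normed_vector => real"
 shows "open S ==> smooth_on S f ==> smooth_on S g ==> smooth_on S (\<lambda>x. f x * g x)"
 by (rule smooth_bilinear[OF _ bounded_bilinear_mult])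

lemma smooth_add: "open S ==> smooth_on S f ==> smooth_on S g ==> smooth_on S (\<lambda>x. f x + g x)"
 unfolding smooth_on_def using Ck_add by blast

lemma smooth_minus: "open S ==> smooth_on S f ==> smooth_on S (\<lambda>x. - f x)"
 by (rule smooth_linear_compose[OF _ bounded_linear_minus[OF bounded_linear_ident]])

lemma smooth_diff: "open S ==> smooth_on S f ==> smooth_on S g ==> smooth_on S (\<lambda>x. f x - g x)"
 using smooth_add[of S f "\<lambda>x. - g x"] smooth_minus[of S g] by simp

lemma smooth_sum:
 "open S ==> (!!i. i \<in> I ==> smooth_on S (f i)) ==> smooth_on S (\<lambda>x. \<Sum>i\<in>I. f i x)"
 by (simp add: smooth_on_def Ck_sum)

lemma smooth_prod:
 fixes f :: "'i => 'a::real_normed_vector => real"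
 assumes "open S" "!!i. i \<in> I ==> smooth_on S (f i)"
 shows "smooth_on S (\<lambda>x. \<Prod>i\<in>I. f i x)"
proof (cases "finite I")
 case True
 then show ?thesis using assms(2)
  by (induction I rule: finite_induct) (auto intro!: smooth_mult assms(1))
qed simp

lemma smooth_compose:
 fixes f :: "'b::euclidean_space => 'c::real_normed_vector"
 shows "open S ==> open T ==> g ` S \<subseteq> T ==> smooth_on T f ==> smooth_on S g ==> smooth_on S (\<lambda>x. f (g x))"
 unfolding smooth_on_def using Ck_compose by blast

lemma smooth_Pair: "open S ==> smooth_on S f ==> smooth_on S g ==> smooth_on S (\<lambda>x. (f x, g x))"
 unfolding smooth_on_def using Ck_Pair by blast

lemma smooth_inverse:
 fixes f :: "'a::real_normed_vector => real"
 shows "open S ==> smooth_on S f ==> (!!x. x \<in> S ==> f x \<noteq> 0) ==> smooth_on S (\<lambda>x. inverse (f x))"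
 unfolding smooth_on_def using Ck_inverse by blast

lemma smooth_componentwise:
 fixes f :: "'a::real_normed_vector => 'b::euclidean_space"
 assumes "open S" "!!i. i \<in> Basis ==> smooth_on S (\<lambda>x. f x \<bullet> i)"
 shows "smooth_on S f"
proof -
 have "smooth_on S (\<lambda>x. \<Sum>i\<in>Basis. (f x \<bullet> i) *\<^sub>R i)"
  by (intro smooth_sum smooth_scaleR assms smooth_const)
 then show ?thesis by (simp add: euclidean_representation)
qed

lemma dd_sum_Basis:
 fixes f :: "'a::euclidean_space => 'b::real_normed_vector"
 assumes "smooth_on S f" "x \<in> S"
 shows "dd v f x = (\<Sum>i\<in>Basis. (v \<bullet> i) *\<^sub>R dd i f x)"
 by (rule linear_Basis_expansion[OF linear_dd[OF assms]])

lemma smooth_dd_var: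
 fixes f :: "'b::euclidean_space => 'c::real_normed_vector"
 assumes "open S" "open T" "g ` S \<subseteq> T" "smooth_on T f" "smooth_on S g" "smooth_on S v"
 shows "smooth_on S (\<lambda>x. dd (v x) f (g x))"
proof (rule smooth_cong[OF assms(1)])
 show "smooth_on S (\<lambda>x. \<Sum>i\<in>Basis. (v x \<bullet> i) *\<^sub>R dd i f (g x))"
  by (intro smooth_sum smooth_scaleR smooth_inner smooth_const
    smooth_compose[where g = g, OF assms(1-3) smooth_dd[OF assms(4)] assms(5)] assms(1,6))
 show "!!x. x \<in> S ==> (\<Sum>i\<in>Basis. (v x \<bullet> i) *\<^sub>R dd i f (g x)) = dd (v x) f (g x)"
  using dd_sum_Basis[OF assms(4)] assms(3) by (metis image_subset_iff)
qed

lemma dd_compose: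
 assumes "f differentiable at (g x)" "g differentiable at x"
 shows "dd v (\<lambda>x. f (g x)) x = dd (dd v g x) f (g x)"
 using frechet_derivative_compose[OF assms(2,1)] by (simp add: o_def)

lemma dd_eqI: "(f has_derivative f') (at x) ==> dd v f x = f' v"
 using frechet_derivative_at by metis

lemma dd_cong:
 assumes "open S" "x \<in> S" "!!y. y \<in> S ==> f y = g y" 
 shows "dd v f x = dd v g x"
proof -
 have "(f has_derivative D) (at x) = (g has_derivative D) (at x)" for D
  using has_derivative_transform_within_open[OF _ assms(1,2)] assms(3) by (metis (full_types))
 then show ?thesis unfolding frechet_derivative_def by simp
qed

lemma has_derivative_line:
 assumes "(f has_derivative f') (at (x + t *\<^sub>R v))"
 shows "((\<lambda>s. f (x + s *\<^sub>R v)) has_vector_derivative f' v) (at t within X)"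
 unfolding has_vector_derivative_def
proof (rule has_derivative_eq_rhs)
 have "((\<lambda>s. x + s *\<^sub>R v) has_derivative (\<lambda>h. h *\<^sub>R v)) (at t within X)"
  by (auto intro!: derivative_eq_intros)
 from has_derivative_compose[OF this assms]
 show "((\<lambda>s. f (x + s *\<^sub>R v)) has_derivative (\<lambda>h. f' (h *\<^sub>R v))) (at t within X)" .
qed (simp add: linear_cmul[OF has_derivative_linear[OF assms]])

text \<open>The mean value theorem, applied twice to the mixed second difference.\<close>

lemma dd_commute_real:
 fixes f :: "'a::real_normed_vector => real"
 assumes "open S" "smooth_on S f" "x \<in> S"
 shows "dd u (dd v f) x = dd v (dd u f) x"
proof -
 obtain e where e: "e > 0" "cball x e \<subseteq> S" using assms open_contains_cball by blast
 let ?\<Delta> = "\<lambda>u v h. f (x + h *\<^sub>R u + h *\<^sub>R v) - f (x + h *\<^sub>R u) - f (x + h *\<^sub>R v) + f x"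
 have key: "((\<lambda>h. ?\<Delta> u v h / (h * h)) \<longlongrightarrow> dd v (dd u f) x) (at_right 0)" for u v
 proof (rule tendstoI)
  fix \<epsilon> :: real assume "\<epsilon> > 0"
  then obtain d where d: "d > 0" "!!y. dist y x < d ==> dist (dd v (dd u f) y) (dd v (dd u f) x) < \<epsilon>"
   using smooth_isCont[OF smooth_dd[OF smooth_dd[OF assms(2)]] assms(3)]
   unfolding continuous_at_eps_delta by blast
  have np: "norm u + norm v + 1 > 0" by (smt (verit) norm_ge_zero)
  show "\<forall>\<^sub>F h in at_right 0. dist (?\<Delta> u v h / (h * h)) (dd v (dd u f) x) < \<epsilon>"
  \<comment> \<open>Below this bound on \<open>h\<close> the whole parallelogram with sides
    \<open>h *\<^sub>R u\<close> and \<open>h *\<^sub>R v\<close> lies in \<open>S\<close> and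
    within distance \<open>d\<close> of \<open>x\<close>.\<close>
  proof (rule eventually_at_rightI[of 0 "min e d / (norm u + norm v + 1)"])
   fix h assume "h \<in> {0<..<min e d / (norm u + norm v + 1)}"
   then have h: "h > 0" "h * (norm u + norm v + 1) < min e d" using np by (auto simp only: greaterThanLessThan_iff pos_less_divide_eq)
   have inS: "x + s *\<^sub>R u + t *\<^sub>R v \<in> S" "dist (x + s *\<^sub>R u + t *\<^sub>R v) x < d"
    if "0 <= s" "s <= h" "0 <= t" "t <= h" for s t
   proof -
    have "norm (s *\<^sub>R u + t *\<^sub>R v) <= h * norm u + h * norm v"
     using that by (intro norm_triangle_le add_mono) (auto intro!: mult_right_mono)
    then have "dist (x + s *\<^sub>R u + t *\<^sub>R v) x < min e d" using h by (simp add: dist_norm algebra_simps)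
    then show "x + s *\<^sub>R u + t *\<^sub>R v \<in> S" "dist (x + s *\<^sub>R u + t *\<^sub>R v) x < d"
     using e(2) by (auto simp: dist_commute subset_iff)
   qed
   define F where "F = (\<lambda>s. f (x + h *\<^sub>R v + s *\<^sub>R u) - f (x + s *\<^sub>R u))"
   have "(F has_real_derivative (dd u f (x + h *\<^sub>R v + s *\<^sub>R u) - dd u f (x + s *\<^sub>R u))) (at s)"
    if "0 <= s" "s <= h" for s
    unfolding F_def has_real_derivative_iff_has_vector_derivative
    by (rule has_vector_derivative_diff; rule has_derivative_line[OF smooth_deriv[OF assms(2)]])
     (use inS[of s h] inS[of s 0] that h in "auto simp: algebra_simps")
   then obtain s where s: "0 < s" "s < h" "F h - F 0 = h * (dd u f (x + h *\<^sub>R v + s *\<^sub>R u) - dd u f (x + s *\<^sub>R u))"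
    using MVT2[of 0 h F "\<lambda>s. dd u f (x + h *\<^sub>R v + s *\<^sub>R u) - dd u f (x + s *\<^sub>R u)"] h by auto
   define G where "G = (\<lambda>t. dd u f (x + s *\<^sub>R u + t *\<^sub>R v))"
   have "(G has_real_derivative (dd v (dd u f) (x + s *\<^sub>R u + t *\<^sub>R v))) (at t)"
    if "0 <= t" "t <= h" for t
    unfolding G_def has_real_derivative_iff_has_vector_derivative
    by (rule has_derivative_line smooth_deriv[OF smooth_dd[OF assms(2)]])+
     (use inS[of s t] that s in auto)
   then obtain t where t: "0 < t" "t < h" "G h - G 0 = h * dd v (dd u f) (x + s *\<^sub>R u + t *\<^sub>R v)"
    using MVT2[of 0 h G "\<lambda>t. dd v (dd u f) (x + s *\<^sub>R u + t *\<^sub>R v)"] h by auto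
   have "?\<Delta> u v h = F h - F 0" by (simp add: F_def algebra_simps)
   also have "... = h * (G h - G 0)" using s by (simp add: G_def algebra_simps)
   finally have "?\<Delta> u v h / (h * h) = dd v (dd u f) (x + s *\<^sub>R u + t *\<^sub>R v)" using t h by simp
   then show "dist (?\<Delta> u v h / (h * h)) (dd v (dd u f) x) < \<epsilon>"
    using d(2)[OF inS(2)[of s t]] s t by simp
  qed (use e d np in auto)
 qed
 \<comment> \<open>The second difference is symmetric in \<open>u\<close> and \<open>v\<close>, so
   both mixed derivatives are limits of the same quotients.\<close>
 have "?\<Delta> v u h = ?\<Delta> u v h" for h by (simp add: algebra_simps)
 with key[of v u] have "((\<lambda>h. ?\<Delta> u v h / (h * h)) \<longlongrightarrow> dd u (dd v f) x) (at_right 0)" by simp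
 from tendsto_unique[OF _ this key] show ?thesis by simp
qed

lemma dd_inner_left:
 assumes "f differentiable at x"
 shows "dd v (\<lambda>x. f x \<bullet> w) x = dd v f x \<bullet> w"
 by (rule dd_eqI) (intro has_derivative_inner_left assms[unfolded frechet_derivative_works])

lemma dd_commute:
 fixes f :: "'a::real_normed_vector => 'b::euclidean_space"
 assumes "open S" "smooth_on S f" "x \<in> S"
 shows "dd u (dd v f) x = dd v (dd u f) x"
proof (rule euclidean_eqI)
 fix i :: 'b
 have s: "smooth_on S (\<lambda>x. f x \<bullet> i)"
  by (intro smooth_inner assms smooth_const)
 have *: "dd u (dd v f) x \<bullet> i = dd u (dd v (\<lambda>x. f x \<bullet> i)) x" for u v
 proof -
  have "dd u (dd v f) x \<bullet> i = dd u (\<lambda>y. dd v f y \<bullet> i) x"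
   by (rule dd_inner_left[symmetric]) (rule smooth_diffble[OF smooth_dd[OF assms(2)] assms(3)])
  also have "... = dd u (dd v (\<lambda>x. f x \<bullet> i)) x"
   by (rule dd_cong[OF assms(1,3)]) (simp add: dd_inner_left smooth_diffble[OF assms(2)])
  finally show ?thesis .
 qed
 show "dd u (dd v f) x \<bullet> i = dd v (dd u f) x \<bullet> i"
  unfolding * by (rule dd_commute_real[OF assms(1) s assms(3)])
qed

section \<open>Smooth inverse function theorem\<close>

lemma contraction_fixpoint:
 fixes T :: "'e::{real_normed_vector,complete_space} => 'e"
 assumes "linear T" "!!y. norm (T y) <= norm y / 2"
 shows "\<exists>!y. y = c + T y"
proof -
 have "\<exists>!y. c + T y = y"
  by (rule banach_fix_type[of "1/2"])
   (use assms(2)[of "_ - _"] in "auto simp: dist_norm linear_diff[OF assms(1)]")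
 then show ?thesis by metis
qed

lemma contraction_fixpoint_norm:
 fixes T :: "'e::real_normed_vector => 'e"
 assumes "!!y. norm (T y) <= norm y / 2" "y = c + T y"
 shows "norm y <= 2 * norm c"
proof -
 have "norm y <= norm c + norm (T y)" by (metis assms(2) norm_triangle_ineq)
 also have "... <= norm c + norm y / 2" using assms(1)[of y] by simp
 finally show ?thesis by simp
qed

text \<open>Linearity comes from uniqueness: \<open>D v + D w\<close> and
  \<open>a *\<^sub>R D v\<close> solve the fixed point equations that determine
  \<open>D (v + w)\<close> and \<open>D (a *\<^sub>R v)\<close>.\<close>

lemma bounded_linear_contraction_fixpoint:
 fixes T :: "'e::{real_normed_vector,complete_space} => 'e"
 assumes "linear T" "!!y. norm (T y) <= norm y / 2" "bounded_linear c" "!!w. D w = c w + T (D w)"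
 shows "bounded_linear D"
proof -
 interpret c: bounded_linear c by fact
 have uniq: "y = D w" if "y = c w + T y" for y w
  using contraction_fixpoint[OF assms(1,2), of "c w"] that assms(4)[of w] by blast
 have add: "D (v + w) = D v + D w" for v w
 proof (rule uniq[symmetric])
  have "D v + D w = (c v + T (D v)) + (c w + T (D w))"
   using assms(4)[of v] assms(4)[of w] by simp
  also have "... = c (v + w) + T (D v + D w)"
   by (simp add: c.add linear_add[OF assms(1)])
  finally show "D v + D w = c (v + w) + T (D v + D w)" .
 qed
 have scale: "D (a *\<^sub>R v) = a *\<^sub>R D v" for a v
 proof (rule uniq[symmetric])
  have "a *\<^sub>R D v = a *\<^sub>R (c v + T (D v))" using assms(4)[of v] by simp
  also have "... = c (a *\<^sub>R v) + T (a *\<^sub>R D v)"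
   by (simp add: c.scale linear_cmul[OF assms(1)] scaleR_right_distrib)
  finally show "a *\<^sub>R D v = c (a *\<^sub>R v) + T (a *\<^sub>R D v)" .
 qed
 obtain K where K: "!!x. norm (c x) <= norm x * K" using c.bounded by blast
 show ?thesis
 proof (rule bounded_linear_intro[of D "2 * K", OF add scale])
  fix w
  have "norm (D w) <= 2 * norm (c w)"
   by (rule contraction_fixpoint_norm[OF assms(2,4)])
  then show "norm (D w) <= norm w * (2 * K)" using K[of w] by simp
 qed
qed

text \<open>The inverse of \<open>id - T\<close>, called \<open>S\<close> in the proof, is bounded
  linear and maps \<open>U - T U\<close> back to \<open>U\<close>. So \<open>U\<close> inherits
  differentiability, and uniqueness of the fixed point identifies the derivative as
  \<open>D\<close>.\<close>

lemma has_derivative_contraction: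
 fixes T :: "'e::{real_normed_vector,complete_space} => 'e"
 assumes T: "linear T" "!!y. norm (T y) <= norm y / 2" and R: "((\<lambda>q. U q - T (U q)) has_derivative c) (at p)"
  and D: "!!w. D w = c w + T (D w)"
 shows "(U has_derivative D) (at p)"
proof -
 define S where "S = (\<lambda>x. THE y. y = x + T y)"
 have S: "S x = x + T (S x)" for x unfolding S_def by (rule theI') (rule contraction_fixpoint[OF T])
 have uniq: "S x = y" if "y = x + T y" for x y using contraction_fixpoint[OF T, of x] S[of x] that by blast
 have "bounded_linear S" by (rule bounded_linear_contraction_fixpoint[OF T bounded_linear_ident S])
 from bounded_linear.has_derivative[OF this R] show ?thesis
  using uniq[of "U q" "U q - T (U q)" for q] uniq[OF D] by simp
qed

text \<open>The product rule with a second factor that is merely continuous: since \<open>f\<close>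
  vanishes at \<open>z\<close>, a change of \<open>Y\<close> contributes only
  \<open>o(norm (x - z))\<close>.\<close>

lemma has_derivative_vanishing_product:
 assumes "bounded_bilinear op" and f: "(f has_derivative f') (at z)" "f z = 0" and Y: "isCont Y z"
 shows "((\<lambda>x. op (f x) (Y x)) has_derivative (\<lambda>w. op (f' w) (Y z))) (at z)"
 unfolding has_derivative_iff_norm
proof
 interpret op: bounded_bilinear op by fact
 show "bounded_linear (\<lambda>w. op (f' w) (Y z))"
  by (rule bounded_linear_compose[OF op.bounded_linear_left has_derivative_bounded_linear[OF f(1)]])
 obtain K where K: "K > 0" "!!a y. norm (op a y) <= norm a * norm y * K" using op.pos_bounded by blast
 obtain C where C: "C > 0" "!!w. norm (f' w) <= norm w * C"
  using bounded_linear.pos_bounded[OF has_derivative_bounded_linear[OF f(1)]] by blast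
 let ?r = "\<lambda>x. norm (f x - f z - f' (x - z)) / norm (x - z)"
 show "((\<lambda>x. norm (op (f x) (Y x) - op (f z) (Y z) - op (f' (x - z)) (Y z)) / norm (x - z)) \<longlongrightarrow> 0) (at z)"
 proof (rule Lim_null_comparison)
  have "((\<lambda>x. ?r x * norm (Y x) * K + C * norm (Y x - Y z) * K) \<longlongrightarrow> 0 * norm (Y z) * K + C * norm (Y z - Y z) * K) (at z)"
   by (intro tendsto_intros) (use f(1) Y in "auto simp: has_derivative_iff_norm isCont_def")
  then show "((\<lambda>x. ?r x * norm (Y x) * K + C * norm (Y x - Y z) * K) \<longlongrightarrow> 0) (at z)" by simp
  have "norm (op (f x) (Y x) - op (f z) (Y z) - op (f' (x - z)) (Y z)) / norm (x - z)
    <= ?r x * norm (Y x) * K + C * norm (Y x - Y z) * K" if x: "x \<noteq> z" for x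
  proof -
   have "op (f x) (Y x) - op (f z) (Y z) - op (f' (x - z)) (Y z) =
     op (f x - f z - f' (x - z)) (Y x) + op (f' (x - z)) (Y x - Y z)"
    by (simp add: f(2) op.diff_left op.diff_right op.zero_left)
   also have "norm ... <= norm (f x - f z - f' (x - z)) * norm (Y x) * K + norm (x - z) * C * norm (Y x - Y z) * K"
    by (intro norm_triangle_le add_mono K(2) order_trans[OF K(2)] mult_right_mono C(2)) (use K in auto)
   also have "... = (?r x * norm (Y x) * K + C * norm (Y x - Y z) * K) * norm (x - z)"
    using x by (simp add: distrib_right)
   finally show ?thesis using x by (simp only: pos_divide_le_eq zero_less_norm_iff right_minus_eq simp_thms)
  qed
  then show "\<forall>\<^sub>F x in at z. norm (norm (op (f x) (Y x) - op (f z) (Y z) - op (f' (x - z)) (Y z)) / norm (x - z))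
    <= ?r x * norm (Y x) * K + C * norm (Y x - Y z) * K"
   by (simp add: eventually_at_filter)
 qed
qed

text \<open>With the operator frozen at \<open>A z\<close>, the equation reads
  \<open>Y x - op (A z) (Y x) = b x + op (A x - A z) (Y x)\<close>. The last term has a vanishing
  factor, so continuity of \<open>Y\<close> is enough to differentiate the right-hand side, and
  \<open>has_derivative_contraction\<close> carries this over to \<open>Y\<close>.\<close>

lemma has_derivative_linear_fixpoint:
 fixes op :: "'c::real_normed_vector => 'e::{real_normed_vector,complete_space} => 'e"
 assumes N: "open N" "z \<in> N" and op: "bounded_bilinear op" and cY: "continuous_on N Y"
  and Y: "!!z. z \<in> N ==> Y z = b z + op (A z) (Y z)"
  and half: "!!z y. z \<in> N ==> norm (op (A z) y) <= norm y / 2"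
  and A': "(A has_derivative A') (at z)" and b': "(b has_derivative b') (at z)"
  and D: "!!w. D w = (b' w + op (A' w) (Y z)) + op (A z) (D w)"
 shows "(Y has_derivative D) (at z)"
proof (rule has_derivative_contraction[OF _ half[OF N(2)] _ D])
 interpret op: bounded_bilinear op by fact
 show "linear (op (A z))" by (rule op.bounded_linear_right[THEN bounded_linear.linear])
 have "((\<lambda>x. A x - A z) has_derivative A') (at z)" using has_derivative_diff[OF A' has_derivative_const] by simp
 moreover have "isCont Y z" using cY N by (simp add: continuous_on_eq_continuous_at)
 ultimately have "((\<lambda>x. b x + op (A x - A z) (Y x)) has_derivative (\<lambda>w. b' w + op (A' w) (Y z))) (at z)"
  by (intro has_derivative_add b' has_derivative_vanishing_product[OF op]) auto
 then show "((\<lambda>x. Y x - op (A z) (Y x)) has_derivative (\<lambda>w. b' w + op (A' w) (Y z))) (at z)"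
  by (rule has_derivative_transform_within_open[OF _ N]) (subst (2) Y, simp_all add: op.diff_left)
qed

text \<open>The solution of a fixed point equation that depends linearly on the unknown is as regular as
 its data: its directional derivatives solve equations of the same form, so one can induct on the
 order of differentiability.\<close>

lemma Ck_linear_fixpoint:
 fixes op :: "'c::real_normed_vector => 'e::{real_normed_vector,complete_space} => 'e"
 assumes N: "open N" and "bounded_bilinear op"
  and Y: "!!z. z \<in> N ==> Y z = b z + op (A z) (Y z)"
  and half: "!!z y. z \<in> N ==> norm (op (A z) y) <= norm y / 2"
  and A: "Ck_on k N A" and b: "Ck_on k N b"
 shows "Ck_on k N Y"
 using Y A b
proof (induction k arbitrary: Y b)
 case 0
 interpret op: bounded_bilinear op by fact
 have "isCont Y z" if z: "z \<in> N" for z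
 proof -
  let ?g = "\<lambda>x. 2 * norm ((b x - b z) + op (A x - A z) (Y z))"
  have "norm (Y x - Y z) <= ?g x" if x: "x \<in> N" for x
  proof (rule contraction_fixpoint_norm[OF half[OF x]])
   show "Y x - Y z = ((b x - b z) + op (A x - A z) (Y z)) + op (A x) (Y x - Y z)"
    by (subst 0(1)[OF x], subst 0(1)[OF z]) (simp add: op.diff_left op.diff_right)
  qed
  then have "\<forall>\<^sub>F x in at z. norm (Y x - Y z) <= ?g x"
   using N z unfolding eventually_at_topological by blast
  moreover have "(?g \<longlongrightarrow> 2 * norm ((b z - b z) + op (A z - A z) (Y z))) (at z)"
   by (intro tendsto_intros op.tendsto) (use 0(2,3) z N in "auto simp: continuous_on_eq_continuous_at isCont_def")
  then have "(?g \<longlongrightarrow> 0) (at z)" by (simp add: op.zero_left)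
  ultimately have "((\<lambda>x. Y x - Y z) \<longlongrightarrow> 0) (at z)" by (rule Lim_null_comparison)
  then show ?thesis unfolding isCont_def by (rule LIM_zero_cancel)
 qed
 then show ?case by (simp add: continuous_at_imp_continuous_on)
next
 case (Suc k)
 interpret op: bounded_bilinear op by fact
 have linop: "linear (op a)" for a by (rule op.bounded_linear_right[THEN bounded_linear.linear])
 \<comment> \<open>The right-hand side of the differentiated equation, whose operator is again
   \<open>op (A z)\<close>; so the contraction factor is unchanged.\<close>
 define c where "c = (\<lambda>z w. frechet_derivative b (at z) w + op (frechet_derivative A (at z) w) (Y z))"
 define D where "D = (\<lambda>z w. THE y. y = c z w + op (A z) y)"
 have D: "D z w = c z w + op (A z) (D z w)" if "z \<in> N" for z w
  unfolding D_def by (rule theI') (rule contraction_fixpoint[OF linop half[OF that]])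
 have YC: "Ck_on k N Y"
  by (rule Suc.IH[OF Suc.prems(1) Ck_Suc_imp[OF Suc.prems(2)] Ck_Suc_imp[OF Suc.prems(3)]])
 show ?case
 proof (rule Ck_SucI[OF N])
  show "(Y has_derivative D z) (at z)" if "z \<in> N" for z
   by (rule has_derivative_linear_fixpoint[OF N that assms(2) Ck_continuous[OF YC] Suc.prems(1) half
      Ck_SucD[OF Suc.prems(2) that] Ck_SucD[OF Suc.prems(3) that]])
    (use D[OF that, unfolded c_def] in auto)
  show "Ck_on k N (\<lambda>z. D z w)" for w
  proof (rule Suc.IH[where b = "\<lambda>z. c z w"])
   show "Ck_on k N A" using Suc.prems(2) by (rule Ck_Suc_imp)
   show "Ck_on k N (\<lambda>z. c z w)"
    unfolding c_def
    by (intro Ck_add Ck_bilinear[OF _ assms(2)] N YC) (use Suc.prems in simp_all)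
  qed (rule D)
 qed
qed

lemma Ck_Blinfun:
 fixes f :: "'x::real_normed_vector => 'a::euclidean_space => 'b::real_normed_vector"
 assumes "open S" "!!x. x \<in> S ==> linear (f x)" "!!v. Ck_on k S (\<lambda>x. f x v)"
 shows "Ck_on k S (\<lambda>x. Blinfun (f x))"
proof (rule Ck_cong[OF assms(1)])
 show "Ck_on k S (\<lambda>x. \<Sum>i\<in>Basis. (blinfun_scaleR_left (f x i) o\<^sub>L blinfun_inner_left i))"
 proof (rule Ck_sum[OF assms(1)])
  fix i :: 'a
  have "bounded_linear (\<lambda>w :: 'b. blinfun_scaleR_left w o\<^sub>L blinfun_inner_left i)"
   by (rule bounded_linear_compose[OF bounded_bilinear.bounded_linear_left[OF bounded_bilinear_blinfun_compose]
     bounded_linear_blinfun_scaleR_left])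
  then show "Ck_on k S (\<lambda>x. blinfun_scaleR_left (f x i) o\<^sub>L blinfun_inner_left i)"
   by (rule Ck_linear_compose[OF assms(1) _ assms(3)])
 qed
 fix x assume x: "x \<in> S"
 note l = assms(2)[OF x]
 have bl: "bounded_linear (f x)" using l by (simp add: linear_conv_bounded_linear)
 show "(\<Sum>i\<in>Basis. (blinfun_scaleR_left (f x i) o\<^sub>L blinfun_inner_left i)) = Blinfun (f x)"
 proof (rule blinfun_eqI)
  fix v
  have "f x v = (\<Sum>i\<in>Basis. (v \<bullet> i) *\<^sub>R f x i)"
   by (rule linear_Basis_expansion[OF l])
  then show "blinfun_apply (\<Sum>i\<in>Basis. (blinfun_scaleR_left (f x i) o\<^sub>L blinfun_inner_left i)) v = Blinfun (f x) v"
   by (simp add: bounded_linear_Blinfun_apply[OF bl] blinfun.sum_left inner_commute)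
 qed
qed

lemma Blinfun_apply_dd:
 assumes "Ck_on (Suc k) S f" "x \<in> S"
 shows "blinfun_apply (Blinfun (\<lambda>v. dd v f x)) = (\<lambda>v. dd v f x)"
 by (rule bounded_linear_Blinfun_apply) (rule has_derivative_bounded_linear[OF Ck_SucD[OF assms]])

text \<open>The inverse function theorem gives an inverse \<open>g\<close> with derivative
  \<open>g' y\<close>. Near a point \<open>y0\<close>, with \<open>m = g' y0\<close>, the vector
  \<open>g' y v\<close> solves \<open>w = m v + (id - m (f' (g y))) w\<close>, a linear fixed point
  equation that is contracting near \<open>y0\<close> and whose coefficients are as regular as
  \<open>g\<close>. So each order of differentiability of \<open>g\<close> gives the next.\<close>

theorem smooth_inverse_function:
 fixes f :: "'a::euclidean_space => 'a"
 assumes "open U" "smooth_on U f" "x0 \<in> U" and inj: "!!v. dd v f x0 = 0 ==> v = 0"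
 obtains U' V g where "open U'" "U' \<subseteq> U" "x0 \<in> U'" "open V" "f x0 \<in> V" "homeomorphism U' V f g"
  "smooth_on V g"
proof -
 define f' where "f' = (\<lambda>x. Blinfun (\<lambda>v. dd v f x))"
 have C: "Ck_on k U f" for k using assms(2) by (simp add: smooth_on_def)
 have f'_apply: "blinfun_apply (f' x) = (\<lambda>v. dd v f x)" if "x \<in> U" for x
  unfolding f'_def by (rule Blinfun_apply_dd[OF C that])
 have Cf': "Ck_on k U f'" for k
  unfolding f'_def
  by (rule Ck_Blinfun[OF assms(1) linear_dd[OF assms(2)]])
   (use smooth_dd[OF assms(2)] in "simp_all add: smooth_on_def")
 have lin0: "linear (\<lambda>v. dd v f x0)" by (rule linear_dd[OF assms(2,3)])
 have "inj (\<lambda>v. dd v f x0)" using inj linear_injective_0[OF lin0] by blast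
 then obtain g0 where g0: "linear g0" "!!v. g0 (dd v f x0) = v" "!!v. dd (g0 v) f x0 = v"
  using linear_injective_isomorphism[OF lin0] by (metis pointfree_idE o_apply)
 have bl0: "bounded_linear g0" using g0(1) by (simp add: linear_conv_bounded_linear)
 obtain U' V g g' where h: "open U'" "U' \<subseteq> U" "x0 \<in> U'" "open V" "f x0 \<in> V" "homeomorphism U' V f g"
  and dg: "!!y. y \<in> V ==> (g has_derivative g' y) (at y)"
  "!!y. y \<in> V ==> g' y = inv (blinfun_apply (f' (g y)))"
  "!!y. y \<in> V ==> bij (blinfun_apply (f' (g y)))"
 proof (rule inverse_function_theorem[of U f f' x0 "Blinfun g0"])
  show "Blinfun g0 o\<^sub>L f' x0 = id_blinfun"
   by (rule blinfun_eqI) (simp add: bounded_linear_Blinfun_apply[OF bl0] f'_apply[OF assms(3)] g0)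
  show "continuous_on U f'" using Cf'[of 0] by simp
  show "(f has_derivative blinfun_apply (f' x)) (at x)" if "x \<in> U" for x
   unfolding f'_apply[OF that] by (rule smooth_deriv[OF assms(2) that])
 qed (use assms in auto)
 have gV: "g ` V \<subseteq> U'" using h(6) by (simp add: homeomorphism_def)
 have "Ck_on k V g" for k
 proof (induction k)
  case 0
  then show ?case using h(6) by (simp add: homeomorphism_def)
 next
  case (Suc k)
  show ?case
  proof (rule Ck_SucI[OF h(4) dg(1)])
   fix v
   show "Ck_on k V (\<lambda>y. g' y v)"
   proof (rule Ck_local)
    fix y0 assume y0: "y0 \<in> V"
    have gy0: "g y0 \<in> U" using y0 gV h(2) by auto
    have bij0: "bij (blinfun_apply (f' (g y0)))" by (rule dg(3)[OF y0])
    define m where "m = g' y0"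
    have blm: "bounded_linear m" unfolding m_def using dg(1)[OF y0] by (rule has_derivative_bounded_linear)
    have m: "m (f' (g y0) v) = v" for v
     unfolding m_def dg(2)[OF y0] using bij0 by (simp add: bij_is_inj)
    define A where "A = (\<lambda>y. id_blinfun - (Blinfun m o\<^sub>L f' (g y)))"
    have CA: "Ck_on k V A"
    proof -
     have "Ck_on k V (\<lambda>y. f' (g y))"
      by (rule Ck_compose[OF h(4) assms(1) _ Cf' Suc]) (use gV h(2) in auto)
     then have "Ck_on k V (\<lambda>y. id_blinfun + - (Blinfun m o\<^sub>L f' (g y)))"
      by (intro Ck_add Ck_const h(4)
        Ck_linear_compose[OF h(4) bounded_linear_minus[OF bounded_linear_ident]]
        Ck_bilinear[OF h(4) bounded_bilinear_blinfun_compose])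
     then show ?thesis by (simp add: A_def)
    qed
    have A0: "A y0 = 0"
     unfolding A_def by (rule blinfun_eqI) (simp add: bounded_linear_Blinfun_apply[OF blm] m blinfun.diff_left)
    have "continuous_on V A" by (rule Ck_continuous[OF CA])
    then have "isCont A y0" using h(4) y0 by (simp add: continuous_on_eq_continuous_at)
    then have "(A \<longlongrightarrow> 0) (nhds y0)"
     using A0 unfolding isCont_def tendsto_at_iff_tendsto_nhds by simp
    from tendstoD[OF this, of "1 / 2"] have "\<forall>\<^sub>F y in nhds y0. norm (A y) < 1 / 2" by simp
    then obtain T where T: "open T" "y0 \<in> T" "!!y. y \<in> T ==> norm (A y) < 1 / 2"
     unfolding eventually_nhds by blast
    have "Ck_on k (T \<inter> V) (\<lambda>y. g' y v)"
    proof (rule Ck_linear_fixpoint[OF _ bounded_bilinear_blinfun_apply, where A = A and b = "\<lambda>y. m v"])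
     fix y assume y: "y \<in> T \<inter> V"
     have "f' (g y) (g' y v) = v"
      unfolding dg(2)[OF IntD2[OF y]] using dg(3)[of y] y by (simp add: bij_is_surj surj_f_inv_f)
     then show "g' y v = m v + A y (g' y v)"
      by (simp add: A_def blinfun.diff_left bounded_linear_Blinfun_apply[OF blm])
     fix x
     have "norm (A y x) <= norm (A y) * norm x" by (rule norm_blinfun)
     also have "... <= 1 / 2 * norm x" using T(3)[of y] y by (intro mult_right_mono) auto
     finally show "norm (A y x) <= norm x / 2" by simp
    qed (use T h(4) CA in "auto intro: Ck_subset simp: Ck_const")
    then show "\<exists>T. open T \<and> y0 \<in> T \<and> Ck_on k T (\<lambda>y. g' y v)"
     using T h(4) y0 by (intro exI[of _ "T \<inter> V"]) auto
   qed
  qed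
 qed
 then have "smooth_on V g" by (simp add: smooth_on_def)
 then show thesis using that[OF h] by blast
qed

section \<open>Ordinary differential equations\<close>

text \<open>Gronwall for the squared distance \<open>g\<close>: since \<open>g'\<close> is at most
  \<open>2 * L * g\<close> in absolute value, \<open>g * exp (- (2 * L * r))\<close> does not
  increase with the distance \<open>r\<close> from \<open>t0\<close>.\<close>

lemma ode_unique:
 fixes x y :: "real => 'e::real_inner"
 assumes "t0 \<in> {a..b}" "x t0 = y t0"
  and x: "!!t. t \<in> {a..b} ==> (x has_vector_derivative X t) (at t within {a..b})"
  and y: "!!t. t \<in> {a..b} ==> (y has_vector_derivative Y t) (at t within {a..b})"
  and L: "!!t. t \<in> {a..b} ==> norm (X t - Y t) <= L * norm (x t - y t)"
  and t: "t \<in> {a..b}"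
 shows "x t = y t"
proof -
 define g where "g = (\<lambda>t. (x t - y t) \<bullet> (x t - y t))"
 define g' where "g' = (\<lambda>t. 2 * ((x t - y t) \<bullet> (X t - Y t)))"
 have dg: "(g has_real_derivative g' t) (at t within {a..b})" if "t \<in> {a..b}" for t
  unfolding g_def g'_def has_real_derivative_iff_has_vector_derivative has_vector_derivative_def
  by (rule has_derivative_eq_rhs[OF has_derivative_inner
     [OF has_derivative_diff has_derivative_diff]])
   (use x[OF that] y[OF that] in "auto simp: has_vector_derivative_def algebra_simps inner_commute")
 have gL: "\<bar>g' t\<bar> <= 2 * L * g t" if "t \<in> {a..b}" for t
 proof -
  have "\<bar>g' t\<bar> <= 2 * (norm (x t - y t) * norm (X t - Y t))"
   unfolding g'_def using Cauchy_Schwarz_ineq2[of "x t - y t" "X t - Y t"] by simp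
  also have "... <= 2 * (norm (x t - y t) * (L * norm (x t - y t)))"
   by (intro mult_left_mono L that) auto
  also have "... = 2 * L * g t" by (simp add: g_def power2_norm_eq_inner[symmetric] power2_eq_square)
  finally show ?thesis .
 qed
 have cg: "continuous_on {a..b} g" using dg by (meson DERIV_continuous continuous_on_eq_continuous_within)
 define d where "d = \<bar>t - t0\<bar>"
 \<comment> \<open>The sign lets one monotonicity argument in the distance from \<open>t0\<close>
   cover times before and after \<open>t0\<close>.\<close>
 define \<sigma> :: real where "\<sigma> = (if t0 <= t then 1 else -1)"
 have \<sigma>: "\<bar>\<sigma>\<bar> = 1" "t = t0 + \<sigma> * d" by (auto simp: \<sigma>_def d_def)
 have inI: "t0 + \<sigma> * r \<in> {a..b}" if "0 <= r" "r <= d" for r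
  by (cases "t0 <= t") (use that assms(1) t in "auto simp: \<sigma>_def d_def")
 have "g (t0 + \<sigma> * d) * exp (- (2 * L * d)) <= g (t0 + \<sigma> * 0) * exp (- (2 * L * 0))"
 proof (rule DERIV_nonpos_imp_decreasing_open[of 0 d])
  fix r assume r: "0 < r" "r < d"
  have s: "t0 + \<sigma> * r \<in> {a<..<b}"
   by (cases "t0 <= t") (use r assms(1) t in "auto simp: \<sigma>_def d_def")
  then have "(g has_real_derivative g' (t0 + \<sigma> * r)) (at (t0 + \<sigma> * r))"
   using dg[of "t0 + \<sigma> * r"] by (simp add: at_within_Icc_at)
  then have "((\<lambda>r. g (t0 + \<sigma> * r)) has_real_derivative g' (t0 + \<sigma> * r) * \<sigma>) (at r)"
   by (rule DERIV_chain2) (auto intro!: derivative_eq_intros)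
  then have "((\<lambda>r. g (t0 + \<sigma> * r) * exp (- (2 * L * r))) has_real_derivative
    (\<sigma> * g' (t0 + \<sigma> * r) - 2 * L * g (t0 + \<sigma> * r)) * exp (- (2 * L * r))) (at r)"
   by (auto intro!: derivative_eq_intros simp: algebra_simps)
  moreover have "\<sigma> * g' (t0 + \<sigma> * r) <= 2 * L * g (t0 + \<sigma> * r)"
   using abs_le_D1[of "\<sigma> * g' (t0 + \<sigma> * r)"] gL[of "t0 + \<sigma> * r"] s \<sigma>(1) by (simp add: abs_mult)
  then have "(\<sigma> * g' (t0 + \<sigma> * r) - 2 * L * g (t0 + \<sigma> * r)) * exp (- (2 * L * r)) <= 0"
   by (intro mult_nonpos_nonneg) auto
  ultimately show "\<exists>y. ((\<lambda>r. g (t0 + \<sigma> * r) * exp (- (2 * L * r))) has_real_derivative y) (at r) \<and> y <= 0" by blast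
 next
  show "continuous_on {0..d} (\<lambda>r. g (t0 + \<sigma> * r) * exp (- (2 * L * r)))"
   by (intro continuous_intros continuous_on_compose2[OF cg]) (use inI in auto)
 qed (simp add: d_def)
 then have "g t <= 0" using assms(2) \<sigma>(2)[symmetric] by (simp add: g_def mult_le_0_iff)
 then have "g t = 0" using inner_ge_zero[of "x t - y t"] unfolding g_def by (rule order_antisym)
 then show ?thesis by (simp add: g_def)
qed

lemma continuous_on_Blinfun_dd:
 fixes G :: "'e::euclidean_space => 'f::real_normed_vector"
 assumes "open A" "Ck_on (Suc 0) A G"
 shows "continuous_on A (\<lambda>x. Blinfun (\<lambda>v. dd v G x))"
 using Ck_Blinfun[OF assms(1) has_derivative_linear[OF Ck_SucD[OF assms(2)]], where k = 0] assms(2) by simp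

text \<open>Uniform continuity of the derivative on the compact set makes the linearization error
  uniform in the base point. Differentiating the superposition operator \<open>nem\<close> in the
  supremum norm requires this.\<close>

lemma C1_uniform_derivative:
 fixes G :: "'e::euclidean_space => 'f::real_normed_vector"
 assumes "open A" "Ck_on (Suc 0) A G" "compact K" "convex K" "K \<subseteq> A" "e > 0"
 obtains d where "d > 0" "!!a b. a \<in> K ==> b \<in> K ==> norm (b - a) < d ==>
  norm (G b - G a - dd (b - a) G a) <= e * norm (b - a)"
proof -
 define G' where "G' = (\<lambda>x. Blinfun (\<lambda>v. dd v G x))"
 have ap: "blinfun_apply (G' x) = (\<lambda>v. dd v G x)" if "x \<in> A" for x
  unfolding G'_def by (rule Blinfun_apply_dd[OF assms(2) that])
 have "continuous_on K G'"
  unfolding G'_def by (rule continuous_on_subset[OF continuous_on_Blinfun_dd[OF assms(1,2)] assms(5)])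
 then have "uniformly_continuous_on K G'" using assms(3) by (rule compact_uniformly_continuous)
 then obtain d where d: "d > 0" "!!a b. a \<in> K ==> b \<in> K ==> dist b a < d ==> dist (G' b) (G' a) < e"
  using assms(6) unfolding uniformly_continuous_on_def by metis
 show ?thesis
 proof (rule that[OF d(1)])
  fix a b assume ab: "a \<in> K" "b \<in> K" "norm (b - a) < d"
  let ?S = "closed_segment a b"
  have sub: "?S \<subseteq> K" using ab assms(4) by (simp add: closed_segment_subset)
  have near: "norm (x - a) < d" if "x \<in> ?S" for x
   using that ab(3) segment_bound(1)[OF that] by (simp add: norm_minus_commute)
  have "norm (G b - G a - dd (b - a) G a) <= norm (b - a) * e"
  proof (rule differentiable_bound_linearization[of a b ?S G "\<lambda>x v. dd v G x" a e])
   show "a + t *\<^sub>R (b - a) \<in> ?S" if "t \<in> {0..1}" for t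
    unfolding closed_segment_def using that by (auto simp: algebra_simps intro!: exI[of _ t])
   show "(G has_derivative (\<lambda>v. dd v G x)) (at x within ?S)" if "x \<in> ?S" for x
    using Ck_SucD[OF assms(2), of x] that sub assms(5) has_derivative_at_withinI by blast
   show "onorm ((\<lambda>v. dd v G x) - (\<lambda>v. dd v G a)) <= e" if "x \<in> ?S" for x
   proof -
    have "onorm (blinfun_apply (G' x - G' a)) < e"
     using d(2)[of a x] near[OF that] that sub ab(1) by (auto simp: dist_norm norm_blinfun.rep_eq)
    moreover have "blinfun_apply (G' x - G' a) = (\<lambda>v. dd v G x - dd v G a)"
    proof -
     have "x \<in> A" "a \<in> A" using that sub ab(1) assms(5) by auto
     then show ?thesis using ap by (intro ext) (simp add: blinfun.diff_left)
    qed
    ultimately show ?thesis by (simp add: fun_diff_def)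
   qed
  qed auto
  then show "norm (G b - G a - dd (b - a) G a) <= e * norm (b - a)" by (simp add: mult.commute)
 qed
qed

lemma C1_bound_Lipschitz:
 fixes G :: "'e::euclidean_space => 'f::real_normed_vector"
 assumes "open A" "Ck_on (Suc 0) A G" "compact K" "convex K" "K \<subseteq> A"
 obtains L where "L > 0" "!!a v. a \<in> K ==> norm (dd v G a) <= L * norm v"
  "!!a b. a \<in> K ==> b \<in> K ==> norm (G b - G a) <= L * norm (b - a)"
proof -
 define G' where "G' = (\<lambda>x. Blinfun (\<lambda>v. dd v G x))"
 have ap: "blinfun_apply (G' x) = (\<lambda>v. dd v G x)" if "x \<in> A" for x
  unfolding G'_def by (rule Blinfun_apply_dd[OF assms(2) that])
 have "continuous_on K G'"
  unfolding G'_def by (rule continuous_on_subset[OF continuous_on_Blinfun_dd[OF assms(1,2)] assms(5)])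
 then have "bounded (G' ` K)" using assms(3) by (simp add: compact_continuous_image compact_imp_bounded)
 then obtain L where L: "L > 0" "!!a. a \<in> K ==> norm (G' a) <= L" by (auto simp: bounded_pos)
 have *: "norm (dd v G a) <= L * norm v" if "a \<in> K" for a v
 proof -
  have "norm (G' a v) <= norm (G' a) * norm v" by (rule norm_blinfun)
  also have "... <= L * norm v" by (intro mult_right_mono L that) auto
  finally show ?thesis using ap[of a] that assms(5) by auto
 qed
 show ?thesis
 proof (rule that[OF L(1) *])
  fix a b assume ab: "a \<in> K" "b \<in> K"
  show "norm (G b - G a) <= L * norm (b - a)"
  proof (rule differentiable_bound[OF assms(4), where f' = "\<lambda>x v. dd v G x"])
   show "(G has_derivative (\<lambda>v. dd v G x)) (at x within K)" if "x \<in> K" for x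
    using Ck_SucD[OF assms(2), of x] that assms(5) has_derivative_at_withinI by blast
   show "onorm (\<lambda>v. dd v G x) <= L" if "x \<in> K" for x
    using *[OF that] L(1) by (intro onorm_bound) auto
  qed (use ab in auto)
 qed auto
qed

subsection \<open>Pointwise operations on bounded continuous curves\<close>

definition pw :: "('b::real_normed_vector => 'c::real_normed_vector => 'd::real_normed_vector) =>
  (real \<Rightarrow>\<^sub>C 'b) => (real \<Rightarrow>\<^sub>C 'c) => (real \<Rightarrow>\<^sub>C 'd)" where
 "pw B u v = Bcontfun (\<lambda>t. B (u t) (v t))"

lemma apply_pw:
 assumes "bounded_bilinear B"
 shows "apply_bcontfun (pw B u v) t = B (u t) (v t)"
proof -
 interpret bounded_bilinear B by fact
 obtain K where K: "K > 0" "!!a b. norm (B a b) <= norm a * norm b * K" using pos_bounded by blast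
 have "(\<lambda>t. B (u t) (v t)) \<in> bcontfun"
 proof (rule bcontfun_normI)
  show "continuous_on UNIV (\<lambda>t. B (u t) (v t))"
   by (intro continuous_on continuous_on_apply_bcontfun)
  show "norm (B (u t) (v t)) <= norm u * norm v * K" for t
   by (rule order_trans[OF K(2)]) (intro mult_mono norm_bounded, use K in auto)
 qed
 then show ?thesis unfolding pw_def by (simp add: Bcontfun_inverse)
qed

lemma bounded_bilinear_pw:
 assumes "bounded_bilinear B"
 shows "bounded_bilinear (pw B)"
proof -
 interpret bounded_bilinear B by fact
 obtain K where K: "K > 0" "!!a b. norm (B a b) <= norm a * norm b * K" using pos_bounded by blast
 show ?thesis
 proof
  show "\<exists>K. \<forall>u v. norm (pw B u v) <= norm u * norm v * K"
  proof (intro exI allI norm_bound)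
   fix u v t
   show "norm (apply_bcontfun (pw B u v) t) <= norm u * norm v * K"
    unfolding apply_pw[OF assms]
    by (rule order_trans[OF K(2)]) (intro mult_mono norm_bounded, use K in auto)
  qed
 qed (auto intro!: bcontfun_eqI simp: apply_pw[OF assms] add_left add_right scaleR_left scaleR_right)
qed

text \<open>The superposition (Nemytskii) operator of \<open>G\<close> on bounded continuous curves;
  \<open>apply_nem\<close> gives its values for curves in a compact set on which \<open>G\<close> is
  continuous.\<close>

definition nem :: "('b::metric_space => 'c::metric_space) => (real \<Rightarrow>\<^sub>C 'b) => (real \<Rightarrow>\<^sub>C 'c)" where
 "nem G u = Bcontfun (\<lambda>t. G (u t))"

lemma apply_nem:
 assumes "continuous_on K G" "compact K" "!!t. apply_bcontfun u t \<in> K"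
 shows "apply_bcontfun (nem G u) t = G (u t)"
proof -
 have "(\<lambda>t. G (u t)) \<in> bcontfun"
  unfolding bcontfun_def
 proof (safe)
  show "continuous_on UNIV (\<lambda>t. G (u t))"
   using assms by (auto intro: continuous_on_compose2)
  show "bounded (range (\<lambda>t. G (u t)))"
   using compact_imp_bounded[OF compact_continuous_image[OF assms(1,2)]]
   by (rule bounded_subset) (use assms(3) in auto)
 qed
 then show ?thesis unfolding nem_def by (simp add: Bcontfun_inverse)
qed

lemma bilinear_inner_scaleR:
 "bounded_bilinear (\<lambda>(a::'a::real_inner) (b::'f::real_normed_vector). (a \<bullet> i) *\<^sub>R b)"
 using bounded_bilinear.comp[OF bounded_bilinear_scaleR bounded_linear_inner_left bounded_linear_ident] .

lemma apply_nem_derivative: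
 fixes G :: "'e::euclidean_space => 'f::real_normed_vector"
 assumes "Ck_on (Suc 0) A G" "compact K" "K \<subseteq> A" and u: "!!t. apply_bcontfun u t \<in> K"
 shows "apply_bcontfun (\<Sum>i\<in>Basis. pw (\<lambda>a b. (a \<bullet> i) *\<^sub>R b) h (nem (dd i G) u)) t = dd (h t) G (u t)"
proof -
 have "continuous_on K (dd i G)" for i
  by (rule continuous_on_subset[OF _ assms(3)]) (use assms(1) in simp)
 moreover have "apply_bcontfun (\<Sum>i\<in>I. f i) t = (\<Sum>i\<in>I. apply_bcontfun (f i) t)" for I and f :: "'e => real \<Rightarrow>\<^sub>C 'f"
  by (induction I rule: infinite_finite_induct) auto
 ultimately have "apply_bcontfun (\<Sum>i\<in>Basis. pw (\<lambda>a b. (a \<bullet> i) *\<^sub>R b) h (nem (dd i G) u)) t = (\<Sum>i\<in>Basis. (h t \<bullet> i) *\<^sub>R dd i G (u t))"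
  by (simp add: apply_pw[OF bilinear_inner_scaleR] apply_nem[OF _ assms(2) u])
 also have "linear (\<lambda>v. dd v G (u t))" using has_derivative_linear[OF Ck_SucD[OF assms(1)]] u assms(3) by blast
 then have "(\<Sum>i\<in>Basis. (h t \<bullet> i) *\<^sub>R dd i G (u t)) = dd (h t) G (u t)"
  by (rule linear_Basis_expansion[symmetric])
 finally show ?thesis .
qed

text \<open>\<open>G\<close> is controlled only on \<open>K\<close>, so the derivative is taken
  within the set of curves with values in \<open>K\<close>. \<open>C1_uniform_derivative\<close>
  supplies a remainder that is uniform along the curve. The sum over \<open>Basis\<close> expresses
  the derivative through operators \<open>pw\<close> and \<open>nem\<close> again.\<close>

lemma has_derivative_nem:
 fixes G :: "'e::euclidean_space => 'f::real_normed_vector"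
 assumes "open A" "Ck_on (Suc 0) A G" "compact K" "convex K" "K \<subseteq> A"
  and u: "!!t. apply_bcontfun u t \<in> K"
 shows "(nem G has_derivative (\<lambda>h. \<Sum>i\<in>Basis. pw (\<lambda>a b. (a \<bullet> i) *\<^sub>R b) h (nem (dd i G) u)))
  (at u within {v. \<forall>t. apply_bcontfun v t \<in> K})"
 unfolding has_derivative_within_alt
proof (intro conjI allI impI ballI)
 let ?D = "\<lambda>h. \<Sum>i\<in>Basis. pw (\<lambda>a b. (a \<bullet> i) *\<^sub>R b) h (nem (dd i G) u)"
 show "bounded_linear ?D"
  by (intro bounded_linear_sum bounded_bilinear.bounded_linear_left[OF bounded_bilinear_pw]
    bilinear_inner_scaleR)
 have cG: "continuous_on K G" using Ck_continuous[OF assms(2)] assms(5) continuous_on_subset by blast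
 note apD = apply_nem_derivative[OF assms(2,3,5) u]
 fix e :: real assume e: "e > 0"
 obtain d where d: "d > 0" "!!a b. a \<in> K ==> b \<in> K ==> norm (b - a) < d ==>
  norm (G b - G a - dd (b - a) G a) <= e * norm (b - a)"
  using C1_uniform_derivative[OF assms(1-5) e] by blast
 show "\<exists>d>0. \<forall>v\<in>{v. \<forall>t. apply_bcontfun v t \<in> K}. norm (v - u) < d \<longrightarrow>
   norm (nem G v - nem G u - ?D (v - u)) <= e * norm (v - u)"
 proof (intro exI[of _ d] conjI ballI impI d(1) norm_bound)
  fix v t assume v: "v \<in> {v. \<forall>t. apply_bcontfun v t \<in> K}" "norm (v - u) < d"
  then have vK: "!!t. apply_bcontfun v t \<in> K" by simp
  have le: "norm (v t - u t) <= norm (v - u)" using norm_bounded[of "v - u" t] by simp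
  have "norm (apply_bcontfun (nem G v - nem G u - ?D (v - u)) t) =
    norm (G (v t) - G (u t) - dd (v t - u t) G (u t))"
   using apD[of "v - u" t] by (simp add: apply_nem[OF cG assms(3) u] apply_nem[OF cG assms(3) vK])
  also have "... <= e * norm (v t - u t)"
   by (rule d(2)[OF u vK]) (use le v(2) in simp)
  also have "... <= e * norm (v - u)" using le e by simp
  finally show "norm (apply_bcontfun (nem G v - nem G u - ?D (v - u)) t) <= e * norm (v - u)" .
 qed
qed

text \<open>The curves \<open>U z\<close> stay in \<open>K\<close>, so the derivative of
  \<open>nem\<close> within that set suffices for the chain rule. Its terms contain the
  superposition operators of \<open>dd i G\<close>, hence the generalization over \<open>G\<close>
  in the induction.\<close>

lemma Ck_nem:
 fixes G :: "'e::euclidean_space => 'f::real_normed_vector"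
  and U :: "'p::real_normed_vector => (real \<Rightarrow>\<^sub>C 'e)"
 assumes "open N" "open A" "compact K" "convex K" "K \<subseteq> A"
  and G: "!!k. Ck_on k A G" and U: "Ck_on k N U" "!!z t. z \<in> N ==> apply_bcontfun (U z) t \<in> K"
 shows "Ck_on k N (\<lambda>z. nem G (U z))"
 using G U(1)
proof (induction k arbitrary: G)
 case 0
 let ?S = "{v. \<forall>t. apply_bcontfun v t \<in> K}"
 have "continuous_on ?S (nem G)"
  using has_derivative_nem[OF assms(2) 0(1) assms(3-5)] has_derivative_continuous
  unfolding continuous_on_eq_continuous_within by blast
 moreover have "continuous_on N U" using 0(2) by simp
 ultimately have "continuous_on N (\<lambda>z. nem G (U z))"
  by (rule continuous_on_compose2) (use U(2) in auto)
 then show ?case by simp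
next
 case (Suc k)
 let ?S = "{v. \<forall>t. apply_bcontfun v t \<in> K}"
 have d: "((\<lambda>z. nem G (U z)) has_derivative
  (\<lambda>w. \<Sum>i\<in>Basis. pw (\<lambda>a b. (a \<bullet> i) *\<^sub>R b) (frechet_derivative U (at z) w) (nem (dd i G) (U z)))) (at z)"
  if z: "z \<in> N" for z
 proof -
  have "(nem G has_derivative (\<lambda>h. \<Sum>i\<in>Basis. pw (\<lambda>a b. (a \<bullet> i) *\<^sub>R b) h (nem (dd i G) (U z))))
   (at (U z) within U ` N)"
   by (rule has_derivative_subset[OF has_derivative_nem[OF assms(2) Suc.prems(1) assms(3-5) U(2)[OF z]]])
    (use U(2) in auto)
  from has_derivative_in_compose[OF has_derivative_at_withinI[OF Ck_SucD[OF Suc.prems(2) z]] this]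
  show ?thesis unfolding at_within_open[OF z assms(1)] .
 qed
 show ?case
 proof (rule Ck_SucI[OF assms(1) d])
  fix v
  show "Ck_on k N (\<lambda>z. \<Sum>i\<in>Basis. pw (\<lambda>a b. (a \<bullet> i) *\<^sub>R b) (frechet_derivative U (at z) v) (nem (dd i G) (U z)))"
  proof (rule Ck_sum[OF assms(1)], rule Ck_bilinear[OF assms(1) bounded_bilinear_pw[OF bilinear_inner_scaleR]])
   show "Ck_on k N (\<lambda>z. frechet_derivative U (at z) v)"
    using Suc.prems(2) unfolding Ck_on.simps(2) by blast
   have "Ck_on j A (dd i G)" for i j using Suc.prems(1)[of "Suc j"] by simp
   then show "Ck_on k N (\<lambda>z. nem (dd i G) (U z))" for i
    by (rule Suc.IH[OF _ Ck_Suc_imp[OF Suc.prems(2)]])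
  qed
 qed
qed

subsection \<open>Smooth local flows\<close>

definition clip :: "real => real" where "clip t = max (-1) (min 1 t)"

text \<open>The primitive that vanishes at \<open>0\<close>, kept constant outside
  \<open>{-1..1}\<close> so that it is again a bounded curve on the line. Subtracting two integrals
  from \<open>-1\<close> covers negative times too.\<close>

definition jint :: "(real \<Rightarrow>\<^sub>C 'e::euclidean_space) => (real \<Rightarrow>\<^sub>C 'e)" where
 "jint u = Bcontfun (\<lambda>t. integral {-1..clip t} u - integral {-1..0} u)"

lemma clip_in: "clip t \<in> {-1..1}" and clip_eq: "t \<in> {-1..1} ==> clip t = t"
 by (auto simp: clip_def)

lemma integral_bcontfun_derivative:
 fixes u :: "real \<Rightarrow>\<^sub>C 'e::euclidean_space"
 assumes "t \<in> {-1..1}"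
 shows "((\<lambda>t. integral {-1..t} u) has_vector_derivative u t) (at t within {-1..1})"
 by (rule integral_has_vector_derivative) (use assms in auto)

lemma integral_bcontfun_bound:
 fixes u :: "real \<Rightarrow>\<^sub>C 'e::euclidean_space"
 shows "norm (integral {-1..clip t} u - integral {-1..0} u) <= norm u"
proof -
 have "norm (integral {-1..clip t} u - integral {-1..0} u) <= norm u * norm (clip t - 0)"
 proof (rule differentiable_bound[where S = "{-1..1}" and f' = "\<lambda>t h. h *\<^sub>R u t"])
  show "((\<lambda>t. integral {-1..t} u) has_derivative (\<lambda>h. h *\<^sub>R u t)) (at t within {-1..1})"
   if "t \<in> {-1..1}" for t
   using integral_bcontfun_derivative[OF that] by (simp add: has_vector_derivative_def)
  show "onorm (\<lambda>h. h *\<^sub>R u t) <= norm u" if "t \<in> {-1..1}" for t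
   by (rule onorm_bound) (simp_all add: norm_bounded mult.commute mult_left_mono)
 qed (use clip_in[of t] in auto)
 also have "... <= norm u * 1" using clip_in[of t] by (intro mult_left_mono) auto
 finally show ?thesis by simp
qed

lemma apply_jint: "apply_bcontfun (jint u) t = integral {-1..clip t} u - integral {-1..0} u"
proof -
 have "continuous_on {-1..1} (\<lambda>t. integral {-1..t} u)"
  using integral_bcontfun_derivative[of _ u] has_vector_derivative_continuous
  unfolding continuous_on_eq_continuous_within by blast
 then have "continuous_on UNIV (\<lambda>t. integral {-1..clip t} u)"
  by (rule continuous_on_compose2) (use clip_in in "auto simp: clip_def intro!: continuous_intros")
 then have "(\<lambda>t. integral {-1..clip t} u - integral {-1..0} u) \<in> bcontfun"
  by (intro bcontfun_normI[OF _ integral_bcontfun_bound] continuous_intros)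
 then show ?thesis unfolding jint_def by (simp add: Bcontfun_inverse)
qed

lemma norm_jint: "norm (jint u) <= norm u"
 by (rule norm_bound) (simp add: apply_jint integral_bcontfun_bound)

lemma bounded_linear_jint: "bounded_linear (jint :: (real \<Rightarrow>\<^sub>C 'e::euclidean_space) => _)"
proof (rule bounded_linear_intro[where K = 1])
 have i: "apply_bcontfun u integrable_on {a..b}" for u :: "real \<Rightarrow>\<^sub>C 'e" and a b
  by (intro integrable_continuous_real) simp
 show "jint (u + v) = jint u + jint v" for u v :: "real \<Rightarrow>\<^sub>C 'e"
  by (rule bcontfun_eqI) (simp add: apply_jint integral_add i)
 show "jint (r *\<^sub>R u) = r *\<^sub>R jint u" for r and u :: "real \<Rightarrow>\<^sub>C 'e"
  by (rule bcontfun_eqI) (simp add: apply_jint scaleR_diff_right)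
qed (simp add: norm_jint)

lemma jint_0: "apply_bcontfun (jint u) 0 = 0"
 by (simp add: apply_jint clip_def)

lemma jint_derivative:
 assumes "t \<in> {-1..1}"
 shows "((\<lambda>t. apply_bcontfun (jint u) t) has_vector_derivative u t) (at t within {-1..1})"
proof (rule has_vector_derivative_transform[OF assms])
 show "((\<lambda>t. integral {-1..t} u - integral {-1..0} u) has_vector_derivative u t) (at t within {-1..1})"
  using integral_bcontfun_derivative[OF assms, of u] by (auto intro!: derivative_eq_intros)
qed (simp add: apply_jint clip_eq)

lemma linear_const_bcontfun:
 "bounded_linear (const_bcontfun :: 'e::real_normed_vector => (real \<Rightarrow>\<^sub>C 'e))"
 by (rule bounded_linear_intro[where K = 1])
  (auto intro!: bcontfun_eqI norm_bound simp: const_bcontfun.rep_eq)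

lemma bounded_bilinear_linear_compose:
 assumes "bounded_linear L" "bounded_bilinear B"
 shows "bounded_bilinear (\<lambda>x y. L (B x y))"
proof -
 interpret L: bounded_linear L by fact
 interpret B: bounded_bilinear B by fact
 obtain K where K: "K > 0" "!!x. norm (L x) <= norm x * K" using L.pos_bounded by blast
 obtain M where M: "M > 0" "!!x y. norm (B x y) <= norm x * norm y * M" using B.pos_bounded by blast
 show ?thesis
 proof
  show "\<exists>K. \<forall>x y. norm (L (B x y)) <= norm x * norm y * K"
  proof (intro exI allI)
   fix x y
   have "norm (L (B x y)) <= norm (B x y) * K" by (rule K(2))
   also have "... <= norm x * norm y * M * K" by (intro mult_right_mono M(2)) (use K in auto)
   finally show "norm (L (B x y)) <= norm x * norm y * (M * K)" by (simp add: mult.assoc)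
  qed
 qed (simp_all add: B.add_left B.add_right B.scaleR_left B.scaleR_right L.add L.scaleR)
qed

text \<open>A chain rule for an inner map that is only Lipschitz: when the outer derivative
  vanishes, no derivative of \<open>U\<close> is called for.\<close>

lemma has_derivative_zero_compose:
 assumes g: "(g has_derivative (\<lambda>h. 0)) (at (U p) within S)" and N: "open N" "p \<in> N"
  and U: "!!q. q \<in> N ==> U q \<in> S" "!!q. q \<in> N ==> norm (U q - U p) <= L * norm (q - p)" and L: "L > 0"
 shows "((\<lambda>q. g (U q)) has_derivative (\<lambda>h. 0)) (at p)"
 unfolding has_derivative_within_alt at_within_open[OF N(2,1), symmetric]
proof (intro conjI allI impI)
 fix e :: real assume "e > 0"
 then have "e / L > 0" using L by simp
 then obtain d where d: "d > 0" "!!v. v \<in> S ==> norm (v - U p) < d ==> norm (g v - g (U p)) <= e / L * norm (v - U p)"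
  using g unfolding has_derivative_within_alt by auto
 have "norm (g (U q) - g (U p) - 0) <= e * norm (q - p)" if q: "q \<in> N" "norm (q - p) < d / L" for q
 proof -
  have "norm (U q - U p) < d" using U(2)[OF q(1)] q(2) L by (simp add: field_simps)
  then have "norm (g (U q) - g (U p)) <= e / L * norm (U q - U p)" using d(2) U(1)[OF q(1)] by blast
  also have "... <= e / L * (L * norm (q - p))" using \<open>e / L > 0\<close> by (intro mult_left_mono U(2)[OF q(1)]) auto
  finally show ?thesis using L by simp
 qed
 then show "\<exists>d>0. \<forall>q\<in>N. norm (q - p) < d --> norm (g (U q) - g (U p) - 0) <= e * norm (q - p)"
  using d(1) L by (intro exI[of _ "d / L"]) auto
qed simp

text \<open>Picard iteration on curves parametrized by the interval from -1 to 1, with a time scale as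
 an additional parameter: the solution depends on time scale and initial value as a smooth map
 into the Banach space of curves.\<close>

lemma Picard_smooth:
 fixes F :: "'e::euclidean_space => 'e"
 assumes A: "open A" and F: "smooth_on A F" and "z0 \<in> A"
 obtains \<tau> r K L and U :: "real \<times> 'e => (real \<Rightarrow>\<^sub>C 'e)" where "\<tau> > 0" "r > 0" "K \<subseteq> A" "ball z0 r \<subseteq> K"
  "!!a b. a \<in> K ==> b \<in> K ==> norm (F a - F b) <= L * norm (a - b)"
  "smooth_on ({+-\<tau>} \<times> ball z0 r) U"
  "!!s z t. \<bar>s\<bar> < \<tau> ==> z \<in> ball z0 r ==> apply_bcontfun (U (s, z)) t \<in> K"
  "!!s z. \<bar>s\<bar> < \<tau> ==> z \<in> ball z0 r ==> apply_bcontfun (U (s, z)) 0 = z"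
  "!!s z t. \<bar>s\<bar> < \<tau> ==> z \<in> ball z0 r ==> t \<in> {-1..1} ==>
   (apply_bcontfun (U (s, z)) has_vector_derivative s *\<^sub>R F (U (s, z) t)) (at t within {-1..1})"
proof -
 have CF: "Ck_on k A F" for k using F by (simp add: smooth_on_def)
 obtain \<rho> where \<rho>: "\<rho> > 0" "cball z0 \<rho> \<subseteq> A"
  using A assms(3) open_contains_cball by blast
 define K where "K = cball z0 \<rho>"
 have K: "compact K" "convex K" "K \<subseteq> A" "closed K" "K \<noteq> {}" using \<rho> by (auto simp: K_def)
 obtain L where L: "L > 0" "!!a v. a \<in> K ==> norm (dd v F a) <= L * norm v"
  "!!a b. a \<in> K ==> b \<in> K ==> norm (F b - F a) <= L * norm (b - a)"
  using C1_bound_Lipschitz[OF A CF K(1-3)] by blast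
 have cF: "continuous_on K F" using Ck_continuous[OF CF] K(3) continuous_on_subset by blast
 obtain M where M: "M > 0" "!!a. a \<in> K ==> norm (F a) <= M"
  using compact_imp_bounded[OF compact_continuous_image[OF cF K(1)]] by (auto simp: bounded_pos)
 \<comment> \<open>The projection to the nearest point of the ball \<open>K\<close> makes the field
   bounded and Lipschitz on the whole space, so the Picard map is defined for all curves. The
   solutions found stay in \<open>K\<close>, where the field is unchanged.\<close>
 define G where "G = (\<lambda>a. F (closest_point K a))"
 have cpK: "closest_point K a \<in> K" for a by (rule closest_point_in_set[OF K(4,5)])
 have contG: "continuous_on S G" for S
  unfolding G_def
  by (rule continuous_on_compose2[OF cF continuous_on_closest_point[OF K(2,4,5)]]) (use cpK in auto)
 have GM: "norm (G a) <= M" for a unfolding G_def by (rule M(2)[OF cpK])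
 have GL: "norm (G a - G b) <= L * norm (a - b)" for a b
 proof -
  have "norm (G a - G b) <= L * norm (closest_point K a - closest_point K b)"
   unfolding G_def by (rule L(3)[OF cpK cpK])
  also have "... <= L * norm (a - b)"
   using closest_point_lipschitz[OF K(2,4,5), of a b] L(1) by (simp add: dist_norm)
  finally show ?thesis .
 qed
 have GF: "G a = F a" if "a \<in> K" for a using that by (simp add: G_def closest_point_self)
 define NG :: "(real \<Rightarrow>\<^sub>C 'e) => (real \<Rightarrow>\<^sub>C 'e)" where "NG = (\<lambda>u. Bcontfun (\<lambda>t. G (apply_bcontfun u t)))"
 have apNG: "apply_bcontfun (NG u) t = G (u t)" for u t
 proof -
  have "(\<lambda>t. G (apply_bcontfun u t)) \<in> bcontfun"
   by (rule bcontfun_normI[OF _ GM]) (auto intro: continuous_on_compose2[OF contG[of UNIV]])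
  then show ?thesis unfolding NG_def by (simp add: Bcontfun_inverse)
 qed
 have NGM: "norm (NG u) <= M" for u by (rule norm_bound) (simp add: apNG GM)
 have NGL: "norm (NG u - NG v) <= L * norm (u - v)" for u v
 proof (rule norm_bound)
  fix t
  have "norm (apply_bcontfun (NG u - NG v) t) <= L * norm (apply_bcontfun (u - v) t)"
   using GL by (simp add: apNG)
  also have "... <= L * norm (u - v)" using norm_bounded[of "u - v" t] L(1) by simp
  finally show "norm (apply_bcontfun (NG u - NG v) t) <= L * norm (u - v)" .
 qed
 interpret J: bounded_linear "jint :: (real \<Rightarrow>\<^sub>C 'e) => _" by (rule bounded_linear_jint)
 interpret C: bounded_linear "const_bcontfun :: 'e => (real \<Rightarrow>\<^sub>C 'e)" by (rule linear_const_bcontfun)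
 \<comment> \<open>The first bound makes the Picard map a contraction with factor 1/2, the second
   keeps a solution within \<open>\<rho> / 4\<close> of its initial value, hence in
   \<open>K\<close>.\<close>
 define \<tau> where "\<tau> = min (1 / (2 * L)) (\<rho> / (4 * M))"
 define r where "r = \<rho> / 2"
 have \<tau>: "\<tau> > 0" and r: "r > 0" using L(1) M(1) \<rho>(1) by (auto simp: \<tau>_def r_def)
 have sL: "\<bar>s\<bar> * L <= 1 / 2" and sM: "\<bar>s\<bar> * M <= \<rho> / 4" if "\<bar>s\<bar> < \<tau>" for s
  using that L(1) M(1) unfolding \<tau>_def by (auto simp: field_simps)
 define T where "T = (\<lambda>(s, z) u. const_bcontfun z + s *\<^sub>R jint (NG u))"
 have contr: "norm (s *\<^sub>R jint (NG u) - s *\<^sub>R jint (NG v)) <= norm (u - v) / 2" if "\<bar>s\<bar> < \<tau>" for s u v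
 proof -
  have "norm (s *\<^sub>R jint (NG u) - s *\<^sub>R jint (NG v)) = \<bar>s\<bar> * norm (jint (NG u - NG v))"
   by (simp add: J.diff scaleR_diff_right[symmetric])
  also have "... <= \<bar>s\<bar> * (L * norm (u - v))"
   by (intro mult_left_mono order_trans[OF norm_jint] NGL) auto
  also have "... = (\<bar>s\<bar> * L) * norm (u - v)" by simp
  also have "... <= 1 / 2 * norm (u - v)" by (intro mult_right_mono sL that) auto
  finally show ?thesis by simp
 qed
 define U where "U = (\<lambda>p. THE u. T p u = u)"
 have U: "U (s, z) = const_bcontfun z + s *\<^sub>R jint (NG (U (s, z)))" if "\<bar>s\<bar> < \<tau>" for s z
 proof -
  have "\<exists>!u. T (s, z) u = u"
   by (rule banach_fix_type[of "1/2"]) (use contr[OF that] in "auto simp: T_def dist_norm")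
  then have "T (s, z) (U (s, z)) = U (s, z)" unfolding U_def by (rule theI')
  then show ?thesis by (simp add: T_def)
 qed
 define N where "N = {+-\<tau>} \<times> ball z0 r"
 have N: "open N" by (simp add: N_def open_Times)
 have inK: "apply_bcontfun (U (s, z)) t \<in> K" if "\<bar>s\<bar> < \<tau>" "z \<in> ball z0 r" for s z t
 proof -
  have "norm (apply_bcontfun (s *\<^sub>R jint (NG (U (s, z)))) t) <= norm (s *\<^sub>R jint (NG (U (s, z))))"
   by (rule norm_bounded)
  also have "... <= \<bar>s\<bar> * M" using order_trans[OF norm_jint NGM] by (simp add: mult_left_mono)
  also have "... <= \<rho> / 4" by (rule sM[OF that(1)])
  finally have "norm (apply_bcontfun (s *\<^sub>R jint (NG (U (s, z)))) t) <= \<rho> / 4" .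
  moreover have "apply_bcontfun (U (s, z)) t = z + apply_bcontfun (s *\<^sub>R jint (NG (U (s, z)))) t"
   by (subst U[OF that(1)]) (simp add: const_bcontfun.rep_eq)
  ultimately have "dist (apply_bcontfun (U (s, z)) t) z <= \<rho> / 4" by (simp add: dist_norm)
  then show ?thesis using that(2) \<rho>(1) dist_triangle2[of z0 "apply_bcontfun (U (s, z)) t" z]
   by (simp add: K_def r_def dist_commute)
 qed
 have UN: "U p = const_bcontfun (snd p) + fst p *\<^sub>R jint (nem F (U p))" if "p \<in> N" for p
 proof -
  obtain s z where p: "p = (s, z)" "\<bar>s\<bar> < \<tau>" "z \<in> ball z0 r"
   using \<open>p \<in> N\<close> by (cases p) (auto simp: N_def)
  have "NG (U p) = nem F (U p)"
   by (rule bcontfun_eqI) (use inK[OF p(2,3)] GF p(1) in "auto simp: apNG apply_nem[OF cF K(1)]")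
  then show ?thesis using U[OF p(2), of z] p(1) by simp
 qed
 have UK: "apply_bcontfun (U p) t \<in> K" if "p \<in> N" for p t
  using that inK by (cases p) (auto simp: N_def)
 have pN: "\<bar>fst p\<bar> < \<tau>" if "p \<in> N" for p using that by (auto simp: N_def)
 \<comment> \<open>Lipschitz dependence on time scale and initial value comes before
   differentiability: it lets the linearization of \<open>nem\<close>, known only within the curves
   in \<open>K\<close>, be composed with \<open>U\<close>.\<close>
 have lip: "norm (U p - U q) <= 2 * (1 + M) * norm (p - q)" if "p \<in> N" "q \<in> N" for p q
 proof -
  obtain s z s' z' where pq: "p = (s, z)" "q = (s', z')" by (cases p, cases q) auto
  have b: "\<bar>s\<bar> < \<tau>" "\<bar>s'\<bar> < \<tau>" using pN[OF that(1)] pN[OF that(2)] pq by auto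
  have "U p - U q = (const_bcontfun (z - z') + (s - s') *\<^sub>R jint (NG (U q)))
    + (s *\<^sub>R jint (NG (U p)) - s *\<^sub>R jint (NG (U q)))"
  proof -
   have "U p - U q = (const_bcontfun z + s *\<^sub>R jint (NG (U p))) - (const_bcontfun z' + s' *\<^sub>R jint (NG (U q)))"
    unfolding pq by (rule arg_cong2[where f = minus, OF U[OF b(1)] U[OF b(2)]])
   then show ?thesis by (simp add: C.diff scaleR_diff_left)
  qed
  then have "norm (U p - U q) <= norm (const_bcontfun (z - z') + (s - s') *\<^sub>R jint (NG (U q)))
    + norm (s *\<^sub>R jint (NG (U p)) - s *\<^sub>R jint (NG (U q)))"
   by (metis norm_triangle_ineq)
  also have "... <= (norm (z - z') + \<bar>s - s'\<bar> * M) + norm (U p - U q) / 2"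
  proof (rule add_mono[OF norm_triangle_le contr[OF b(1)]])
   have "norm (const_bcontfun (z - z') :: real \<Rightarrow>\<^sub>C 'e) <= norm (z - z')"
    by (rule norm_bound) (simp add: const_bcontfun.rep_eq)
   moreover have "norm ((s - s') *\<^sub>R jint (NG (U q))) <= \<bar>s - s'\<bar> * M"
    using order_trans[OF norm_jint NGM] by (simp add: mult_left_mono)
   ultimately show "norm (const_bcontfun (z - z') :: real \<Rightarrow>\<^sub>C 'e) + norm ((s - s') *\<^sub>R jint (NG (U q)))
    <= norm (z - z') + \<bar>s - s'\<bar> * M" by (rule add_mono)
  qed
  finally have "norm (U p - U q) <= 2 * (norm (z - z') + \<bar>s - s'\<bar> * M)" by simp
  also have "... <= 2 * (norm (p - q) + norm (p - q) * M)"
   using norm_snd_le[of "z - z'" "s - s'"] norm_fst_le[of "s - s'" "z - z'"] M(1) pq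
   by (intro mult_left_mono add_mono mult_right_mono) auto
  finally show ?thesis by (simp add: algebra_simps)
 qed
 define DF where "DF = (\<lambda>a. Blinfun (\<lambda>v. dd v F a))"
 have apDF: "blinfun_apply (DF a) = (\<lambda>v. dd v F a)" if "a \<in> A" for a
  unfolding DF_def by (rule Blinfun_apply_dd[OF CF that])
 have CDF: "Ck_on k A DF" for k
  unfolding DF_def
  by (rule Ck_Blinfun[OF A linear_dd[OF F]])
   (use smooth_dd[OF F] in "simp_all add: smooth_on_def")
 have cDF: "continuous_on K DF" using Ck_continuous[OF CDF] K(3) continuous_on_subset by blast
 define B where "B = (\<lambda>p. fst p *\<^sub>R nem DF (U p))"
 define op :: "(real \<Rightarrow>\<^sub>C ('e \<Rightarrow>\<^sub>L 'e)) => (real \<Rightarrow>\<^sub>C 'e) => (real \<Rightarrow>\<^sub>C 'e)"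
  where "op = (\<lambda>b y. jint (pw blinfun_apply b y))"
 have opb: "bounded_bilinear op"
  unfolding op_def
  by (rule bounded_bilinear_linear_compose[OF bounded_linear_jint bounded_bilinear_pw[OF bounded_bilinear_blinfun_apply]])
 interpret op: bounded_bilinear op by (rule opb)
 have op_half: "norm (op (B p) y) <= norm y / 2" if "p \<in> N" for p y
 proof -
  have "norm (op (B p) y) <= norm (pw blinfun_apply (B p) y)" unfolding op_def by (rule norm_jint)
  also have "... <= norm y / 2"
  proof (rule norm_bound)
   fix t
   have UA: "apply_bcontfun (U p) t \<in> A" using UK[OF that] K(3) by auto
   have "apply_bcontfun (pw blinfun_apply (B p) y) t = fst p *\<^sub>R dd (y t) F (U p t)"
    unfolding apply_pw[OF bounded_bilinear_blinfun_apply] B_def scaleR_bcontfun.rep_eq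
     apply_nem[OF cDF K(1) UK[OF that]] blinfun.scaleR_left apDF[OF UA] by simp
   also have "norm ... <= \<bar>fst p\<bar> * (L * norm (y t))"
    using L(2)[OF UK[OF that]] by (simp add: mult_left_mono)
   also have "... = (\<bar>fst p\<bar> * L) * norm (y t)" by simp
   also have "... <= 1 / 2 * norm y" by (intro mult_mono sL pN that norm_bounded) auto
   finally show "norm (apply_bcontfun (pw blinfun_apply (B p) y) t) <= norm y / 2" by simp
  qed
  finally show ?thesis .
 qed
 have linop: "linear (op b)" for b by (rule op.bounded_linear_right[THEN bounded_linear.linear])
 \<comment> \<open>\<open>c\<close> collects the derivative in the explicit parameters; the
   derivative of \<open>U\<close> is the solution of the linearized equation with this
   inhomogeneity.\<close>
 define c where "c = (\<lambda>p h. const_bcontfun (snd h) + fst h *\<^sub>R jint (nem F (U p)))"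
 define D where "D = (\<lambda>p h. THE y. y = c p h + op (B p) y)"
 have D: "D p h = c p h + op (B p) (D p h)" if "p \<in> N" for p h
  unfolding D_def by (rule theI') (rule contraction_fixpoint[OF linop op_half[OF that]])
 let ?C = "2 * (1 + M)"
 have "?C-lipschitz_on N U" using lip M(1) by (auto intro!: lipschitz_onI simp: dist_norm)
 then have C0: "Ck_on 0 N U" by (simp add: lipschitz_on_continuous_on)
 have dU: "(U has_derivative D p) (at p)" if p: "p \<in> N" for p
 proof (rule has_derivative_contraction[OF linop op_half[OF p] _ D[OF p]])
  define E where "E = (\<lambda>h. \<Sum>i\<in>Basis. pw (\<lambda>a b. (a \<bullet> i) *\<^sub>R b) h (nem (dd i F) (U p)))"
  have E: "(nem F has_derivative E) (at (U p) within {v. \<forall>t. apply_bcontfun v t \<in> K})"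
   unfolding E_def by (rule has_derivative_nem[OF A CF K(1-3) UK[OF p]])
  have Eop: "fst p *\<^sub>R jint (E y) = op (B p) y" for y
  proof -
   have "E y = pw blinfun_apply (nem DF (U p)) y"
   proof (rule bcontfun_eqI)
    fix t
    have UA: "apply_bcontfun (U p) t \<in> A" using UK[OF p] K(3) by auto
    show "apply_bcontfun (E y) t = apply_bcontfun (pw blinfun_apply (nem DF (U p)) y) t"
     unfolding E_def apply_nem_derivative[OF CF K(1,3) UK[OF p]] apply_pw[OF bounded_bilinear_blinfun_apply]
      apply_nem[OF cDF K(1) UK[OF p]] apDF[OF UA] ..
   qed
   then show ?thesis
    by (simp add: op_def B_def bounded_bilinear.scaleR_left[OF bounded_bilinear_pw[OF bounded_bilinear_blinfun_apply]] J.scaleR)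
  qed
  have "((\<lambda>v. nem F v - E v) has_derivative (\<lambda>h. 0)) (at (U p) within {v. \<forall>t. apply_bcontfun v t \<in> K})"
   using has_derivative_diff[OF E bounded_linear_imp_has_derivative[OF has_derivative_bounded_linear[OF E]]] by simp
  then have d3: "((\<lambda>q. nem F (U q) - E (U q)) has_derivative (\<lambda>h. 0)) (at p)"
   by (rule has_derivative_zero_compose[OF _ N p _ lip[OF _ p]]) (use UK M(1) in auto)
  have "continuous_on N (\<lambda>q. nem F (U q))" using Ck_nem[OF N A K(1-3) CF C0 UK] by simp
  then have "isCont (\<lambda>q. jint (nem F (U q))) p"
   using N p by (simp add: continuous_on_eq_continuous_at bounded_linear.isCont[OF bounded_linear_jint])
  then have d2: "((\<lambda>q. (fst q - fst p) *\<^sub>R jint (nem F (U q))) has_derivative (\<lambda>h. fst h *\<^sub>R jint (nem F (U p)))) (at p)"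
   using has_derivative_diff[OF has_derivative_fst[OF has_derivative_ident] has_derivative_const]
   by (intro has_derivative_vanishing_product[OF bounded_bilinear_scaleR]) auto
  have "((\<lambda>q. const_bcontfun (snd q) + ((fst q - fst p) *\<^sub>R jint (nem F (U q)) + fst p *\<^sub>R jint (nem F (U q) - E (U q))))
    has_derivative (\<lambda>h. const_bcontfun (snd h) + (fst h *\<^sub>R jint (nem F (U p)) + fst p *\<^sub>R jint 0))) (at p)"
   by (intro has_derivative_add d2 bounded_linear.has_derivative[OF linear_const_bcontfun] has_derivative_snd
     has_derivative_ident has_derivative_scaleR_right bounded_linear.has_derivative[OF bounded_linear_jint] d3)
  then have "((\<lambda>q. const_bcontfun (snd q) + ((fst q - fst p) *\<^sub>R jint (nem F (U q)) + fst p *\<^sub>R jint (nem F (U q) - E (U q))))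
    has_derivative c p) (at p)" by (simp add: c_def J.zero)
  then show "((\<lambda>q. U q - op (B p) (U q)) has_derivative c p) (at p)"
  proof (rule has_derivative_transform_within_open[OF _ N p])
   fix q assume "q \<in> N"
   from UN[OF this] have "U q - op (B p) (U q) = (const_bcontfun (snd q) + fst q *\<^sub>R jint (nem F (U q))) - op (B p) (U q)" by simp
   then show "const_bcontfun (snd q) + ((fst q - fst p) *\<^sub>R jint (nem F (U q)) + fst p *\<^sub>R jint (nem F (U q) - E (U q)))
     = U q - op (B p) (U q)"
    by (simp add: Eop[symmetric] J.diff scaleR_diff_left scaleR_diff_right)
  qed
 qed
 have CU: "Ck_on k N U" for k
 proof (induction k)
  case 0
  show ?case by (rule C0)
 next
  case (Suc k)
  have fstC: "Ck_on k N fst" by (rule Ck_bounded_linear[OF N bounded_linear_fst])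
  show ?case
  proof (rule Ck_SucI[OF N dU])
   fix h
   show "Ck_on k N (\<lambda>p. D p h)"
   proof (rule Ck_linear_fixpoint[OF N opb, where A = B and b = "\<lambda>p. c p h"])
    show "Ck_on k N B"
     unfolding B_def
     by (intro Ck_bilinear[OF N bounded_bilinear_scaleR] fstC
       Ck_nem[OF N A K(1-3) CDF Suc UK])
    show "Ck_on k N (\<lambda>p. c p h)"
     unfolding c_def
     by (intro Ck_add[OF N] Ck_const Ck_linear_compose[OF N bounded_linear_scaleR_right]
       Ck_linear_compose[OF N bounded_linear_jint] Ck_nem[OF N A K(1-3) CF Suc UK])
   qed (use D op_half in auto)
  qed
 qed
 show thesis
 proof (rule that[of \<tau> r K L U, OF \<tau> r K(3)])
  show "ball z0 r \<subseteq> K" using \<rho>(1) by (auto simp: r_def K_def)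
  show "norm (F a - F b) <= L * norm (a - b)" if "a \<in> K" "b \<in> K" for a b
   by (rule L(3)[OF that(2,1)])
  show "smooth_on ({+-\<tau>} \<times> ball z0 r) U" using CU by (simp add: smooth_on_def N_def)
  show "apply_bcontfun (U (s, z)) t \<in> K" if "\<bar>s\<bar> < \<tau>" "z \<in> ball z0 r" for s z t
   by (rule inK[OF that])
  show "apply_bcontfun (U (s, z)) 0 = z" if "\<bar>s\<bar> < \<tau>" "z \<in> ball z0 r" for s z
   by (subst U[OF that(1)]) (simp add: const_bcontfun.rep_eq jint_0)
  show "(apply_bcontfun (U (s, z)) has_vector_derivative s *\<^sub>R F (U (s, z) t)) (at t within {-1..1})"
   if "\<bar>s\<bar> < \<tau>" "z \<in> ball z0 r" "t \<in> {-1..1}" for s z t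
  proof -
   have "apply_bcontfun (U (s, z)) = (\<lambda>t. z + s *\<^sub>R apply_bcontfun (jint (NG (U (s, z)))) t)"
    by (subst U[OF that(1)]) (auto simp: const_bcontfun.rep_eq)
   moreover have "((\<lambda>t. z + s *\<^sub>R apply_bcontfun (jint (NG (U (s, z)))) t) has_vector_derivative
     0 + s *\<^sub>R (NG (U (s, z)) t)) (at t within {-1..1})"
    by (intro has_vector_derivative_add has_vector_derivative_const
      bounded_linear.has_vector_derivative[OF bounded_linear_scaleR_right] jint_derivative that(3))
   ultimately show ?thesis using GF[OF inK[OF that(1,2)]] by (simp add: apNG)
  qed
 qed
qed

text \<open>The flow at time \<open>s\<close> is read off at curve parameter 1 of the Picard
  solution with time scale \<open>s\<close>, so smoothness in \<open>s\<close> is smoothness in a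
  parameter. By uniqueness of solutions \<open>U (s, z)\<close> is a reparametrization of
  \<open>U (\<sigma>, z)\<close>, which gives the differential equation in \<open>s\<close>.\<close>

theorem smooth_local_flow:
 fixes F :: "'e::euclidean_space => 'e"
 assumes A: "open A" and F: "smooth_on A F" and "z0 \<in> A"
 obtains \<tau> r and \<phi> :: "real \<times> 'e => 'e" where "\<tau> > 0" "r > 0" "ball z0 r \<subseteq> A"
  "smooth_on ({+-\<tau>} \<times> ball z0 r) \<phi>"
  "!!z. z \<in> ball z0 r ==> \<phi> (0, z) = z"
  "!!s z. \<bar>s\<bar> < \<tau> ==> z \<in> ball z0 r ==> \<phi> (s, z) \<in> A"
  "!!s z. \<bar>s\<bar> < \<tau> ==> z \<in> ball z0 r ==> ((\<lambda>s. \<phi> (s, z)) has_vector_derivative F (\<phi> (s, z))) (at s)"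
proof -
 obtain \<tau> r K L and U :: "real \<times> 'e => (real \<Rightarrow>\<^sub>C 'e)" where U: "\<tau> > 0" "r > 0" "K \<subseteq> A" "ball z0 r \<subseteq> K"
  "!!a b. a \<in> K ==> b \<in> K ==> norm (F a - F b) <= L * norm (a - b)"
  "smooth_on ({+-\<tau>} \<times> ball z0 r) U"
  "!!s z t. \<bar>s\<bar> < \<tau> ==> z \<in> ball z0 r ==> apply_bcontfun (U (s, z)) t \<in> K"
  "!!s z. \<bar>s\<bar> < \<tau> ==> z \<in> ball z0 r ==> apply_bcontfun (U (s, z)) 0 = z"
  "!!s z t. \<bar>s\<bar> < \<tau> ==> z \<in> ball z0 r ==> t \<in> {-1..1} ==>
   (apply_bcontfun (U (s, z)) has_vector_derivative s *\<^sub>R F (U (s, z) t)) (at t within {-1..1})"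
  using Picard_smooth[OF assms] by blast
 define \<phi> where "\<phi> = (\<lambda>p. apply_bcontfun (U p) 1)"
 have resc: "\<phi> (s, z) = apply_bcontfun (U (\<sigma>, z)) (s / \<sigma>)"
  if s: "\<bar>s\<bar> <= \<sigma>" "0 < \<sigma>" "\<sigma> < \<tau>" "z \<in> ball z0 r" for s \<sigma> z
 proof -
  have s\<tau>: "\<bar>s\<bar> < \<tau>" "\<bar>\<sigma>\<bar> < \<tau>" using s by auto
  have in1: "s / \<sigma> * t \<in> {-1..1}" if "t \<in> {-1..1}" for t
  proof -
   have "\<bar>s / \<sigma> * t\<bar> = (\<bar>s\<bar> / \<sigma>) * \<bar>t\<bar>" using s(2) by (simp add: abs_mult)
   also have "... <= 1 * 1" using s(1,2) that by (intro mult_mono) auto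
   finally have "\<bar>s / \<sigma> * t\<bar> <= 1" by simp
   then show ?thesis unfolding abs_le_iff atLeastAtMost_iff by linarith
  qed
  have "apply_bcontfun (U (s, z)) 1 = apply_bcontfun (U (\<sigma>, z)) (s / \<sigma> * 1)"
  proof (rule ode_unique[of 0 "-1" 1 "apply_bcontfun (U (s, z))" "\<lambda>t. apply_bcontfun (U (\<sigma>, z)) (s / \<sigma> * t)"
     "\<lambda>t. s *\<^sub>R F (U (s, z) t)" "\<lambda>t. s *\<^sub>R F (U (\<sigma>, z) (s / \<sigma> * t))" "\<bar>s\<bar> * L" 1])
   show "apply_bcontfun (U (s, z)) 0 = apply_bcontfun (U (\<sigma>, z)) (s / \<sigma> * 0)"
    using U(8)[OF s\<tau>(1) s(4)] U(8)[OF s\<tau>(2) s(4)] by simp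
   show "(apply_bcontfun (U (s, z)) has_vector_derivative s *\<^sub>R F (U (s, z) t)) (at t within {-1..1})"
    if "t \<in> {-1..1}" for t by (rule U(9)[OF s\<tau>(1) s(4) that])
   show "((\<lambda>t. apply_bcontfun (U (\<sigma>, z)) (s / \<sigma> * t)) has_vector_derivative
     s *\<^sub>R F (U (\<sigma>, z) (s / \<sigma> * t))) (at t within {-1..1})" if t: "t \<in> {-1..1}" for t
   proof -
    have 1: "((\<lambda>t. s / \<sigma> * t) has_vector_derivative s / \<sigma>) (at t within {-1..1})"
     by (auto intro!: derivative_eq_intros)
    have 2: "(apply_bcontfun (U (\<sigma>, z)) has_vector_derivative \<sigma> *\<^sub>R F (U (\<sigma>, z) (s / \<sigma> * t)))
      (at (s / \<sigma> * t) within (\<lambda>t. s / \<sigma> * t) ` {-1..1})"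
     by (rule has_vector_derivative_within_subset[OF U(9)[OF s\<tau>(2) s(4) in1[OF t]]]) (use in1 in auto)
    from vector_diff_chain_within[OF 1 2] show ?thesis using s(2) by (simp add: o_def)
   qed
   show "norm (s *\<^sub>R F (U (s, z) t) - s *\<^sub>R F (U (\<sigma>, z) (s / \<sigma> * t)))
     <= \<bar>s\<bar> * L * norm (U (s, z) t - U (\<sigma>, z) (s / \<sigma> * t))" for t
    using mult_left_mono[OF U(5)[OF U(7)[OF s\<tau>(1) s(4)] U(7)[OF s\<tau>(2) s(4)]], of "\<bar>s\<bar>"]
    by (simp add: scaleR_diff_right[symmetric] mult.assoc)
  qed auto
  then show ?thesis by (simp add: \<phi>_def)
 qed
 show thesis
 proof (rule that[of \<tau> r \<phi>])
  show "smooth_on ({+-\<tau>} \<times> ball z0 r) \<phi>"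
   unfolding \<phi>_def
  proof (rule smooth_linear_compose[OF _ _ U(6)])
   show "bounded_linear (\<lambda>u :: real \<Rightarrow>\<^sub>C 'e. apply_bcontfun u 1)"
    by (rule bounded_linear_intro[where K = 1]) (auto simp: norm_bounded)
  qed (simp add: open_Times)
  show "\<phi> (0, z) = z" if "z \<in> ball z0 r" for z
   using resc[of 0 "\<tau> / 2" z] U(1) U(8)[of "\<tau> / 2" z] that by simp
  show "\<phi> (s, z) \<in> A" if "\<bar>s\<bar> < \<tau>" "z \<in> ball z0 r" for s z
   unfolding \<phi>_def using U(3) U(7)[OF that] by auto
  show "((\<lambda>s. \<phi> (s, z)) has_vector_derivative F (\<phi> (s, z))) (at s)" if s: "\<bar>s\<bar> < \<tau>" "z \<in> ball z0 r" for s z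
  proof -
   \<comment> \<open>A scale strictly between \<open>\<bar>s\<bar>\<close> and
     \<open>\<tau>\<close>, so that \<open>s / \<sigma>\<close> is an interior point of the curve
     parameter interval.\<close>
   define \<sigma> where "\<sigma> = (\<bar>s\<bar> + \<tau>) / 2"
   have \<sigma>: "\<bar>s\<bar> < \<sigma>" "0 < \<sigma>" "\<sigma> < \<tau>" "\<bar>\<sigma>\<bar> < \<tau>" using s(1) by (auto simp: \<sigma>_def)
   have in1: "s / \<sigma> \<in> {+-1}" using \<sigma> by (auto simp: field_simps abs_less_iff)
   have "(apply_bcontfun (U (\<sigma>, z)) has_vector_derivative \<sigma> *\<^sub>R F (U (\<sigma>, z) (s / \<sigma>))) (at (s / \<sigma>))"
    using U(9)[OF \<sigma>(4) s(2), of "s / \<sigma>"] in1 by (simp add: at_within_Icc_at)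
   then have "((apply_bcontfun (U (\<sigma>, z)) \<circ> (\<lambda>s. s / \<sigma>)) has_vector_derivative (1 / \<sigma>) *\<^sub>R (\<sigma> *\<^sub>R F (U (\<sigma>, z) (s / \<sigma>)))) (at s)"
    by (intro vector_diff_chain_at) (use \<sigma>(2) in "auto intro!: derivative_eq_intros")
   then have "((\<lambda>s. apply_bcontfun (U (\<sigma>, z)) (s / \<sigma>)) has_vector_derivative F (\<phi> (s, z))) (at s)"
    using \<sigma>(2) resc[of s \<sigma> z] \<sigma> s(2) by (simp add: o_def)
   then show ?thesis
   proof (rule has_vector_derivative_transform_within_open)
    show "open {+-\<sigma>}" "s \<in> {+-\<sigma>}" using \<sigma> by (auto simp: abs_less_iff)
    show "apply_bcontfun (U (\<sigma>, z)) (s' / \<sigma>) = \<phi> (s', z)" if "s' \<in> {+-\<sigma>}" for s'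
     using resc[of s' \<sigma> z] that \<sigma> s(2) by (auto simp: abs_le_iff)
   qed
  qed
 qed (use U in auto)
qed

section \<open>Smooth curves and their order of vanishing\<close>

lemma smooth_vderiv:
 fixes f :: "real => 'b::real_normed_vector"
 assumes "smooth_on S f" "t \<in> S"
 shows "(f has_vector_derivative dd 1 f t) (at t)"
 unfolding has_vector_derivative_def
proof (rule has_derivative_eq_rhs[OF smooth_deriv[OF assms]])
 show "(\<lambda>v. dd v f t) = (\<lambda>x. x *\<^sub>R dd 1 f t)"
 proof
  fix v show "dd v f t = v *\<^sub>R dd 1 f t"
   using linear_cmul[OF linear_dd[OF assms], of v 1] by simp
 qed
qed

lemma smooth_power: "open S ==> smooth_on S (\<lambda>t :: real. t ^ k)"
 by (induction k) (auto intro!: smooth_mult smooth_id)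

lemma scaled_in_interval: "t \<in> {+-\<epsilon>} ==> s \<in> {0..1} ==> t * s \<in> {-\<epsilon><..<\<epsilon> :: real}"
proof -
 assume "t \<in> {+-\<epsilon>}" "s \<in> {0..1}"
 moreover then have "\<bar>t * s\<bar> <= \<bar>t\<bar>" by (simp add: abs_mult mult_left_le)
 ultimately show ?thesis by auto
qed

text \<open>Differentiating under the integral produces a factor \<open>s\<close>, hence the power
  \<open>s ^ j\<close> in the statement that is proved by induction.\<close>

lemma Ck_integral_scaled:
 fixes h :: "real => 'b::euclidean_space"
 assumes "smooth_on {+-\<epsilon>} h"
 shows "Ck_on k {+-\<epsilon>} (\<lambda>t. integral {0..1} (\<lambda>s. s ^ j *\<^sub>R h (t * s)))"
 using assms
proof (induction k arbitrary: j h)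
 case 0
 have "continuous_on ({+-\<epsilon>} \<times> cbox 0 1) (\<lambda>(t, s). s ^ j *\<^sub>R h (t * s))"
  unfolding split_beta
  by (intro continuous_intros continuous_on_compose2[OF smooth_continuous[OF 0]]) (use scaled_in_interval in auto)
 then have "continuous_on {+-\<epsilon>} (\<lambda>t. integral (cbox 0 1) (\<lambda>s. s ^ j *\<^sub>R h (t * s)))"
  by (rule integral_continuous_on_param)
 then show ?case by simp
next
 case (Suc k)
 let ?h' = "\<lambda>t. integral {0..1} (\<lambda>s. s ^ Suc j *\<^sub>R dd 1 h (t * s))"
 show ?case
 proof (rule Ck_SucI)
  fix t assume t: "t \<in> {+-\<epsilon>}"
  have "((\<lambda>t. integral (cbox 0 1) (\<lambda>s. s ^ j *\<^sub>R h (t * s))) has_vector_derivative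
    integral (cbox 0 1) (\<lambda>s. s ^ Suc j *\<^sub>R dd 1 h (t * s))) (at t within {+-\<epsilon>})"
  proof (rule leibniz_rule_vector_derivative)
   fix t s :: real assume ts: "t \<in> {+-\<epsilon>}" "s \<in> cbox 0 1"
   have "((\<lambda>t. t * s) has_vector_derivative s) (at t within {+-\<epsilon>})"
    by (auto intro!: derivative_eq_intros)
   from bounded_linear.has_vector_derivative[OF bounded_linear_scaleR_right
     vector_diff_chain_within[OF this has_vector_derivative_at_within[OF smooth_vderiv[OF Suc.prems scaled_in_interval]]], of "s ^ j"]
   show "((\<lambda>t. s ^ j *\<^sub>R h (t * s)) has_vector_derivative s ^ Suc j *\<^sub>R dd 1 h (t * s)) (at t within {+-\<epsilon>})"
    using ts by (simp add: o_def mult.commute)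
  next
   show "(\<lambda>s. s ^ j *\<^sub>R h (t * s)) integrable_on cbox 0 1" if "t \<in> {+-\<epsilon>}" for t
    by (intro integrable_continuous continuous_intros continuous_on_compose2[OF smooth_continuous[OF Suc.prems]])
     (use scaled_in_interval that in auto)
  next
   show "continuous_on ({+-\<epsilon>} \<times> cbox 0 1) (\<lambda>(t, s). s ^ Suc j *\<^sub>R dd 1 h (t * s))"
    unfolding split_beta
    by (intro continuous_intros continuous_on_compose2[OF smooth_continuous[OF smooth_dd[OF Suc.prems]]])
     (use scaled_in_interval in auto)
  qed (use t in auto)
  then show "((\<lambda>t. integral {0..1} (\<lambda>s. s ^ j *\<^sub>R h (t * s))) has_derivative (\<lambda>v. v *\<^sub>R ?h' t)) (at t)"
   using t by (simp add: has_vector_derivative_def at_within_open[OF t])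
 next
  show "Ck_on k {+-\<epsilon>} (\<lambda>t. v *\<^sub>R ?h' t)" for v
   by (rule Ck_linear_compose[OF _ bounded_linear_scaleR_right Suc.IH[OF smooth_dd[OF Suc.prems]]]) simp
 qed simp
qed

text \<open>Hadamard's quotient \<open>(f t - f 0) / t\<close>, extended smoothly to \<open>t = 0\<close>.\<close>

definition hq :: "(real => 'b::euclidean_space) => real => 'b" where
 "hq f = (\<lambda>t. integral {0..1} (\<lambda>s. dd 1 f (t * s)))"

lemma hq_0 [simp]: "hq f 0 = dd 1 f 0" by (simp add: hq_def)

lemma smooth_hq: "smooth_on {+-\<epsilon>} f ==> smooth_on {+-\<epsilon>} ((hq ^^ k) f)"
proof (induction k)
 case (Suc k)
 have "smooth_on {+-\<epsilon>} (hq g)" if "smooth_on {+-\<epsilon>} g" for g :: "real => 'a"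
  using Ck_integral_scaled[OF smooth_dd[OF that], of _ 0 1] by (simp add: smooth_on_def hq_def)
 then show ?case using Suc by simp
qed simp

lemma hq:
 assumes "smooth_on {+-\<epsilon>} f" "t \<in> {+-\<epsilon>}"
 shows "f t = f 0 + t *\<^sub>R hq f t"
proof -
 have "((\<lambda>s. t *\<^sub>R dd 1 f (t * s)) has_integral f (t * 1) - f (t * 0)) {0..1}"
 proof (rule fundamental_theorem_of_calculus)
  fix s :: real assume s: "s \<in> {0..1}"
  have "((\<lambda>s. t * s) has_vector_derivative t) (at s within {0..1})"
   by (auto intro!: derivative_eq_intros)
  from vector_diff_chain_within[OF this has_vector_derivative_at_within[OF
     smooth_vderiv[OF assms(1) scaled_in_interval[OF assms(2) s]]]]
  show "((\<lambda>s. f (t * s)) has_vector_derivative t *\<^sub>R dd 1 f (t * s)) (at s within {0..1})"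
   by (simp add: o_def)
 qed simp
 then have "integral {0..1} (\<lambda>s. t *\<^sub>R dd 1 f (t * s)) = f (t * 1) - f (t * 0)" by (rule integral_unique)
 then show ?thesis by (simp add: hq_def)
qed

text \<open>Taylor's formula with smooth remainder; the factorials are absorbed in the coefficients
  \<open>(hq ^^ j) f 0\<close>.\<close>

lemma Taylor_hq:
 assumes "smooth_on {+-\<epsilon>} f" "t \<in> {+-\<epsilon>}"
 shows "f t = (\<Sum>j<m. t ^ j *\<^sub>R (hq ^^ j) f 0) + t ^ m *\<^sub>R (hq ^^ m) f t"
proof (induction m)
 case (Suc m)
 then show ?case using hq[OF smooth_hq[OF assms(1)] assms(2), of m] by (simp add: mult.commute scaleR_add_right)
qed simp

lemma smooth_bounded_near_0:
 fixes f :: "real => 'b::euclidean_space"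
 assumes "smooth_on {+-\<epsilon>} f" "0 <= d" "d < \<epsilon>"
 obtains B where "B > 0" "!!t. \<bar>t\<bar> <= d ==> norm (f t) <= B"
proof -
 have "continuous_on {-d..d} f"
  by (rule continuous_on_subset[OF smooth_continuous[OF assms(1)]]) (use assms in auto)
 then have "bounded (f ` {-d..d})" by (intro compact_imp_bounded compact_continuous_image) auto
 then obtain B where B: "B > 0" "\<forall>x\<in>f ` {-d..d}. norm x <= B" by (auto simp: bounded_pos)
 show thesis
 proof (rule that[OF B(1)])
  fix t :: real assume "\<bar>t\<bar> <= d"
  then have "t \<in> {-d..d}" by auto
  then show "norm (f t) <= B" using B(2) by blast
 qed
qed

text \<open>A one-sided bound suffices: it forces \<open>f 0 = 0\<close>, so \<open>hq f\<close> is
  a smooth quotient that satisfies the bound with exponent lowered by one, and the resulting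
  factorization holds on both sides of 0.\<close>

lemma smooth_order_division:
 fixes f :: "real => 'b::euclidean_space"
 assumes "smooth_on {+-\<epsilon>} f" "\<epsilon> > 0" "\<forall>\<^sub>F t in at_right 0. norm (f t) <= C * t ^ k"
 obtains g where "smooth_on {+-\<epsilon>} g" "!!t. t \<in> {+-\<epsilon>} ==> f t = t ^ k *\<^sub>R g t"
 using assms
proof (induction k arbitrary: f thesis)
 case 0
 then show ?case by auto
next
 case (Suc k)
 have "(f \<longlongrightarrow> f 0) (at_right 0)"
  using smooth_isCont[OF Suc.prems(2), of 0] \<open>\<epsilon> > 0\<close>
  by (simp add: continuous_at filterlim_at_split)
 moreover have "((\<lambda>t. C * t ^ Suc k) \<longlongrightarrow> C * 0 ^ Suc k) (at_right 0)"
  by (intro tendsto_intros)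
 ultimately have "norm (f 0) <= C * 0 ^ Suc k"
  by (intro tendsto_le[OF _ _ tendsto_norm Suc.prems(4)]) auto
 then have f0: "f 0 = 0" by simp
 have "\<forall>\<^sub>F t in at_right 0. norm (hq f t) <= C * t ^ k"
  using Suc.prems(4) eventually_at_right_real[OF \<open>\<epsilon> > 0\<close>]
 proof eventually_elim
  fix t assume t: "norm (f t) <= C * t ^ Suc k" "t \<in> {0<..<\<epsilon>}"
  then have "t * norm (hq f t) <= t * (C * t ^ k)" using hq[OF Suc.prems(2), of t] f0 by (simp add: mult_ac)
  then show "norm (hq f t) <= C * t ^ k" using t(2) by simp
 qed
 with Suc.IH[OF _ smooth_hq[OF Suc.prems(2), of 1, simplified] Suc.prems(3)] obtain g
  where "smooth_on {+-\<epsilon>} g" "!!t. t \<in> {+-\<epsilon>} ==> hq f t = t ^ k *\<^sub>R g t" by blast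
 then show ?case using Suc.prems(1)[of g] hq[OF Suc.prems(2)] f0 by simp
qed

text \<open>The lower bound limits how often \<open>f\<close> can be divided by \<open>t\<close>:
  dividing as long as the value at 0 is zero stops after at most \<open>k\<close> divisions.\<close>

lemma smooth_order_exact:
 fixes f :: "real => real"
 assumes "smooth_on {+-\<epsilon>} f" "\<epsilon> > 0" "c > 0" "\<forall>\<^sub>F t in at_right 0. c * t ^ k <= \<bar>f t\<bar>"
 obtains j g where "smooth_on {+-\<epsilon>} g" "!!t. t \<in> {+-\<epsilon>} ==> f t = t ^ j * g t" "g 0 \<noteq> 0"
 using assms
proof (induction k arbitrary: f thesis)
 case 0
 have "(f \<longlongrightarrow> f 0) (at_right 0)"
  using smooth_isCont[OF 0(2), of 0] \<open>\<epsilon> > 0\<close>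
  by (simp add: continuous_at filterlim_at_split)
 with 0(5) have "c <= \<bar>f 0\<bar>" by (intro tendsto_lowerbound[OF tendsto_rabs]) auto
 then show ?case using 0(1)[of f 0] 0(2,4) by simp
next
 case (Suc k)
 show ?case
 proof (cases "f 0 = 0")
  case False
  then show ?thesis using Suc.prems(1)[of f 0] Suc.prems(2) by simp
 next
  case f0: True
  have "\<forall>\<^sub>F t in at_right 0. c * t ^ k <= \<bar>hq f t\<bar>"
   using Suc.prems(5) eventually_at_right_real[OF \<open>\<epsilon> > 0\<close>]
  proof eventually_elim
   fix t assume t: "c * t ^ Suc k <= \<bar>f t\<bar>" "t \<in> {0<..<\<epsilon>}"
   then have "t * (c * t ^ k) <= t * \<bar>hq f t\<bar>" using hq[OF Suc.prems(2), of t] f0 by (simp add: abs_mult mult_ac)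
   then show "c * t ^ k <= \<bar>hq f t\<bar>" using t(2) by simp
  qed
  with Suc.IH[OF _ smooth_hq[OF Suc.prems(2), of 1, simplified] Suc.prems(3,4)] obtain j g
   where "smooth_on {+-\<epsilon>} g" "!!t. t \<in> {+-\<epsilon>} ==> hq f t = t ^ j * g t" "g 0 \<noteq> 0" by blast
  then show ?thesis using Suc.prems(1)[of g "Suc j"] hq[OF Suc.prems(2)] f0 by (simp add: mult_ac)
 qed
qed

section \<open>Functions vanishing to infinite order at 0 from the right\<close>

definition flat_at_0 :: "(real => 'b::real_normed_vector) => bool" where
 "flat_at_0 g \<longleftrightarrow> (\<forall>k. \<exists>C>0. \<forall>\<^sub>F t in at_right 0. norm (g t) <= C * t ^ k)"

lemma flat_at_0I:
 assumes "!!k. \<exists>C. \<forall>\<^sub>F t in at_right 0. norm (g t) <= C * t ^ k"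
 shows "flat_at_0 g"
 unfolding flat_at_0_def
proof
 fix k
 obtain C where "\<forall>\<^sub>F t in at_right 0. norm (g t) <= C * t ^ k" using assms by blast
 then have "\<forall>\<^sub>F t in at_right 0. norm (g t) <= (\<bar>C\<bar> + 1) * t ^ k"
  using eventually_at_right_less[of 0]
 proof eventually_elim
  case (elim t)
  then show ?case by (intro order_trans[OF elim(1)] mult_right_mono) auto
 qed
 then show "\<exists>C>0. \<forall>\<^sub>F t in at_right 0. norm (g t) <= C * t ^ k" by (intro exI[of _ "\<bar>C\<bar> + 1"]) auto
qed

lemma flat_at_0D:
 assumes "flat_at_0 g" "e > 0"
 obtains C d where "C > 0" "0 < d" "d <= e" "!!t. 0 < t ==> t < d ==> norm (g t) <= C * t ^ k"
proof -
 obtain C b where "C > 0" "b > 0" "!!t. 0 < t ==> t < b ==> norm (g t) <= C * t ^ k"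
  using assms(1) unfolding flat_at_0_def eventually_at_right_field by blast
 then show thesis using that[of C "min b e"] assms(2) by simp
qed

lemma flat_at_0_bound:
 assumes "flat_at_0 g" "e > 0" "!!t. 0 < t ==> t < e ==> norm (h t) <= B * norm (g t)" "B \<ge> 0"
 shows "flat_at_0 h"
proof (rule flat_at_0I)
 fix k
 obtain C where "\<forall>\<^sub>F t in at_right 0. norm (g t) <= C * t ^ k" using assms(1) unfolding flat_at_0_def by blast
 then have "\<forall>\<^sub>F t in at_right 0. norm (h t) <= (B * C) * t ^ k"
  using eventually_at_right_real[OF assms(2)]
 proof eventually_elim
  case (elim t)
  then show ?case using assms(3)[of t] mult_left_mono[OF elim(1) assms(4)] by simp
 qed
 then show "\<exists>C. \<forall>\<^sub>F t in at_right 0. norm (h t) <= C * t ^ k" by blast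
qed

lemma flat_at_0_sum:
 assumes "!!i. i \<in> I ==> flat_at_0 (g i)"
 shows "flat_at_0 (\<lambda>t. \<Sum>i\<in>I. g i t)"
proof (cases "finite I")
 case fin: True
 show ?thesis
 proof (rule flat_at_0I)
  fix k
  have "\<forall>i. \<exists>C. i \<in> I --> (\<forall>\<^sub>F t in at_right 0. norm (g i t) <= C * t ^ k)"
   using assms unfolding flat_at_0_def by blast
  then obtain C where "\<forall>i\<in>I. \<forall>\<^sub>F t in at_right 0. norm (g i t) <= C i * t ^ k" by metis
  then have "\<forall>\<^sub>F t in at_right 0. \<forall>i\<in>I. norm (g i t) <= C i * t ^ k" using fin by (simp add: eventually_ball_finite)
  then have "\<forall>\<^sub>F t in at_right 0. norm (\<Sum>i\<in>I. g i t) <= (\<Sum>i\<in>I. C i) * t ^ k"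
   by eventually_elim (simp add: sum_distrib_right sum_norm_le)
  then show "\<exists>C. \<forall>\<^sub>F t in at_right 0. norm (\<Sum>i\<in>I. g i t) <= C * t ^ k" by blast
 qed
qed (auto simp: flat_at_0_def intro!: exI[of _ 1] eventually_at_rightI[of 0 1])

text \<open>The exponent \<open>2 * k\<close> for \<open>g\<close> yields the exponent
  \<open>k\<close> for the square root.\<close>

lemma flat_at_0_square:
 assumes "flat_at_0 g" "e > 0" "B \<ge> 0" "!!t. 0 < t ==> t < e ==> (h t)\<^sup>2 <= B * norm (g t)"
 shows "flat_at_0 (h :: real => real)"
proof (rule flat_at_0I)
 fix k
 obtain C d where C: "C > 0" "0 < d" "d <= e" "!!t. 0 < t ==> t < d ==> norm (g t) <= C * t ^ (2 * k)"
  using flat_at_0D[OF assms(1,2)] by blast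
 have "norm (h t) <= sqrt (B * C) * t ^ k" if t: "t \<in> {0<..<d}" for t
 proof -
  have "(h t)\<^sup>2 <= B * (C * t ^ (2 * k))"
   using assms(4)[of t] mult_left_mono[OF C(4)[of t] assms(3)] t C(3) by simp
  also have "... = (sqrt (B * C) * t ^ k)\<^sup>2"
   using assms(3) C(1) by (simp add: power_mult_distrib power_mult[symmetric] mult.commute)
  finally show ?thesis using abs_le_square_iff[of "h t" "sqrt (B * C) * t ^ k"] assms(3) C(1) t by simp
 qed
 then show "\<exists>C. \<forall>\<^sub>F t in at_right 0. norm (h t) <= C * t ^ k" by (intro exI eventually_at_rightI[OF _ C(2)])
qed

text \<open>Bounds on \<open>g\<close> alone do not bound its derivative; together with smoothness
  they do, because \<open>g\<close> is then \<open>t ^ (k + 1)\<close> times a smooth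
  function.\<close>

lemma flat_at_0_derivative:
 fixes g :: "real => 'b::euclidean_space"
 assumes "smooth_on {+-\<epsilon>} g" "\<epsilon> > 0" "flat_at_0 g"
 shows "flat_at_0 (dd 1 g)"
proof (rule flat_at_0I)
 fix k
 let ?I = "{+-\<epsilon>}"
 obtain C where "\<forall>\<^sub>F t in at_right 0. norm (g t) <= C * t ^ Suc k" using assms(3) unfolding flat_at_0_def by blast
 then obtain h where h: "smooth_on ?I h" "!!t. t \<in> ?I ==> g t = t ^ Suc k *\<^sub>R h t"
  using smooth_order_division[OF assms(1,2)] by blast
 define r where "r = (\<lambda>t. t *\<^sub>R dd 1 h t + real (Suc k) *\<^sub>R h t)"
 have "smooth_on ?I r" unfolding r_def
  by (intro smooth_add smooth_scaleR smooth_id smooth_const smooth_dd h) auto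
 then obtain B where B: "!!t. \<bar>t\<bar> <= \<epsilon> / 2 ==> norm (r t) <= B"
  using smooth_bounded_near_0[of \<epsilon> r "\<epsilon> / 2"] assms(2) by auto
 have "norm (dd 1 g t) <= B * t ^ k" if t: "t \<in> {0<..<\<epsilon> / 2}" for t
 proof -
  have tI: "t \<in> ?I" using t by auto
  have "((\<lambda>t. t ^ Suc k *\<^sub>R h t) has_vector_derivative t ^ Suc k *\<^sub>R dd 1 h t + (real (Suc k) * t ^ k) *\<^sub>R h t) (at t)"
   using DERIV_pow[of "Suc k" t UNIV]
   by (intro has_vector_derivative_scaleR smooth_vderiv[OF h(1) tI]) simp
  then have "(g has_vector_derivative t ^ k *\<^sub>R r t) (at t)"
   by (intro has_vector_derivative_transform_within_open[where S = ?I and g = g])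
    (use h(2) tI in "auto simp: r_def scaleR_add_right mult_ac")
  from vector_derivative_unique_at[OF smooth_vderiv[OF assms(1) tI] this]
  show ?thesis using B[of t] t by (simp add: mult_left_mono mult.commute)
 qed
 then show "\<exists>C. \<forall>\<^sub>F t in at_right 0. norm (dd 1 g t) <= C * t ^ k"
  using assms(2) by (intro exI eventually_at_rightI[of 0 "\<epsilon> / 2"]) auto
qed

lemma flat_at_0_eq_0:
 assumes "flat_at_0 g" "isCont g 0"
 shows "g 0 = 0"
proof -
 obtain C where "\<forall>\<^sub>F t in at_right 0. norm (g t) <= C * t ^ 1" using assms(1) unfolding flat_at_0_def by blast
 then have "(g \<longlongrightarrow> 0) (at_right 0)"
  by (rule Lim_null_comparison) (auto intro!: tendsto_eq_intros)
 moreover have "(g \<longlongrightarrow> g 0) (at_right 0)"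
  using assms(2) unfolding isCont_def by (rule filterlim_mono) (auto simp: at_within_le_at)
 ultimately show ?thesis using tendsto_unique trivial_limit_at_right_real by blast
qed

lemma flat_at_0_integral:
 fixes g :: "real => 'b::real_normed_vector"
 assumes "e > 0" "!!t. 0 <= t ==> t < e ==> (g has_vector_derivative g' t) (at t)" "flat_at_0 g'" "g' 0 = 0" "g 0 = 0"
 shows "flat_at_0 g"
proof (rule flat_at_0I)
 fix k
 obtain C d where C: "C > 0" "0 < d" "d <= min e 1" "!!t. 0 < t ==> t < d ==> norm (g' t) <= C * t ^ k"
  using flat_at_0D[OF assms(3), of "min e 1"] assms(1) by auto
 have "norm (g t) <= C * t ^ k" if t: "t \<in> {0<..<d}" for t
 proof -
  have "norm (g t - g 0) <= (C * t ^ k) * norm (t - 0)"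
  proof (rule differentiable_bound[where S = "{0..t}" and f' = "\<lambda>s h. h *\<^sub>R g' s"])
   fix s assume s: "s \<in> {0..t}"
   show "(g has_derivative (\<lambda>h. h *\<^sub>R g' s)) (at s within {0..t})"
    using assms(2)[of s] s t C(3) by (auto simp: has_vector_derivative_def intro: has_derivative_at_withinI)
   \<comment> \<open>Flatness is a statement about positive times, so the value of \<open>g'\<close>
     at 0 is supplied separately.\<close>
   have "norm (g' s) <= C * s ^ k" using C(1) C(4)[of s] assms(4) s t by (cases "s = 0") auto
   also have "... <= C * t ^ k" using s C(1) by (intro mult_left_mono power_mono) auto
   finally show "onorm (\<lambda>h. h *\<^sub>R g' s) <= C * t ^ k"
    by (intro onorm_bound) (use C(1) t in "auto simp: mult.commute mult_left_mono")
  qed (use t in auto)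
  also have "... <= (C * t ^ k) * 1" using t C(1,3) by (intro mult_left_mono) auto
  finally show ?thesis by (simp add: assms(5))
 qed
 then show "\<exists>C. \<forall>\<^sub>F t in at_right 0. norm (g t) <= C * t ^ k" by (intro exI eventually_at_rightI[OF _ C(2)])
qed

text \<open>Induction on the degree: subtracting \<open>2 ^ m\<close> times the polynomial at
  \<open>\<sigma> / 2\<close> from the polynomial at \<open>\<sigma>\<close> removes the top
  coefficient and multiplies the others by \<open>1 - 2 ^ (m - i)\<close>, which is at least 1 in
  absolute value. The top coefficient then follows from the value at 1.\<close>

lemma coefficient_bound:
 "\<exists>N\<ge>0. \<forall>a H. (\<forall>\<sigma>\<in>{0..1}. \<bar>\<Sum>i<m. \<sigma> ^ i * a i\<bar> <= H) --> (\<forall>i<m. \<bar>a i :: real\<bar> <= N * H)"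
proof (induction m)
 case (Suc m)
 then obtain N where N: "N \<ge> 0" "!!a H i. (!!\<sigma>. \<sigma> \<in> {0..1} ==> \<bar>\<Sum>i<m. \<sigma> ^ i * a i\<bar> <= H) ==> i < m ==> \<bar>a i :: real\<bar> <= N * H" by blast
 define N' where "N' = N * (1 + 2 ^ m)"
 have N': "N' \<ge> 0" using N(1) by (simp add: N'_def)
 have "\<bar>a i\<bar> <= (1 + N' + real m * N') * H"
  if H: "!!\<sigma>. \<sigma> \<in> {0..1} ==> \<bar>\<Sum>i<Suc m. \<sigma> ^ i * a i\<bar> <= H" and i: "i < Suc m" for a :: "nat => real" and H i
 proof -
  have H0: "H \<ge> 0" using H[of 0] by (meson abs_ge_zero atLeastAtMost_iff order_refl order_trans zero_le_one)
  have low: "\<bar>a i\<bar> <= N' * H" if i: "i < m" for i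
  proof -
   have "\<bar>\<Sum>i<m. \<sigma> ^ i * ((1 - 2 ^ (m - i)) * a i)\<bar> <= (1 + 2 ^ m) * H" if s: "\<sigma> \<in> {0..1}" for \<sigma> :: real
   proof -
    have "\<sigma> ^ i * ((1 - 2 ^ (m - i)) * a i) = \<sigma> ^ i * a i - 2 ^ m * ((\<sigma> / 2) ^ i * a i)" if "i < Suc m" for i
    proof -
     have "(2::real) ^ m = 2 ^ i * 2 ^ (m - i)" using that by (simp flip: power_add)
     then show ?thesis by (simp add: power_divide algebra_simps)
    qed
    then have "(\<Sum>i<Suc m. \<sigma> ^ i * ((1 - 2 ^ (m - i)) * a i)) = (\<Sum>i<Suc m. \<sigma> ^ i * a i - 2 ^ m * ((\<sigma> / 2) ^ i * a i))"
     by (intro sum.cong) auto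
    then have "(\<Sum>i<m. \<sigma> ^ i * ((1 - 2 ^ (m - i)) * a i)) =
      (\<Sum>i<Suc m. \<sigma> ^ i * a i) - 2 ^ m * (\<Sum>i<Suc m. (\<sigma> / 2) ^ i * a i)"
     by (simp add: sum_subtractf sum_distrib_left distrib_left)
    moreover have "\<bar>2 ^ m * (\<Sum>i<Suc m. (\<sigma> / 2) ^ i * a i)\<bar> <= 2 ^ m * H"
     unfolding abs_mult using H[of "\<sigma> / 2"] s by (simp add: mult_left_mono del: sum.lessThan_Suc)
    ultimately show ?thesis using H[OF s] by (simp only: distrib_right)
   qed
   from N(2)[OF this i] have "\<bar>2 ^ (m - i) - 1\<bar> * \<bar>a i\<bar> <= N' * H" by (simp add: N'_def abs_mult abs_minus_commute mult.assoc)
   moreover have "(2::real) ^ 1 <= 2 ^ (m - i)" using i by (intro power_increasing) auto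
   then have "1 * \<bar>a i\<bar> <= \<bar>2 ^ (m - i) - 1\<bar> * \<bar>a i\<bar>" by (intro mult_right_mono) auto
   ultimately show ?thesis by simp
  qed
  show ?thesis
  proof (cases "i < m")
   case False
   have "\<bar>\<Sum>i<m. a i\<bar> <= (\<Sum>i<m. N' * H)" by (rule sum_abs[THEN order_trans], rule sum_mono) (use low in auto)
   moreover have "\<bar>(\<Sum>i<m. a i) + a m\<bar> <= H" using H[of 1] by simp
   moreover have "i = m" using False i by simp
   moreover have "0 <= H * N'" using N' H0 by simp
   ultimately show ?thesis by (simp add: algebra_simps)
  next
   case True
   have "0 <= H * (N' * real m)" using N' H0 by simp
   then show ?thesis using low[OF True] H0 by (simp add: algebra_simps)
  qed
 qed
 then show ?case using N' by (intro exI[of _ "1 + N' + real m * N'"]) auto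
qed auto

section \<open>Inverses of degenerate families of positive quadratic forms\<close>

lemma bilinear_matrix_vector:
 "bounded_bilinear (\<lambda>(A :: real^'n^'m) x. A *v x)"
 unfolding bilinear_conv_bounded_bilinear[symmetric] bilinear_def
 by (auto intro!: linearI simp: matrix_vector_mult_add_rdistrib matrix_vector_right_distrib
   scaleR_matrix_vector_assoc matrix_vector_mult_scaleR)

lemma bilinear_matrix_matrix:
 "bounded_bilinear (\<lambda>(A :: real^'n^'m) (B :: real^'k^'n). A ** B)"
 unfolding bilinear_conv_bounded_bilinear[symmetric] bilinear_def
 by (auto intro!: linearI simp: vec_eq_iff matrix_matrix_mult_def sum.distrib distrib_left distrib_right
   sum_distrib_left mult_ac)

lemmas smooth_matrix_vector_mult = smooth_bilinear[OF _ bilinear_matrix_vector]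

lemma matrix_form_bound:
 fixes A :: "real^'n^'m"
 assumes "norm A <= B"
 shows "\<bar>p \<bullet> (A *v q)\<bar> <= norm p * B * norm q"
proof -
 have "norm (A *v q) <= L2_set (\<lambda>i. norm (A $ i) * norm q) UNIV"
  unfolding norm_vec_def[of "A *v q"]
  by (rule L2_set_mono) (auto simp: matrix_vector_mul_component Cauchy_Schwarz_ineq2)
 also have "... = norm A * norm q" by (simp add: L2_set_left_distrib norm_vec_def)
 also have "... <= B * norm q" by (rule mult_right_mono[OF assms]) simp
 finally have "norm p * norm (A *v q) <= norm p * (B * norm q)" by (rule mult_left_mono) simp
 then show ?thesis using Cauchy_Schwarz_ineq2[of p "A *v q"] by simp
qed

text \<open>Weighted Cauchy-Schwarz, from nonnegativity of the form at
  \<open>\<alpha> *\<^sub>R p + q\<close> and \<open>\<alpha> *\<^sub>R p - q\<close>. The free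
  weight serves to absorb a term in \<open>form_upper_bound\<close>.\<close>

lemma psd_form_AMGM:
 fixes A :: "real^'n^'n"
 assumes "!!p q. p \<bullet> (A *v q) = q \<bullet> (A *v p)" "!!p. 0 <= p \<bullet> (A *v p)" "\<alpha> > 0"
 shows "\<bar>p \<bullet> (A *v q)\<bar> <= \<alpha> / 2 * (p \<bullet> (A *v p)) + 1 / (2 * \<alpha>) * (q \<bullet> (A *v q))"
proof -
 have *: "0 <= \<alpha> * (p \<bullet> (A *v p)) + 2 * s * (p \<bullet> (A *v q)) + 1 / \<alpha> * (q \<bullet> (A *v q))" if "s\<^sup>2 = 1" for s
 proof -
  have "0 <= (\<alpha> *\<^sub>R p + s *\<^sub>R q) \<bullet> (A *v (\<alpha> *\<^sub>R p + s *\<^sub>R q))" by (rule assms(2))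
  also have "... = \<alpha> * (\<alpha> * (p \<bullet> (A *v p))) + \<alpha> * s * (p \<bullet> (A *v q)) + \<alpha> * s * (q \<bullet> (A *v p)) + s\<^sup>2 * (q \<bullet> (A *v q))"
   by (simp add: matrix_vector_right_distrib matrix_vector_mult_scaleR inner_add_left inner_add_right
     power2_eq_square algebra_simps)
  also have "... = \<alpha> * (\<alpha> * (p \<bullet> (A *v p)) + 2 * s * (p \<bullet> (A *v q)) + 1 / \<alpha> * (q \<bullet> (A *v q)))"
   using assms(1)[of q p] assms(3) that by (simp add: algebra_simps)
  finally show ?thesis using assms(3) by (simp add: zero_le_mult_iff)
 qed
 from *[of 1] *[of "-1"] show ?thesis by (auto simp: abs_le_iff field_simps)
qed

section \<open>Increasing families of symmetric forms without flat directions\<close>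

context
 fixes W :: "real => real^'n^'n" and \<epsilon> :: real
 assumes eps: "\<epsilon> > 0" and W: "smooth_on {+-\<epsilon>} W" and W0: "W 0 = 0"
  and sym: "!!t p q. t \<in> {+-\<epsilon>} ==> p \<bullet> (W t *v q) = q \<bullet> (W t *v p)"
  and pos: "!!t p. 0 <= t ==> t < \<epsilon> ==> 0 <= p \<bullet> (dd 1 W t *v p)"
  and nonflat: "!!p. flat_at_0 (\<lambda>t. p \<bullet> (W t *v p)) ==> p = 0"
begin

lemma form_deriv:
 assumes "t \<in> {+-\<epsilon>}"
 shows "((\<lambda>t. p \<bullet> (W t *v q)) has_vector_derivative p \<bullet> (dd 1 W t *v q)) (at t within X)"
 using bounded_linear.has_vector_derivative[OF bounded_linear_inner_right
   bounded_linear.has_vector_derivative[OF bounded_bilinear.bounded_linear_left[OF bilinear_matrix_vector]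
    has_vector_derivative_at_within[OF smooth_vderiv[OF W assms]]]] .

lemma sym': "t \<in> {+-\<epsilon>} ==> p \<bullet> (dd 1 W t *v q) = q \<bullet> (dd 1 W t *v p)"
proof -
 assume t: "t \<in> {+-\<epsilon>}"
 have "((\<lambda>t. p \<bullet> (W t *v q)) has_vector_derivative q \<bullet> (dd 1 W t *v p)) (at t)"
  by (rule has_vector_derivative_transform_within_open[OF form_deriv[OF t], of "{+-\<epsilon>}"])
   (use t sym in auto)
 with form_deriv[OF t] show ?thesis by (rule vector_derivative_unique_at)
qed

lemma form_mono:
 assumes "0 <= s" "s <= t" "t < \<epsilon>"
 shows "p \<bullet> (W s *v p) <= p \<bullet> (W t *v p)"
proof (rule DERIV_nonneg_imp_nondecreasing[OF assms(2)])
 fix x assume x: "s <= x" "x <= t"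
 have "((\<lambda>t. p \<bullet> (W t *v p)) has_real_derivative p \<bullet> (dd 1 W x *v p)) (at x)"
  unfolding has_real_derivative_iff_has_vector_derivative by (rule form_deriv) (use x assms in auto)
 then show "\<exists>y. ((\<lambda>t. p \<bullet> (W t *v p)) has_real_derivative y) (at x) \<and> 0 <= y"
  using pos[of x p] x assms by auto
qed

lemma form_nonneg: "0 <= t ==> t < \<epsilon> ==> 0 <= p \<bullet> (W t *v p)"
 using form_mono[of 0 t p] by (simp add: W0)

abbreviation tc :: "nat => real^'n^'n" where "tc j \<equiv> (hq ^^ j) W 0"

lemma remainder_bound: obtains B where "B > 0" "!!t. \<bar>t\<bar> <= \<epsilon> / 2 ==> norm ((hq ^^ m) W t) <= B"
 using smooth_bounded_near_0[OF smooth_hq[OF W], of "\<epsilon> / 2"] eps by auto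

text \<open>The values of the form on the interval from 0 to \<open>t\<close> control its Taylor coefficients: in the
 variable \<open>s / t\<close> the Taylor polynomial is a polynomial of bounded degree on the unit interval.\<close>

lemma form_coefficient_bound:
 "\<exists>N\<ge>0. \<forall>t p q H j. 0 <= t --> t <= \<epsilon> / 2 --> (\<forall>s. 0 <= s --> s <= t --> \<bar>p \<bullet> (W s *v q)\<bar> <= H) --> j < m \<longrightarrow>
  t ^ j * \<bar>p \<bullet> (tc j *v q)\<bar> <= N * (H + norm p * norm q * t ^ m)"
proof -
 obtain B where B: "B > 0" "!!t. \<bar>t\<bar> <= \<epsilon> / 2 ==> norm ((hq ^^ m) W t) <= B" using remainder_bound by blast
 obtain N where N: "N \<ge> 0" "!!a H i. (!!\<sigma>. \<sigma> \<in> {0..1} ==> \<bar>\<Sum>i<m. \<sigma> ^ i * a i\<bar> <= H) ==> i < m ==> \<bar>a i :: real\<bar> <= N * H"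
  using coefficient_bound[of m] by blast
 have "t ^ j * \<bar>p \<bullet> (tc j *v q)\<bar> <= N * (1 + B) * (H + norm p * norm q * t ^ m)"
  if t: "0 <= t" "t <= \<epsilon> / 2" and H: "!!s. 0 <= s ==> s <= t ==> \<bar>p \<bullet> (W s *v q)\<bar> <= H" and j: "j < m" for t p q H j
 proof -
  let ?R = "norm p * norm q * t ^ m"
  have R: "0 <= ?R" "0 <= H" using t H[of 0] by auto
  interpret L: bounded_linear "\<lambda>A. p \<bullet> (A *v q)"
   by (intro bounded_linear_inner_right_comp bounded_bilinear.bounded_linear_left[OF bilinear_matrix_vector])
  have "\<bar>\<Sum>i<m. \<sigma> ^ i * (t ^ i * (p \<bullet> (tc i *v q)))\<bar> <= H + B * ?R" if s: "\<sigma> \<in> {0..1}" for \<sigma>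
  proof -
   have u: "0 <= t * \<sigma>" "t * \<sigma> <= t" using s t by (auto simp: mult_left_le)
   have "p \<bullet> (W (t * \<sigma>) *v q) = (\<Sum>i<m. \<sigma> ^ i * (t ^ i * (p \<bullet> (tc i *v q)))) + (t * \<sigma>) ^ m * (p \<bullet> ((hq ^^ m) W (t * \<sigma>) *v q))"
    by (subst Taylor_hq[OF W]) (use u t eps in "auto simp: L.add L.sum L.scaleR power_mult_distrib mult_ac")
   moreover have "\<bar>(t * \<sigma>) ^ m * (p \<bullet> ((hq ^^ m) W (t * \<sigma>) *v q))\<bar> <= t ^ m * (norm p * B * norm q)"
    unfolding abs_mult by (intro mult_mono matrix_form_bound B(2)) (use u t in "auto simp: power_mono")
   ultimately show ?thesis using H[OF u] by (simp add: mult_ac)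
  qed
  from N(2)[OF this j] have "t ^ j * \<bar>p \<bullet> (tc j *v q)\<bar> <= N * (H + B * ?R)" using t by (simp add: abs_mult)
  also have "... <= N * ((1 + B) * (H + ?R))"
   using R B(1) by (intro mult_left_mono N(1)) (simp add: distrib_left distrib_right)
  finally show ?thesis by (simp add: mult.assoc)
 qed
 then show ?thesis using N B(1) by (intro exI[of _ "N * (1 + B)"]) auto
qed

text \<open>For each \<open>p \<noteq> 0\<close> some Taylor coefficient of
  \<open>p \<bullet> (W t *v p)\<close> is nonzero, since otherwise the form would be flat at
  \<open>p\<close>. Compactness of the sphere bounds the index needed by one \<open>m\<close>. As
  the form increases with time, its value at \<open>t\<close> dominates the earlier values and thus,
  by \<open>form_coefficient_bound\<close>, these coefficients.\<close>

lemma form_lower_bound: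
 obtains c d m where "c > 0" "d > 0" "d < \<epsilon>" "d < 1"
  "!!t p. 0 < t ==> t < d ==> c * t ^ m * (norm p)\<^sup>2 <= p \<bullet> (W t *v p)"
proof -
 define a where "a = (\<lambda>j p. p \<bullet> (tc j *v p))"
 have nz: "\<exists>j. a j p \<noteq> 0" if p: "p \<noteq> 0" for p
 proof (rule ccontr)
  assume "\<not> ?thesis"
  then have a0: "p \<bullet> (tc j *v p) = 0" for j by (simp add: a_def)
  have "flat_at_0 (\<lambda>t. p \<bullet> (W t *v p))"
  proof (rule flat_at_0I)
   fix k
   obtain B where B: "B > 0" "!!t. \<bar>t\<bar> <= \<epsilon> / 2 ==> norm ((hq ^^ k) W t) <= B" using remainder_bound by blast
   interpret L: bounded_linear "\<lambda>A. p \<bullet> (A *v p)"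
    by (intro bounded_linear_inner_right_comp bounded_bilinear.bounded_linear_left[OF bilinear_matrix_vector])
   have "norm (p \<bullet> (W t *v p)) <= (norm p * B * norm p) * t ^ k" if t: "t \<in> {0<..<\<epsilon> / 2}" for t
   proof -
    have "p \<bullet> (W t *v p) = t ^ k * (p \<bullet> ((hq ^^ k) W t *v p))"
     by (subst Taylor_hq[OF W]) (use t eps in "auto simp: L.add L.sum L.scaleR a0")
    then show ?thesis using matrix_form_bound[OF B(2), of t p p] t by (simp add: abs_mult mult_left_mono mult.commute)
   qed
   then show "\<exists>C. \<forall>\<^sub>F t in at_right 0. norm (p \<bullet> (W t *v p)) <= C * t ^ k"
    using eps by (intro exI eventually_at_rightI[of 0 "\<epsilon> / 2"]) auto
  qed
  then show False using nonflat p by blast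
 qed
 have conta: "continuous_on X (a j)" for j X
  unfolding a_def by (intro continuous_intros matrix_vector_mult_linear_continuous_on)
 have cover: "sphere 0 1 \<subseteq> (\<Union>j\<in>UNIV. {p. a j p \<noteq> 0})"
 proof
  fix p :: "real^'n" assume "p \<in> sphere 0 1"
  then have "p \<noteq> 0" by auto
  then show "p \<in> (\<Union>j\<in>UNIV. {p. a j p \<noteq> 0})" using nz by blast
 qed
 have op: "open {p. a j p \<noteq> 0}" for j
  by (rule open_Collect_neq) (use conta in auto)
 obtain J where J: "finite J" "sphere 0 1 \<subseteq> (\<Union>j\<in>J. {p. a j p \<noteq> 0})"
  by (rule compactE_image[OF compact_sphere op cover])
 obtain m where m: "J \<subseteq> {..m}" using J(1) by (meson finite_nat_iff_bounded_le)
 define h where "h = (\<lambda>p. \<Sum>j\<le>m. \<bar>a j p\<bar>)"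
 have "\<exists>p0\<in>sphere 0 1. \<forall>p\<in>sphere 0 1. h p0 <= h p"
  by (rule continuous_attains_inf)
   (auto simp: h_def intro!: continuous_intros continuous_on_rabs conta exI[of _ "axis undefined 1"])
 then obtain p0 :: "real^'n" where p0: "p0 \<in> sphere 0 1" "!!p. p \<in> sphere 0 1 ==> h p0 <= h p" by blast
 define c0 where "c0 = h p0"
 obtain j0 where "j0 \<in> J" "a j0 p0 \<noteq> 0" using J(2) p0(1) by blast
 then have c0: "c0 > 0" unfolding c0_def h_def using m by (intro sum_pos2[of _ j0]) auto
 obtain N0 where N0: "N0 \<ge> 0" "!!t p q H j. 0 <= t ==> t <= \<epsilon> / 2 ==>
  (\<forall>s. 0 <= s --> s <= t --> \<bar>p \<bullet> (W s *v q)\<bar> <= H) ==> j < Suc m ==>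
  t ^ j * \<bar>p \<bullet> (tc j *v q)\<bar> <= N0 * (H + norm p * norm q * t ^ Suc m)"
  using form_coefficient_bound[of "Suc m"] by auto
 define N where "N = 1 + real (Suc m) * N0"
 have N: "N > 0" using N0(1) by (simp add: N_def add_pos_nonneg)
 have est: "t ^ m * c0 <= N * (p \<bullet> (W t *v p) + t ^ Suc m)"
  if t: "0 < t" "t <= \<epsilon> / 2" "t < 1" and p: "norm p = 1" for t p
 proof -
  let ?w = "p \<bullet> (W t *v p)"
  have w: "\<bar>p \<bullet> (W s *v p)\<bar> <= ?w" if "0 <= s" "s <= t" for s
   using form_nonneg[of s p] form_mono[of s t p] that t eps by simp
  have "t ^ m * c0 <= t ^ m * h p" unfolding c0_def using p0(2)[of p] p t by (intro mult_left_mono) auto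
  also have "... = (\<Sum>j\<le>m. t ^ m * \<bar>a j p\<bar>)" by (simp add: h_def sum_distrib_left)
  also have "... <= (\<Sum>j\<le>m. N0 * (?w + t ^ Suc m))"
  proof (rule sum_mono)
   fix j assume j: "j \<in> {..m}"
   have "t ^ m * \<bar>a j p\<bar> <= t ^ j * \<bar>a j p\<bar>" using t j by (intro mult_right_mono) (auto intro: power_decreasing)
   also have "... <= N0 * (?w + t ^ Suc m)" using N0(2)[of t p p ?w j] w j t by (simp add: a_def p)
   finally show "t ^ m * \<bar>a j p\<bar> <= N0 * (?w + t ^ Suc m)" .
  qed
  also have "... = real (Suc m) * N0 * (?w + t ^ Suc m)" by simp
  also have "... <= N * (?w + t ^ Suc m)" using w[of 0] t by (intro mult_right_mono) (auto simp: N_def)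
  finally show ?thesis .
 qed
 \<comment> \<open>For \<open>t\<close> below \<open>c0 / (2 * N)\<close> the remainder
   \<open>N * t ^ (m + 1)\<close> is at most half of \<open>c0 * t ^ m\<close>.\<close>
 define d where "d = min (min (\<epsilon> / 2) (1/2)) (c0 / (2 * N))"
 have d: "d > 0" "d < \<epsilon>" "d < 1" using eps c0 N by (auto simp: d_def)
 have c: "c0 / (2 * N) > 0" using c0 N by simp
 show thesis
 proof (rule that[OF c d])
  fix t p assume t: "0 < t" "t < d"
  show "c0 / (2 * N) * t ^ m * (norm p)\<^sup>2 <= p \<bullet> (W t *v p)"
  proof (cases "p = 0")
   case False
   define e where "e = p /\<^sub>R norm p"
   have pe: "p = norm p *\<^sub>R e" "norm e = 1" using False by (auto simp: e_def)
   have "t < c0 / (2 * N)" using t by (simp add: d_def)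
   then have "t * (2 * N) <= c0" using N by (simp add: field_simps)
   then have "t ^ m * (t * (2 * N)) <= t ^ m * c0" using t by (intro mult_left_mono) auto
   moreover have "t ^ m * c0 <= N * (e \<bullet> (W t *v e) + t ^ Suc m)" by (rule est) (use t pe in "auto simp: d_def")
   ultimately have "t ^ m * c0 <= 2 * N * (e \<bullet> (W t *v e))" by (simp add: algebra_simps)
   then have "c0 / (2 * N) * t ^ m <= e \<bullet> (W t *v e)" using N by (simp add: field_simps)
   then have "c0 / (2 * N) * t ^ m * (norm p)\<^sup>2 <= (e \<bullet> (W t *v e)) * (norm p)\<^sup>2" by (intro mult_right_mono) auto
   also have "... = (norm p *\<^sub>R e) \<bullet> (W t *v (norm p *\<^sub>R e))"
    by (simp add: matrix_vector_mult_scaleR power2_eq_square)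
   finally show ?thesis using pe(1) by simp
  qed simp
 qed
qed

text \<open>For such \<open>p\<close> the number \<open>s = p \<bullet> (W t *v p)\<close> equals
  \<open>p \<bullet> (dd 1 W 0 *v \<eta>)\<close>, and \<open>dd 1 W 0\<close> is the linear Taylor
  coefficient of \<open>W\<close>. Hence \<open>t * s\<close> is controlled by the values of the
  mixed form \<open>p \<bullet> (W x *v \<eta>)\<close> for \<open>x\<close> up to \<open>t\<close>.
  Cauchy-Schwarz bounds these by \<open>s\<close> itself, with a small weight, and by
  \<open>norm \<eta>\<close>.\<close>

lemma form_upper_bound:
 obtains C d where "d > 0" "d < \<epsilon>" "!!t p \<eta>. 0 < t ==> t < d ==> W t *v p = dd 1 W 0 *v \<eta> ==>
  p \<bullet> (W t *v p) <= C * (norm \<eta>)\<^sup>2 / t"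
proof -
 let ?G = "dd 1 W 0"
 obtain c d m where lb: "c > 0" "d > 0" "d < \<epsilon>" "d < 1"
  "!!t p. 0 < t ==> t < d ==> c * t ^ m * (norm p)\<^sup>2 <= p \<bullet> (W t *v p)"
  using form_lower_bound by blast
 obtain B where B: "B > 0" "!!t. \<bar>t\<bar> <= \<epsilon> / 2 ==> norm (hq W t) <= B" using remainder_bound[of 1] by auto
 \<comment> \<open>Order \<open>m + 2\<close> is high enough: the factor \<open>t ^ (m + 2)\<close>
   in the remainder compensates \<open>norm p\<close>, which grows at most like
   \<open>1 / t ^ m\<close>, and the linear coefficient is included even for
   \<open>m = 0\<close>.\<close>
 obtain N where N: "N \<ge> 0" "!!t p q H j. 0 <= t ==> t <= \<epsilon> / 2 ==>
  (\<forall>s. 0 <= s --> s <= t --> \<bar>p \<bullet> (W s *v q)\<bar> <= H) ==> j < Suc (Suc m) ==>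
  t ^ j * \<bar>p \<bullet> (tc j *v q)\<bar> <= N * (H + norm p * norm q * t ^ Suc (Suc m))"
  using form_coefficient_bound[of "Suc (Suc m)"] by auto
 define N1 where "N1 = N + 1"
 have N1: "N1 > 0" using N(1) by (simp add: N1_def)
 define D where "D = N1\<^sup>2 * B + 2 * N1 * norm ?G / c"
 show thesis
 proof (rule that[of "min d (\<epsilon> / 2)" D])
  show "min d (\<epsilon> / 2) > 0" "min d (\<epsilon> / 2) < \<epsilon>" using lb eps by auto
  fix t p \<eta> assume t': "0 < t" "t < min d (\<epsilon> / 2)" and p: "W t *v p = ?G *v \<eta>"
  have t: "0 < t" "t < d" "t <= \<epsilon> / 2" "t < \<epsilon>" "t < 1" using t' lb eps by auto
  define s where "s = p \<bullet> (W t *v p)"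
  have s_eq: "s = p \<bullet> (?G *v \<eta>)" by (simp add: s_def p)
  have pb: "t ^ m * norm p <= norm ?G / c * norm \<eta>"
  proof (cases "p = 0")
   case False
   have "c * t ^ m * (norm p)\<^sup>2 <= s" unfolding s_def by (rule lb(5)[OF t(1,2)])
   also have "s <= norm p * norm ?G * norm \<eta>" unfolding s_eq using matrix_form_bound[OF order_refl, of p ?G \<eta>] by simp
   finally have "norm p * (c * (t ^ m * norm p)) <= norm p * (norm ?G * norm \<eta>)"
    by (simp add: power2_eq_square mult_ac)
   then have "c * (t ^ m * norm p) <= norm ?G * norm \<eta>" using False by simp
   then show ?thesis using lb(1) by (simp add: field_simps)
  qed (use lb(1) in simp)
  \<comment> \<open>The weight \<open>t / N1\<close> is chosen so that multiplication by
    \<open>N1\<close> turns the term with \<open>s\<close> into \<open>t * s / 2\<close>, which is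
    absorbed on the left.\<close>
  define H where "H = t / N1 / 2 * s + 1 / (2 * (t / N1)) * (t * (B * (norm \<eta>)\<^sup>2))"
  have H: "\<bar>p \<bullet> (W x *v \<eta>)\<bar> <= H" if x: "0 <= x" "x <= t" for x
  proof -
   have xI: "x \<in> {+-\<epsilon>}" "x < \<epsilon>" using x t eps by auto
   have "\<eta> \<bullet> (W x *v \<eta>) = x * (\<eta> \<bullet> (hq W x *v \<eta>))" using hq[OF W xI(1)] by (simp add: W0 scaleR_matrix_vector_assoc[symmetric])
   also have "... <= x * (norm \<eta> * B * norm \<eta>)"
    using matrix_form_bound[OF B(2), of x \<eta> \<eta>] x t by (intro mult_left_mono) auto
   also have "... <= t * (B * (norm \<eta>)\<^sup>2)"
    using x B by (simp add: power2_eq_square mult_ac mult_right_mono)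
   finally have 1: "\<eta> \<bullet> (W x *v \<eta>) <= t * (B * (norm \<eta>)\<^sup>2)" .
   have "\<bar>p \<bullet> (W x *v \<eta>)\<bar> <= t / N1 / 2 * (p \<bullet> (W x *v p)) + 1 / (2 * (t / N1)) * (\<eta> \<bullet> (W x *v \<eta>))"
    by (rule psd_form_AMGM) (use sym[OF xI(1)] form_nonneg[OF x(1) xI(2)] t N1 in auto)
   also have "... <= H" unfolding H_def s_def
    by (intro add_mono mult_left_mono 1 form_mono) (use x t N1 in auto)
   finally show ?thesis .
  qed
  have H0: "H \<ge> 0" using H[of 0] t by auto
  have "t * s <= t * \<bar>p \<bullet> (?G *v \<eta>)\<bar>" unfolding s_eq using t by (intro mult_left_mono) auto
  also have "... <= N * (H + norm p * norm \<eta> * t ^ Suc (Suc m))"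
   using N(2)[of t p \<eta> H 1] H t by simp
  also have "... <= N1 * (H + norm ?G / c * (norm \<eta>)\<^sup>2)"
  proof (rule mult_mono)
   have "norm p * norm \<eta> * t ^ Suc (Suc m) = (norm \<eta> * t\<^sup>2) * (t ^ m * norm p)" by (simp add: power2_eq_square mult_ac)
   also have "... <= (norm \<eta> * 1) * (norm ?G / c * norm \<eta>)"
    by (rule mult_mono[OF _ pb]) (use t in "auto simp: power_le_one mult_left_le")
   finally show "H + norm p * norm \<eta> * t ^ Suc (Suc m) <= H + norm ?G / c * (norm \<eta>)\<^sup>2"
    by (simp add: power2_eq_square mult_ac)
  qed (use H0 t N in "auto simp: N1_def")
  also have "... = t * s / 2 + N1\<^sup>2 * B * (norm \<eta>)\<^sup>2 / 2 + N1 * norm ?G / c * (norm \<eta>)\<^sup>2"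
   using N1 t by (simp add: H_def field_simps power2_eq_square)
  finally have "t * s <= N1\<^sup>2 * B * (norm \<eta>)\<^sup>2 + 2 * (N1 * norm ?G / c * (norm \<eta>)\<^sup>2)" by linarith
  also have "... = D * (norm \<eta>)\<^sup>2" by (simp only: D_def distrib_right mult.assoc)
  finally have "t * s <= D * (norm \<eta>)\<^sup>2" .
  then show "p \<bullet> (W t *v p) <= D * (norm \<eta>)\<^sup>2 / t" using t by (simp add: s_def[symmetric] field_simps)
 qed
qed

text \<open>Cramer's rule: the inverse is the smooth adjugate divided by the determinant. The lower
  bound on the form bounds the inverse matrix by a power of \<open>1 / t\<close>, hence the
  determinant from below by a power of \<open>t\<close>; so the determinant is \<open>t ^ j\<close>
  times a smooth function that does not vanish at 0.\<close>

lemma form_inverse: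
 obtains j S \<delta> where "0 < \<delta>" "\<delta> < \<epsilon>" "\<delta> < 1" "smooth_on {+-\<delta>} (S :: real => real^'n^'n)"
  "!!t p. 0 < t ==> t < \<delta> ==> W t *v p = 0 ==> p = 0"
  "!!t v. 0 < t ==> t < \<delta> ==> W t *v (S t *v v) = t ^ j *\<^sub>R v"
proof -
 obtain c d m where lb: "c > 0" "d > 0" "d < \<epsilon>" "d < 1"
  "!!t p. 0 < t ==> t < d ==> c * t ^ m * (norm p)\<^sup>2 <= p \<bullet> (W t *v p)"
  using form_lower_bound by blast
 let ?I = "{+-\<epsilon>}"
 let ?n = "CARD('n)"
 have det_smooth: "smooth_on ?I (\<lambda>t. det (A t))"
  if "!!i j. smooth_on ?I (\<lambda>t. A t $ i $ j)" for A :: "real => real^'n^'n"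
  unfolding det_def by (intro smooth_sum smooth_mult smooth_prod smooth_const that) auto
 have Wij: "smooth_on ?I (\<lambda>t. W t $ i $ j)" for i j
  by (rule smooth_linear_compose[OF _ bounded_linear_compose[OF bounded_linear_vec_nth bounded_linear_vec_nth] W]) simp
 have inj: "p = 0" if "0 < t" "t < d" "W t *v p = 0" for t p
 proof -
  have "c * t ^ m * (norm p)\<^sup>2 <= 0" using lb(5)[OF that(1,2), of p] that(3) by simp
  moreover have "c * t ^ m > 0" using lb(1) that(1) by simp
  ultimately have "(norm p)\<^sup>2 <= 0" by (meson mult_pos_pos not_le)
  then show ?thesis by simp
 qed
 have det_nz: "det (W t) \<noteq> 0" if "0 < t" "t < d" for t
  using inj[OF that] unfolding invertible_det_nz[symmetric] invertible_left_inverse matrix_left_invertible_ker by blast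
 \<comment> \<open>The Leibniz expansion of \<open>det Z\<close> has \<open>fact ?n\<close> terms,
   each a product of \<open>?n\<close> entries bounded by \<open>1 / (c * t ^ m)\<close>.\<close>
 define K where "K = fact ?n * (1 / c) ^ ?n"
 have Kp: "K > 0" using lb(1) by (simp add: K_def)
 have det_lb: "1 / K * t ^ (m * ?n) <= \<bar>det (W t)\<bar>" if t: "0 < t" "t < d" for t
 proof -
  obtain Z where Z: "W t ** Z = mat 1"
   using det_nz[OF t] unfolding invertible_det_nz[symmetric] invertible_right_inverse by blast
  have Zb: "\<bar>Z $ i $ k\<bar> <= 1 / (c * t ^ m)" for i k
  proof -
   define p where "p = Z *v axis k 1"
   have Wp: "W t *v p = axis k 1" by (simp add: p_def matrix_vector_mul_assoc Z)
   have "c * t ^ m * (norm p)\<^sup>2 <= p \<bullet> axis k 1" using lb(5)[OF t, of p] by (simp add: Wp)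
   also have "... <= norm p * 1" using norm_cauchy_schwarz[of p "axis k 1"] by simp
   finally have "norm p * (c * t ^ m * norm p) <= norm p * 1" by (simp add: power2_eq_square mult_ac)
   then have "c * t ^ m * norm p <= 1" by (cases "p = 0") (simp, metis mult_le_cancel_left_pos zero_less_norm_iff)
   moreover have "Z $ i $ k = p $ i" by (simp add: p_def matrix_vector_mult_basis column_def)
   then have "\<bar>Z $ i $ k\<bar> <= norm p" using component_le_norm_cart[of p i] by simp
   moreover have "c * t ^ m > 0" using lb(1) t by simp
   ultimately have "c * t ^ m * \<bar>Z $ i $ k\<bar> <= 1"
    using mult_left_mono[of "\<bar>Z $ i $ k\<bar>" "norm p" "c * t ^ m"] by linarith
   then have "\<bar>Z $ i $ k\<bar> * (c * t ^ m) <= 1" by (simp add: mult.commute)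
   then show ?thesis using \<open>c * t ^ m > 0\<close> by (simp add: pos_le_divide_eq)
  qed
  have "\<bar>det Z\<bar> <= (\<Sum>p | p permutes (UNIV :: 'n set). \<bar>of_int (sign p) * (\<Prod>i\<in>UNIV. Z $ i $ p i)\<bar>)"
   unfolding det_def by (rule sum_abs)
  also have "... <= (\<Sum>p | p permutes (UNIV :: 'n set). (1 / (c * t ^ m)) ^ ?n)"
  proof (rule sum_mono)
   fix p :: "'n => 'n"
   have "\<bar>of_int (sign p) * (\<Prod>i\<in>UNIV. Z $ i $ p i)\<bar> = (\<Prod>i\<in>UNIV. \<bar>Z $ i $ p i\<bar>)"
    by (simp add: abs_mult abs_prod sign_def)
   also have "... <= (\<Prod>i\<in>(UNIV::'n set). 1 / (c * t ^ m))" by (intro prod_mono) (simp add: Zb)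
   finally show "\<bar>of_int (sign p) * (\<Prod>i\<in>UNIV. Z $ i $ p i)\<bar> <= (1 / (c * t ^ m)) ^ ?n" by simp
  qed
  also have "... = fact ?n * (1 / (c * t ^ m)) ^ ?n" by (simp add: card_permutations[OF refl])
  also have "... = K / t ^ (m * ?n)" by (simp add: K_def power_divide power_mult_distrib power_mult)
  finally have dZ: "\<bar>det Z\<bar> <= K / t ^ (m * ?n)" .
  have "\<bar>det (W t)\<bar> * \<bar>det Z\<bar> = 1" using det_mul[of "W t" Z] Z by (simp add: abs_mult[symmetric])
  then have "1 <= \<bar>det (W t)\<bar> * (K / t ^ (m * ?n))" using mult_left_mono[OF dZ, of "\<bar>det (W t)\<bar>"] by simp
  then show ?thesis using Kp t by (simp add: field_simps)
 qed
 have ev: "\<forall>\<^sub>F t in at_right 0. 1 / K * t ^ (m * ?n) <= \<bar>det (W t)\<bar>"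
  by (rule eventually_at_rightI[OF _ lb(2)]) (use det_lb in auto)
 obtain j e where e: "smooth_on ?I e" "!!t. t \<in> ?I ==> det (W t) = t ^ j * e t" "e 0 \<noteq> 0"
  by (rule smooth_order_exact[OF det_smooth[OF Wij] eps _ ev]) (use Kp in auto)
 have "isCont e 0" by (rule smooth_isCont[OF e(1)]) (use eps in auto)
 then have "eventually (\<lambda>t. e t \<noteq> 0) (nhds 0)"
  using e(3) by (simp add: isCont_def tendsto_at_iff_tendsto_nhds tendsto_imp_eventually_ne)
 then obtain d1 where d1: "d1 > 0" "!!t. \<bar>t\<bar> < d1 ==> e t \<noteq> 0"
  by (auto simp: eventually_nhds_metric dist_real_def)
 define \<delta> where "\<delta> = min d d1"
 have \<delta>: "0 < \<delta>" "\<delta> <= d" "\<delta> <= d1" using lb d1 by (auto simp: \<delta>_def)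
 \<comment> \<open>Cramer's numerators: \<open>N t\<close> is the adjugate matrix of
   \<open>W t\<close>.\<close>
 define N where "N = (\<lambda>t. \<chi> k l. det (\<chi> i i'. if i' = k then axis l 1 $ i else W t $ i $ i') :: real^'n^'n)"
 have Nij: "smooth_on ?I (\<lambda>t. N t $ k $ l)" for k l
 proof -
  have "smooth_on ?I (\<lambda>t. det (\<chi> i i'. if i' = k then axis l 1 $ i else W t $ i $ i'))"
  proof (rule det_smooth)
   fix i i'
   show "smooth_on ?I (\<lambda>t. (\<chi> i i'. if i' = k then axis l 1 $ i else W t $ i $ i') $ i $ i')"
    using Wij by (cases "i' = k") auto
  qed
  then show ?thesis by (simp add: N_def)
 qed
 have Nsm: "smooth_on ?I N"
  by (rule smooth_componentwise) (auto simp: Basis_vec_def inner_axis Nij)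
 define S where "S = (\<lambda>t. inverse (e t) *\<^sub>R N t)"
 have sub: "{+-\<delta>} \<subseteq> ?I" using \<delta> lb by auto
 show thesis
 proof (rule that[of \<delta> S j])
  show "smooth_on {+-\<delta>} S"
   unfolding S_def
   by (intro smooth_scaleR smooth_inverse smooth_subset[OF e(1) sub] smooth_subset[OF Nsm sub])
    (use d1(2) \<delta> in auto)
  show "p = 0" if "0 < t" "t < \<delta>" "W t *v p = 0" for t p using inj[OF that(1) _ that(3)] that \<delta> by simp
  show "W t *v (S t *v v) = t ^ j *\<^sub>R v" if t: "0 < t" "t < \<delta>" for t v
  proof -
   have td: "t < d" "t \<in> ?I" "e t \<noteq> 0" using t \<delta> lb d1(2)[of t] by auto
   have col: "W t *v (N t *v axis l 1) = det (W t) *\<^sub>R axis l 1" for l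
   proof -
    let ?x = "\<chi> k. det (\<chi> i j. if j = k then axis l 1 $ i else W t $ i $ j) / det (W t)"
    have "W t *v ?x = axis l 1" using cramer[OF det_nz[OF t(1) td(1)], of ?x "axis l 1"] by blast
    moreover have "N t *v axis l 1 = det (W t) *\<^sub>R ?x"
     using det_nz[OF t(1) td(1)] by (simp add: vec_eq_iff matrix_vector_mult_basis column_def N_def)
    ultimately show ?thesis by (simp add: matrix_vector_mult_scaleR)
   qed
   have all: "W t *v (N t *v v) = det (W t) *\<^sub>R v" for v
   proof -
    have "v = (\<Sum>l\<in>UNIV. v $ l *\<^sub>R axis l 1)" using basis_expansion[of v] by (simp add: scalar_mult_eq_scaleR)
    then have "W t *v (N t *v v) = W t *v (N t *v (\<Sum>l\<in>UNIV. v $ l *\<^sub>R axis l 1))" by simp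
    also have "... = (\<Sum>l\<in>UNIV. v $ l *\<^sub>R (W t *v (N t *v axis l 1)))"
     by (simp only: linear_sum[OF matrix_vector_mul_linear] matrix_vector_mult_scaleR)
    also have "... = (\<Sum>l\<in>UNIV. det (W t) *\<^sub>R (v $ l *\<^sub>R axis l 1))" by (simp add: col mult.commute)
    also have "... = det (W t) *\<^sub>R (\<Sum>l\<in>UNIV. v $ l *\<^sub>R axis l 1)" by (rule scaleR_sum_right[symmetric])
    also have "... = det (W t) *\<^sub>R v" using \<open>v = _\<close> by simp
    finally show ?thesis .
   qed
   show ?thesis
    using td by (simp add: S_def scaleR_matrix_vector_assoc[symmetric] matrix_vector_mult_scaleR all e(2))
  qed
 qed (use \<delta> lb in auto)
qed

text \<open>Differentiating \<open>W t *v P \<xi> t = G *v \<xi>\<close> expresses the derivative of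
  \<open>P\<close> through that of \<open>W\<close>. This is what turns \<open>t\<^sup>2\<close>
  times the form of \<open>dd 1 W t\<close> at the solutions \<open>p\<close> and \<open>q\<close>
  into \<open>F - t F'\<close> with \<open>F = t G W^-1 G\<close>.\<close>

theorem inverse_form_rate:
 obtains \<delta> M where "0 < \<delta>" "\<delta> < \<epsilon>"
  "!!t p. 0 < t ==> t < \<delta> ==> W t *v p = 0 ==> p = 0"
  "smooth_on {+-\<delta>} (M :: real => real^'n^'n)" "dd 1 M 0 = 0"
  "!!t \<xi> \<eta> p q. 0 < t ==> t < \<delta> ==> W t *v p = dd 1 W 0 *v \<xi> ==> W t *v q = dd 1 W 0 *v \<eta> ==>
   t\<^sup>2 * (p \<bullet> (dd 1 W t *v q)) = \<xi> \<bullet> (M t *v \<eta>)"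
  "!!\<eta>. \<eta> \<bullet> (dd 1 W 0 *v \<eta>) <= \<eta> \<bullet> (M 0 *v \<eta>)"
proof -
 define G where "G = dd 1 W 0"
 obtain j S \<delta>1 where S: "0 < \<delta>1" "\<delta>1 < \<epsilon>" "\<delta>1 < 1" "smooth_on {+-\<delta>1} (S :: real => real^'n^'n)"
  "!!t p. 0 < t ==> t < \<delta>1 ==> W t *v p = 0 ==> p = 0"
  "!!t v. 0 < t ==> t < \<delta>1 ==> W t *v (S t *v v) = t ^ j *\<^sub>R v"
  by (rule form_inverse) (rule that, assumption+)
 obtain C d where C: "d > 0" "d < \<epsilon>" "!!t p \<eta>. 0 < t ==> t < d ==> W t *v p = dd 1 W 0 *v \<eta> ==>
  p \<bullet> (W t *v p) <= C * (norm \<eta>)\<^sup>2 / t"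
  by (rule form_upper_bound) (rule that, assumption+)
 note C = C[folded G_def]
 define \<delta> where "\<delta> = min d \<delta>1"
 have \<delta>: "0 < \<delta>" "\<delta> < \<epsilon>" "\<delta> <= d" "\<delta> <= \<delta>1" using S C by (auto simp: \<delta>_def)
 let ?I = "{+-\<delta>}"
 have in_eps: "t \<in> {+-\<epsilon>}" if "t \<in> ?I" for t using that \<delta> by auto
 have Ssm: "smooth_on ?I S" by (rule smooth_subset[OF S(4)]) (use \<delta> in auto)
 have Gsym: "x \<bullet> (G *v y) = y \<bullet> (G *v x)" for x y unfolding G_def by (rule sym') (use eps in auto)
 define P where "P = (\<lambda>\<eta> t. inverse (t ^ j) *\<^sub>R (S t *v (G *v \<eta>)))"
 have P: "W t *v P \<eta> t = G *v \<eta>" if "0 < t" "t < \<delta>" for t \<eta>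
  using S(6)[of t "G *v \<eta>"] that \<delta> by (simp add: P_def matrix_vector_mult_scaleR)
 have Puniq: "p = P \<eta> t" if "0 < t" "t < \<delta>" "W t *v p = G *v \<eta>" for t p \<eta>
  using S(5)[of t "p - P \<eta> t"] P[OF that(1,2), of \<eta>] that \<delta> by (simp add: matrix_vector_mult_diff_distrib)
 \<comment> \<open>\<open>\<Sigma> t\<close> is \<open>t ^ j\<close> times the compressed inverse
   \<open>G W^-1 G\<close>. The estimate \<open>\<Sigma>b\<close> below replaces the crude pole
   order \<open>j\<close> by order 1.\<close>
 define \<Sigma> where "\<Sigma> = (\<lambda>t. G ** S t ** G)"
 have \<Sigma>form: "\<xi> \<bullet> (\<Sigma> t *v \<eta>) = t ^ j * (P \<xi> t \<bullet> (W t *v P \<eta> t))" if "0 < t" "t < \<delta>" for \<xi> \<eta> t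
 proof -
  have Pp: "S t *v (G *v \<eta>) = t ^ j *\<^sub>R P \<eta> t" using that by (simp add: P_def)
  have "\<xi> \<bullet> (\<Sigma> t *v \<eta>) = \<xi> \<bullet> (G *v (S t *v (G *v \<eta>)))" by (simp add: \<Sigma>_def matrix_vector_mul_assoc[symmetric])
  also have "... = t ^ j * (P \<eta> t \<bullet> (G *v \<xi>))" unfolding Pp Gsym[of \<xi>] by simp
  also have "... = t ^ j * (P \<eta> t \<bullet> (W t *v P \<xi> t))" by (simp add: P[OF that])
  also have "... = t ^ j * (P \<xi> t \<bullet> (W t *v P \<eta> t))" using sym[of t "P \<eta> t"] that \<delta> by simp
  finally show ?thesis .
 qed
 have \<Sigma>sm: "smooth_on ?I \<Sigma>"
  unfolding \<Sigma>_def
  by (intro smooth_linear_compose[OF _ bounded_bilinear.bounded_linear_left[OF bilinear_matrix_matrix]]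
    smooth_linear_compose[OF _ bounded_bilinear.bounded_linear_right[OF bilinear_matrix_matrix]] Ssm) auto
 define Cn where "Cn = real (card (Basis :: (real^'n^'n) set))"
 have \<Sigma>b: "norm (t *\<^sub>R \<Sigma> t) <= (Cn * C) * t ^ j" if t: "0 < t" "t < \<delta>" for t
 proof -
  have ent: "\<bar>\<Sigma> t $ i $ k\<bar> <= t ^ j * (C / t)" for i k
  proof -
   let ?x = "P (axis i 1) t" and ?y = "P (axis k 1) t"
   have "\<Sigma> t $ i $ k = axis i 1 \<bullet> (\<Sigma> t *v axis k 1)"
    by (simp add: matrix_vector_mult_basis column_def inner_axis')
   also have "... = t ^ j * (?x \<bullet> (W t *v ?y))" by (rule \<Sigma>form[OF t])
   finally have 1: "\<bar>\<Sigma> t $ i $ k\<bar> = t ^ j * \<bar>?x \<bullet> (W t *v ?y)\<bar>" using t by (simp add: abs_mult)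
   have "\<bar>?x \<bullet> (W t *v ?y)\<bar> <= 1 / 2 * (?x \<bullet> (W t *v ?x)) + 1 / (2 * 1) * (?y \<bullet> (W t *v ?y))"
    by (rule psd_form_AMGM) (use t \<delta> in_eps[of t] sym form_nonneg in auto)
   also have "... <= 1 / 2 * (C / t) + 1 / (2 * 1) * (C / t)"
    using C(3)[of t ?x "axis i 1"] C(3)[of t ?y "axis k 1"] P[OF t] t \<delta>
    by (intro add_mono mult_left_mono) auto
   also have "... = C / t" by simp
   finally show ?thesis unfolding 1 using t by (intro mult_left_mono) auto
  qed
  have "norm (t *\<^sub>R \<Sigma> t) <= (\<Sum>b\<in>Basis. \<bar>(t *\<^sub>R \<Sigma> t) \<bullet> b\<bar>)" by (rule norm_le_l1)
  also have "... <= (\<Sum>b\<in>(Basis :: (real^'n^'n) set). C * t ^ j)"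
  proof (rule sum_mono)
   fix b :: "real^'n^'n" assume "b \<in> Basis"
   then obtain i k where b: "b = axis i (axis k 1)" by (auto simp: Basis_vec_def)
   have "\<bar>(t *\<^sub>R \<Sigma> t) \<bullet> b\<bar> = t * \<bar>\<Sigma> t $ i $ k\<bar>" using t by (simp add: b inner_axis abs_mult)
   also have "... <= t * (t ^ j * (C / t))" using t by (intro mult_left_mono ent) auto
   also have "... = C * t ^ j" using t by simp
   finally show "\<bar>(t *\<^sub>R \<Sigma> t) \<bullet> b\<bar> <= C * t ^ j" .
  qed
  finally show ?thesis by (simp add: Cn_def)
 qed
 have tsm: "smooth_on ?I (\<lambda>t. t *\<^sub>R \<Sigma> t)" by (intro smooth_scaleR smooth_id \<Sigma>sm) auto
 obtain F where F: "smooth_on ?I F" "!!t. t \<in> ?I ==> t *\<^sub>R \<Sigma> t = t ^ j *\<^sub>R F t"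
  by (rule smooth_order_division[OF tsm \<delta>(1) eventually_at_rightI[OF \<Sigma>b \<delta>(1)]]) auto
 have Fform: "\<xi> \<bullet> (F t *v \<eta>) = t * (P \<xi> t \<bullet> (W t *v P \<eta> t))" if t: "0 < t" "t < \<delta>" for \<xi> \<eta> t
 proof -
  have "t ^ j * (\<xi> \<bullet> (F t *v \<eta>)) = \<xi> \<bullet> ((t ^ j *\<^sub>R F t) *v \<eta>)" by (simp add: scaleR_matrix_vector_assoc[symmetric])
  also have "... = \<xi> \<bullet> ((t *\<^sub>R \<Sigma> t) *v \<eta>)" using F(2)[of t] t by simp
  also have "... = t * (\<xi> \<bullet> (\<Sigma> t *v \<eta>))" by (simp add: scaleR_matrix_vector_assoc[symmetric])
  also have "... = t ^ j * (t * (P \<xi> t \<bullet> (W t *v P \<eta> t)))" by (simp add: \<Sigma>form[OF t])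
  finally show ?thesis using t by simp
 qed
 define M where "M = (\<lambda>t. F t - t *\<^sub>R dd 1 F t)"
 have Msm: "smooth_on ?I M"
  unfolding M_def by (intro smooth_diff smooth_scaleR smooth_id smooth_dd F(1)) auto
 show thesis
 proof (rule that[OF \<delta>(1,2) _ Msm])
  show "p = 0" if "0 < t" "t < \<delta>" "W t *v p = 0" for t p using S(5)[of t p] that \<delta> by simp
  have I0: "(0::real) \<in> ?I" using \<delta> by auto
  have "(M has_vector_derivative dd 1 F 0 - (0 *\<^sub>R dd 1 (dd 1 F) 0 + 1 *\<^sub>R dd 1 F 0)) (at 0)"
   unfolding M_def
   by (intro has_vector_derivative_diff smooth_vderiv[OF F(1) I0]
     has_vector_derivative_scaleR DERIV_ident smooth_vderiv[OF smooth_dd[OF F(1)] I0])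
  then have "(M has_derivative (\<lambda>h. h *\<^sub>R 0)) (at 0)" by (simp add: has_vector_derivative_def)
  then show "dd 1 M 0 = 0" by (simp add: dd_eqI)
 next
  fix t \<xi> \<eta> p q
  assume t: "0 < t" "t < \<delta>" and pq: "W t *v p = dd 1 W 0 *v \<xi>" "W t *v q = dd 1 W 0 *v \<eta>"
  have t\<epsilon>: "t \<in> {+-\<epsilon>}" "t \<in> ?I" using t \<delta> by auto
  have p: "p = P \<xi> t" and q: "q = P \<eta> t" using Puniq[OF t] pq by (auto simp: G_def)
  let ?J = "{0<..<\<delta>}"
  have Psm: "smooth_on ?J (P \<zeta>)" for \<zeta>
   unfolding P_def
   by (intro smooth_scaleR smooth_inverse smooth_power smooth_matrix_vector_mult
     smooth_subset[OF Ssm] smooth_const) auto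
  define p' where "p' = dd 1 (P \<xi>) t"
  have dP: "(P \<xi> has_vector_derivative p') (at t)"
   unfolding p'_def by (rule smooth_vderiv[OF Psm]) (use t in auto)
  have d1: "((\<lambda>t. W t *v P \<xi> t) has_vector_derivative W t *v p' + dd 1 W t *v P \<xi> t) (at t)"
   by (rule bounded_bilinear.has_vector_derivative[OF bilinear_matrix_vector
      smooth_vderiv[OF W t\<epsilon>(1)] dP])
  have "((\<lambda>t. W t *v P \<xi> t) has_vector_derivative 0) (at t)"
   by (rule has_vector_derivative_transform_within_open[OF has_vector_derivative_const, of ?J t "G *v \<xi>"])
    (use t P in auto)
  from vector_derivative_unique_at[OF d1 this] have e1: "W t *v p' = - (dd 1 W t *v P \<xi> t)"
   by (simp add: eq_neg_iff_add_eq_0)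
  have d2: "((\<lambda>t. t * (P \<xi> t \<bullet> (G *v \<eta>))) has_vector_derivative t * (p' \<bullet> (G *v \<eta>)) + 1 * (P \<xi> t \<bullet> (G *v \<eta>))) (at t)"
   unfolding has_real_derivative_iff_has_vector_derivative[symmetric]
   by (rule DERIV_mult'[OF DERIV_ident])
    (unfold has_real_derivative_iff_has_vector_derivative,
     rule bounded_linear.has_vector_derivative[OF bounded_linear_inner_left dP])
  have d3: "((\<lambda>t. \<xi> \<bullet> (F t *v \<eta>)) has_vector_derivative \<xi> \<bullet> (dd 1 F t *v \<eta>)) (at t)"
   by (rule bounded_linear.has_vector_derivative[OF bounded_linear_inner_right
      bounded_linear.has_vector_derivative[OF bounded_bilinear.bounded_linear_left[OF bilinear_matrix_vector]
       smooth_vderiv[OF F(1) t\<epsilon>(2)]]])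
  have "((\<lambda>t. \<xi> \<bullet> (F t *v \<eta>)) has_vector_derivative t * (p' \<bullet> (G *v \<eta>)) + 1 * (P \<xi> t \<bullet> (G *v \<eta>))) (at t)"
   by (rule has_vector_derivative_transform_within_open[OF d2, of ?J]) (use t Fform P in auto)
  from vector_derivative_unique_at[OF d3 this]
  have e2: "\<xi> \<bullet> (dd 1 F t *v \<eta>) = t * (p' \<bullet> (G *v \<eta>)) + P \<xi> t \<bullet> (G *v \<eta>)" by simp
  have "p' \<bullet> (G *v \<eta>) = p' \<bullet> (W t *v P \<eta> t)" by (simp add: P[OF t])
  also have "... = P \<eta> t \<bullet> (W t *v p')" by (rule sym[OF t\<epsilon>(1)])
  also have "... = - (P \<xi> t \<bullet> (dd 1 W t *v P \<eta> t))" unfolding e1 using sym'[OF t\<epsilon>(1), of "P \<eta> t"] by simp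
  finally have e3: "p' \<bullet> (G *v \<eta>) = - (P \<xi> t \<bullet> (dd 1 W t *v P \<eta> t))" .
  have "\<xi> \<bullet> (M t *v \<eta>) = \<xi> \<bullet> (F t *v \<eta>) - t * (\<xi> \<bullet> (dd 1 F t *v \<eta>))"
   by (simp add: M_def matrix_vector_mult_diff_rdistrib inner_diff_right scaleR_matrix_vector_assoc[symmetric])
  also have "... = t\<^sup>2 * (P \<xi> t \<bullet> (dd 1 W t *v P \<eta> t))"
   unfolding e2 e3 Fform[OF t] P[OF t] by (simp add: power2_eq_square algebra_simps)
  finally show "t\<^sup>2 * (p \<bullet> (dd 1 W t *v q)) = \<xi> \<bullet> (M t *v \<eta>)" by (simp add: p q)
 next
  fix \<eta> :: "real^'n"
  \<comment> \<open>Nonnegativity of the form \<open>W t\<close> at the difference of the solution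
    \<open>P \<eta> t\<close> and \<open>\<eta> / t\<close>, multiplied by \<open>t\<close>. In the
    limit \<open>hq W t\<close> tends to \<open>G\<close>, which leaves the comparison of
    \<open>F 0\<close> with \<open>G\<close>.\<close>
  have ineq: "2 * (\<eta> \<bullet> (G *v \<eta>)) - \<eta> \<bullet> (hq W t *v \<eta>) <= \<eta> \<bullet> (F t *v \<eta>)" if t: "0 < t" "t < \<delta>" for t
  proof -
   let ?q = "P \<eta> t"
   have t\<epsilon>: "t \<in> {+-\<epsilon>}" using t \<delta> by auto
   have Wt: "W t = t *\<^sub>R hq W t" using hq[OF W t\<epsilon>] W0 by simp
   have "0 <= (?q - (1 / t) *\<^sub>R \<eta>) \<bullet> (W t *v (?q - (1 / t) *\<^sub>R \<eta>))" by (rule form_nonneg) (use t \<delta> in auto)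
   also have "... = ?q \<bullet> (W t *v ?q) - (1 / t) * (?q \<bullet> (W t *v \<eta>)) - (1 / t) * (\<eta> \<bullet> (W t *v ?q)) + (1 / t) * (1 / t) * (\<eta> \<bullet> (W t *v \<eta>))"
    by (simp add: matrix_vector_mult_diff_distrib matrix_vector_mult_scaleR inner_diff_left inner_diff_right algebra_simps)
   also have "... = ?q \<bullet> (W t *v ?q) - (2 / t) * (\<eta> \<bullet> (G *v \<eta>)) + (1 / t) * (\<eta> \<bullet> (hq W t *v \<eta>))"
   proof -
    have 1: "\<eta> \<bullet> (W t *v ?q) = \<eta> \<bullet> (G *v \<eta>)" "?q \<bullet> (W t *v \<eta>) = \<eta> \<bullet> (G *v \<eta>)"
     using sym[OF t\<epsilon>, of ?q \<eta>] P[OF t, of \<eta>] by simp_all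
    have 2: "\<eta> \<bullet> (W t *v \<eta>) = t * (\<eta> \<bullet> (hq W t *v \<eta>))"
     by (simp add: Wt scaleR_matrix_vector_assoc[symmetric])
    show ?thesis unfolding 1 2 using t by (simp add: field_simps)
   qed
   finally have "0 <= t * (?q \<bullet> (W t *v ?q) - (2 / t) * (\<eta> \<bullet> (G *v \<eta>)) + (1 / t) * (\<eta> \<bullet> (hq W t *v \<eta>)))"
    using t by simp
   also have "... = \<eta> \<bullet> (F t *v \<eta>) - 2 * (\<eta> \<bullet> (G *v \<eta>)) + \<eta> \<bullet> (hq W t *v \<eta>)"
    unfolding Fform[OF t] using t by (simp add: algebra_simps)
   finally show ?thesis by simp
  qed
  have lim: "((\<lambda>t. \<eta> \<bullet> (A t *v \<eta>)) \<longlongrightarrow> \<eta> \<bullet> (A 0 *v \<eta>)) (at_right 0)" if "isCont A 0" for A :: "real => real^'n^'n"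
  proof -
   have "(A \<longlongrightarrow> A 0) (at_right 0)" using that by (simp add: isCont_def filterlim_at_split)
   then show ?thesis
    by (intro tendsto_inner tendsto_const bounded_bilinear.tendsto[OF bilinear_matrix_vector])
  qed
  have "2 * (\<eta> \<bullet> (G *v \<eta>)) - \<eta> \<bullet> (hq W 0 *v \<eta>) <= \<eta> \<bullet> (F 0 *v \<eta>)"
  proof (rule tendsto_le[of "at_right (0::real)"])
   show "((\<lambda>t. 2 * (\<eta> \<bullet> (G *v \<eta>)) - \<eta> \<bullet> (hq W t *v \<eta>)) \<longlongrightarrow> 2 * (\<eta> \<bullet> (G *v \<eta>)) - \<eta> \<bullet> (hq W 0 *v \<eta>)) (at_right 0)"
    by (intro tendsto_intros lim[of "hq W"] smooth_isCont[OF smooth_hq[OF W, of 1, simplified]])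
     (use eps in auto)
   show "((\<lambda>t. \<eta> \<bullet> (F t *v \<eta>)) \<longlongrightarrow> \<eta> \<bullet> (F 0 *v \<eta>)) (at_right 0)"
    by (rule lim[OF smooth_isCont[OF F(1)]]) (use \<delta> in auto)
   show "\<forall>\<^sub>F t in at_right 0. 2 * (\<eta> \<bullet> (G *v \<eta>)) - \<eta> \<bullet> (hq W t *v \<eta>) <= \<eta> \<bullet> (F t *v \<eta>)"
    unfolding eventually_at_right_field using ineq \<delta>(1) by blast
  qed simp
  then show "\<eta> \<bullet> (dd 1 W 0 *v \<eta>) <= \<eta> \<bullet> (M 0 *v \<eta>)" by (simp add: M_def G_def)
 qed
qed

end

section \<open>The maximized Hamiltonian in a chart\<close>

lemma dd_has_derivative:
 "f differentiable at x ==> (f has_derivative (\<lambda>v. dd v f x)) (at x)"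
 by (simp add: frechet_derivative_works)

lemmas bounded_linear_snd_snd = bounded_linear_compose[OF bounded_linear_snd bounded_linear_snd]
lemmas bounded_linear_fst_snd = bounded_linear_compose[OF bounded_linear_fst bounded_linear_snd]

lemma has_derivative_slice_snd:
 "(g has_derivative g') (at (y, w)) ==> ((\<lambda>w. g (y, w)) has_derivative (\<lambda>v. g' (0, v))) (at w)"
 by (rule has_derivative_compose[OF has_derivative_Pair[OF has_derivative_const has_derivative_ident]])

lemma dd_slice_snd: "g differentiable at (y, w) ==> dd v (\<lambda>w. g (y, w)) w = dd (0, v) g (y, w)"
 by (rule dd_eqI[OF has_derivative_slice_snd[OF dd_has_derivative]])

lemma dd_slice_fst: "g differentiable at (y, w) ==> dd v (\<lambda>y. g (y, w)) y = dd (v, 0) g (y, w)"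
 by (rule dd_eqI[OF has_derivative_compose[OF has_derivative_Pair[OF has_derivative_ident has_derivative_const] dd_has_derivative]])

lemma linear_dd_snd:
 assumes "g differentiable at z"
 shows "linear (\<lambda>v. dd (0, v) g z)"
proof -
 have "linear (\<lambda>v. (0, v))" by (rule linearI) auto
 from linear_compose[OF this linear_frechet_derivative[OF assms]] show ?thesis by (simp add: o_def)
qed

locale chart_problem =
 fixes Om :: "'a::euclidean_space set" and f :: "'a \<times> 'c::euclidean_space => 'a" and l :: "'a \<times> 'c => real"
 assumes Om: "open Om"
  and f: "smooth_on (Om \<times> UNIV) f" and l: "smooth_on (Om \<times> UNIV) l"
  and affine: "!!y. y \<in> Om ==> \<exists>f0 L. linear L \<and> (\<forall>w. f (y, w) = f0 + L w)"
  and convex: "!!y w v. y \<in> Om ==> v \<noteq> 0 ==> hessian (\<lambda>w. l (y, w)) w v v > 0"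
  and superlinear: "!!y. y \<in> Om ==> filterlim (\<lambda>w. l (y, w) / norm w) at_top at_infinity"
begin

lemma open_OmU: "open (Om \<times> UNIV)" using Om by (simp add: open_Times)

definition Fl :: "'a => 'c => 'a" where "Fl y w = f (y, w) - f (y, 0)"

lemma f_Fl: "f (y, w) = f (y, 0) + Fl y w" by (simp add: Fl_def)

lemma linear_Fl: "y \<in> Om ==> linear (Fl y)"
proof -
 assume "y \<in> Om"
 then obtain f0 L where L: "linear L" "!!w. f (y, w) = f0 + L w" using affine by blast
 then have "Fl y = L" by (auto simp: Fl_def linear_0[OF L(1)])
 with L show ?thesis by simp
qed

lemma dd_f_control: "y \<in> Om ==> dd (0, v) f (y, w) = Fl y v"
proof -
 assume y: "y \<in> Om"
 have "dd (0, v) f (y, w) = dd v (\<lambda>w. f (y, w)) w"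
  by (rule dd_slice_snd[symmetric]) (rule smooth_diffble[OF f], use y in simp)
 also have "... = Fl y v"
 proof (rule dd_eqI)
  have "(Fl y has_derivative Fl y) (at w)"
   by (rule bounded_linear_imp_has_derivative) (use linear_Fl[OF y] in "simp add: linear_conv_bounded_linear")
  then have "((\<lambda>w. f (y, 0) + Fl y w) has_derivative (\<lambda>v. 0 + Fl y v)) (at w)"
   by (intro has_derivative_add has_derivative_const)
  then show "((\<lambda>w. f (y, w)) has_derivative Fl y) (at w)" by (simp add: f_Fl[symmetric])
 qed
 finally show ?thesis .
qed

definition lww :: "'a => 'c => 'c => 'c => real" where
 "lww y w v v' = dd (0, v) (dd (0, v') l) (y, w)"

lemma dd_l_slice: "y \<in> Om ==> dd v (\<lambda>w. l (y, w)) w = dd (0, v) l (y, w)"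
 by (rule dd_slice_snd) (rule smooth_diffble[OF l], simp)

lemma hessian_l: "y \<in> Om ==> hessian (\<lambda>w. l (y, w)) w v v' = lww y w v' v"
 unfolding hessian_def lww_def
 using dd_slice_snd[of "dd (0, v) l" y w v'] smooth_diffble[OF smooth_dd[OF l]]
 by (simp add: dd_l_slice)

lemma lww_pos: "y \<in> Om ==> v \<noteq> 0 ==> lww y w v v > 0"
 using convex[of y v w] hessian_l[of y w v v] by simp

lemma lww_sym: "y \<in> Om ==> lww y w v v' = lww y w v' v"
 unfolding lww_def by (rule dd_commute[OF open_OmU l]) simp

lemma lww_linear: "y \<in> Om ==> linear (\<lambda>v. lww y w v v')"
 unfolding lww_def by (rule linear_dd_snd[OF smooth_diffble[OF smooth_dd[OF l]]]) simp

section \<open>The maximizing control\<close>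

definition gain :: "'a => 'a => 'c => real" where "gain y p w = p \<bullet> f (y, w) - l (y, w)"

definition critical :: "'a => 'a => 'c => bool" where
 "critical y p w \<longleftrightarrow> (\<forall>v. dd (0, v) l (y, w) = p \<bullet> Fl y v)"

text \<open>Strict convexity along the segment from \<open>w\<close> to \<open>w'\<close>: two uses
  of the mean value theorem show that the increase of \<open>l\<close> exceeds its linearization at
  \<open>w\<close>, while the other part of \<open>gain\<close> is affine.\<close>

lemma critical_strict_max:
 assumes y: "y \<in> Om" and c: "critical y p w" and ne: "w' \<noteq> w"
 shows "gain y p w' < gain y p w"
proof -
 define v where "v = w' - w"
 define g where "g = (\<lambda>t. l (y, w + t *\<^sub>R v))"
 define g' where "g' = (\<lambda>t. dd (0, v) l (y, w + t *\<^sub>R v))"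
 have dg: "(g has_real_derivative g' t) (at t)" for t
 proof -
  have "(l has_derivative (\<lambda>h. dd h l (y, w + t *\<^sub>R v))) (at ((y, w) + t *\<^sub>R (0, v)))"
   using smooth_deriv[OF l, of "(y, w + t *\<^sub>R v)"] y by simp
  from has_derivative_line[OF this, of UNIV] show ?thesis
   by (simp add: has_real_derivative_iff_has_vector_derivative g_def g'_def)
 qed
 have dg': "(g' has_real_derivative lww y (w + t *\<^sub>R v) v v) (at t)" for t
 proof -
  have "(dd (0, v) l has_derivative (\<lambda>h. dd h (dd (0, v) l) (y, w + t *\<^sub>R v))) (at ((y, w) + t *\<^sub>R (0, v)))"
   using smooth_deriv[OF smooth_dd[OF l], of "(y, w + t *\<^sub>R v)"] y by simp
  from has_derivative_line[OF this, of UNIV] show ?thesis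
   by (simp add: has_real_derivative_iff_has_vector_derivative g'_def lww_def)
 qed
 have v0: "v \<noteq> 0" using ne by (simp add: v_def)
 obtain t where t: "0 < t" "t < 1" "g 1 - g 0 = (1 - 0) * g' t"
  using MVT2[of 0 1 g g'] dg by auto
 obtain t' where t': "0 < t'" "t' < t" "g' t - g' 0 = (t - 0) * lww y (w + t' *\<^sub>R v) v v"
  using MVT2[of 0 t g' "\<lambda>t. lww y (w + t *\<^sub>R v) v v"] dg' t(1) by auto
 have "g' t > g' 0" using t'(3) lww_pos[OF y v0] t(1) by (metis diff_gt_0_iff_gt diff_zero mult_pos_pos)
 then have "g 1 - g 0 > g' 0" using t(3) by simp
 then have "l (y, w') - l (y, w) > p \<bullet> Fl y v"
  using c by (simp add: g_def g'_def v_def critical_def)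
 moreover have "Fl y v = f (y, w') - f (y, w)"
  using linear_diff[OF linear_Fl[OF y], of w' w] by (simp add: v_def Fl_def)
 ultimately show ?thesis by (simp add: gain_def inner_diff_right)
qed

lemma gain_attains_max:
 assumes y: "y \<in> Om"
 shows "\<exists>w. \<forall>w'. gain y p w' <= gain y p w"
proof -
 obtain B where B: "!!w. norm (Fl y w) <= B * norm w"
  using linear_bounded[OF linear_Fl[OF y]] by blast
 \<comment> \<open>The first summand beats the linear growth of \<open>p \<bullet> f\<close>; the
   rest, multiplied by \<open>norm w \<ge> 1\<close>, pushes \<open>gain\<close> below its value at
   0.\<close>
 define C where "C = norm p * B + 1 + \<bar>gain y p 0\<bar> + norm p * norm (f (y, 0))"
 have "eventually (\<lambda>w. l (y, w) / norm w \<ge> C) at_infinity"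
  using superlinear[OF y] by (simp add: filterlim_at_top)
 then obtain R where R: "!!w. norm w \<ge> R ==> l (y, w) / norm w \<ge> C"
  by (auto simp: eventually_at_infinity)
 define r where "r = max R 1"
 have far: "gain y p w <= gain y p 0" if "norm w \<ge> r" for w
 proof -
  have n1: "norm w \<ge> 1" "norm w \<ge> R" using that by (auto simp: r_def)
  have "l (y, w) \<ge> C * norm w"
  proof -
   have "norm w > 0" using n1(1) by linarith
   then show ?thesis using R[OF n1(2)] by (simp only: pos_le_divide_eq)
  qed
  moreover have "p \<bullet> f (y, w) <= norm p * norm (f (y, 0)) + norm p * (B * norm w)"
  proof -
   have "p \<bullet> f (y, w) <= norm p * norm (f (y, w))" by (rule norm_cauchy_schwarz)
   also have "... <= norm p * (norm (f (y, 0)) + B * norm w)"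
    using f_Fl[of y w] norm_triangle_ineq[of "f (y, 0)" "Fl y w"] B[of w] by (intro mult_left_mono) auto
   finally show ?thesis by (simp add: distrib_left)
  qed
  moreover have "C * norm w = norm p * (B * norm w) + (1 + \<bar>gain y p 0\<bar> + norm p * norm (f (y, 0))) * norm w"
   by (simp add: C_def algebra_simps)
  moreover have "(1 + \<bar>gain y p 0\<bar> + norm p * norm (f (y, 0))) * 1 <= (1 + \<bar>gain y p 0\<bar> + norm p * norm (f (y, 0))) * norm w"
   using n1(1) by (intro mult_left_mono) auto
  ultimately show ?thesis by (simp add: gain_def)
 qed
 have cont: "continuous_on (cball 0 r) (gain y p)"
  unfolding gain_def
  by (intro continuous_intros continuous_on_compose2[OF smooth_continuous[OF f]]
    continuous_on_compose2[OF smooth_continuous[OF l]]) (use y in auto)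
 have "\<exists>w\<in>cball 0 r. \<forall>w'\<in>cball 0 r. gain y p w' <= gain y p w"
  by (rule continuous_attains_sup[OF _ _ cont]) (auto simp: r_def)
 then obtain w where w: "w \<in> cball 0 r" "!!w'. w' \<in> cball 0 r ==> gain y p w' <= gain y p w" by blast
 have "gain y p w' <= gain y p w" for w'
 proof (cases "norm w' <= r")
  case True
  then show ?thesis using w by simp
 next
  case False
  then have "gain y p w' <= gain y p 0" using far by simp
  also have "... <= gain y p w" by (rule w(2)) (simp add: r_def)
  finally show ?thesis .
 qed
 then show ?thesis by blast
qed

lemma max_critical:
 assumes y: "y \<in> Om" and m: "!!w'. gain y p w' <= gain y p w"
 shows "critical y p w"
proof -
 have "(gain y p has_derivative (\<lambda>v. p \<bullet> Fl y v - dd (0, v) l (y, w))) (at w)"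
  unfolding gain_def
 proof (intro has_derivative_diff has_derivative_inner_right)
  have "(f has_derivative (\<lambda>v. dd v f (y, w))) (at (y, w))" by (rule smooth_deriv[OF f]) (use y in simp)
  from has_derivative_slice_snd[OF this]
  show "((\<lambda>w. f (y, w)) has_derivative Fl y) (at w)" by (simp add: dd_f_control[OF y])
  have "(l has_derivative (\<lambda>v. dd v l (y, w))) (at (y, w))" by (rule smooth_deriv[OF l]) (use y in simp)
  from has_derivative_slice_snd[OF this]
  show "((\<lambda>w. l (y, w)) has_derivative (\<lambda>v. dd (0, v) l (y, w))) (at w)" .
 qed
 then have "(\<lambda>v. p \<bullet> Fl y v - dd (0, v) l (y, w)) = (\<lambda>v. 0)"
  by (rule differential_zero_maxmin[OF UNIV_I open_UNIV]) (use m in auto)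
 then show ?thesis by (simp add: critical_def fun_eq_iff)
qed

text \<open>Defined by the critical point equation, to which the inverse function theorem applies;
  \<open>us_max\<close> and \<open>us_unique_max\<close> identify it with the maximizer.\<close>

definition us :: "'a \<times> 'a => 'c" where "us z = (THE w. critical (fst z) (snd z) w)"

lemma ex1_critical: "y \<in> Om ==> \<exists>!w. critical y p w"
proof -
 assume y: "y \<in> Om"
 obtain w where w: "critical y p w" using gain_attains_max[OF y] max_critical[OF y] by blast
 moreover have "w' = w" if "critical y p w'" for w'
  using critical_strict_max[OF y that, of w] critical_strict_max[OF y w, of w'] by fastforce
 ultimately show ?thesis by blast
qed

lemma critical_us: "y \<in> Om ==> critical y p (us (y, p))"
 unfolding us_def fst_conv snd_conv by (rule theI'[OF ex1_critical])

lemma us_eqI: "y \<in> Om ==> critical y p w ==> us (y, p) = w"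
 using ex1_critical critical_us by blast

lemma us_max: "y \<in> Om ==> gain y p w <= gain y p (us (y, p))"
 using critical_strict_max[OF _ critical_us, of y w p] by (cases "w = us (y, p)") auto

lemma us_unique_max: "y \<in> Om ==> (!!w'. gain y p w' <= gain y p w) ==> w = us (y, p)"
 using us_eqI[of y p w] max_critical[of y p w] by simp

text \<open>The implicit function theorem, obtained from the inverse function theorem for
  \<open>\<Xi> (y, p, w) = (y, p, \<Gamma> (y, p, w))\<close>: the zeros of \<open>\<Gamma>\<close>
  are the critical points, and its derivative in \<open>w\<close> is the positive definite Hessian
  of \<open>l\<close>.\<close>

lemma smooth_us: "smooth_on (Om \<times> UNIV) us"
proof (rule smooth_local)
 fix z0 assume z0: "z0 \<in> Om \<times> (UNIV :: 'a set)"
 obtain y0 p0 where z0_eq: "z0 = (y0, p0)" and y0: "y0 \<in> Om" using z0 by auto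
 define U where "U = Om \<times> (UNIV :: ('a \<times> 'c) set)"
 have oU: "open U" using Om by (simp add: U_def open_Times)
 define \<Gamma> where "\<Gamma> = (\<lambda>(y, p, w). \<Sum>i\<in>Basis. (dd (0, i) l (y, w) - p \<bullet> (f (y, i) - f (y, 0))) *\<^sub>R i)"
 define \<Xi> where "\<Xi> = (\<lambda>z. (fst z, fst (snd z), \<Gamma> z))"
 have sfst: "smooth_on U fst" "smooth_on U (\<lambda>z. fst (snd z))" "smooth_on U (\<lambda>z. snd (snd z))"
  by (intro smooth_linear[OF oU] bounded_linear_intros)+
 have s1: "smooth_on U (\<lambda>z. dd (0, i) l (fst z, snd (snd z)))" for i
  by (rule smooth_compose[OF oU open_OmU _ smooth_dd[OF l]])
   (auto simp: U_def intro!: smooth_Pair sfst[unfolded U_def] oU[unfolded U_def])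
 have s2: "smooth_on U (\<lambda>z. f (fst z, i))" for i
  by (rule smooth_compose[OF oU open_OmU _ f])
   (auto simp: U_def intro!: smooth_Pair sfst[unfolded U_def] oU[unfolded U_def])
 have s\<Gamma>: "smooth_on U \<Gamma>"
  unfolding \<Gamma>_def split_beta
  by (intro smooth_sum smooth_scaleR smooth_diff smooth_inner s1 s2 sfst smooth_const oU)
 have s\<Xi>: "smooth_on U \<Xi>" unfolding \<Xi>_def by (intro smooth_Pair oU sfst s\<Gamma>)
 define z1 where "z1 = (y0, p0, us (y0, p0))"
 have z1: "z1 \<in> U" using y0 by (simp add: z1_def U_def)
 have \<Gamma>0: "\<Gamma> (y, p, w) = 0 \<longleftrightarrow> critical y p w" if "y \<in> Om" for y p w
 proof
  assume "critical y p w"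
  then show "\<Gamma> (y, p, w) = 0" by (simp add: \<Gamma>_def critical_def Fl_def)
 next
  assume g: "\<Gamma> (y, p, w) = 0"
  have i: "dd (0, i) l (y, w) = p \<bullet> Fl y i" if "i \<in> Basis" for i
  proof -
   have "\<Gamma> (y, p, w) \<bullet> i = dd (0, i) l (y, w) - p \<bullet> Fl y i"
    using that by (simp add: \<Gamma>_def Fl_def inner_sum_left inner_Basis if_distrib cong: if_cong)
   then show ?thesis using g by simp
  qed
  show "critical y p w" unfolding critical_def
  proof
   fix v
   have l1: "linear (\<lambda>v. dd (0, v) l (y, w))"
    by (rule linear_dd_snd[OF smooth_diffble[OF l]]) (use \<open>y \<in> Om\<close> in simp)
   have l2: "linear (\<lambda>v. p \<bullet> Fl y v)"
    by (rule linearI) (simp_all add: linear_add[OF linear_Fl[OF \<open>y \<in> Om\<close>]]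
      linear_cmul[OF linear_Fl[OF \<open>y \<in> Om\<close>]] inner_add_right)
   show "dd (0, v) l (y, w) = p \<bullet> Fl y v"
    by (rule linear_eq_on_span[OF l1 l2, of Basis]) (use i in auto)
  qed
 qed
 have inj: "v = 0" if v: "dd v \<Xi> z1 = 0" for v :: "'a \<times> 'a \<times> 'c"
 proof -
  obtain a b c where abc: "v = (a, b, c)" by (cases v) auto
  have d\<Gamma>: "(\<Gamma> has_derivative (\<lambda>v. dd v \<Gamma> z1)) (at z1)" by (rule smooth_deriv[OF s\<Gamma> z1])
  have "(\<Xi> has_derivative (\<lambda>v. (fst v, fst (snd v), dd v \<Gamma> z1))) (at z1)"
   unfolding \<Xi>_def by (intro has_derivative_Pair d\<Gamma>) (auto intro!: derivative_eq_intros)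
  then have "dd v \<Xi> z1 = (a, b, dd v \<Gamma> z1)" by (simp add: dd_eqI abc)
  then have ab: "a = 0" "b = 0" and \<Gamma>v: "dd (0, 0, c) \<Gamma> z1 = 0" using v abc by (auto simp: zero_prod_def)
  define w0 where "w0 = us (y0, p0)"
  have "((\<lambda>w. \<Gamma> (y0, p0, w)) has_derivative (\<lambda>v. dd (0, 0, v) \<Gamma> z1)) (at w0)"
   unfolding w0_def by (rule has_derivative_slice_snd[OF has_derivative_slice_snd[OF d\<Gamma>[unfolded z1_def], folded z1_def]])
  moreover have "((\<lambda>w. \<Gamma> (y0, p0, w)) has_derivative (\<lambda>v. \<Sum>i\<in>Basis. (lww y0 w0 v i - 0) *\<^sub>R i)) (at w0)"
   unfolding \<Gamma>_def prod.case lww_def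
   by (intro has_derivative_sum has_derivative_scaleR_left has_derivative_diff has_derivative_const
     has_derivative_slice_snd[OF smooth_deriv[OF smooth_dd[OF l]]]) (use y0 in simp)
  ultimately have "(\<Sum>i\<in>Basis. lww y0 w0 c i *\<^sub>R i) = 0"
   using \<Gamma>v has_derivative_unique by (metis (no_types, lifting) diff_zero sum.cong)
  then have "lww y0 w0 c i = 0" if "i \<in> Basis" for i
   using that inner_sum_left_Basis[of i "\<lambda>i. lww y0 w0 c i"] by simp
  then have lci: "lww y0 w0 i c = 0" if "i \<in> Basis" for i using that lww_sym[OF y0] by metis
  have "lww y0 w0 c c = 0"
   by (rule linear_eq_on_span[OF lww_linear[OF y0] linear_zero, of Basis]) (use lci in auto)
  then have "c = 0" using lww_pos[OF y0, of c w0] by force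
  then show "v = 0" using ab abc by (simp add: zero_prod_def)
 qed
 obtain U' V g where g: "open U'" "U' \<subseteq> U" "z1 \<in> U'" "open V" "\<Xi> z1 \<in> V" "homeomorphism U' V \<Xi> g" "smooth_on V g"
  using smooth_inverse_function[OF oU s\<Xi> z1 inj] by metis
 have \<Xi>z1: "\<Xi> z1 = (y0, p0, 0)" using \<Gamma>0[OF y0, of p0] critical_us[OF y0] by (simp add: \<Xi>_def z1_def)
 define V' where "V' = (\<lambda>(y, p). (y, p, 0 :: 'c)) -` V"
 have oV': "open V'"
  unfolding V'_def split_beta by (intro open_vimage g(4) continuous_intros)
 have z0V': "z0 \<in> V'" using g(5) by (simp add: V'_def z0_eq \<Xi>z1)
 have sV: "smooth_on V' (\<lambda>z. (fst z, snd z, 0 :: 'c))"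
  by (intro smooth_Pair smooth_const smooth_linear[OF oV'] bounded_linear_intros oV')
 have "smooth_on V' (\<lambda>z. g (fst z, snd z, 0))"
  by (rule smooth_compose[OF oV' g(4) _ g(7) sV]) (auto simp: V'_def)
 then have "smooth_on V' (\<lambda>z. snd (snd (g (fst z, snd z, 0))))"
  by (intro smooth_snd oV')
 moreover have "snd (snd (g (fst z, snd z, 0))) = us z" if "z \<in> V'" for z
 proof -
  obtain y p where z: "z = (y, p)" by (cases z) auto
  have V: "(y, p, 0) \<in> V" using that by (simp add: V'_def z)
  have gU: "g (y, p, 0) \<in> U" using V g(2,6) by (auto simp: homeomorphism_def)
  have "\<Xi> (g (y, p, 0)) = (y, p, 0)" using V g(6) by (simp add: homeomorphism_def)
  then have "\<exists>w. g (y, p, 0) = (y, p, w) \<and> \<Gamma> (y, p, w) = 0"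
   by (cases "g (y, p, 0)") (auto simp: \<Xi>_def)
  then obtain w where w: "g (y, p, 0) = (y, p, w)" "\<Gamma> (y, p, w) = 0" by blast
  have y: "y \<in> Om" using gU w(1) by (simp add: U_def)
  show ?thesis using us_eqI[OF y, of p w] \<Gamma>0[OF y] w by (simp add: z)
 qed
 ultimately have "smooth_on V' us" by (rule smooth_cong[OF oV'])
 then show "\<exists>T. open T \<and> z0 \<in> T \<and> smooth_on T us" using oV' z0V' by blast
qed

section \<open>The Hamiltonian and its fibre derivatives\<close>

definition H :: "'a \<times> 'a => real" where "H z = gain (fst z) (snd z) (us z)"

definition fu :: "'a \<times> 'a => 'a" where "fu z = f (fst z, us z)"

definition lu :: "'a \<times> 'a => real" where "lu z = l (fst z, us z)"

lemma H_eq: "H (y, p) = p \<bullet> fu (y, p) - lu (y, p)" by (simp add: H_def fu_def lu_def gain_def)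

lemma smooth_fst_us: "smooth_on (Om \<times> UNIV) (\<lambda>z. (fst z, us z))"
 by (intro smooth_Pair smooth_us smooth_linear bounded_linear_fst open_OmU)

lemma smooth_fu: "smooth_on (Om \<times> UNIV) fu"
 unfolding fu_def by (rule smooth_compose[OF open_OmU open_OmU _ f smooth_fst_us]) auto

lemma smooth_lu: "smooth_on (Om \<times> UNIV) lu"
 unfolding lu_def by (rule smooth_compose[OF open_OmU open_OmU _ l smooth_fst_us]) auto

lemma smooth_H: "smooth_on (Om \<times> UNIV) H"
proof -
 have "smooth_on (Om \<times> UNIV) (\<lambda>z. snd z \<bullet> fu z - lu z)"
  by (intro smooth_diff smooth_inner smooth_fu smooth_lu smooth_linear[OF _ bounded_linear_snd] open_OmU)
 then show ?thesis by (rule smooth_cong[OF open_OmU]) (auto simp: H_eq)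
qed

lemma Fenchel: "y \<in> Om ==> p \<bullet> f (y, w) - l (y, w) <= H (y, p)"
 using us_max[of y p w] by (simp add: H_def gain_def)

lemma us_critical_dd: "y \<in> Om ==> dd (0, v) l (y, us (y, p)) = p \<bullet> Fl y v"
 using critical_us[of y p] by (simp add: critical_def)

text \<open>Envelope argument: the variation of the maximizer drops out by criticality.\<close>

lemma dd_H_covector: "y \<in> Om ==> dd (0, b) H (y, p) = b \<bullet> fu (y, p)"
proof -
 assume y: "y \<in> Om"
 have z: "(y, p) \<in> Om \<times> UNIV" using y by simp
 have du: "((\<lambda>p. us (y, p)) has_derivative (\<lambda>b. dd (0, b) us (y, p))) (at p)"
  by (rule has_derivative_slice_snd[OF smooth_deriv[OF smooth_us z]])
 have df: "((\<lambda>p. f (y, us (y, p))) has_derivative (\<lambda>b. dd (0, dd (0, b) us (y, p)) f (y, us (y, p)))) (at p)"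
  by (rule has_derivative_compose[OF has_derivative_Pair[OF has_derivative_const du] smooth_deriv[OF f]]) (use y in simp)
 have dl: "((\<lambda>p. l (y, us (y, p))) has_derivative (\<lambda>b. dd (0, dd (0, b) us (y, p)) l (y, us (y, p)))) (at p)"
  by (rule has_derivative_compose[OF has_derivative_Pair[OF has_derivative_const du] smooth_deriv[OF l]]) (use y in simp)
 have "((\<lambda>p. p \<bullet> f (y, us (y, p)) - l (y, us (y, p))) has_derivative
   (\<lambda>b. (p \<bullet> dd (0, dd (0, b) us (y, p)) f (y, us (y, p)) + b \<bullet> f (y, us (y, p)))
    - dd (0, dd (0, b) us (y, p)) l (y, us (y, p)))) (at p)"
  by (intro has_derivative_diff has_derivative_inner has_derivative_ident df dl)
 then have "((\<lambda>p. H (y, p)) has_derivative (\<lambda>b. b \<bullet> fu (y, p))) (at p)"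
  by (simp add: H_def gain_def fu_def dd_f_control[OF y] us_critical_dd[OF y])
 then show ?thesis using dd_slice_snd[OF smooth_diffble[OF smooth_H z]] by (simp add: dd_eqI)
qed

definition Hpp :: "'a \<times> 'a => 'a => 'a => real" where
 "Hpp z b b' = dd (0, b) (dd (0, b') H) z"

lemma Hpp_sym: "y \<in> Om ==> Hpp (y, p) b b' = Hpp (y, p) b' b"
 unfolding Hpp_def by (rule dd_commute[OF open_OmU smooth_H]) simp

lemma Hpp_eq: "y \<in> Om ==> Hpp (y, p) b b' = b' \<bullet> Fl y (dd (0, b) us (y, p))"
proof -
 assume y: "y \<in> Om"
 have z: "(y, p) \<in> Om \<times> UNIV" using y by simp
 have "Hpp (y, p) b b' = dd (0, b) (\<lambda>z. fu z \<bullet> b') (y, p)"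
  unfolding Hpp_def by (rule dd_cong[OF open_OmU z]) (auto simp: dd_H_covector inner_commute)
 also have "... = dd (0, b) fu (y, p) \<bullet> b'"
  by (rule dd_inner_left[OF smooth_diffble[OF smooth_fu z]])
 also have "dd (0, b) fu (y, p) = dd (dd (0, b) (\<lambda>z. (fst z, us z)) (y, p)) f (y, us (y, p))"
  unfolding fu_def
  using dd_compose[of f "\<lambda>z. (fst z, us z)" "(y, p)" "(0, b)"] y
   smooth_diffble[OF f] smooth_diffble[OF smooth_fst_us z] by simp
 also have "dd (0, b) (\<lambda>z. (fst z, us z)) (y, p) = (0, dd (0, b) us (y, p))"
  by (rule dd_eqI[THEN trans, OF has_derivative_Pair[OF has_derivative_fst[OF has_derivative_ident] smooth_deriv[OF smooth_us z]]]) simp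
 finally show ?thesis using dd_f_control[OF y] by (simp add: inner_commute)
qed

text \<open>The critical point equation differentiated in \<open>p\<close>. It makes
  \<open>Hpp\<close> the Hessian of \<open>l\<close> pulled back by the derivative of the maximizer,
  hence nonnegative.\<close>

lemma lww_us: "y \<in> Om ==> lww y (us (y, p)) (dd (0, b) us (y, p)) c = b \<bullet> Fl y c"
proof -
 assume y: "y \<in> Om"
 have z: "(y, p) \<in> Om \<times> UNIV" using y by simp
 have du: "((\<lambda>p. us (y, p)) has_derivative (\<lambda>b. dd (0, b) us (y, p))) (at p)"
  by (rule has_derivative_slice_snd[OF smooth_deriv[OF smooth_us z]])
 have "((\<lambda>p. dd (0, c) l (y, us (y, p))) has_derivative (\<lambda>b. lww y (us (y, p)) (dd (0, b) us (y, p)) c)) (at p)"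
  unfolding lww_def
  by (rule has_derivative_compose[OF has_derivative_Pair[OF has_derivative_const du] smooth_deriv[OF smooth_dd[OF l]]]) (use y in simp)
 moreover have "((\<lambda>p. dd (0, c) l (y, us (y, p))) has_derivative (\<lambda>b. b \<bullet> Fl y c)) (at p)"
  unfolding us_critical_dd[OF y] by (rule has_derivative_inner_left[OF has_derivative_ident])
 ultimately show ?thesis by (metis has_derivative_unique)
qed

lemma Hpp_lww: "y \<in> Om ==> Hpp (y, p) b b = lww y (us (y, p)) (dd (0, b) us (y, p)) (dd (0, b) us (y, p))"
 by (simp add: Hpp_eq lww_us)

lemma Hpp_nonneg: "y \<in> Om ==> 0 <= Hpp (y, p) b b"
 using Hpp_lww[of y p b] lww_pos[of y "dd (0, b) us (y, p)" "us (y, p)"] linear_0[OF lww_linear, of y "us (y, p)" 0]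
 by (cases "dd (0, b) us (y, p) = 0") auto

text \<open>Cauchy-Schwarz for \<open>lww\<close> with the vectors \<open>c\<close> and
  \<open>dd (0, b) us (y, p)\<close>. It lets smallness of the second derivative of \<open>H\<close>
  at \<open>b\<close> bound the pairing of \<open>b\<close> with the distribution.\<close>

lemma Fl_pairing_bound:
 assumes y: "y \<in> Om"
 shows "(b \<bullet> Fl y c)\<^sup>2 <= lww y (us (y, p)) c c * Hpp (y, p) b b"
proof (cases "c = 0")
 case True
 then show ?thesis by (simp add: linear_0[OF linear_Fl[OF y]] linear_0[OF lww_linear[OF y]])
next
 case False
 define x where "x = dd (0, b) us (y, p)"
 let ?B = "lww y (us (y, p))"
 note l1 = lww_linear[OF y, of "us (y, p)"]
 have l2: "linear (\<lambda>v'. ?B v v')" for v using l1[of v] lww_sym[OF y, of _ v] by simp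
 have c: "?B c c > 0" by (rule lww_pos[OF y False])
 have "0 <= ?B v v" for v using lww_pos[OF y, of v] linear_0[OF l1] by (cases "v = 0") (auto simp: less_imp_le)
 then have "0 <= ?B (?B c c *\<^sub>R x - ?B x c *\<^sub>R c) (?B c c *\<^sub>R x - ?B x c *\<^sub>R c)" .
 also have "... = ?B c c * (?B c c * ?B x x - (?B x c)\<^sup>2)"
  using lww_sym[OF y, of _ c x]
  by (simp add: linear_diff[OF l1] linear_diff[OF l2] linear_cmul[OF l1] linear_cmul[OF l2] power2_eq_square algebra_simps)
 finally show ?thesis
  using c lww_us[OF y, of p b c] Hpp_lww[OF y, of p b] by (simp add: zero_le_mult_iff x_def)
qed

text \<open>The second derivative of \<open>H\<close> maps onto the distribution: a vector
  \<open>z\<close> orthogonal to its range has \<open>Hpp (y, p) z z = 0\<close>, so the maximizer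
  does not move in direction \<open>z\<close> to first order, and by \<open>lww_us\<close> then
  \<open>z\<close> annihilates the distribution.\<close>

lemma range_Hpp_operator:
 assumes y: "y \<in> Om"
 shows "range (\<lambda>b. Fl y (dd (0, b) us (y, p))) = range (Fl y)"
proof
 let ?G = "\<lambda>b. Fl y (dd (0, b) us (y, p))"
 note lF = linear_Fl[OF y]
 have z: "(y, p) \<in> Om \<times> UNIV" using y by simp
 have lG: "linear ?G"
  using linear_compose[OF linear_dd_snd[OF smooth_diffble[OF smooth_us z]] lF] by (simp add: o_def)
 show "range (Fl y) \<subseteq> range ?G"
 proof
  fix v assume "v \<in> range (Fl y)"
  then obtain w where w: "v = Fl y w" by blast
  have sub: "span (range ?G) = range ?G" by (simp add: linear_subspace_image[OF lG] span_eq_iff)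
  obtain a z where az: "a \<in> range ?G" "!!u. u \<in> range ?G ==> orthogonal z u" "v = a + z"
   using orthogonal_subspace_decomp_exists[of "range ?G" v] unfolding sub by metis
  have "Hpp (y, p) z z = 0"
   using az(2)[of "?G z"] by (simp add: Hpp_eq[OF y] orthogonal_def)
  then have "dd (0, z) us (y, p) = 0"
   using Hpp_lww[OF y, of p z] lww_pos[OF y, of "dd (0, z) us (y, p)" "us (y, p)"] by force
  then have "z \<bullet> Fl y w = 0"
   using lww_us[OF y, of p z w] linear_0[OF lww_linear[OF y, of "us (y, p)" w]] by simp
  then have "z \<bullet> (a + z) = 0" using w az(3) by simp
  then have "z \<bullet> a + z \<bullet> z = 0" by (simp add: inner_add_right)
  then have "z = 0" using az(1,2) by (simp add: orthogonal_def)
  then show "v \<in> range ?G" using az by simp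
 qed
qed auto

end

section \<open>Fields of extremals\<close>

context chart_problem
begin

definition Hy :: "'a \<times> 'a => 'a" where "Hy z = (\<Sum>i\<in>Basis. dd (i, 0) H z *\<^sub>R i)"

lemma smooth_Hy: "smooth_on (Om \<times> UNIV) Hy"
 unfolding Hy_def by (intro smooth_sum smooth_scaleR smooth_dd smooth_H smooth_const open_OmU)

lemma dd_H_point:
 assumes "y \<in> Om"
 shows "dd (v, 0) H (y, p) = v \<bullet> Hy (y, p)"
proof -
 have d: "H differentiable at (y, p)" by (rule smooth_diffble[OF smooth_H]) (use assms in simp)
 have "linear (\<lambda>v. (v, 0))" by (rule linearI) auto
 from linear_compose[OF this linear_frechet_derivative[OF d]]
 have l: "linear (\<lambda>v. dd (v, 0) H (y, p))" by (simp add: o_def)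
 have "dd (v, 0) H (y, p) = (\<Sum>i\<in>Basis. (v \<bullet> i) *\<^sub>R dd (i, 0) H (y, p))"
  by (rule linear_Basis_expansion[OF l])
 then show ?thesis by (simp add: Hy_def inner_sum_right mult.commute)
qed

lemma dd_H:
 assumes "y \<in> Om"
 shows "dd (v, w) H (y, p) = v \<bullet> Hy (y, p) + w \<bullet> fu (y, p)"
proof -
 have l: "linear (\<lambda>v. dd v H (y, p))" by (rule linear_dd[OF smooth_H]) (use assms in simp)
 have "dd ((v, 0) + (0, w)) H (y, p) = dd (v, 0) H (y, p) + dd (0, w) H (y, p)" by (rule linear_add[OF l])
 then show ?thesis by (simp add: dd_H_point[OF assms] dd_H_covector[OF assms])
qed

lemma dd_lu:
 assumes "y \<in> Om"
 shows "dd (v, w) lu (y, p) = p \<bullet> dd (v, w) fu (y, p) - v \<bullet> Hy (y, p)"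
proof -
 have z: "(y, p) \<in> Om \<times> UNIV" using assms by simp
 have "dd (v, w) lu (y, p) = dd (v, w) (\<lambda>z. snd z \<bullet> fu z - H z) (y, p)"
  by (rule dd_cong[OF open_OmU z]) (auto simp: H_eq)
 also have "... = (snd (y, p) \<bullet> dd (v, w) fu (y, p) + snd (v, w) \<bullet> fu (y, p)) - dd (v, w) H (y, p)"
  by (rule dd_eqI) (intro has_derivative_diff has_derivative_inner has_derivative_snd has_derivative_ident
    smooth_deriv[OF smooth_fu z] smooth_deriv[OF smooth_H z])
 finally show ?thesis by (simp add: dd_H[OF assms])
qed

end

lemma vderiv_slice:
 assumes "g differentiable at (s, z)"
 shows "((\<lambda>s. g (s, z)) has_vector_derivative dd (1, 0) g (s, z)) (at s)"
proof -
 have "((\<lambda>s. (s, z)) has_vector_derivative (1, 0)) (at s)"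
  by (intro has_vector_derivative_Pair has_vector_derivative_const) (auto intro!: derivative_eq_intros)
 from vector_derivative_diff_chain_within[OF this[unfolded] has_derivative_at_withinI[OF dd_has_derivative[OF assms]]]
 show ?thesis by (simp add: o_def)
qed

lemma dd_time_eqI:
 assumes "g differentiable at (s, z)" "((\<lambda>s. g (s, z)) has_vector_derivative D) (at s)"
 shows "dd (1, 0) g (s, z) = D"
 using vderiv_slice[OF assms(1)] assms(2) by (rule vector_derivative_unique_at)

text \<open>\<open>X\<close>, \<open>P\<close> and \<open>A\<close> are position, momentum and action of the extremal with initial position \<open>y\<close> and
 initial covector \<open>p\<close>; \<open>Y\<close> recovers the initial position from the final one.\<close>

locale extremal_field = chart_problem Om f l
 for Om :: "'a::euclidean_space set" and f :: "'a \<times> 'c::euclidean_space => 'a" and l :: "'a \<times> 'c => real" +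
 fixes y0 \<eta> :: 'a and \<tau> r \<rho> :: real and X P :: "real \<times> 'a \<times> 'a => 'a" and A :: "real \<times> 'a \<times> 'a => real"
  and Y :: "real \<times> 'a \<times> 'a => 'a" and B1 B2 :: "(real \<times> 'a \<times> 'a) set"
 assumes B1: "B1 = {+-\<tau>} \<times> ball y0 r \<times> ball \<eta> r" and B2: "B2 = {+-\<tau>} \<times> ball y0 \<rho> \<times> ball \<eta> \<rho>"
  and pos: "\<tau> > 0" "\<rho> > 0" "\<rho> <= r"
  and X: "smooth_on B1 X" and P: "smooth_on B1 P" and A: "smooth_on B1 A"
  and XOm: "!!z. z \<in> B1 ==> X z \<in> Om"
  and init: "!!y p. y \<in> ball y0 r ==> p \<in> ball \<eta> r ==> X (0, y, p) = y"
   "!!y p. y \<in> ball y0 r ==> p \<in> ball \<eta> r ==> P (0, y, p) = p"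
   "!!y p. y \<in> ball y0 r ==> p \<in> ball \<eta> r ==> A (0, y, p) = 0"
  and dX: "!!s z. (s, z) \<in> B1 ==> ((\<lambda>s. X (s, z)) has_vector_derivative fu (X (s, z), P (s, z))) (at s)"
  and dP: "!!s z. (s, z) \<in> B1 ==> ((\<lambda>s. P (s, z)) has_vector_derivative - Hy (X (s, z), P (s, z))) (at s)"
  and dA: "!!s z. (s, z) \<in> B1 ==> ((\<lambda>s. A (s, z)) has_vector_derivative lu (X (s, z), P (s, z))) (at s)"
  and Y: "smooth_on B2 Y" and YB: "!!z. z \<in> B2 ==> Y z \<in> ball y0 r"
  and XY: "!!s x p. (s, x, p) \<in> B2 ==> X (s, Y (s, x, p), p) = x"
  and Y0: "!!s. \<bar>s\<bar> < \<tau> ==> X (s, y0, \<eta>) \<in> ball y0 \<rho> \<and> Y (s, X (s, y0, \<eta>), \<eta>) = y0"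
begin

lemma open_B1: "open B1" and open_B2: "open B2"
 unfolding B1 B2 by (intro open_Times open_ball open_greaterThanLessThan)+

text \<open>First variation of the action along extremals. By Hamilton's equations the difference of
  the variation of \<open>A\<close> and the pairing of \<open>P\<close> with the variation of
  \<open>X\<close> is constant in time; at time 0 it equals
  \<open>- (p \<bullet> v)\<close>.\<close>

lemma action_variation:
 assumes z: "(s, y, p) \<in> B1"
 shows "dd (0, v, w) A (s, y, p) = P (s, y, p) \<bullet> dd (0, v, w) X (s, y, p) - p \<bullet> v"
proof -
 let ?u = "(0, v, w) :: real \<times> 'a \<times> 'a"
 let ?I = "{+-\<tau>}"
 have yp: "y \<in> ball y0 r" "p \<in> ball \<eta> r" "s \<in> ?I" using z by (auto simp: B1)
 have inB: "(t, y, p) \<in> B1" if "t \<in> ?I" for t using that yp by (simp add: B1)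
 define q where "q = (\<lambda>t. dd ?u A (t, y, p) - P (t, y, p) \<bullet> dd ?u X (t, y, p))"
 have dq: "(q has_vector_derivative 0) (at t within ?I)" if t: "t \<in> ?I" for t
 proof -
  let ?z = "(t, y, p)"
  have zB: "?z \<in> B1" by (rule inB[OF t])
  define a b where "a = dd ?u X ?z" and "b = dd ?u P ?z"
  have XO: "X ?z \<in> Om" by (rule XOm[OF zB])
  let ?Z = "\<lambda>z. (X z, P z)"
  have dZ: "(?Z has_derivative (\<lambda>u. (dd u X ?z, dd u P ?z))) (at ?z)"
   by (intro has_derivative_Pair smooth_deriv[OF X zB] smooth_deriv[OF P zB])
  \<comment> \<open>Time derivative and variation commute, so the variations of \<open>X\<close> and
    \<open>A\<close> solve the linearized equations.\<close>
  have sw: "dd (1, 0) (dd ?u g) ?z = dd (a, b) G (?Z ?z)"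
   if g: "smooth_on B1 g" and dg: "!!s z. (s, z) \<in> B1 ==> ((\<lambda>s. g (s, z)) has_vector_derivative G (X (s, z), P (s, z))) (at s)"
    and G: "smooth_on (Om \<times> UNIV) G" for g :: "real \<times> 'a \<times> 'a => 'x::euclidean_space" and G
  proof -
   have "dd (1, 0) (dd ?u g) ?z = dd ?u (dd (1, 0) g) ?z" by (rule dd_commute[OF open_B1 g zB])
   also have "... = dd ?u (\<lambda>z. G (?Z z)) ?z"
   proof (rule dd_cong[OF open_B1 zB])
    fix z assume "z \<in> B1"
    then show "dd (1, 0) g z = G (?Z z)"
     using dd_time_eqI[OF smooth_diffble[OF g] dg] by (cases z) auto
   qed
   also have "... = dd (a, b) G (?Z ?z)"
    unfolding a_def b_def
    by (rule dd_eqI, rule has_derivative_compose[OF dZ smooth_deriv[OF G]]) (use XO in simp)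
   finally show ?thesis .
  qed
  have "(q has_vector_derivative dd (1, 0) (dd ?u A) ?z
    - (P ?z \<bullet> dd (1, 0) (dd ?u X) ?z + - Hy (?Z ?z) \<bullet> dd ?u X ?z)) (at t)"
   unfolding q_def
   by (intro has_vector_derivative_diff bounded_bilinear.has_vector_derivative[OF bounded_bilinear_inner]
     vderiv_slice smooth_diffble[OF smooth_dd[OF A] zB]
     smooth_diffble[OF smooth_dd[OF X] zB] dP[OF zB])
  moreover have swX: "dd (1, 0) (dd ?u X) ?z = dd (a, b) fu (?Z ?z)" by (rule sw[OF X dX smooth_fu])
  moreover have swA: "dd (1, 0) (dd ?u A) ?z = dd (a, b) lu (?Z ?z)" by (rule sw[OF A dA smooth_lu])
  moreover have "dd (1, 0) (dd ?u A) ?z - (P ?z \<bullet> dd (1, 0) (dd ?u X) ?z + - Hy (?Z ?z) \<bullet> dd ?u X ?z) = 0"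
   unfolding swX swA dd_lu[OF XO] a_def[symmetric]
   by (simp add: inner_commute)
  ultimately show ?thesis using has_vector_derivative_at_within by metis
 qed
 have "q s = q 0"
  using has_vector_derivative_zero_constant[of ?I q] dq yp(3) pos(1)
  by (metis convex_real_interval(8) greaterThanLessThan_iff neg_less_0_iff_less)
 moreover have "q 0 = - (p \<bullet> v)"
 proof -
  have z0: "(0, y, p) \<in> B1" by (rule inB) (use pos in auto)
  let ?B = "ball y0 r \<times> ball \<eta> r"
  have oB: "open ?B" "(y, p) \<in> ?B" using yp by (auto intro: open_Times)
  have sl: "dd ?u g (0, y, p) = dd (v, w) (\<lambda>z. g (0, z)) (y, p)" if "smooth_on B1 g"
   for g :: "real \<times> 'a \<times> 'a => 'x::real_normed_vector"
   using dd_slice_snd[OF smooth_diffble[OF that z0], of "(v, w)"] by simp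
  have "dd (v, w) (\<lambda>z. A (0, z)) (y, p) = dd (v, w) (\<lambda>z. 0) (y, p)"
   by (rule dd_cong[OF oB]) (use init(3) in auto)
  then have 1: "dd ?u A (0, y, p) = 0" by (simp add: sl[OF A])
  have "dd (v, w) (\<lambda>z. X (0, z)) (y, p) = dd (v, w) fst (y, p)"
   by (rule dd_cong[OF oB]) (use init(1) in auto)
  moreover have "dd (v, w) (fst :: 'a \<times> 'a => 'a) (y, p) = v"
   by (rule dd_eqI[THEN trans, OF bounded_linear_imp_has_derivative[OF bounded_linear_fst]]) simp
  ultimately have 2: "dd ?u X (0, y, p) = v" by (simp add: sl[OF X])
  show ?thesis using 1 2 init(2)[OF yp(1,2)] by (simp add: q_def)
 qed
 ultimately show ?thesis by (simp add: q_def)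
qed

text \<open>\<open>a\<close> solves the Hamilton-Jacobi equation with initial value \<open>p \<bullet> x\<close>; its differential in \<open>x\<close>
 is \<open>Pf\<close>.\<close>

definition emb :: "real \<times> 'a \<times> 'a => real \<times> 'a \<times> 'a" where
 "emb z = (fst z, Y z, snd (snd z))"

definition Pf :: "real \<times> 'a \<times> 'a => 'a" where "Pf z = P (emb z)"

definition a :: "real \<times> 'a \<times> 'a => real" where
 "a z = snd (snd z) \<bullet> Y z + A (emb z)"

lemma emb_B1: "z \<in> B2 ==> emb z \<in> B1"
 using YB[of z] pos by (cases z) (auto simp: emb_def B1 B2)

lemma smooth_emb: "smooth_on B2 emb"
 unfolding emb_def
 by (intro smooth_Pair Y open_B2 smooth_linear bounded_linear_fst
   bounded_linear_snd_snd)

lemma smooth_Pf: "smooth_on B2 Pf"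
 unfolding Pf_def by (rule smooth_compose[OF open_B2 open_B1 _ P smooth_emb]) (use emb_B1 in auto)

lemma smooth_a: "smooth_on B2 a"
 unfolding a_def
 by (intro smooth_add smooth_inner Y open_B2 smooth_linear
   bounded_linear_snd_snd
   smooth_compose[OF open_B2 open_B1 _ A smooth_emb]) (use emb_B1 in auto)

lemma X_emb: "z \<in> B2 ==> X (emb z) = fst (snd z)"
 using XY by (cases z) (auto simp: emb_def)

lemma x_Om: "z \<in> B2 ==> fst (snd z) \<in> Om"
 using XOm[OF emb_B1] X_emb by metis

text \<open>Moving \<open>s\<close> and \<open>x\<close> changes the starting point
  \<open>Y\<close>; by \<open>action_variation\<close> its contributions from
  \<open>p \<bullet> Y\<close> and from the action cancel. What remains is the Hamilton-Jacobi
  equation and the gradients \<open>Pf\<close> in \<open>x\<close> and \<open>Y\<close> in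
  \<open>p\<close>.\<close>

lemma dd_a:
 assumes z: "z \<in> B2"
 shows "dd (\<sigma>, v, w) a z = w \<bullet> Y z + Pf z \<bullet> v - \<sigma> * H (fst (snd z), Pf z)"
proof -
 let ?h = "(\<sigma>, v, w)"
 define k where "k = dd ?h Y z"
 have eB: "emb z \<in> B1" by (rule emb_B1[OF z])
 have de: "(emb has_derivative (\<lambda>h. (fst h, dd h Y z, snd (snd h)))) (at z)"
  unfolding emb_def
  by (intro has_derivative_Pair smooth_deriv[OF Y z] bounded_linear_imp_has_derivative
    bounded_linear_fst bounded_linear_snd_snd)
 have split: "dd (\<sigma>, k, w) g (emb z) = \<sigma> *\<^sub>R dd (1, 0) g (emb z) + dd (0, k, w) g (emb z)"
  if "smooth_on B1 g" for g :: "real \<times> 'a \<times> 'a => 'x::real_normed_vector"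
 proof -
  note lin = linear_dd[OF that eB]
  have "dd (\<sigma> *\<^sub>R (1, 0) + (0, k, w)) g (emb z) = \<sigma> *\<^sub>R dd (1, 0) g (emb z) + dd (0, k, w) g (emb z)"
   unfolding linear_add[OF lin] linear_cmul[OF lin] ..
  then show ?thesis by (simp add: zero_prod_def)
 qed
 have time: "dd (1, 0) g (emb z) = G (X (emb z), P (emb z))"
  if "smooth_on B1 g" "!!s z. (s, z) \<in> B1 ==> ((\<lambda>s. g (s, z)) has_vector_derivative G (X (s, z), P (s, z))) (at s)"
  for g :: "real \<times> 'a \<times> 'a => 'x::real_normed_vector" and G
  using dd_time_eqI[OF smooth_diffble[OF that(1)] that(2)] eB by (cases "emb z") auto
 have tX: "dd (1, 0) X (emb z) = fu (X (emb z), P (emb z))" by (rule time[OF X dX])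
 have tA: "dd (1, 0) A (emb z) = lu (X (emb z), P (emb z))" by (rule time[OF A dA])
 have "dd ?h (\<lambda>z. X (emb z)) z = dd ?h (\<lambda>z. fst (snd z)) z"
  by (rule dd_cong[OF open_B2 z]) (rule X_emb)
 also have "... = v"
  by (rule dd_eqI[THEN trans, OF bounded_linear_imp_has_derivative[OF bounded_linear_fst_snd]]) simp
 also have "dd ?h (\<lambda>z. X (emb z)) z = dd (\<sigma>, k, w) X (emb z)"
  by (rule dd_eqI[THEN trans, OF has_derivative_compose[OF de smooth_deriv[OF X eB]]]) (simp add: k_def)
 finally have Xk: "dd (0, k, w) X (emb z) = v - \<sigma> *\<^sub>R fu (X (emb z), P (emb z))"
  unfolding split[OF X] tX by (simp add: algebra_simps)
 have "dd ?h a z = (snd (snd z) \<bullet> k + w \<bullet> Y z) + dd (\<sigma>, k, w) A (emb z)"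
  unfolding a_def
  by (rule dd_eqI[THEN trans, OF has_derivative_add[OF has_derivative_inner[OF
       bounded_linear_imp_has_derivative[OF bounded_linear_snd_snd]
       smooth_deriv[OF Y z]] has_derivative_compose[OF de smooth_deriv[OF A eB]]]])
   (simp add: k_def)
 also have "dd (\<sigma>, k, w) A (emb z) = \<sigma> * lu (X (emb z), P (emb z)) + (P (emb z) \<bullet> dd (0, k, w) X (emb z) - snd (snd z) \<bullet> k)"
  unfolding split[OF A] tA using action_variation[of "fst z" "Y z" "snd (snd z)" k w] eB by (simp add: emb_def)
 finally show ?thesis
  unfolding Xk by (simp add: Pf_def X_emb[OF z] H_eq algebra_simps inner_diff_right)
qed

end

lemma dist_Pair_le: "dist (a :: 'x::real_normed_vector, b :: 'y::real_normed_vector) (c, d) <= dist a c + dist b d"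
 by (simp add: dist_norm norm_Pair_le)

text \<open>The action is carried as a third component of the Hamiltonian flow, so one flow theorem
  gives all three functions. At time 0 the map from initial to final position is the identity, so
  near \<open>(0, y0, \<eta>)\<close> the variables \<open>(s, y, p)\<close> can be replaced by
  \<open>(s, x, p)\<close>.\<close>

theorem (in chart_problem) extremal_field_exists:
 assumes y0: "y0 \<in> Om"
 obtains \<tau> r \<rho> X P A Y B1 B2 where "extremal_field Om f l y0 \<eta> \<tau> r \<rho> X P A Y B1 B2"
proof -
 let ?D = "Om \<times> (UNIV :: ('a \<times> real) set)"
 have oD: "open ?D" using Om by (simp add: open_Times)
 define F where "F = (\<lambda>z :: 'a \<times> 'a \<times> real. (fu (fst z, fst (snd z)), - Hy (fst z, fst (snd z)), lu (fst z, fst (snd z))))"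
 have sp: "smooth_on ?D (\<lambda>z. (fst z, fst (snd z)))"
  by (intro smooth_Pair oD smooth_linear bounded_linear_fst
    bounded_linear_fst_snd)
 have sF: "smooth_on ?D F"
  unfolding F_def
  by (intro smooth_Pair smooth_minus oD smooth_compose[OF oD open_OmU _ smooth_fu sp]
    smooth_compose[OF oD open_OmU _ smooth_Hy sp] smooth_compose[OF oD open_OmU _ smooth_lu sp]) auto
 obtain \<tau>1 r1 and \<phi> :: "real \<times> 'a \<times> 'a \<times> real => 'a \<times> 'a \<times> real" where
  fl: "\<tau>1 > 0" "r1 > 0" "ball (y0, \<eta>, 0) r1 \<subseteq> ?D"
  "smooth_on ({+-\<tau>1} \<times> ball (y0, \<eta>, 0) r1) \<phi>"
  "!!z. z \<in> ball (y0, \<eta>, 0) r1 ==> \<phi> (0, z) = z"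
  "!!s z. \<bar>s\<bar> < \<tau>1 ==> z \<in> ball (y0, \<eta>, 0) r1 ==> \<phi> (s, z) \<in> ?D"
  "!!s z. \<bar>s\<bar> < \<tau>1 ==> z \<in> ball (y0, \<eta>, 0) r1 ==> ((\<lambda>s. \<phi> (s, z)) has_vector_derivative F (\<phi> (s, z))) (at s)"
  using smooth_local_flow[OF oD sF, of "(y0, \<eta>, 0)"] y0 by auto
 define r where "r = r1 / 2"
 have r: "r > 0" using fl by (simp add: r_def)
 have in1: "(y, p, 0 :: real) \<in> ball (y0, \<eta>, 0) r1" if "y \<in> ball y0 r" "p \<in> ball \<eta> r" for y p
 proof -
  show ?thesis using dist_Pair_le[of y0 "(\<eta>, 0::real)" y "(p, 0)"] dist_Pair_le[of \<eta> "0::real" p 0] that by (simp add: r_def)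
 qed
 define B where "B = {+-\<tau>1} \<times> ball y0 r \<times> ball \<eta> r"
 have oB: "open B" by (simp add: B_def open_Times)
 define j where "j = (\<lambda>z :: real \<times> 'a \<times> 'a. (fst z, fst (snd z), snd (snd z), 0 :: real))"
 have jB: "j ` B \<subseteq> {+-\<tau>1} \<times> ball (y0, \<eta>, 0) r1"
  using in1 by (auto simp: j_def B_def)
 have sj: "smooth_on B j"
  unfolding j_def
  by (intro smooth_Pair smooth_const oB smooth_linear bounded_linear_fst
    bounded_linear_fst_snd bounded_linear_snd_snd)
 have s\<phi>j: "smooth_on B (\<lambda>z. \<phi> (j z))"
  by (rule smooth_compose[OF oB _ jB fl(4) sj]) (intro open_Times open_ball open_greaterThanLessThan)
 define X where "X = (\<lambda>z. fst (\<phi> (j z)))"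
 define P where "P = (\<lambda>z. fst (snd (\<phi> (j z))))"
 define A where "A = (\<lambda>z. snd (snd (\<phi> (j z))))"
 have sX: "smooth_on B X" and sP: "smooth_on B P" and sA: "smooth_on B A"
  unfolding X_def P_def A_def by (intro smooth_fst smooth_snd s\<phi>j oB)+
 have d\<phi>: "((\<lambda>s. \<phi> (j (s, z))) has_vector_derivative F (\<phi> (j (s, z)))) (at s)" if "(s, z) \<in> B" for s z
  using fl(7)[of s "(fst z, snd z, 0)"] that in1[of "fst z" "snd z"] by (auto simp: j_def B_def abs_less_iff)
 have XO: "X z \<in> Om" if "z \<in> B" for z
  using fl(6)[of "fst z" "(fst (snd z), snd (snd z), 0)"] that in1[of "fst (snd z)" "snd (snd z)"]
  by (auto simp: X_def j_def B_def abs_less_iff)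
 define \<Theta> where "\<Theta> = (\<lambda>z. (fst z, X z, snd (snd z)))"
 have s\<Theta>: "smooth_on B \<Theta>"
  unfolding \<Theta>_def
  by (intro smooth_Pair sX oB smooth_linear bounded_linear_fst
    bounded_linear_snd_snd)
 let ?z0 = "(0, y0, \<eta>) :: real \<times> 'a \<times> 'a"
 have z0: "?z0 \<in> B" using fl r by (simp add: B_def)
 have X0: "X (0, y, p) = y" "P (0, y, p) = p" "A (0, y, p) = 0" if "y \<in> ball y0 r" "p \<in> ball \<eta> r" for y p
  using fl(5)[OF in1[OF that]] by (simp_all add: X_def P_def A_def j_def)
 have inj: "h = 0" if h: "dd h \<Theta> ?z0 = 0" for h :: "real \<times> 'a \<times> 'a"
 proof -
  obtain \<sigma> v w where hh: "h = (\<sigma>, v, w)" by (cases h) auto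
  have "(\<Theta> has_derivative (\<lambda>h. (fst h, dd h X ?z0, snd (snd h)))) (at ?z0)"
   unfolding \<Theta>_def
   by (intro has_derivative_Pair smooth_deriv[OF sX z0] bounded_linear_imp_has_derivative
     bounded_linear_fst bounded_linear_snd_snd)
  from dd_eqI[OF this, of h] h have 0: "\<sigma> = 0" "w = 0" "dd (0, v, 0) X ?z0 = 0"
   by (auto simp: hh zero_prod_def)
  have "dd (0, v, 0) X ?z0 = dd (v, 0) (\<lambda>z. X (0, z)) (y0, \<eta>)"
   using dd_slice_snd[OF smooth_diffble[OF sX z0], of "(v, 0)"] by simp
  also have "... = dd (v, 0) fst (y0, \<eta>)"
   by (rule dd_cong[of "ball y0 r \<times> ball \<eta> r"]) (use X0 r in "auto intro: open_Times")
  also have "... = v"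
   by (rule dd_eqI[THEN trans, OF bounded_linear_imp_has_derivative[OF bounded_linear_fst]]) simp
  finally show "h = 0" using 0 hh by (simp add: zero_prod_def)
 qed
 obtain U' V g where g: "open U'" "U' \<subseteq> B" "?z0 \<in> U'" "open V" "\<Theta> ?z0 \<in> V" "homeomorphism U' V \<Theta> g" "smooth_on V g"
  using smooth_inverse_function[OF oB s\<Theta> z0 inj] by metis
 have \<Theta>0: "\<Theta> ?z0 = ?z0" using X0(1)[of y0 \<eta>] r by (simp add: \<Theta>_def)
 have box: "\<exists>e>0. {+-e} \<times> ball y0 e \<times> ball \<eta> e \<subseteq> S" if S: "open S" "?z0 \<in> S" for S
 proof -
  obtain e where e: "e > 0" "ball ?z0 e \<subseteq> S" using openE[OF S] by blast
  have "(s, y, p) \<in> ball ?z0 e" if "s \<in> {-(e/3)<..<e/3}" "y \<in> ball y0 (e/3)" "p \<in> ball \<eta> (e/3)" for s y p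
   using dist_Pair_le[of 0 "(y0, \<eta>)" s "(y, p)"] dist_Pair_le[of y0 \<eta> y p] that by (auto simp: dist_real_def)
  then show ?thesis using e by (intro exI[of _ "e / 3"]) auto
 qed
 obtain e where e: "e > 0" "{+-e} \<times> ball y0 e \<times> ball \<eta> e \<subseteq> V"
  using box[OF g(4)] g(5) unfolding \<Theta>0 by blast
 \<comment> \<open>In this second box \<open>g\<close> also undoes \<open>\<Theta>\<close>, not only
   the other way round; this determines \<open>Y\<close> along the central extremal.\<close>
 obtain e' where e': "e' > 0" "{+-e'} \<times> ball y0 e' \<times> ball \<eta> e' \<subseteq> U'"
  using box[OF g(1) g(3)] by blast
 define \<rho> where "\<rho> = min e r"
 have \<rho>: "\<rho> > 0" "\<rho> <= r" "\<rho> <= e" using e(1) r by (auto simp: \<rho>_def)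
 have "isCont (\<lambda>s. X (s, y0, \<eta>)) 0"
  by (rule isCont_o2[where f = "\<lambda>s. (s, y0, \<eta>)" and g = X])
   (auto intro!: continuous_intros smooth_isCont[OF sX z0])
 then have "((\<lambda>s. X (s, y0, \<eta>)) \<longlongrightarrow> y0) (nhds 0)"
  using X0(1)[of y0 \<eta>] r tendsto_at_iff_tendsto_nhds[of "\<lambda>s. X (s, y0, \<eta>)" 0] by (simp add: isCont_def)
 from tendstoD[OF this \<rho>(1)] have "\<forall>\<^sub>F s in nhds 0. X (s, y0, \<eta>) \<in> ball y0 \<rho>"
  by (simp add: dist_commute)
 then obtain e2 where e2: "e2 > 0" "!!s. \<bar>s\<bar> < e2 ==> X (s, y0, \<eta>) \<in> ball y0 \<rho>"
  by (auto simp: eventually_nhds_metric dist_real_def)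
 define \<tau> where "\<tau> = min (min \<tau>1 e) (min e' e2)"
 have \<tau>: "\<tau> > 0" "\<tau> <= \<tau>1" "\<tau> <= e" "\<tau> <= e'" "\<tau> <= e2" using fl(1) e(1) e'(1) e2(1) by (auto simp: \<tau>_def)
 define B1 where "B1 = {+-\<tau>} \<times> ball y0 r \<times> ball \<eta> r"
 define B2 where "B2 = {+-\<tau>} \<times> ball y0 \<rho> \<times> ball \<eta> \<rho>"
 have B1B: "B1 \<subseteq> B" using \<tau> by (auto simp: B1_def B_def)
 have B2V: "B2 \<subseteq> V" using e(2) \<tau> \<rho> unfolding B2_def by (rule_tac order_trans[OF _ e(2)]) (auto simp: subset_iff)
 have oB2: "open B2" by (simp add: B2_def open_Times)
 define Y where "Y = (\<lambda>z. fst (snd (g z)))"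
 have \<Theta>g: "\<Theta> (g z) = z" "g z \<in> B" if "z \<in> B2" for z
 proof -
  have zV: "z \<in> V" using that B2V by blast
  show "\<Theta> (g z) = z" using g(6) zV by (simp add: homeomorphism_def)
  have "g ` V = U'" using g(6) by (simp add: homeomorphism_def)
  then show "g z \<in> B" using zV g(2) by blast
 qed
 have gz: "fst (g z) = fst z \<and> snd (snd (g z)) = snd (snd z) \<and> X (g z) = fst (snd z)" if "z \<in> B2" for z
  using \<Theta>g(1)[OF that] unfolding \<Theta>_def by (metis fst_conv snd_conv)
 show thesis
 proof (rule that, unfold_locales)
  show "B1 = {+-\<tau>} \<times> ball y0 r \<times> ball \<eta> r" "B2 = {+-\<tau>} \<times> ball y0 \<rho> \<times> ball \<eta> \<rho>"
   by (simp_all add: B1_def B2_def)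
  show "\<tau> > 0" "\<rho> > 0" "\<rho> <= r" using \<tau> \<rho> by auto
  show "smooth_on B1 X" "smooth_on B1 P" "smooth_on B1 A"
   using sX sP sA B1B smooth_subset by blast+
  show "X z \<in> Om" if "z \<in> B1" for z using XO[of z] B1B that by blast
  show "((\<lambda>s. X (s, z)) has_vector_derivative fu (X (s, z), P (s, z))) (at s)" if "(s, z) \<in> B1" for s z
   using bounded_linear.has_vector_derivative[OF bounded_linear_fst d\<phi>[OF subsetD[OF B1B that]]] by (simp add: X_def P_def F_def)
  show "((\<lambda>s. P (s, z)) has_vector_derivative - Hy (X (s, z), P (s, z))) (at s)" if "(s, z) \<in> B1" for s z
   using bounded_linear.has_vector_derivative[OF bounded_linear_fst_snd d\<phi>[OF subsetD[OF B1B that]]]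
   by (simp add: X_def P_def F_def)
  show "((\<lambda>s. A (s, z)) has_vector_derivative lu (X (s, z), P (s, z))) (at s)" if "(s, z) \<in> B1" for s z
   using bounded_linear.has_vector_derivative[OF bounded_linear_snd_snd d\<phi>[OF subsetD[OF B1B that]]]
   by (simp add: X_def P_def A_def F_def)
  show "smooth_on B2 Y" unfolding Y_def
   by (intro smooth_fst smooth_snd oB2 smooth_subset[OF g(7) B2V])
  show "Y z \<in> ball y0 r" if "z \<in> B2" for z using \<Theta>g(2)[OF that] by (auto simp: Y_def B_def)
  show "X (s, Y (s, x, p), p) = x" if "(s, x, p) \<in> B2" for s x p
   using gz[OF that] unfolding Y_def by (metis fst_conv prod.collapse snd_conv)
  show "X (s, y0, \<eta>) \<in> ball y0 \<rho> \<and> Y (s, X (s, y0, \<eta>), \<eta>) = y0" if "\<bar>s\<bar> < \<tau>" for s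
  proof
   show "X (s, y0, \<eta>) \<in> ball y0 \<rho>" using e2(2)[of s] that \<tau> by simp
   have "(s, y0, \<eta>) \<in> {+-e'} \<times> ball y0 e' \<times> ball \<eta> e'" using that \<tau> e'(1) by (auto simp: abs_less_iff)
   then have "(s, y0, \<eta>) \<in> U'" using e'(2) by blast
   then have "g (\<Theta> (s, y0, \<eta>)) = (s, y0, \<eta>)" using g(6) by (simp add: homeomorphism_def)
   then show "Y (s, X (s, y0, \<eta>), \<eta>) = y0" by (simp add: Y_def \<Theta>_def)
  qed
 qed (use X0 in auto)
qed

section \<open>The second variation along an extremal\<close>

lemma smooth_slice_snd:
 assumes "open T" "smooth_on S g" "!!p. p \<in> T ==> (t, p) \<in> S" "open S"
 shows "smooth_on T (\<lambda>p. g (t :: 'x::euclidean_space, p :: 'y::euclidean_space))"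
 by (rule smooth_compose[OF assms(1,4) _ assms(2)])
  (use assms in "auto intro!: smooth_Pair smooth_id")

lemma dd_dd_slice_snd:
 assumes "open T" "smooth_on S g" "!!p. p \<in> T ==> (t, p) \<in> S" "p \<in> T"
 shows "dd (0, v) (dd (0, w) g) (t, p) = dd v (dd w (\<lambda>p. g (t, p))) p"
proof -
 have "dd v (dd w (\<lambda>p. g (t, p))) p = dd v (\<lambda>p. dd (0, w) g (t, p)) p"
  by (rule dd_cong[OF assms(1,4)])
   (rule dd_slice_snd[OF smooth_diffble[OF assms(2)]], rule assms(3))
 also have "... = dd (0, v) (dd (0, w) g) (t, p)"
  by (rule dd_slice_snd[OF smooth_diffble[OF smooth_dd[OF assms(2)]]]) (rule assms(3)[OF assms(4)])
 finally show ?thesis by simp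
qed

text \<open>At a critical point of the outer function the second derivative of the inner one drops
  out, so Hessians transform as quadratic forms.\<close>

lemma dd_dd_compose_critical:
 fixes h :: "'b::euclidean_space => real" and g :: "'a::real_normed_vector => 'b"
 assumes "open S" "open T" "g ` S \<subseteq> T" and h: "smooth_on T h" and g: "smooth_on S g" and x: "x \<in> S"
  and crit: "!!u. dd u h (g x) = 0"
 shows "dd v (dd w (\<lambda>x. h (g x))) x = dd (dd v g x) (dd (dd w g x) h) (g x)"
proof -
 have gT: "g y \<in> T" if "y \<in> S" for y using assms(3) that by auto
 have 1: "dd w (\<lambda>x. h (g x)) y = (\<Sum>i\<in>Basis. (dd w g y \<bullet> i) * dd i h (g y))" if "y \<in> S" for y
  unfolding dd_compose[OF smooth_diffble[OF h gT[OF that]] smooth_diffble[OF g that]]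
  by (subst dd_sum_Basis[OF h gT[OF that]]) simp
 have dg: "(dd w g has_derivative (\<lambda>v. dd v (dd w g) x)) (at x)"
  by (rule smooth_deriv[OF smooth_dd[OF g] x])
 have dh: "((\<lambda>y. dd i h (g y)) has_derivative (\<lambda>v. dd (dd v g x) (dd i h) (g x))) (at x)" for i
  by (rule has_derivative_compose[OF smooth_deriv[OF g x] smooth_deriv[OF smooth_dd[OF h] gT[OF x]]])
 have "((\<lambda>y. \<Sum>i\<in>Basis. (dd w g y \<bullet> i) * dd i h (g y)) has_derivative
   (\<lambda>v. \<Sum>i\<in>Basis. (dd w g x \<bullet> i) * dd (dd v g x) (dd i h) (g x) + (dd v (dd w g) x \<bullet> i) * dd i h (g x))) (at x)"
  by (intro has_derivative_sum has_derivative_mult has_derivative_inner_left dg dh)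
 then have 2: "dd v (\<lambda>y. \<Sum>i\<in>Basis. (dd w g y \<bullet> i) * dd i h (g y)) x =
   (\<Sum>i\<in>Basis. (dd w g x \<bullet> i) * dd (dd v g x) (dd i h) (g x))"
  by (simp add: dd_eqI crit)
 have "(dd (dd w g x) h has_derivative (\<lambda>u. \<Sum>i\<in>Basis. (dd w g x \<bullet> i) * dd u (dd i h) (g x))) (at (g x))"
 proof (rule has_derivative_transform_within_open[OF _ assms(2) gT[OF x]])
  show "((\<lambda>y. \<Sum>i\<in>Basis. (dd w g x \<bullet> i) * dd i h y) has_derivative (\<lambda>u. \<Sum>i\<in>Basis. (dd w g x \<bullet> i) * dd u (dd i h) (g x))) (at (g x))"
   by (intro has_derivative_sum has_derivative_mult_right smooth_deriv[OF smooth_dd[OF h] gT[OF x]])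
  show "(\<Sum>i\<in>Basis. (dd w g x \<bullet> i) * dd i h y) = dd (dd w g x) h y" if "y \<in> T" for y
   by (subst dd_sum_Basis[OF h that]) simp
 qed
 then have 3: "dd (dd v g x) (dd (dd w g x) h) (g x) = (\<Sum>i\<in>Basis. (dd w g x \<bullet> i) * dd (dd v g x) (dd i h) (g x))"
  by (simp add: dd_eqI)
 have "dd v (dd w (\<lambda>x. h (g x))) x = dd v (\<lambda>y. \<Sum>i\<in>Basis. (dd w g y \<bullet> i) * dd i h (g y)) x"
  by (rule dd_cong[OF assms(1) x 1])
 then show ?thesis using 2 3 by simp
qed

context extremal_field
begin

text \<open>Everything is restricted to the central extremal \<open>gam\<close>, with covector \<open>lam\<close>: \<open>Wf\<close> is minus the
 Hessian of \<open>a\<close> in the covector and \<open>qf\<close> the derivative of the final covector in the parameter \<open>p\<close>.\<close>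

definition gam :: "real => 'a" where "gam t = X (t, y0, \<eta>)"
definition lam :: "real => 'a" where "lam t = P (t, y0, \<eta>)"
definition C :: "(real \<times> 'a) set" where "C = {+-\<tau>} \<times> ball \<eta> \<rho>"
definition cm :: "real \<times> 'a => real \<times> 'a \<times> 'a" where "cm z = (fst z, gam (fst z), snd z)"
definition ah :: "real \<times> 'a => real" where "ah z = a (cm z)"
definition Yh :: "real \<times> 'a => 'a" where "Yh z = Y (cm z)"
definition Ph :: "real \<times> 'a => 'a" where "Ph z = Pf (cm z)"
text \<open>Minus the time derivative of \<open>ah\<close> (see \<open>dd_ah\<close>). The linear
  term comes from the motion of \<open>gam\<close>; it makes \<open>hh\<close> critical at the
  central covector.\<close>

definition hh :: "real \<times> 'a => real" where
 "hh z = H (gam (fst z), Ph z) - Ph z \<bullet> fu (gam (fst z), lam (fst z))"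

lemma open_C: "open C" by (simp add: C_def open_Times)

lemma base_B1: "t \<in> {+-\<tau>} ==> (t, y0, \<eta>) \<in> B1"
 using pos by (simp add: B1)

lemma smooth_gam: "smooth_on {+-\<tau>} gam"
 unfolding gam_def
 by (rule smooth_compose[OF _ open_B1 _ X]) (use base_B1 in "auto intro!: smooth_Pair smooth_id")

lemma gam_derivative: "t \<in> {+-\<tau>} ==> (gam has_vector_derivative fu (gam t, lam t)) (at t)"
 unfolding gam_def lam_def by (rule dX[OF base_B1])

lemma gam_in: "t \<in> {+-\<tau>} ==> gam t \<in> ball y0 \<rho>"
 and Yh_center: "t \<in> {+-\<tau>} ==> Yh (t, \<eta>) = y0"
 using Y0[of t] by (auto simp: gam_def Yh_def cm_def abs_less_iff)

lemma gam_Om: "t \<in> {+-\<tau>} ==> gam t \<in> Om"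
 unfolding gam_def by (rule XOm[OF base_B1])

lemma cm_B2: "z \<in> C ==> cm z \<in> B2"
 using gam_in by (cases z) (auto simp: cm_def C_def B2)

lemma center_C: "t \<in> {+-\<tau>} ==> (t, \<eta>) \<in> C"
 using pos by (simp add: C_def)

lemma smooth_gam_fst: "smooth_on C (\<lambda>z. gam (fst z))"
 by (rule smooth_compose[OF open_C _ _ smooth_gam]) (auto simp: C_def intro!: smooth_linear bounded_linear_fst open_Times)

lemma smooth_cm: "smooth_on C cm"
 unfolding cm_def
 by (intro smooth_Pair smooth_gam_fst open_C smooth_linear bounded_linear_fst bounded_linear_snd)

lemma smooth_ah: "smooth_on C ah"
 unfolding ah_def by (rule smooth_compose[OF open_C open_B2 _ smooth_a smooth_cm]) (use cm_B2 in auto)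

lemma smooth_Yh: "smooth_on C Yh"
 unfolding Yh_def by (rule smooth_compose[OF open_C open_B2 _ Y smooth_cm]) (use cm_B2 in auto)

lemma smooth_Ph: "smooth_on C Ph"
 unfolding Ph_def by (rule smooth_compose[OF open_C open_B2 _ smooth_Pf smooth_cm]) (use cm_B2 in auto)

lemma Ph_center: "t \<in> {+-\<tau>} ==> Ph (t, \<eta>) = lam t"
 using Yh_center[of t] by (simp add: Ph_def Pf_def emb_def lam_def Yh_def cm_def)

lemma dd_cm:
 assumes "z \<in> C"
 shows "(cm has_derivative (\<lambda>h. (fst h, fst h *\<^sub>R fu (gam (fst z), lam (fst z)), snd h))) (at z)"
proof -
 have t: "fst z \<in> {+-\<tau>}" using assms by (auto simp: C_def)
 have "((\<lambda>z. gam (fst z)) has_derivative (\<lambda>h. fst h *\<^sub>R fu (gam (fst z), lam (fst z)))) (at z)"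
  by (rule has_derivative_compose[OF bounded_linear_imp_has_derivative[OF bounded_linear_fst] gam_derivative[OF t, unfolded has_vector_derivative_def]])
 then show ?thesis unfolding cm_def
  by (intro has_derivative_Pair bounded_linear_imp_has_derivative bounded_linear_fst bounded_linear_snd)
qed

lemma dd_ah:
 assumes "z \<in> C"
 shows "dd (\<sigma>, w) ah z = w \<bullet> Yh z - \<sigma> * hh z"
proof -
 have "dd (\<sigma>, w) ah z = dd (\<sigma>, \<sigma> *\<^sub>R fu (gam (fst z), lam (fst z)), w) a (cm z)"
  unfolding ah_def
  by (rule dd_eqI[THEN trans, OF has_derivative_compose[OF dd_cm[OF assms] smooth_deriv[OF smooth_a cm_B2[OF assms]]]]) simp
 also have "... = w \<bullet> Yh z - \<sigma> * hh z"
  unfolding dd_a[OF cm_B2[OF assms]] by (simp add: Yh_def hh_def Ph_def cm_def algebra_simps)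
 finally show ?thesis .
qed

lemma smooth_hh: "smooth_on C hh"
proof (rule smooth_cong[OF open_C smooth_minus[OF open_C smooth_dd[OF smooth_ah]]])
 show "- dd (1, 0) ah z = hh z" if "z \<in> C" for z by (simp add: dd_ah[OF that])
qed

definition Wf :: "real => 'a => 'a => real" where
 "Wf t v w = - dd (0, v) (dd (0, w) ah) (t, \<eta>)"

definition qf :: "real => 'a => 'a" where "qf t v = dd (0, v) Ph (t, \<eta>)"

lemma Wf_Yh: "t \<in> {+-\<tau>} ==> Wf t v w = - (w \<bullet> dd (0, v) Yh (t, \<eta>))"
proof -
 assume t: "t \<in> {+-\<tau>}"
 have "dd (0, v) (dd (0, w) ah) (t, \<eta>) = dd (0, v) (\<lambda>z. Yh z \<bullet> w) (t, \<eta>)"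
  by (rule dd_cong[OF open_C center_C[OF t]]) (simp add: dd_ah inner_commute)
 also have "... = dd (0, v) Yh (t, \<eta>) \<bullet> w"
  by (rule dd_inner_left[OF smooth_diffble[OF smooth_Yh center_C[OF t]]])
 finally show ?thesis by (simp add: Wf_def inner_commute)
qed

lemma Wf_sym: "t \<in> {+-\<tau>} ==> Wf t v w = Wf t w v"
 unfolding Wf_def using dd_commute[OF open_C smooth_ah center_C] by simp

lemma smooth_Wf: "smooth_on {+-\<tau>} (\<lambda>t. Wf t v w)"
 unfolding Wf_def
 by (intro smooth_minus smooth_compose[OF _ open_C _ smooth_dd[OF smooth_dd[OF smooth_ah]]])
  (use center_C in "auto intro!: smooth_Pair smooth_id")

lemma linear_Wf: "t \<in> {+-\<tau>} ==> linear (\<lambda>v. Wf t v w)"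
proof -
 assume t: "t \<in> {+-\<tau>}"
 have "linear (\<lambda>v. dd (0, v) (dd (0, w) ah) (t, \<eta>))"
  by (rule linear_dd_snd[OF smooth_diffble[OF smooth_dd[OF smooth_ah] center_C[OF t]]])
 then show ?thesis unfolding Wf_def by (rule linear_compose_neg)
qed

lemma hh_critical:
 assumes t: "t \<in> {+-\<tau>}"
 shows "dd (0, w) hh (t, \<eta>) = 0"
proof -
 have y: "gam t \<in> Om" by (rule gam_Om[OF t])
 let ?h = "\<lambda>p. H (gam t, p) - p \<bullet> fu (gam t, lam t)"
 have dh: "(?h has_derivative (\<lambda>u. 0)) (at (lam t))"
 proof -
  have "((\<lambda>p. H (gam t, p)) has_derivative (\<lambda>u. dd (0, u) H (gam t, lam t))) (at (lam t))"
   by (rule has_derivative_slice_snd[OF smooth_deriv[OF smooth_H]]) (use y in simp)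
  from has_derivative_diff[OF this has_derivative_inner_left[OF has_derivative_ident, where b = "fu (gam t, lam t)"]]
  show ?thesis by (simp add: dd_H_covector[OF y])
 qed
 have dPh: "((\<lambda>p. Ph (t, p)) has_derivative (\<lambda>w. dd (0, w) Ph (t, \<eta>))) (at \<eta>)"
  by (rule has_derivative_slice_snd[OF smooth_deriv[OF smooth_Ph center_C[OF t]]])
 have "((\<lambda>p. ?h (Ph (t, p))) has_derivative (\<lambda>w. 0)) (at \<eta>)"
  by (rule has_derivative_compose[OF dPh]) (use dh in "simp add: Ph_center[OF t]")
 then have "dd w (\<lambda>p. hh (t, p)) \<eta> = 0" unfolding hh_def by (simp add: dd_eqI)
 then show ?thesis using dd_slice_snd[OF smooth_diffble[OF smooth_hh center_C[OF t]]] by simp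
qed

lemma hh_hessian:
 assumes t: "t \<in> {+-\<tau>}"
 shows "dd (0, v) (dd (0, w) hh) (t, \<eta>) = Hpp (gam t, lam t) (qf t v) (qf t w)"
proof -
 have y: "gam t \<in> Om" by (rule gam_Om[OF t])
 let ?h = "\<lambda>p. H (gam t, p) - p \<bullet> fu (gam t, lam t)"
 let ?g = "\<lambda>p. Ph (t, p)"
 let ?S = "ball \<eta> \<rho>"
 have SC: "(t, p) \<in> C" if "p \<in> ?S" for p using that t by (simp add: C_def)
 have \<eta>S: "\<eta> \<in> ?S" using pos by simp
 have sg: "smooth_on ?S ?g" by (rule smooth_slice_snd[OF open_ball smooth_Ph SC open_C])
 have sHs: "smooth_on UNIV (\<lambda>p. H (gam t, p))"
  by (rule smooth_slice_snd[OF open_UNIV smooth_H _ open_OmU]) (use y in simp)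
 have sh: "smooth_on UNIV ?h"
  by (intro smooth_diff smooth_inner sHs smooth_id smooth_const open_UNIV)
 have dh: "dd u ?h p = u \<bullet> (fu (gam t, p) - fu (gam t, lam t))" for u p
 proof -
  have "((\<lambda>p. H (gam t, p)) has_derivative (\<lambda>u. dd (0, u) H (gam t, p))) (at p)"
   by (rule has_derivative_slice_snd[OF smooth_deriv[OF smooth_H]]) (use y in simp)
  from has_derivative_diff[OF this has_derivative_inner_left[OF has_derivative_ident, where b = "fu (gam t, lam t)"]]
  show ?thesis by (simp add: dd_eqI dd_H_covector[OF y] inner_diff_right)
 qed
 have q: "dd v ?g \<eta> = qf t v" for v
  unfolding qf_def by (rule dd_slice_snd[OF smooth_diffble[OF smooth_Ph center_C[OF t]]])
 have "dd (0, v) (dd (0, w) hh) (t, \<eta>) = dd v (dd w (\<lambda>p. hh (t, p))) \<eta>"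
  by (rule dd_dd_slice_snd[OF open_ball smooth_hh SC \<eta>S])
 also have "... = dd v (dd w (\<lambda>p. ?h (?g p))) \<eta>" by (simp add: hh_def)
 also have "... = dd (dd v ?g \<eta>) (dd (dd w ?g \<eta>) ?h) (?g \<eta>)"
  by (rule dd_dd_compose_critical[OF open_ball open_UNIV _ sh sg \<eta>S]) (auto simp: dh Ph_center[OF t])
 also have "... = dd (qf t v) (\<lambda>p. dd (qf t w) (\<lambda>p. H (gam t, p)) p - qf t w \<bullet> fu (gam t, lam t)) (lam t)"
 proof -
  have "dd (qf t w) ?h p = dd (qf t w) (\<lambda>p. H (gam t, p)) p - qf t w \<bullet> fu (gam t, lam t)" for p
   using dd_slice_snd[OF smooth_diffble[OF smooth_H], of "gam t" p "qf t w"] y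
   by (simp add: dh dd_H_covector inner_diff_right)
  then show ?thesis unfolding q Ph_center[OF t] by simp
 qed
 also have "... = dd (qf t v) (dd (qf t w) (\<lambda>p. H (gam t, p))) (lam t)"
  by (rule dd_eqI[THEN trans, OF has_derivative_diff[OF smooth_deriv[OF smooth_dd[OF sHs]] has_derivative_const]]) simp_all
 also have "... = Hpp (gam t, lam t) (qf t v) (qf t w)"
  unfolding Hpp_def by (rule dd_dd_slice_snd[OF open_UNIV smooth_H, symmetric]) (use y in auto)
 finally show ?thesis .
qed

text \<open>The time derivative of \<open>ah\<close> is \<open>- hh\<close>, so after exchanging
  derivatives the rate of \<open>Wf\<close> is the Hessian of \<open>hh\<close> in the covector. As
  \<open>hh\<close> is critical on the central extremal, this is the Hessian of \<open>H\<close>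
  pulled back by \<open>qf\<close>; hence the monotonicity of \<open>Wf\<close>.\<close>

lemma dd_Wf:
 assumes t: "t \<in> {+-\<tau>}"
 shows "((\<lambda>t. Wf t v w) has_vector_derivative Hpp (gam t, lam t) (qf t v) (qf t w)) (at t)"
proof -
 have c: "(t, \<eta>) \<in> C" by (rule center_C[OF t])
 have "((\<lambda>t. - dd (0, v) (dd (0, w) ah) (t, \<eta>)) has_vector_derivative - dd (1, 0) (dd (0, v) (dd (0, w) ah)) (t, \<eta>)) (at t)"
  by (intro has_vector_derivative_minus vderiv_slice
    smooth_diffble[OF smooth_dd[OF smooth_dd[OF smooth_ah]] c])
 moreover have "dd (1, 0) (dd (0, v) (dd (0, w) ah)) (t, \<eta>) = - Hpp (gam t, lam t) (qf t v) (qf t w)"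
 proof -
  have "dd (1, 0) (dd (0, v) (dd (0, w) ah)) (t, \<eta>) = dd (0, v) (dd (1, 0) (dd (0, w) ah)) (t, \<eta>)"
   by (rule dd_commute[OF open_C smooth_dd[OF smooth_ah] c])
  also have "... = dd (0, v) (dd (0, w) (dd (1, 0) ah)) (t, \<eta>)"
   by (rule dd_cong[OF open_C c]) (rule dd_commute[OF open_C smooth_ah])
  also have "... = dd (0, v) (\<lambda>z. - dd (0, w) hh z) (t, \<eta>)"
  proof (rule dd_cong[OF open_C c])
   fix z assume z: "z \<in> C"
   have "dd (0, w) (dd (1, 0) ah) z = dd (0, w) (\<lambda>z. - hh z) z"
    by (rule dd_cong[OF open_C z]) (simp add: dd_ah)
   also have "... = - dd (0, w) hh z"
    by (rule dd_eqI) (rule has_derivative_minus[OF smooth_deriv[OF smooth_hh z]])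
   finally show "dd (0, w) (dd (1, 0) ah) z = - dd (0, w) hh z" .
  qed
  also have "... = - dd (0, v) (dd (0, w) hh) (t, \<eta>)"
   by (rule dd_eqI) (rule has_derivative_minus[OF smooth_deriv[OF smooth_dd[OF smooth_hh] c]])
  finally show ?thesis by (simp add: hh_hessian[OF t])
 qed
 ultimately show ?thesis by (simp add: Wf_def)
qed

section \<open>Values on the central extremal at time 0\<close>

lemma zero_in: "0 \<in> {+-\<tau>}" using pos by simp

lemma gam_0: "gam 0 = y0" and lam_0: "lam 0 = \<eta>"
 using init(1,2)[of y0 \<eta>] pos by (auto simp: gam_def lam_def)

lemma Yh_0: "p \<in> ball \<eta> \<rho> ==> Yh (0, p) = y0"
proof -
 assume p: "p \<in> ball \<eta> \<rho>"
 have z: "(0, y0, p) \<in> B2" using p pos by (simp add: B2)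
 have pr: "p \<in> ball \<eta> r" using p pos by auto
 have "X (0, Y (0, y0, p), p) = y0" by (rule XY[OF z])
 then show ?thesis using init(1)[OF YB[OF z] pr] by (simp add: Yh_def cm_def gam_0)
qed

lemma Ph_0: "p \<in> ball \<eta> \<rho> ==> Ph (0, p) = p"
 using Yh_0[of p] init(2)[of y0 p] pos by (auto simp: Ph_def Pf_def emb_def cm_def Yh_def gam_0)

lemma qf_0: "qf 0 v = v"
proof -
 have "qf 0 v = dd v (\<lambda>p. Ph (0, p)) \<eta>"
  unfolding qf_def by (rule dd_slice_snd[OF smooth_diffble[OF smooth_Ph center_C[OF zero_in]], symmetric])
 also have "... = dd v (\<lambda>p. p) \<eta>" by (rule dd_cong[OF open_ball[of \<eta> \<rho>]]) (use Ph_0 pos in auto)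
 finally show ?thesis by simp
qed

lemma Wf_0: "Wf 0 v w = 0"
proof -
 have "dd (0, v) Yh (0, \<eta>) = dd v (\<lambda>p. Yh (0, p)) \<eta>"
  by (rule dd_slice_snd[OF smooth_diffble[OF smooth_Yh center_C[OF zero_in]], symmetric])
 also have "... = dd v (\<lambda>p. y0) \<eta>" by (rule dd_cong[OF open_ball[of \<eta> \<rho>]]) (use Yh_0 pos in auto)
 finally show ?thesis using Wf_Yh[OF zero_in] by simp
qed

text \<open>The extremals from \<open>x\<close> to \<open>gam s\<close>, for \<open>(s, x)\<close> near a point \<open>(t, y0)\<close> with nondegenerate \<open>Wf t\<close>.\<close>

lemma connecting_covector:
 assumes t: "t \<in> {+-\<tau>}" and nd: "!!v. (!!w. Wf t v w = 0) ==> v = 0"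
 obtains T and pt :: "real \<times> 'a => 'a" where "open T" "(t, y0) \<in> T" "smooth_on T pt" "pt (t, y0) = \<eta>"
  "!!s x. (s, x) \<in> T ==> (s, pt (s, x)) \<in> C" "!!s x. (s, x) \<in> T ==> Yh (s, pt (s, x)) = x"
proof -
 define K where "K = (\<lambda>z. (fst z, Yh z))"
 have sK: "smooth_on C K"
  unfolding K_def by (intro smooth_Pair smooth_Yh open_C smooth_linear bounded_linear_fst)
 note c = center_C[OF t]
 obtain U' V g where g: "open U'" "U' \<subseteq> C" "(t, \<eta>) \<in> U'" "open V" "K (t, \<eta>) \<in> V" "homeomorphism U' V K g" "smooth_on V g"
 proof (rule smooth_inverse_function[OF open_C sK c])
  fix h :: "real \<times> 'a" assume h: "dd h K (t, \<eta>) = 0"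
  obtain \<sigma> v where hh: "h = (\<sigma>, v)" by (cases h) auto
  have "(K has_derivative (\<lambda>h. (fst h, dd h Yh (t, \<eta>)))) (at (t, \<eta>))"
   unfolding K_def
   by (intro has_derivative_Pair smooth_deriv[OF smooth_Yh c] bounded_linear_imp_has_derivative bounded_linear_fst)
  from dd_eqI[OF this, of h] h have 0: "\<sigma> = 0" "dd (0, v) Yh (t, \<eta>) = 0"
   by (auto simp: hh zero_prod_def)
  then have "Wf t v w = 0" for w using Wf_Yh[OF t] by simp
  then show "h = 0" using nd 0 hh by (simp add: zero_prod_def)
 next
  fix U' V g
  assume "open U'" "U' \<subseteq> C" "(t, \<eta>) \<in> U'" "open V" "K (t, \<eta>) \<in> V" "homeomorphism U' V K g" "smooth_on V g"
  then show thesis by (rule that)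
 qed
 have Kt: "K (t, \<eta>) = (t, y0)" by (simp add: K_def Yh_center[OF t])
 show thesis
 proof (rule that[of V "\<lambda>z. snd (g z)"])
  show "open V" "(t, y0) \<in> V" using g(4,5) by (auto simp: Kt)
  show "smooth_on V (\<lambda>z. snd (g z))" by (intro smooth_snd g)
  show "snd (g (t, y0)) = \<eta>" using g(3,6) by (simp add: homeomorphism_def Kt[symmetric])
  fix s x assume sx: "(s, x) \<in> V"
  have K: "K (g (s, x)) = (s, x)" using g(6) sx by (simp add: homeomorphism_def)
  then have fs: "fst (g (s, x)) = s" by (simp add: K_def)
  have "g ` V = U'" using g(6) by (simp add: homeomorphism_def)
  then have "g (s, x) \<in> C" using sx g(2) by blast
  then show "(s, snd (g (s, x))) \<in> C" using fs by (metis prod.collapse)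
  show "Yh (s, snd (g (s, x))) = x" using K fs by (metis K_def prod.collapse snd_conv)
 qed
qed

text \<open>A Legendre-type transform in \<open>p\<close>: the derivative through \<open>pt\<close>
  cancels, because the gradient of \<open>ah\<close> in the covector is \<open>Yh\<close>, which
  equals \<open>x\<close> at \<open>pt (s, x)\<close>.\<close>

lemma value_time_derivative:
 assumes T: "open T" "smooth_on T pt" "!!s x. (s, x) \<in> T ==> (s, pt (s, x)) \<in> C"
  "!!s x. (s, x) \<in> T ==> Yh (s, pt (s, x)) = x" and z: "(t, x) \<in> T"
 shows "((\<lambda>s. ah (s, pt (s, x)) - pt (s, x) \<bullet> x) has_vector_derivative - hh (t, pt (t, x))) (at t)"
proof -
 define q where "q = dd (1, 0) pt (t, x)"
 have dpt: "((\<lambda>s. pt (s, x)) has_vector_derivative q) (at t)"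
  unfolding q_def by (rule vderiv_slice[OF smooth_diffble[OF T(2) z]])
 have dp: "((\<lambda>s. (s, pt (s, x))) has_vector_derivative (1, q)) (at t)"
  by (intro has_vector_derivative_Pair dpt) (auto intro!: derivative_eq_intros)
 have "((\<lambda>s. ah (s, pt (s, x))) has_vector_derivative dd (1, q) ah (t, pt (t, x))) (at t)"
  using vector_derivative_diff_chain_within[OF dp has_derivative_at_withinI[OF smooth_deriv[OF smooth_ah T(3)[OF z]]]]
  by (simp add: o_def)
 then have "((\<lambda>s. ah (s, pt (s, x)) - pt (s, x) \<bullet> x) has_vector_derivative dd (1, q) ah (t, pt (t, x)) - q \<bullet> x) (at t)"
  by (intro has_vector_derivative_diff bounded_linear.has_vector_derivative[OF bounded_linear_inner_left dpt])
 then show ?thesis by (simp add: dd_ah[OF T(3)[OF z]] T(4)[OF z])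
qed

text \<open>The map \<open>pt\<close> inverts \<open>Yh\<close>, whose derivative in the covector is
  minus the form \<open>Wf\<close>; so the differential of \<open>pt\<close> at \<open>y0\<close>
  maps \<open>v\<close> to the solution of \<open>Wf t v' = - v\<close>. The Hessian then follows
  from \<open>hh_hessian\<close> because \<open>hh\<close> is critical.\<close>

lemma value_rate_hessian:
 assumes T: "open T" "smooth_on T pt" "!!s x. (s, x) \<in> T ==> (s, pt (s, x)) \<in> C"
  "!!s x. (s, x) \<in> T ==> Yh (s, pt (s, x)) = x" and t: "t \<in> {+-\<tau>}"
  and N: "open N" "y0 \<in> N" "!!x. x \<in> N ==> (t, x) \<in> T" and pt0: "pt (t, y0) = \<eta>"
 shows "smooth_on N (\<lambda>x. hh (t, pt (t, x)))"
  and "dd v (\<lambda>x. hh (t, pt (t, x))) y0 = 0"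
  and "\<exists>v' w'. (\<forall>u. Wf t v' u = - (u \<bullet> v)) \<and> (\<forall>u. Wf t w' u = - (u \<bullet> w)) \<and>
   dd v (dd w (\<lambda>x. hh (t, pt (t, x)))) y0 = Hpp (gam t, lam t) (qf t v') (qf t w')"
proof -
 let ?S = "ball \<eta> \<rho>" and ?g = "\<lambda>x. pt (t, x)" and ?h = "\<lambda>p. hh (t, p)"
 have SC: "(t, p) \<in> C" if "p \<in> ?S" for p using that t by (simp add: C_def)
 have gS: "?g ` N \<subseteq> ?S" using T(3) N(3) by (auto simp: C_def)
 have sg: "smooth_on N ?g" by (rule smooth_slice_snd[OF N(1) T(2) N(3) T(1)])
 have sh: "smooth_on ?S ?h" by (rule smooth_slice_snd[OF open_ball smooth_hh SC open_C])
 show sm: "smooth_on N (\<lambda>x. hh (t, pt (t, x)))"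
  by (rule smooth_compose[OF N(1) open_ball gS sh sg])
 have crit: "dd u ?h (?g y0) = 0" for u
  using hh_critical[OF t, of u] dd_slice_snd[OF smooth_diffble[OF smooth_hh center_C[OF t]], of u] by (simp add: pt0)
 show "dd v (\<lambda>x. hh (t, pt (t, x))) y0 = 0"
  using dd_compose[of ?h ?g y0 v] crit smooth_diffble[OF sg N(2)]
   smooth_diffble[OF sh, of "?g y0"] gS N(2) by (auto simp: image_subset_iff)
 have W: "Wf t (dd v ?g y0) u = - (u \<bullet> v)" for v u
 proof -
  have dg: "(?g has_derivative (\<lambda>v. dd v ?g y0)) (at y0)" by (rule smooth_deriv[OF sg N(2)])
  have dY: "(Yh has_derivative (\<lambda>h. dd h Yh (t, \<eta>))) (at (t, ?g y0))"
   using smooth_deriv[OF smooth_Yh center_C[OF t]] by (simp add: pt0)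
  have "((\<lambda>x. Yh (t, ?g x)) has_derivative (\<lambda>v. dd (0, dd v ?g y0) Yh (t, \<eta>))) (at y0)"
   by (rule has_derivative_compose[OF has_derivative_Pair[OF has_derivative_const dg] dY])
  moreover have "((\<lambda>x. Yh (t, ?g x)) has_derivative (\<lambda>v. v)) (at y0)"
   by (rule has_derivative_transform_within_open[OF has_derivative_ident N(1,2)]) (simp add: T(4) N(3))
  ultimately have "dd (0, dd v ?g y0) Yh (t, \<eta>) = v" using has_derivative_unique by metis
  then show ?thesis by (simp add: Wf_Yh[OF t])
 qed
 have "dd v (dd w (\<lambda>x. ?h (?g x))) y0 = dd (dd v ?g y0) (dd (dd w ?g y0) ?h) (?g y0)"
  by (rule dd_dd_compose_critical[OF N(1) open_ball gS sh sg N(2) crit])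
 also have "... = dd (0, dd v ?g y0) (dd (0, dd w ?g y0) hh) (t, \<eta>)"
  unfolding pt0 by (rule dd_dd_slice_snd[OF open_ball smooth_hh SC, symmetric]) (use pos in auto)
 also have "... = Hpp (gam t, lam t) (qf t (dd v ?g y0)) (qf t (dd w ?g y0))" by (rule hh_hessian[OF t])
 finally show "\<exists>v' w'. (\<forall>u. Wf t v' u = - (u \<bullet> v)) \<and> (\<forall>u. Wf t w' u = - (u \<bullet> w)) \<and>
   dd v (dd w (\<lambda>x. hh (t, pt (t, x)))) y0 = Hpp (gam t, lam t) (qf t v') (qf t w')"
  using W by blast
qed

end

section \<open>Ampleness and the order of vanishing of the second variation\<close>

context extremal_field
begin

text \<open>Symmetry of the mixed second derivatives of \<open>a\<close>, whose first derivatives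
  are \<open>Y\<close>, \<open>Pf\<close> and \<open>- H\<close>.\<close>

lemma dd_Y_Pf:
 assumes z: "z \<in> B2"
 shows "p \<bullet> dd (\<sigma>, v, 0) Y z = (v - \<sigma> *\<^sub>R fu (fst (snd z), Pf z)) \<bullet> dd (0, 0, p) Pf z"
proof -
 have "p \<bullet> dd (\<sigma>, v, 0) Y z = dd (\<sigma>, v, 0) (\<lambda>z. Y z \<bullet> p) z"
  using dd_inner_left[OF smooth_diffble[OF Y z]] by (simp add: inner_commute)
 also have "... = dd (\<sigma>, v, 0) (dd (0, 0, p) a) z"
  by (rule dd_cong[OF open_B2 z]) (simp add: dd_a inner_commute)
 also have "... = dd (0, 0, p) (dd (\<sigma>, v, 0) a) z" by (rule dd_commute[OF open_B2 smooth_a z])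
 also have "... = dd (0, 0, p) (\<lambda>z. Pf z \<bullet> v - \<sigma> * H (fst (snd z), Pf z)) z"
  by (rule dd_cong[OF open_B2 z]) (simp add: dd_a)
 also have "... = dd (0, 0, p) Pf z \<bullet> v - \<sigma> * dd (0, dd (0, 0, p) Pf z) H (fst (snd z), Pf z)"
 proof -
  have dP: "(Pf has_derivative (\<lambda>h. dd h Pf z)) (at z)" by (rule smooth_deriv[OF smooth_Pf z])
  have dH: "((\<lambda>z. H (fst (snd z), Pf z)) has_derivative (\<lambda>h. dd (fst (snd h), dd h Pf z) H (fst (snd z), Pf z))) (at z)"
   by (rule has_derivative_compose[OF has_derivative_Pair[OF bounded_linear_imp_has_derivative[OF
       bounded_linear_fst_snd] dP] smooth_deriv[OF smooth_H]])
    (use x_Om[OF z] in simp)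
  have "((\<lambda>z. Pf z \<bullet> v - \<sigma> * H (fst (snd z), Pf z)) has_derivative
    (\<lambda>h. dd h Pf z \<bullet> v - \<sigma> * dd (fst (snd h), dd h Pf z) H (fst (snd z), Pf z))) (at z)"
   by (intro has_derivative_diff has_derivative_inner_left dP has_derivative_mult_right dH)
  then show ?thesis by (simp add: dd_eqI)
 qed
 finally show ?thesis
  using dd_H_covector[OF x_Om[OF z]] by (simp add: inner_diff_left inner_diff_right inner_commute)
qed

lemma cm_center: "cm (t, \<eta>) = (t, gam t, \<eta>)" by (simp add: cm_def)

lemma qf_Pf: "t \<in> {+-\<tau>} ==> qf t p = dd (0, 0, p) Pf (t, gam t, \<eta>)"
proof -
 assume t: "t \<in> {+-\<tau>}"
 have c: "cm (t, \<eta>) \<in> B2" by (rule cm_B2[OF center_C[OF t]])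
 show ?thesis
  unfolding qf_def Ph_def
  by (rule dd_eqI[THEN trans, OF has_derivative_compose[OF dd_cm[OF center_C[OF t]] smooth_deriv[OF smooth_Pf c]]])
   (simp add: cm_center)
qed

lemma smooth_lam: "smooth_on {+-\<tau>} lam"
 unfolding lam_def
 by (rule smooth_compose[OF _ open_B1 _ P]) (use base_B1 in "auto intro!: smooth_Pair smooth_id")

text \<open>Flatness passes to the derivative of \<open>Wf\<close>, which is \<open>Hpp\<close> at
  \<open>qf t p\<close>, and from there by \<open>Fl_pairing_bound\<close> and a square root to the
  pairing with the distribution. The value at 0 is stated separately since flatness only concerns
  positive times.\<close>

lemma flat_pairing:
 assumes flat: "flat_at_0 (\<lambda>t. Wf t p p)"
 shows "flat_at_0 (\<lambda>t. adjoint (Fl (gam t)) (qf t p))" "adjoint (Fl (gam 0)) (qf 0 p) = 0"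
proof -
 let ?I = "{+-\<tau>}" and ?g = "dd 1 (\<lambda>t. Wf t p p)" and ?u = "\<lambda>t. us (gam t, lam t)"
 let ?F = "\<lambda>t. adjoint (Fl (gam t)) (qf t p)"
 have flat1: "flat_at_0 ?g" by (rule flat_at_0_derivative[OF smooth_Wf pos(1) flat])
 have le: "(?F t \<bullet> c)\<^sup>2 <= lww (gam t) (?u t) c c * norm (?g t)" if t: "t \<in> ?I" for t c
 proof -
  have "?g t = Hpp (gam t, lam t) (qf t p) (qf t p)"
   by (rule vector_derivative_unique_at[OF smooth_vderiv[OF smooth_Wf t] dd_Wf[OF t]])
  moreover have "?F t \<bullet> c = qf t p \<bullet> Fl (gam t) c"
   using adjoint_works[OF linear_Fl[OF gam_Om[OF t]], of c "qf t p"] by (simp add: inner_commute)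
  ultimately show ?thesis
   using Fl_pairing_bound[OF gam_Om[OF t]] Hpp_nonneg[OF gam_Om[OF t], of "lam t" "qf t p"] by simp
 qed
 have su: "smooth_on ?I ?u"
  by (rule smooth_compose[OF _ open_OmU _ smooth_us]) (use gam_Om in "auto intro!: smooth_Pair smooth_gam smooth_lam")
 have comp: "flat_at_0 (\<lambda>t. ?F t \<bullet> c)" for c
 proof -
  have "smooth_on ?I (\<lambda>t. lww (gam t) (?u t) c c)"
   unfolding lww_def
   by (rule smooth_compose[OF _ open_OmU _ smooth_dd[OF smooth_dd[OF l]]])
    (use gam_Om in "auto intro!: smooth_Pair smooth_gam su")
  then obtain B where B: "B > 0" "!!t. \<bar>t\<bar> <= \<tau> / 2 ==> norm (lww (gam t) (?u t) c c) <= B"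
   using smooth_bounded_near_0[of \<tau> "\<lambda>t. lww (gam t) (?u t) c c" "\<tau> / 2"] pos by auto
  show ?thesis
  proof (rule flat_at_0_square[OF flat1, of "\<tau> / 2" B])
   fix t :: real assume t: "0 < t" "t < \<tau> / 2"
   show "(?F t \<bullet> c)\<^sup>2 <= B * norm (?g t)"
    by (rule order_trans[OF le mult_right_mono]) (use t B(2)[of t] in auto)
  qed (use pos B in auto)
 qed
 have "flat_at_0 (\<lambda>t. \<Sum>i\<in>Basis. (?F t \<bullet> i) *\<^sub>R i)"
  by (rule flat_at_0_sum, rule flat_at_0_bound[OF comp zero_less_one, where B = 1]) auto
 then show "flat_at_0 ?F" by (simp add: euclidean_representation)
 have "?g 0 = 0"
  by (rule flat_at_0_eq_0[OF flat1 smooth_isCont[OF smooth_dd[OF smooth_Wf] zero_in]])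
 then have "(?F 0 \<bullet> ?F 0)\<^sup>2 <= 0" using le[OF zero_in, of "?F 0"] by simp
 then show "?F 0 = 0" by simp
qed

lemma flat_at_0_diff:
 assumes "flat_at_0 g" "flat_at_0 h"
 shows "flat_at_0 (\<lambda>t. g t - h t)"
proof -
 have "flat_at_0 (\<lambda>t. - h t)" by (rule flat_at_0_bound[OF assms(2) zero_less_one, where B = 1]) auto
 with assms(1) have "flat_at_0 (\<lambda>t. if b then g t else - h t)" for b by (cases b) simp_all
 from flat_at_0_sum[of UNIV "\<lambda>b t. if b then g t else - h t", OF this] show ?thesis by (simp add: UNIV_bool)
qed

lemma flat_at_0_inner:
 fixes F e :: "real => 'x::euclidean_space"
 assumes "flat_at_0 F" "smooth_on {+-\<epsilon>} e" "\<epsilon> > 0"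
 shows "flat_at_0 (\<lambda>t. F t \<bullet> e t)"
proof -
 obtain B where B: "B > 0" "!!t. \<bar>t\<bar> <= \<epsilon> / 2 ==> norm (e t) <= B"
  using smooth_bounded_near_0[OF assms(2), of "\<epsilon> / 2"] assms(3) by auto
 show ?thesis
 proof (rule flat_at_0_bound[OF assms(1), of "\<epsilon> / 2" _ B])
  fix t :: real assume "0 < t" "t < \<epsilon> / 2"
  then show "norm (F t \<bullet> e t) <= B * norm (F t)"
   using Cauchy_Schwarz_ineq2[of "F t" "e t"] mult_left_mono[OF B(2)[of t] norm_ge_zero[of "F t"]]
   by (simp add: mult.commute)
 qed (use B assms in auto)
qed

text \<open>If \<open>Wf t p p\<close> vanishes to infinite order then so does the pairing of \<open>p\<close> with the fields
 of the distribution, pulled back along any flow which has \<open>gam\<close> as trajectory and differs from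
 the field of extremals by a feedback.\<close>

lemma flat_second_variation:
 assumes \<delta>: "0 < \<delta>" "\<delta> <= \<tau>" and d: "0 < d"
  and N: "N = {+-\<delta>} \<times> ball y0 d"
  and \<Phi>: "smooth_on N \<Phi>" and G: "smooth_on N G"
  and \<Phi>B: "!!z. z \<in> N ==> \<Phi> z \<in> ball y0 \<rho>"
  and \<Phi>0: "!!x. x \<in> ball y0 d ==> \<Phi> (0, x) = x"
  and d\<Phi>: "!!s x. (s, x) \<in> N ==> ((\<lambda>s. \<Phi> (s, x)) has_vector_derivative f (\<Phi> (s, x), G (s, x))) (at s)"
  and \<Phi>g: "!!s. \<bar>s\<bar> < \<delta> ==> \<Phi> (s, y0) = gam s" and Gg: "!!s. \<bar>s\<bar> < \<delta> ==> G (s, y0) = us (gam s, lam s)"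
  and flat: "flat_at_0 (\<lambda>t. Wf t p p)"
  and c: "!!s. 0 < s ==> s < \<delta> ==> dd (0, c s) \<Phi> (s, y0) = Fl (gam s) (e s)"
  and sc: "smooth_on {+-\<delta>} c" and se: "smooth_on {+-\<delta>} e"
 shows "flat_at_0 (\<lambda>s. p \<bullet> c s)"
proof -
 have oN: "open N" by (simp add: N open_Times)
 have y0N: "(s, y0) \<in> N" if "\<bar>s\<bar> < \<delta>" for s using that d by (auto simp: N abs_less_iff)
 have tI: "s \<in> {+-\<tau>}" if "\<bar>s\<bar> < \<delta>" for s using that \<delta> by (auto simp: abs_less_iff)
 define q where "q = (\<lambda>s. qf s p)"
 define Fq where "Fq = (\<lambda>s. adjoint (Fl (gam s)) (q s))"
 have flatF: "flat_at_0 Fq" and Fq0: "Fq 0 = 0" using flat_pairing[OF flat] by (simp_all add: Fq_def q_def)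
 define Z where "Z = (\<lambda>z. (fst z, \<Phi> z, \<eta>))"
 have ZB: "Z z \<in> B2" if "z \<in> N" for z using \<Phi>B[OF that] that \<delta> pos by (auto simp: Z_def B2 N)
 have sZ: "smooth_on N Z"
  unfolding Z_def by (intro smooth_Pair \<Phi> oN smooth_const smooth_linear bounded_linear_fst)
 \<comment> \<open>The pairing of \<open>p\<close> with the starting point of the extremal with
   initial covector \<open>\<eta>\<close> that passes through \<open>\<Phi> z\<close> at the time of
   \<open>z\<close>. If \<open>\<Phi>\<close> followed the field of extremals, it would be constant
   along trajectories.\<close>
 define \<kappa> where "\<kappa> = (\<lambda>z. p \<bullet> Y (Z z))"
 have s\<kappa>: "smooth_on N \<kappa>"
  unfolding \<kappa>_def
  by (intro smooth_inner smooth_const oN smooth_compose[OF oN open_B2 _ Y sZ]) (use ZB in auto)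
 define G2 where "G2 = (\<lambda>z. us (\<Phi> z, Pf (Z z)))"
 have sPZ: "smooth_on N (\<lambda>z. Pf (Z z))"
  by (rule smooth_compose[OF oN open_B2 _ smooth_Pf sZ]) (use ZB in auto)
 have \<Phi>Om: "\<Phi> z \<in> Om" if "z \<in> N" for z using x_Om[OF ZB[OF that]] by (simp add: Z_def)
 have sG2: "smooth_on N G2"
  unfolding G2_def
  by (rule smooth_compose[OF oN open_OmU _ smooth_us]) (use \<Phi>Om in "auto intro!: smooth_Pair \<Phi> sPZ oN")
 define Q where "Q = (\<lambda>z. dd (0, 0, p) Pf (Z z))"
 have sQ: "smooth_on N Q"
  unfolding Q_def by (rule smooth_compose[OF oN open_B2 _ smooth_dd[OF smooth_Pf] sZ]) (use ZB in auto)
 have dZ: "(Z has_derivative (\<lambda>h. (fst h, dd h \<Phi> z, 0))) (at z)" if "z \<in> N" for z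
  unfolding Z_def
  by (intro has_derivative_Pair has_derivative_const smooth_deriv[OF \<Phi> that] bounded_linear_imp_has_derivative bounded_linear_fst)
 have d\<kappa>: "dd h \<kappa> z = (dd h \<Phi> z - fst h *\<^sub>R f (\<Phi> z, G2 z)) \<bullet> Q z" if z: "z \<in> N" for z h
 proof -
  have "((\<lambda>z. Y (Z z)) has_derivative (\<lambda>h. dd (fst h, dd h \<Phi> z, 0) Y (Z z))) (at z)"
   by (rule has_derivative_compose[OF dZ[OF z] smooth_deriv[OF Y ZB[OF z]]])
  then have "(\<kappa> has_derivative (\<lambda>h. p \<bullet> dd (fst h, dd h \<Phi> z, 0) Y (Z z))) (at z)"
   unfolding \<kappa>_def by (rule has_derivative_inner_right)
  then have "dd h \<kappa> z = p \<bullet> dd (fst h, dd h \<Phi> z, 0) Y (Z z)" by (simp add: dd_eqI)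
  also have "... = (dd h \<Phi> z - fst h *\<^sub>R fu (fst (snd (Z z)), Pf (Z z))) \<bullet> Q z"
   unfolding Q_def by (rule dd_Y_Pf[OF ZB[OF z]])
  finally show ?thesis by (simp add: Z_def fu_def G2_def)
 qed
 have center: "\<Phi> (s, y0) = gam s" "Z (s, y0) = (s, gam s, \<eta>)" "G2 (s, y0) = us (gam s, lam s)" "Q (s, y0) = q s"
  if s: "\<bar>s\<bar> < \<delta>" for s
 proof -
  show 1: "\<Phi> (s, y0) = gam s" by (rule \<Phi>g[OF s])
  show 2: "Z (s, y0) = (s, gam s, \<eta>)" using 1 by (simp add: Z_def)
  have "Pf (s, gam s, \<eta>) = lam s" using Ph_center[OF tI[OF s]] by (simp add: Ph_def cm_def)
  then show "G2 (s, y0) = us (gam s, lam s)" using 1 2 by (simp add: G2_def)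
  show "Q (s, y0) = q s" by (simp add: Q_def 2 q_def qf_Pf[OF tI[OF s]])
 qed
 \<comment> \<open>The variation of \<open>\<kappa>\<close> with the initial point; on the central
   extremal it is the pairing of \<open>q s\<close> with the linearized flow. Its time derivative
   sees only the difference of the two feedbacks, through the distribution.\<close>
 define y where "y = (\<lambda>\<xi> s. dd (0, \<xi>) \<kappa> (s, y0))"
 have y_eq: "y \<xi> s = dd (0, \<xi>) \<Phi> (s, y0) \<bullet> q s" if "\<bar>s\<bar> < \<delta>" for \<xi> s
  using d\<kappa>[OF y0N[OF that], of "(0, \<xi>)"] center(4)[OF that] by (simp add: y_def)
 define E where "E = (\<lambda>\<xi> s. dd (0, \<xi>) G (s, y0) - dd (0, \<xi>) G2 (s, y0))"
 have dy: "(y \<xi> has_vector_derivative Fq s \<bullet> E \<xi> s) (at s)" if s: "\<bar>s\<bar> < \<delta>" for \<xi> s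
 proof -
  let ?z = "(s, y0)"
  have z: "?z \<in> N" by (rule y0N[OF s])
  have g: "gam s \<in> Om" by (rule gam_Om[OF tI[OF s]])
  have "(y \<xi> has_vector_derivative dd (1, 0) (dd (0, \<xi>) \<kappa>) ?z) (at s)"
   unfolding y_def by (rule vderiv_slice[OF smooth_diffble[OF smooth_dd[OF s\<kappa>] z]])
  moreover have "dd (1, 0) (dd (0, \<xi>) \<kappa>) ?z = dd (0, \<xi>) (dd (1, 0) \<kappa>) ?z"
   by (rule dd_commute[OF oN s\<kappa> z])
  moreover have "... = dd (0, \<xi>) (\<lambda>z. (f (\<Phi> z, G z) - f (\<Phi> z, G2 z)) \<bullet> Q z) ?z"
  proof (rule dd_cong[OF oN z])
   fix z assume zN: "z \<in> N"
   have "dd (1, 0) \<Phi> z = f (\<Phi> z, G z)"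
    using dd_time_eqI[OF smooth_diffble[OF \<Phi>] d\<Phi>] zN by (cases z) auto
   then show "dd (1, 0) \<kappa> z = (f (\<Phi> z, G z) - f (\<Phi> z, G2 z)) \<bullet> Q z" by (simp add: d\<kappa>[OF zN])
  qed
  moreover have "... = Fl (gam s) (E \<xi> s) \<bullet> q s"
  proof -
   let ?u = "us (gam s, lam s)"
   have df: "(f has_derivative (\<lambda>h. dd h f (gam s, ?u))) (at (gam s, ?u))"
    by (rule smooth_deriv[OF f]) (use g in simp)
   have c1: "((\<lambda>z. f (\<Phi> z, G z)) has_derivative (\<lambda>h. dd (dd h \<Phi> ?z, dd h G ?z) f (gam s, ?u))) (at ?z)"
    by (rule has_derivative_compose[OF has_derivative_Pair[OF smooth_deriv[OF \<Phi> z] smooth_deriv[OF G z]]])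
     (use df center(1)[OF s] Gg[OF s] in simp)
   have c2: "((\<lambda>z. f (\<Phi> z, G2 z)) has_derivative (\<lambda>h. dd (dd h \<Phi> ?z, dd h G2 ?z) f (gam s, ?u))) (at ?z)"
    by (rule has_derivative_compose[OF has_derivative_Pair[OF smooth_deriv[OF \<Phi> z] smooth_deriv[OF sG2 z]]])
     (use df center(1,3)[OF s] in simp)
   have "((\<lambda>z. (f (\<Phi> z, G z) - f (\<Phi> z, G2 z)) \<bullet> Q z) has_derivative
    (\<lambda>h. (f (\<Phi> ?z, G ?z) - f (\<Phi> ?z, G2 ?z)) \<bullet> dd h Q ?z
     + (dd (dd h \<Phi> ?z, dd h G ?z) f (gam s, ?u) - dd (dd h \<Phi> ?z, dd h G2 ?z) f (gam s, ?u)) \<bullet> Q ?z)) (at ?z)"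
    by (intro has_derivative_inner has_derivative_diff c1 c2 smooth_deriv[OF sQ z])
   then have "dd (0, \<xi>) (\<lambda>z. (f (\<Phi> z, G z) - f (\<Phi> z, G2 z)) \<bullet> Q z) ?z =
     (dd (dd (0, \<xi>) \<Phi> ?z, dd (0, \<xi>) G ?z) f (gam s, ?u) - dd (dd (0, \<xi>) \<Phi> ?z, dd (0, \<xi>) G2 ?z) f (gam s, ?u)) \<bullet> q s"
    using center[OF s] Gg[OF s] by (simp add: dd_eqI)
   also have "dd (dd (0, \<xi>) \<Phi> ?z, dd (0, \<xi>) G ?z) f (gam s, ?u) - dd (dd (0, \<xi>) \<Phi> ?z, dd (0, \<xi>) G2 ?z) f (gam s, ?u) =
     dd (0, E \<xi> s) f (gam s, ?u)"
    using linear_diff[OF linear_dd[OF f, of "(gam s, ?u)"], of "(dd (0, \<xi>) \<Phi> ?z, dd (0, \<xi>) G ?z)" "(dd (0, \<xi>) \<Phi> ?z, dd (0, \<xi>) G2 ?z)"] g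
    by (simp add: E_def)
   also have "... = Fl (gam s) (E \<xi> s)" by (rule dd_f_control[OF g])
   finally show ?thesis .
  qed
  moreover have "Fl (gam s) (E \<xi> s) \<bullet> q s = Fq s \<bullet> E \<xi> s"
   using adjoint_works[OF linear_Fl[OF g], of "E \<xi> s" "q s"] by (simp add: Fq_def inner_commute)
  ultimately show ?thesis by simp
 qed
 have sE: "smooth_on {+-\<delta>} (E \<xi>)" for \<xi>
 proof -
  have "smooth_on {+-\<delta>} (\<lambda>s. dd (0, \<xi>) g (s, y0))" if "smooth_on N g" for g :: "real \<times> 'a => 'c"
   by (rule smooth_compose[OF _ oN _ smooth_dd[OF that]])
    (use y0N in "auto intro!: smooth_Pair smooth_id simp: abs_less_iff")
  from smooth_diff[OF _ this[OF G] this[OF sG2]] show ?thesis unfolding E_def by simp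
 qed
 have yflat: "flat_at_0 (\<lambda>s. y \<xi> s - p \<bullet> \<xi>)" for \<xi>
 proof (rule flat_at_0_integral[OF \<delta>(1), where g' = "\<lambda>s. Fq s \<bullet> E \<xi> s"])
  show "((\<lambda>s. y \<xi> s - p \<bullet> \<xi>) has_vector_derivative Fq t \<bullet> E \<xi> t) (at t)" if "0 <= t" "t < \<delta>" for t
   using has_vector_derivative_diff[OF dy[of t \<xi>] has_vector_derivative_const] that by simp
  show "flat_at_0 (\<lambda>s. Fq s \<bullet> E \<xi> s)" by (rule flat_at_0_inner[OF flatF sE \<delta>(1)])
  have y0p: "y \<xi> 0 = p \<bullet> \<xi>"
  proof -
   have "dd (0, \<xi>) \<Phi> (0, y0) = dd \<xi> (\<lambda>x. \<Phi> (0, x)) y0"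
    by (rule dd_slice_snd[OF smooth_diffble[OF \<Phi> y0N], symmetric]) (use \<delta> in simp)
   also have "... = dd \<xi> (\<lambda>x. x) y0" by (rule dd_cong[OF open_ball[of y0 d]]) (use \<Phi>0 d in auto)
   finally show ?thesis using y_eq[of 0 \<xi>] \<delta>(1) by (simp add: q_def qf_0 inner_commute)
  qed
  then show "y \<xi> 0 - p \<bullet> \<xi> = 0" by simp
  show "Fq 0 \<bullet> E \<xi> 0 = 0" by (simp add: Fq0)
 qed
 \<comment> \<open>The direction \<open>c s\<close> moves with time, so flatness for the fixed
   directions in \<open>Basis\<close> is combined with the smooth coefficients of
   \<open>c\<close>.\<close>
 have "flat_at_0 (\<lambda>s. (\<Sum>i\<in>Basis. (y i s - p \<bullet> i) *\<^sub>R i) \<bullet> c s)"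
  by (intro flat_at_0_inner[OF flat_at_0_sum sc \<delta>(1)], rule flat_at_0_bound[OF yflat zero_less_one, where B = 1]) auto
 then have "flat_at_0 (\<lambda>s. Fq s \<bullet> e s - (\<Sum>i\<in>Basis. (y i s - p \<bullet> i) *\<^sub>R i) \<bullet> c s)"
  by (rule flat_at_0_diff[OF flat_at_0_inner[OF flatF se \<delta>(1)]])
 then show ?thesis
 proof (rule flat_at_0_bound[OF _ \<delta>(1), of _ _ 1])
  fix s assume s: "0 < s" "s < \<delta>"
  have s': "\<bar>s\<bar> < \<delta>" using s by simp
  have lin: "linear (\<lambda>\<xi>. y \<xi> s)"
   unfolding y_def by (rule linear_dd_snd[OF smooth_diffble[OF s\<kappa> y0N[OF s']]])
  have "y (c s) s = (\<Sum>i\<in>Basis. (c s \<bullet> i) * y i s)"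
   using linear_Basis_expansion[OF lin, of "c s"] by simp
  moreover have "(\<Sum>i\<in>Basis. (y i s - p \<bullet> i) *\<^sub>R i) \<bullet> c s = (\<Sum>i\<in>Basis. (c s \<bullet> i) * (y i s - p \<bullet> i))"
   by (subst inner_commute) (simp add: inner_sum_right mult.commute)
  moreover have "p \<bullet> c s = (\<Sum>i\<in>Basis. (c s \<bullet> i) * (p \<bullet> i))"
   by (subst (1) euclidean_inner) (simp add: mult.commute)
  moreover have "y (c s) s = Fq s \<bullet> e s"
   using y_eq[OF s', of "c s"] c[OF s] adjoint_works[OF linear_Fl[OF gam_Om[OF tI[OF s']]], of "e s" "q s"]
   by (simp add: Fq_def inner_commute)
  ultimately show "norm (p \<bullet> c s) <= 1 * norm (Fq s \<bullet> e s - (\<Sum>i\<in>Basis. (y i s - p \<bullet> i) *\<^sub>R i) \<bullet> c s)"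
   by (simp add: right_diff_distrib sum_subtractf)
 qed simp
qed

end

section \<open>Charts and trivializations\<close>

lemma continuous_on_UNIV_local:
 assumes "!!x. \<exists>A. open A \<and> x \<in> A \<and> continuous_on A f"
 shows "continuous_on UNIV f"
proof -
 have "continuous_on (\<Union>A\<in>{A. open A \<and> continuous_on A f}. A) f" by (rule continuous_on_open_UN) auto
 moreover have "(\<Union>A\<in>{A. open A \<and> continuous_on A f}. A) = UNIV" using assms by blast
 ultimately show ?thesis by simp
qed

locale affine_tonelli =
 fixes S :: "('m::{t2_space,second_countable_topology}, 'n::finite, 'u::topological_space, 'r::finite) control_problem"
 assumes problem: "affine_control_problem S" and ton: "tonelli S"
begin

lemma atl: "smooth_atlas (atlas S)" and bun: "smooth_vector_bundle S"
 and aff: "smooth_affine_dynamics S" and sml: "smooth_lagrangian S"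
 using problem by (auto simp: affine_control_problem_def)

lemma chart_open: "c \<in> atlas S ==> open (fst c)" and chart_image_open: "c \<in> atlas S ==> open (snd c ` fst c)"
 and chart_homeo: "c \<in> atlas S ==> homeomorphism (fst c) (snd c ` fst c) (snd c) (cinv c)"
 and transition_smooth: "c \<in> atlas S ==> d \<in> atlas S ==> smooth_on (snd c ` (fst c \<inter> fst d)) (snd d \<circ> cinv c)"
 using atl by (auto simp: smooth_atlas_def)

lemma chart_at: "chart_at S x \<in> atlas S" "x \<in> fst (chart_at S x)"
proof -
 have "x \<in> (\<Union>c\<in>atlas S. fst c)" using atl by (simp only: smooth_atlas_def) simp
 then have "\<exists>c. c \<in> atlas S \<and> x \<in> fst c" by blast
 from someI_ex[OF this] show "chart_at S x \<in> atlas S" "x \<in> fst (chart_at S x)"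
  by (auto simp: chart_at_def)
qed

lemma cinv_chart: "c \<in> atlas S ==> x \<in> fst c ==> cinv c (snd c x) = x"
 and chart_cinv: "c \<in> atlas S ==> y \<in> snd c ` fst c ==> snd c (cinv c y) = y"
 and cinv_in: "c \<in> atlas S ==> y \<in> snd c ` fst c ==> cinv c y \<in> fst c"
 and continuous_chart: "c \<in> atlas S ==> continuous_on (fst c) (snd c)"
 and continuous_cinv: "c \<in> atlas S ==> continuous_on (snd c ` fst c) (cinv c)"
 using chart_homeo[of c] by (auto simp: homeomorphism_def)

lemma image_chart: "c \<in> atlas S ==> y \<in> snd c ` (fst c \<inter> V) \<longleftrightarrow> y \<in> snd c ` fst c \<and> cinv c y \<in> V"
proof
 assume c: "c \<in> atlas S"
 { assume "y \<in> snd c ` (fst c \<inter> V)"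
  then show "y \<in> snd c ` fst c \<and> cinv c y \<in> V" using cinv_chart[OF c] by auto }
 assume "y \<in> snd c ` fst c \<and> cinv c y \<in> V"
 then show "y \<in> snd c ` (fst c \<inter> V)" using chart_cinv[OF c, of y] cinv_in[OF c, of y] by (intro image_eqI[of _ _ "cinv c y"]) auto
qed

lemma open_chart_image:
 assumes "c \<in> atlas S" "open V"
 shows "open (snd c ` (fst c \<inter> V))"
proof -
 have "snd c ` (fst c \<inter> V) = snd c ` fst c \<inter> cinv c -` V" using image_chart[OF assms(1)] by auto
 then show ?thesis
  using continuous_on_open_vimage[OF chart_image_open[OF assms(1)]] continuous_cinv[OF assms(1)] assms(2)
  by (metis Int_commute)
qed

lemma open_cinv_image:
 assumes "c \<in> atlas S" "open V" "V \<subseteq> snd c ` fst c"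
 shows "open (cinv c ` V)"
proof -
 have "cinv c ` V = fst c \<inter> snd c -` V"
 proof (intro equalityI subsetI)
  fix x assume "x \<in> cinv c ` V"
  then show "x \<in> fst c \<inter> snd c -` V" using assms(3) chart_cinv[OF assms(1)] cinv_in[OF assms(1)] by auto
 next
  fix x assume "x \<in> fst c \<inter> snd c -` V"
  then show "x \<in> cinv c ` V" using cinv_chart[OF assms(1), of x] by (intro image_eqI[of _ _ "snd c x"]) auto
 qed
 then show ?thesis
  using continuous_on_open_vimage[OF chart_open[OF assms(1)]] continuous_chart[OF assms(1)] assms(2)
  by (metis Int_commute)
qed

section \<open>Change of charts for tangent vectors and velocities\<close>

definition trans where "trans c d x = frechet_derivative (snd d \<circ> cinv c) (at (snd c x))"

lemma tcomp_trans: "tcomp S c x = trans (chart_at S x) c x"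
 by (simp add: tcomp_def trans_def)

lemma transition_derivative:
 assumes "c \<in> atlas S" "d \<in> atlas S" "x \<in> fst c" "x \<in> fst d"
 shows "(snd d \<circ> cinv c has_derivative trans c d x) (at (snd c x))"
 unfolding trans_def by (rule smooth_deriv[OF transition_smooth[OF assms(1,2)]]) (use assms in auto)

lemma trans_comp:
 assumes "c \<in> atlas S" "d \<in> atlas S" "e \<in> atlas S" "x \<in> fst c" "x \<in> fst d" "x \<in> fst e"
 shows "trans d e x (trans c d x v) = trans c e x v"
proof -
 have "((\<lambda>y. (snd e \<circ> cinv d) ((snd d \<circ> cinv c) y)) has_derivative (\<lambda>v. trans d e x (trans c d x v))) (at (snd c x))"
  by (rule has_derivative_compose[OF transition_derivative[OF assms(1,2,4,5)]])
   (use transition_derivative[OF assms(2,3,5,6)] cinv_chart[OF assms(1,4)] in "simp add: o_def")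
 moreover have "((\<lambda>y. (snd e \<circ> cinv d) ((snd d \<circ> cinv c) y)) has_derivative trans c e x) (at (snd c x))"
 proof (rule has_derivative_transform_within_open[OF transition_derivative[OF assms(1,3,4,6)]
    open_chart_image[OF assms(1) chart_open[OF assms(2)]]])
  fix y assume "y \<in> snd c ` (fst c \<inter> fst d)"
  then show "(snd e \<circ> cinv c) y = (snd e \<circ> cinv d) ((snd d \<circ> cinv c) y)"
   using image_chart[OF assms(1)] cinv_chart[OF assms(2)] by auto
 qed (use assms in auto)
 ultimately show ?thesis using has_derivative_unique by metis
qed

lemma trans_id: "c \<in> atlas S ==> x \<in> fst c ==> trans c c x v = v"
proof -
 assume a: "c \<in> atlas S" "x \<in> fst c"
 have "((snd c \<circ> cinv c) has_derivative (\<lambda>v. v)) (at (snd c x))"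
  by (rule has_derivative_transform_within_open[OF has_derivative_ident chart_image_open[OF a(1)]])
   (use a chart_cinv in auto)
 with transition_derivative[OF a(1,1,2,2)] show ?thesis using has_derivative_unique by metis
qed

lemma linear_trans: "c \<in> atlas S ==> d \<in> atlas S ==> x \<in> fst c ==> x \<in> fst d ==> linear (trans c d x)"
 using transition_derivative has_derivative_linear by blast

lemma trans_inverse:
 "c \<in> atlas S ==> d \<in> atlas S ==> x \<in> fst c ==> x \<in> fst d ==> trans d c x (trans c d x v) = v"
 using trans_comp[of c d c x v] trans_id by simp

lemma linear_tcomp: "c \<in> atlas S ==> x \<in> fst c ==> linear (tcomp S c x)"
 unfolding tcomp_trans using linear_trans chart_at by blast

lemma trans_tcomp: "c \<in> atlas S ==> d \<in> atlas S ==> x \<in> fst c ==> x \<in> fst d ==>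
  trans c d x (tcomp S c x v) = tcomp S d x v"
 unfolding tcomp_trans by (rule trans_comp) (use chart_at in auto)

lemma tcomp_chart_at: "tcomp S (chart_at S x) x v = v"
 unfolding tcomp_trans by (rule trans_id) (use chart_at in auto)

text \<open>Continuity of the curve is a separate assumption: \<open>snd c\<close> is arbitrary
  outside the chart domain, so a derivative of \<open>snd c (\<zeta> s)\<close> does not keep the
  curve near \<open>\<zeta> t\<close>.\<close>

lemma chart_curve_derivative:
 assumes c: "c \<in> atlas S" "d \<in> atlas S" "\<zeta> t \<in> fst c" "\<zeta> t \<in> fst d"
  and \<zeta>: "continuous (at t within I) \<zeta>" and t: "t \<in> I"
  and D: "((\<lambda>s. snd c (\<zeta> s)) has_vector_derivative w) (at t within I)"
 shows "((\<lambda>s. snd d (\<zeta> s)) has_vector_derivative trans c d (\<zeta> t) w) (at t within I)"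
proof -
 have "((\<lambda>s. (snd d \<circ> cinv c) (snd c (\<zeta> s))) has_vector_derivative trans c d (\<zeta> t) w) (at t within I)"
  using vector_derivative_diff_chain_within[OF D has_derivative_at_withinI[OF transition_derivative[OF c]]]
  by (simp add: o_def)
 moreover have "\<forall>\<^sub>F s in at t within I. (snd d \<circ> cinv c) (snd c (\<zeta> s)) = snd d (\<zeta> s)"
 proof -
  have "\<forall>\<^sub>F s in at t within I. \<zeta> s \<in> fst c"
   using \<zeta> chart_open[OF c(1)] c(3) unfolding continuous_within by (rule topological_tendstoD)
  then show ?thesis by eventually_elim (simp add: cinv_chart[OF c(1)])
 qed
 ultimately show ?thesis
  using t by (simp add: has_vector_derivative_def has_derivative_transform_eventually cinv_chart[OF c(1,3)])
qed

lemma velocity_chart: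
 assumes "velocity S I \<zeta> t v" "continuous (at t within I) \<zeta>" "t \<in> I" "c \<in> atlas S" "\<zeta> t \<in> fst c"
 shows "((\<lambda>s. snd c (\<zeta> s)) has_vector_derivative tcomp S c (\<zeta> t) v) (at t within I)"
 unfolding tcomp_trans
 by (rule chart_curve_derivative) (use assms chart_at in "auto simp: velocity_def")

lemma velocityI:
 assumes "((\<lambda>s. snd c (\<zeta> s)) has_vector_derivative tcomp S c (\<zeta> t) v) (at t within I)"
  "continuous (at t within I) \<zeta>" "t \<in> I" "c \<in> atlas S" "\<zeta> t \<in> fst c"
 shows "velocity S I \<zeta> t v"
 using chart_curve_derivative[of c "chart_at S (\<zeta> t)" \<zeta> t I, OF _ _ _ _ _ _ assms(1)] assms(2-5) chart_at
  trans_tcomp[of c "chart_at S (\<zeta> t)" "\<zeta> t" v] tcomp_chart_at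
 by (auto simp: velocity_def)

section \<open>Trivializations; continuity of the projection and of the Lagrangian\<close>

lemma triv_open: "b \<in> trivs S ==> open (fst b)" and triv_total_open: "b \<in> trivs S ==> open (proj S -` fst b)"
 and triv_homeo: "b \<in> trivs S ==> \<exists>k. homeomorphism (proj S -` fst b) (fst b \<times> UNIV) (\<lambda>e. (proj S e, snd b e)) k"
 using bun by (auto simp: smooth_vector_bundle_def)

lemma triv_exists: "\<exists>b\<in>trivs S. x \<in> fst b" using bun by (auto simp: smooth_vector_bundle_def)

lemma fibre_point:
 assumes b: "b \<in> trivs S" and x: "x \<in> fst b"
 shows proj_fibre_point: "proj S (fibre_point S b x w) = x" and snd_fibre_point: "snd b (fibre_point S b x w) = w"
  and fibre_point_unique: "!!e. proj S e = x ==> fibre_point S b x (snd b e) = e"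
proof -
 obtain k where k: "homeomorphism (proj S -` fst b) (fst b \<times> UNIV) (\<lambda>e. (proj S e, snd b e)) k"
  using triv_homeo[OF b] by blast
 have u: "e = k (x, w)" if "proj S e = x \<and> snd b e = w" for e w
  using k that x by (auto simp: homeomorphism_def)
 have kp: "proj S (k (x, w)) = x \<and> snd b (k (x, w)) = w" for w using k x by (auto simp: homeomorphism_def)
 have fp: "fibre_point S b x w = k (x, w)" for w unfolding fibre_point_def using u kp by (intro the_equality) auto
 show "proj S (fibre_point S b x w) = x" "snd b (fibre_point S b x w) = w" using kp by (auto simp: fp)
 show "fibre_point S b x (snd b e) = e" if "proj S e = x" for e using u that by (metis fp)
qed

lemma continuous_fibre_point:
 assumes b: "b \<in> trivs S"
 shows "continuous_on (fst b \<times> UNIV) (\<lambda>z. fibre_point S b (fst z) (snd z))"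
proof -
 obtain k where k: "homeomorphism (proj S -` fst b) (fst b \<times> UNIV) (\<lambda>e. (proj S e, snd b e)) k"
  using triv_homeo[OF b] by blast
 have "fibre_point S b x w = k (x, w)" if "x \<in> fst b" for x w
  using fibre_point_unique[OF b that, of "k (x, w)"] k that by (auto simp: homeomorphism_def)
 then have "continuous_on (fst b \<times> UNIV) k = continuous_on (fst b \<times> UNIV) (\<lambda>z. fibre_point S b (fst z) (snd z))"
  by (intro continuous_on_cong) auto
 then show ?thesis using k by (simp add: homeomorphism_def)
qed

lemma continuous_triv:
 assumes b: "b \<in> trivs S"
 shows "continuous_on (proj S -` fst b) (\<lambda>e. (proj S e, snd b e))"
 using triv_homeo[OF b] by (auto simp: homeomorphism_def)

lemma continuous_proj: "continuous_on UNIV (proj S)"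
proof -
 have "\<exists>A. open A \<and> e \<in> A \<and> continuous_on A (proj S)" for e
 proof -
  obtain b where b: "b \<in> trivs S" "proj S e \<in> fst b" using triv_exists by blast
  show ?thesis using triv_total_open[OF b(1)] b(2) continuous_on_fst[OF continuous_triv[OF b(1)]]
   by (intro exI[of _ "proj S -` fst b"]) auto
 qed
 then show ?thesis by (rule continuous_on_UNIV_local)
qed

lemma continuous_lag: "continuous_on UNIV (lag S)"
proof -
 have "\<exists>A. open A \<and> e \<in> A \<and> continuous_on A (lag S)" for e
 proof -
  obtain b where b: "b \<in> trivs S" "proj S e \<in> fst b" using triv_exists by blast
  define c where "c = chart_at S (proj S e)"
  have c: "c \<in> atlas S" "proj S e \<in> fst c" using chart_at by (auto simp: c_def)
  define A where "A = proj S -` (fst c \<inter> fst b)"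
  have cp: "continuous_on A (proj S)" using continuous_proj continuous_on_subset by blast
  have cb: "continuous_on A (snd b)"
   using continuous_on_subset[OF continuous_on_snd[OF continuous_triv[OF b(1)]]] by (auto simp: A_def)
  have cc: "continuous_on A (\<lambda>e. snd c (proj S e))"
   by (rule continuous_on_compose2[OF continuous_chart[OF c(1)] cp]) (auto simp: A_def)
  have cl: "continuous_on ((snd c ` (fst c \<inter> fst b)) \<times> UNIV) (\<lambda>(y, w). lag S (fibre_point S b (cinv c y) w))"
   using sml c(1) b(1) smooth_continuous unfolding smooth_lagrangian_def by blast
  have "continuous_on A (\<lambda>e. (\<lambda>(y, w). lag S (fibre_point S b (cinv c y) w)) (snd c (proj S e), snd b e))"
   by (rule continuous_on_compose2[OF cl continuous_on_Pair[OF cc cb]]) (auto simp: A_def)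
  moreover have "(\<lambda>(y, w). lag S (fibre_point S b (cinv c y) w)) (snd c (proj S e), snd b e) = lag S e" if "e \<in> A" for e
   using that fibre_point_unique[OF b(1), of "proj S e" e] by (auto simp: A_def cinv_chart[OF c(1)])
  ultimately have "continuous_on A (lag S)" by (simp cong: continuous_on_cong)
  moreover have "open A" unfolding A_def
   using open_vimage[OF open_Int[OF chart_open[OF c(1)] triv_open[OF b(1)]] continuous_proj] .
  ultimately show ?thesis using b c by (auto simp: A_def)
 qed
 then show ?thesis by (rule continuous_on_UNIV_local)
qed

end

section \<open>The fundamental theorem of calculus for Lipschitz functions\<close>

text \<open>In terms of an antiderivative \<open>F\<close> of \<open>k\<close> the integral is a
  difference of two difference quotients of \<open>F\<close>, one at \<open>b\<close> and one at
  \<open>a\<close>.\<close>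

lemma continuous_difference_quotient_limit:
 fixes k :: "real => real"
 assumes k: "continuous_on UNIV k" and ab: "a <= b"
 shows "(\<lambda>n. integral {a..b} (\<lambda>x. real (Suc n) * (k (x + 1 / real (Suc n)) - k x))) \<longlonglongrightarrow> k b - k a"
proof -
 \<comment> \<open>The interval is enlarged so that the points shifted to the right by at most 1 are
   interior and \<open>F\<close> is differentiable there.\<close>
 obtain F where F: "!!x. x \<in> {a - 1..b + 2} ==> (F has_vector_derivative k x) (at x within {a - 1..b + 2})"
  using antiderivative_continuous[OF continuous_on_subset[OF k subset_UNIV]] by metis
 have F1: "(F has_vector_derivative k x) (at x)" if "x \<in> {a - 1<..<b + 2}" for x
  using F[of x] that by (simp add: at_within_Icc_at)
 have Ft: "(F has_vector_derivative k x) (at x within X)" if "x \<in> {a..b + 1}" for x X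
  by (rule has_vector_derivative_at_within[OF F1]) (use that in auto)
 have int: "integral {a..b} (\<lambda>x. real (Suc n) * (k (x + 1 / real (Suc n)) - k x))
   = real (Suc n) * (F (b + 1 / real (Suc n)) - F b) - real (Suc n) * (F (a + 1 / real (Suc n)) - F a)" for n
 proof -
  let ?h = "1 / real (Suc n)"
  have "((\<lambda>x. k (x + ?h) - k x) has_integral (F (b + ?h) - F b - (F (a + ?h) - F a))) {a..b}"
  proof (rule fundamental_theorem_of_calculus[OF ab])
   fix x assume x: "x \<in> {a..b}"
   have "?h <= 1" "?h > 0" by auto
   then have x': "x + ?h \<in> {a..b + 1}" using x by (simp only: atLeastAtMost_iff) linarith
   have "(F \<circ> (\<lambda>x. x + ?h) has_vector_derivative 1 *\<^sub>R k (x + ?h)) (at x within {a..b})"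
    by (rule vector_diff_chain_within[where f = "\<lambda>x. x + ?h" and g = F, OF _ Ft[OF x', of "(\<lambda>x. x + ?h) ` {a..b}"]])
     (auto intro!: derivative_eq_intros)
   then show "((\<lambda>x. F (x + ?h) - F x) has_vector_derivative k (x + ?h) - k x) (at x within {a..b})"
    using Ft[of x "{a..b}"] x by (auto simp: o_def intro!: has_vector_derivative_diff)
  qed
  from has_integral_mult_right[OF this, of "real (Suc n)"] show ?thesis
   by (simp only: integral_unique right_diff_distrib)
 qed
 have lim: "(\<lambda>n. real (Suc n) * (F (x + 1 / real (Suc n)) - F x)) \<longlonglongrightarrow> k x" if "x \<in> {a..b}" for x
 proof -
  have "(F has_field_derivative k x) (at x)"
   using F1[of x] that by (simp add: has_real_derivative_iff_has_vector_derivative)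
  then have "((\<lambda>h. (F (x + h) - F x) / h) \<longlongrightarrow> k x) (at 0)" by (simp add: DERIV_def)
  moreover have "filterlim (\<lambda>n. 1 / real (Suc n)) (at 0) sequentially"
   using LIMSEQ_inverse_real_of_nat by (simp add: filterlim_at inverse_eq_divide)
  ultimately have "((\<lambda>n. (F (x + 1 / real (Suc n)) - F x) / (1 / real (Suc n))) \<longlongrightarrow> k x) sequentially"
   by (rule filterlim_compose)
  then show ?thesis by (simp add: mult.commute)
 qed
 show ?thesis unfolding int by (intro tendsto_diff lim) (use ab in auto)
qed

text \<open>Difference quotients of a Lipschitz function are uniformly bounded, so dominated convergence
 applies although the function is only differentiable almost everywhere.\<close>

lemma Lipschitz_increment_le_integral:
 fixes h l :: "real => real"
 assumes ab: "a <= b" and h: "K-lipschitz_on {a..b} h" and l: "integrable (lebesgue_on {a..b}) l"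
  and d: "AE t in lebesgue_on {a..b}. \<exists>D. (h has_vector_derivative D) (at t within {a..b}) \<and> D <= l t"
 shows "h b - h a <= integral\<^sup>L (lebesgue_on {a..b}) l"
proof -
 let ?M = "lebesgue_on {a..b}"
 \<comment> \<open>Clamping to \<open>{a..b}\<close> extends \<open>h\<close> by constants with the
   same Lipschitz constant, so the quotients are defined up to the end point.\<close>
 define pr where "pr = (\<lambda>x::real. max a (min b x))"
 define k where "k = (\<lambda>x. h (pr x))"
 have pr: "pr x \<in> {a..b}" "\<bar>pr x - pr y\<bar> <= \<bar>x - y\<bar>" for x y using ab by (auto simp: pr_def)
 have K: "K \<ge> 0" by (rule lipschitz_on_nonneg[OF h])
 have kL: "\<bar>k x - k y\<bar> <= K * \<bar>x - y\<bar>" for x y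
  using lipschitz_onD[OF h pr(1)[of x] pr(1)[of y]] mult_left_mono[OF pr(2)[of x y] K] by (simp add: k_def dist_real_def)
 have kh: "k x = h x" if "x \<in> {a..b}" for x using that by (simp add: k_def pr_def)
 have kc: "continuous_on UNIV k"
  by (rule lipschitz_on_continuous_on[of K]) (use kL K in "auto intro!: lipschitz_onI simp: dist_real_def")
 define q where "q = (\<lambda>n x. real (Suc n) * (k (x + 1 / real (Suc n)) - k x))"
 have qc: "continuous_on UNIV (q n)" for n
  unfolding q_def by (intro continuous_intros continuous_on_compose2[OF kc]) auto
 have qint: "integrable ?M (q n)" for n
  using continuous_imp_integrable_real[OF continuous_on_subset[OF qc subset_UNIV]] by blast
 have qlim: "(\<lambda>n. integral\<^sup>L ?M (q n)) \<longlonglongrightarrow> k b - k a"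
  using continuous_difference_quotient_limit[OF kc ab]
  by (subst lebesgue_integral_eq_integral[OF qint]) (auto simp only: q_def intro: fmeasurableD lmeasurable_interval)
 have qb: "\<bar>q n x\<bar> <= K" for n x
 proof -
  have "\<bar>q n x\<bar> = real (Suc n) * \<bar>k (x + 1 / real (Suc n)) - k x\<bar>" by (simp add: q_def abs_mult)
  also have "... <= real (Suc n) * (K * \<bar>1 / real (Suc n)\<bar>)"
   using kL[of "x + 1 / real (Suc n)" x] by (intro mult_left_mono) auto
  finally show ?thesis by simp
 qed
 \<comment> \<open>At \<open>b\<close> the forward quotients of the extension vanish and say nothing
   about the derivative, so this one point is discarded.\<close>
 have ae: "AE x in ?M. x \<noteq> b"
 proof -
  have "AE x in lebesgue. x \<noteq> b" using AE_completion[OF AE_lborel_singleton] .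
  then have "AE x in lebesgue. x \<in> {a..b} --> x \<noteq> b" by (rule AE_mp) simp
  then show ?thesis by (subst AE_restrict_space_iff) (simp_all add: fmeasurableD lmeasurable_interval)
 qed
 \<comment> \<open>The pointwise \<open>lim\<close> serves as a measurable derivative; almost
   everywhere the quotients converge to it and it is bounded by \<open>l\<close>.\<close>
 have ql: "AE x in ?M. (\<lambda>n. q n x) \<longlonglongrightarrow> lim (\<lambda>n. q n x) \<and> lim (\<lambda>n. q n x) <= l x"
  using d ae AE_space
 proof eventually_elim
  case (elim x)
  then obtain D where D: "(h has_vector_derivative D) (at x within {a..b})" "D <= l x" by blast
  have x: "a <= x" "x < b" using elim by (auto simp: space_restrict_space)
  have "((\<lambda>y. (h y - h x) / (y - x)) \<longlongrightarrow> D) (at x within {a..b})"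
   using D(1) by (simp add: has_field_derivative_iff flip: has_real_derivative_iff_has_vector_derivative)
  moreover have "filterlim (\<lambda>n. x + 1 / real (Suc n)) (at x within {a..b}) sequentially"
   unfolding filterlim_at
  proof
   have "(\<lambda>n. x + 1 / real (Suc n)) \<longlonglongrightarrow> x + 0"
    using LIMSEQ_inverse_real_of_nat by (intro tendsto_add tendsto_const) (simp add: inverse_eq_divide)
   then show t: "(\<lambda>n. x + 1 / real (Suc n)) \<longlonglongrightarrow> x" by simp
   show "\<forall>\<^sub>F n in sequentially. x + 1 / real (Suc n) \<in> {a..b} \<and> x + 1 / real (Suc n) \<noteq> x"
    using order_tendstoD(2)[OF t x(2)]
   proof eventually_elim
    case (elim n)
    have "1 / real (Suc n) > 0" by simp
    then show ?case using elim x unfolding atLeastAtMost_iff by linarith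
   qed
  qed
  ultimately have "((\<lambda>n. (h (x + 1 / real (Suc n)) - h x) / (x + 1 / real (Suc n) - x)) \<longlongrightarrow> D) sequentially"
   by (rule filterlim_compose)
  moreover have "\<forall>\<^sub>F n in sequentially. (h (x + 1 / real (Suc n)) - h x) / (x + 1 / real (Suc n) - x) = q n x"
  proof -
   have "(\<lambda>n. x + 1 / real (Suc n)) \<longlonglongrightarrow> x + 0"
    using LIMSEQ_inverse_real_of_nat by (intro tendsto_add tendsto_const) (simp add: inverse_eq_divide)
   then have "(\<lambda>n. x + 1 / real (Suc n)) \<longlonglongrightarrow> x" by simp
   from order_tendstoD(2)[OF this x(2)] show ?thesis
   proof eventually_elim
    case (elim n)
    have "1 / real (Suc n) > 0" by simp
    then have "x + 1 / real (Suc n) \<in> {a..b}" "x \<in> {a..b}" using elim x unfolding atLeastAtMost_iff by linarith+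
    then show ?case by (simp add: q_def kh mult.commute)
   qed
  qed
  ultimately have "(\<lambda>n. q n x) \<longlonglongrightarrow> D" by (rule Lim_transform_eventually)
  then show ?case using D(2) by (simp add: limI)
 qed
 have meas: "(\<lambda>x. lim (\<lambda>n. q n x)) \<in> borel_measurable ?M"
  by (rule borel_measurable_lim_metric) (use qint in auto)
 have ki: "integrable ?M (\<lambda>x. K)"
  using continuous_imp_integrable_real[of a b "\<lambda>x. K"] by simp
 have qm: "!!n. q n \<in> borel_measurable ?M" using qint by blast
 have cv: "AE x in ?M. (\<lambda>n. q n x) \<longlonglongrightarrow> lim (\<lambda>n. q n x)" using ql by auto
 have bd: "AE x in ?M. norm (q n x) <= K" for n using qb by auto
 have "(\<lambda>n. integral\<^sup>L ?M (q n)) \<longlonglongrightarrow> integral\<^sup>L ?M (\<lambda>x. lim (\<lambda>n. q n x))"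
  by (rule integral_dominated_convergence[OF meas qm ki cv bd])
 with qlim have "k b - k a = integral\<^sup>L ?M (\<lambda>x. lim (\<lambda>n. q n x))" by (rule LIMSEQ_unique)
 also have "... <= integral\<^sup>L ?M l"
 proof (rule integral_mono_AE[OF _ l])
  show "integrable ?M (\<lambda>x. lim (\<lambda>n. q n x))" by (rule integrable_dominated_convergence[OF meas qm ki cv bd])
  show "AE x in ?M. lim (\<lambda>n. q n x) <= l x" using ql by auto
 qed
 finally show ?thesis using ab kh by simp
qed

section \<open>The problem in a chart\<close>

locale geodesic_chart = affine_tonelli S
 for S :: "('m::{t2_space,second_countable_topology}, 'n::finite, 'u::topological_space, 'r::finite) control_problem" +
 fixes M' :: "'m set" and x0 :: 'm and b :: "'m set \<times> ('u => real^'r)"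
 assumes M': "open M'" "x0 \<in> M'" and b: "b \<in> trivs S" "x0 \<in> fst b"
begin

definition c where "c = chart_at S x0"
text \<open>The intersection with \<open>M'\<close> keeps curves in the chart inside
  \<open>M'\<close>, as competitors in \<open>value_fun\<close> must be.\<close>

definition Om where "Om = snd c ` (fst c \<inter> (fst b \<inter> M'))"
definition fp where "fp z = fibre_point S b (cinv c (fst z)) (snd z)"
definition f where "f z = tcomp S c (cinv c (fst z)) (dyn S (fp z))"
definition l where "l z = lag S (fp z)"
definition y0 where "y0 = snd c x0"

lemma c: "c \<in> atlas S" "x0 \<in> fst c" by (simp_all add: c_def chart_at)

lemma Om_iff: "y \<in> Om \<longleftrightarrow> y \<in> snd c ` fst c \<and> cinv c y \<in> fst b \<and> cinv c y \<in> M'"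
 unfolding Om_def using image_chart[OF c(1)] by blast

lemma open_Om: "open Om"
 unfolding Om_def by (rule open_chart_image[OF c(1) open_Int[OF triv_open[OF b(1)] M'(1)]])

lemma OmD: "y \<in> Om ==> cinv c y \<in> fst c" "y \<in> Om ==> snd c (cinv c y) = y" "y \<in> Om ==> cinv c y \<in> fst b"
  "y \<in> Om ==> cinv c y \<in> M'" "y \<in> Om ==> y \<in> snd c ` fst c"
 using Om_iff cinv_in[OF c(1)] chart_cinv[OF c(1)] by auto

lemma y0_in: "y0 \<in> Om" and cinv_y0: "cinv c y0 = x0"
 unfolding Om_def y0_def using c b M' cinv_chart[OF c] by auto

lemma Om_sub: "Om \<subseteq> snd c ` (fst c \<inter> fst b)"
 unfolding Om_def by blast

lemma fp: "y \<in> Om ==> proj S (fp (y, w)) = cinv c y" "y \<in> Om ==> snd b (fp (y, w)) = w"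
  "y \<in> Om ==> proj S e = cinv c y ==> fp (y, snd b e) = e"
 using fibre_point[OF b(1)] OmD(3) by (simp_all add: fp_def)

lemma fibre_Om: "y \<in> Om ==> {e. proj S e = cinv c y} = range (\<lambda>w. fp (y, w))"
 using fp by (auto intro!: image_eqI[OF sym])

lemma continuous_fp: "continuous_on (Om \<times> UNIV) fp"
proof -
 have "continuous_on (Om \<times> (UNIV :: (real^'r) set)) (\<lambda>z. cinv c (fst z))"
  by (rule continuous_on_compose2[OF continuous_cinv[OF c(1)]])
   (use OmD(5) in "auto intro: continuous_on_fst continuous_on_id")
 then have 1: "continuous_on (Om \<times> UNIV) (\<lambda>z. (cinv c (fst z), snd z :: real^'r))"
  by (intro continuous_on_Pair continuous_on_snd continuous_on_id)
 have 2: "(\<lambda>z. (cinv c (fst z), snd z :: real^'r)) ` (Om \<times> UNIV) \<subseteq> fst b \<times> UNIV" using OmD(3) by auto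
 show ?thesis
  using continuous_on_compose2[OF continuous_fibre_point[OF b(1)] 1 2] by (simp add: fp_def[abs_def])
qed

sublocale chart_problem Om f l
proof
 show "open Om" by (rule open_Om)
 have sub: "Om \<times> UNIV \<subseteq> (snd c ` (fst c \<inter> fst b)) \<times> (UNIV :: (real^'r) set)" using Om_sub by blast
 have e: "(\<lambda>(y, w). tcomp S c (cinv c y) (dyn S (fibre_point S b (cinv c y) w))) = f"
  "(\<lambda>(y, w). lag S (fibre_point S b (cinv c y) w)) = l"
  by (auto simp: f_def l_def fp_def)
 have "smooth_on ((snd c ` (fst c \<inter> fst b)) \<times> UNIV) f"
  unfolding e(1)[symmetric] using aff c(1) b(1) unfolding smooth_affine_dynamics_def by blast
 then show "smooth_on (Om \<times> UNIV) f" by (rule smooth_subset[OF _ sub])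
 have "smooth_on ((snd c ` (fst c \<inter> fst b)) \<times> UNIV) l"
  unfolding e(2)[symmetric] using sml c(1) b(1) unfolding smooth_lagrangian_def by blast
 then show "smooth_on (Om \<times> UNIV) l" by (rule smooth_subset[OF _ sub])
 fix y assume y: "y \<in> Om"
 obtain f0 L where L: "linear L" "!!w. dyn S (fp (y, w)) = f0 + L w"
  using aff b(1) OmD(3)[OF y] unfolding smooth_affine_dynamics_def fp_def by fastforce
 have lt: "linear (tcomp S c (cinv c y))" by (rule linear_tcomp[OF c(1) OmD(1)[OF y]])
 show "\<exists>f0 L. linear L \<and> (\<forall>w. f (y, w) = f0 + L w)"
  using linear_compose[OF L(1) lt] by (auto simp: f_def L(2) linear_add[OF lt] o_def)
 have T: "(\<forall>w v. v \<noteq> 0 --> hessian (\<lambda>w. l (y, w)) w v v > 0) \<and> filterlim (\<lambda>w. l (y, w) / norm w) at_top at_infinity"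
  using ton b(1) OmD(3)[OF y] by (simp add: tonelli_def l_def fp_def)
 show "v \<noteq> 0 ==> hessian (\<lambda>w. l (y, w)) w v v > 0" for w v using T by blast
 show "filterlim (\<lambda>w. l (y, w) / norm w) at_top at_infinity" using T by blast
qed

lemma tcomp_dyn: "y \<in> Om ==> proj S e = cinv c y ==> tcomp S c (cinv c y) (dyn S e) = f (y, snd b e)"
 using fp(3) by (simp add: f_def)

lemma lag_l: "y \<in> Om ==> proj S e = cinv c y ==> lag S e = l (y, snd b e)"
 using fp(3) by (simp add: l_def)

lemma gain_fp:
 assumes y: "y \<in> Om" and p: "!!v. p \<bullet> tcomp S c (cinv c y) v = \<zeta> \<bullet> v" and e: "proj S e = cinv c y"
 shows "\<zeta> \<bullet> dyn S e - lag S e = gain y p (snd b e)"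
 using p[of "dyn S e"] tcomp_dyn[OF y e] lag_l[OF y e] by (simp add: gain_def)

lemma ham_H:
 assumes y: "y \<in> Om" and p: "!!v. p \<bullet> tcomp S c (cinv c y) v = \<zeta> \<bullet> v"
 shows "ham S (cinv c y) \<zeta> = H (y, p)" and "maximizer S (cinv c y) \<zeta> = fp (y, us (y, p))"
proof -
 have g: "\<zeta> \<bullet> dyn S (fp (y, w)) - lag S (fp (y, w)) = gain y p w" for w
  using gain_fp[OF y p fp(1)[OF y]] fp(2)[OF y] by simp
 have "(\<lambda>e. \<zeta> \<bullet> dyn S e - lag S e) ` {e. proj S e = cinv c y} = range (gain y p)"
  unfolding fibre_Om[OF y] image_image g ..
 moreover have "Sup (range (gain y p)) = H (y, p)"
  by (rule cSup_eq_maximum) (use us_max[OF y] in "auto simp: H_def")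
 ultimately show "ham S (cinv c y) \<zeta> = H (y, p)" by (simp add: ham_def)
 show "maximizer S (cinv c y) \<zeta> = fp (y, us (y, p))"
  unfolding maximizer_def
 proof (rule the_equality)
  show "proj S (fp (y, us (y, p))) = cinv c y \<and> (\<forall>e'. proj S e' = cinv c y \<longrightarrow>
    \<zeta> \<bullet> dyn S e' - lag S e' <= \<zeta> \<bullet> dyn S (fp (y, us (y, p))) - lag S (fp (y, us (y, p))))"
   using us_max[OF y] by (auto simp: g fp[OF y] gain_fp[OF y p])
 next
  fix e assume e: "proj S e = cinv c y \<and> (\<forall>e'. proj S e' = cinv c y \<longrightarrow>
    \<zeta> \<bullet> dyn S e' - lag S e' <= \<zeta> \<bullet> dyn S e - lag S e)"
  then have "gain y p w' <= gain y p (snd b e)" for w'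
   using g[of w'] fp(1)[OF y, of w'] gain_fp[OF y p, of e] by metis
  then have "snd b e = us (y, p)" by (rule us_unique_max[OF y])
  then show "e = fp (y, us (y, p))" using fp(3)[OF y, of e] e by metis
 qed
qed

lemma ham_in_chart_H: "y \<in> Om ==> ham_in_chart S c y p = H (y, p)"
 unfolding ham_in_chart_def
 by (rule ham_H(1)) (auto simp: adjoint_works[OF linear_tcomp[OF c(1) OmD(1)]] inner_commute)

text \<open>\<open>ccomp\<close> is a definite description; the adjoint of the transition map to the
  chart chosen at the point is its witness.\<close>

lemma ccomp_tcomp:
 assumes y: "y \<in> Om"
 shows "ccomp S c (cinv c y) \<zeta> \<bullet> tcomp S c (cinv c y) v = \<zeta> \<bullet> v"
proof -
 let ?x = "cinv c y"
 let ?d = "chart_at S ?x"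
 let ?p = "adjoint (trans c ?d ?x) \<zeta>"
 note d = chart_at[of ?x] and x = OmD(1)[OF y]
 have inv: "trans c ?d ?x (tcomp S c ?x v) = v" for v
  using trans_tcomp[OF c(1) d(1) x d(2)] tcomp_chart_at by simp
 have p: "?p \<bullet> tcomp S c ?x v = \<zeta> \<bullet> v" for v
  using adjoint_works[OF linear_trans[OF c(1) d(1) x d(2)], of "tcomp S c ?x v" \<zeta>] inv
  by (simp add: inner_commute)
 have "ccomp S c ?x \<zeta> = ?p"
  unfolding ccomp_def
 proof (rule the_equality)
  show "\<forall>v. ?p \<bullet> tcomp S c ?x v = \<zeta> \<bullet> v" using p by blast
  fix q assume q: "\<forall>v. q \<bullet> tcomp S c ?x v = \<zeta> \<bullet> v"
  have "q \<bullet> w = ?p \<bullet> w" for w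
  proof -
   have "tcomp S c ?x (trans c ?d ?x w) = w"
    unfolding tcomp_trans by (rule trans_inverse[OF c(1) d(1) x d(2)])
   then show ?thesis using q p by metis
  qed
  then show "q = ?p" by (metis vector_eq_rdot)
 qed
 with p show ?thesis by simp
qed

lemma tcomp_x0: "tcomp S c x0 v = v"
 unfolding c_def by (rule tcomp_chart_at)

lemma ccomp_x0: "ccomp S c x0 \<zeta> = \<zeta>"
 using ccomp_tcomp[OF y0_in, of \<zeta>] unfolding cinv_y0 tcomp_x0 by (metis vector_eq_rdot)

lemma ham_x0: "ham S x0 \<zeta> = H (y0, \<zeta>)"
 using ham_H(1)[OF y0_in, of \<zeta> \<zeta>] by (simp add: cinv_y0 tcomp_x0)

text \<open>The zero section is taken in some chosen trivialization; transition maps are linear, so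
  it is zero in \<open>b\<close> as well.\<close>

lemma zero_section_fp: "y \<in> Om ==> zero_section S (cinv c y) = fp (y, 0)"
proof -
 assume y: "y \<in> Om"
 let ?x = "cinv c y"
 define b' where "b' = (SOME b. b \<in> trivs S \<and> ?x \<in> fst b)"
 have b': "b' \<in> trivs S" "?x \<in> fst b'"
  using someI_ex[of "\<lambda>b. b \<in> trivs S \<and> ?x \<in> fst b"] triv_exists[of ?x] unfolding b'_def by blast+
 have z: "zero_section S ?x = fibre_point S b' ?x 0" by (simp add: zero_section_def b'_def)
 note p = proj_fibre_point[OF b', of 0] snd_fibre_point[OF b', of 0]
 obtain G :: "'m => real^'r^'r" where "!!e. proj S e \<in> fst b' \<inter> fst b ==> snd b e = G (proj S e) *v snd b' e"
  using bun[unfolded smooth_vector_bundle_def, THEN conjunct2, THEN conjunct2, rule_format, OF b'(1) b(1)] by blast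
 then have "snd b (zero_section S ?x) = 0" using b'(2) OmD(3)[OF y] p by (simp add: z)
 with fp(3)[OF y, of "zero_section S ?x"] p show ?thesis by (simp add: z)
qed

lemma tcomp_lin_dyn: "y \<in> Om ==> proj S e = cinv c y ==> tcomp S c (cinv c y) (lin_dyn S e) = Fl y (snd b e)"
 using tcomp_dyn[of y e] tcomp_dyn[of y "fp (y, 0)"] fp[of y]
 by (simp add: lin_dyn_def drift_def zero_section_fp Fl_def linear_diff[OF linear_tcomp[OF c(1) OmD(1)]])

lemma distribution_x0: "distribution S x0 = range (Fl y0)"
proof -
 have "lin_dyn S (fp (y0, w)) = Fl y0 w" for w
  using tcomp_lin_dyn[OF y0_in, of "fp (y0, w)"] fp[OF y0_in] by (simp add: cinv_y0 tcomp_x0)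
 then show ?thesis
  using fibre_Om[OF y0_in] by (auto simp: distribution_def cinv_y0 image_iff)
qed

section \<open>The Hamiltonian inner product in the chart\<close>

definition G where "G \<zeta> v = Fl y0 (dd (0, v) us (y0, \<zeta>))"

lemma G_inner: "\<zeta>1 \<bullet> G \<eta> \<zeta>2 = Hpp (y0, \<eta>) \<zeta>1 \<zeta>2"
 using Hpp_eq[OF y0_in, of \<eta> \<zeta>2 \<zeta>1] Hpp_sym[OF y0_in, of \<eta> \<zeta>1 \<zeta>2] by (simp add: G_def)

lemma G_sym: "\<zeta>1 \<bullet> G \<eta> \<zeta>2 = G \<eta> \<zeta>1 \<bullet> \<zeta>2"
 using G_inner[of \<zeta>1] G_inner[of \<zeta>2 \<eta> \<zeta>1] Hpp_sym[OF y0_in] by (simp add: inner_commute)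

lemma linear_G: "linear (G \<eta>)"
proof -
 have "linear (\<lambda>v. dd (0, v) us (y0, \<eta>))"
  by (rule linear_dd_snd[OF smooth_diffble[OF smooth_us]]) (use y0_in in simp)
 from linear_compose[OF this linear_Fl[OF y0_in]] show ?thesis by (simp add: G_def[abs_def] o_def)
qed

lemma range_G: "range (G \<eta>) = distribution S x0"
 unfolding G_def[abs_def] distribution_x0 by (rule range_Hpp_operator[OF y0_in])

lemma ham_second_derivative_G: "ham_second_derivative S x0 \<eta> = G \<eta>"
proof -
 have o: "(y0, \<zeta>) \<in> Om \<times> UNIV" for \<zeta> using y0_in by simp
 have hs: "ham S x0 = (\<lambda>\<zeta>. H (y0, \<zeta>))" using ham_x0 by blast
 have 1: "(\<chi> i. frechet_derivative (ham S x0) (at \<zeta>) (axis i 1)) = fu (y0, \<zeta>)" for \<zeta>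
  unfolding hs
  by (simp add: vec_eq_iff dd_slice_snd[OF smooth_diffble[OF smooth_H o]] dd_H_covector[OF y0_in] inner_axis')
 have "G \<eta> v = dd v (\<lambda>\<zeta>. fu (y0, \<zeta>)) \<eta>" for v
 proof -
  have "dd v (\<lambda>\<zeta>. fu (y0, \<zeta>)) \<eta> = dd (0, v) fu (y0, \<eta>)"
   by (rule dd_slice_snd[OF smooth_diffble[OF smooth_fu o]])
  moreover have "w \<bullet> dd (0, v) fu (y0, \<eta>) = w \<bullet> G \<eta> v" for w
  proof -
   have "Hpp (y0, \<eta>) v w = dd (0, v) (\<lambda>z. fu z \<bullet> w) (y0, \<eta>)"
    unfolding Hpp_def by (rule dd_cong[OF open_Times[OF open_Om open_UNIV] o]) (auto simp: dd_H_covector inner_commute)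
   also have "... = dd (0, v) fu (y0, \<eta>) \<bullet> w"
    by (rule dd_inner_left[OF smooth_diffble[OF smooth_fu o]])
   finally show ?thesis using G_inner Hpp_sym[OF y0_in] by (metis inner_commute)
  qed
  ultimately show ?thesis by (metis vector_eq_ldot)
 qed
 then show ?thesis by (auto simp: ham_second_derivative_def 1)
qed

text \<open>The covectors that represent the two vectors are not unique; by symmetry of
  \<open>G\<close> the value does not depend on them.\<close>

lemma ham_inner_G: "ham_inner S x0 \<eta> (G \<eta> \<zeta>1) (G \<eta> \<zeta>2) = \<zeta>1 \<bullet> G \<eta> \<zeta>2"
 unfolding ham_inner_def ham_second_derivative_G
proof (rule the_equality)
 fix a assume "\<exists>\<zeta>1' \<zeta>2'. G \<eta> \<zeta>1 = G \<eta> \<zeta>1' \<and> G \<eta> \<zeta>2 = G \<eta> \<zeta>2' \<and> a = \<zeta>1' \<bullet> G \<eta> \<zeta>2'"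
 then show "a = \<zeta>1 \<bullet> G \<eta> \<zeta>2" using G_sym by metis
qed blast

lemma ham_inner_pos:
 assumes "v \<in> distribution S x0" "v \<noteq> 0"
 shows "ham_inner S x0 \<eta> v v > 0"
proof -
 obtain \<zeta> where v: "v = G \<eta> \<zeta>" using assms(1) range_G by (metis rangeE)
 let ?k = "dd (0, \<zeta>) us (y0, \<eta>)"
 have "?k \<noteq> 0" using assms(2) v linear_0[OF linear_Fl[OF y0_in]] by (auto simp: G_def)
 then have "Hpp (y0, \<eta>) \<zeta> \<zeta> > 0" using Hpp_lww[OF y0_in] lww_pos[OF y0_in] by simp
 then show ?thesis by (simp add: v ham_inner_G G_inner)
qed

end

section \<open>The geodesic in the chart\<close>

text \<open>\<open>F\<close> is only locally Lipschitz: continuity confines both curves to one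
  compact ball near \<open>t0\<close>, where \<open>ode_unique\<close> applies. The time
  \<open>t0\<close> may be an end point of the interval.\<close>

lemma ode_unique_near:
 fixes F :: "'e::euclidean_space => 'e"
 assumes A: "open A" and F: "smooth_on A F" and t0: "t0 \<in> {a..b}" and xy: "x t0 = y t0" "x t0 \<in> A"
  and d: "d > 0"
  and x: "!!t. t \<in> {a..b} ==> \<bar>t - t0\<bar> < d ==> (x has_vector_derivative F (x t)) (at t within {a..b})"
  and y: "!!t. t \<in> {a..b} ==> \<bar>t - t0\<bar> < d ==> (y has_vector_derivative F (y t)) (at t within {a..b})"
 shows "\<exists>e>0. \<forall>t\<in>{a..b}. \<bar>t - t0\<bar> < e --> x t = y t"
proof -
 obtain R where R: "R > 0" "cball (x t0) R \<subseteq> A" using A xy(2) open_contains_cball by blast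
 have "Ck_on (Suc 0) A F" using F by (simp add: smooth_on_def)
 from C1_bound_Lipschitz[OF A this compact_cball convex_cball R(2)]
 obtain L where L: "L > 0" "!!a b. a \<in> cball (x t0) R ==> b \<in> cball (x t0) R ==> norm (F b - F a) <= L * norm (b - a)"
  by metis
 have near: "\<exists>e>0. \<forall>t\<in>{a..b}. \<bar>t - t0\<bar> < e --> z t \<in> cball (x t0) R"
  if z: "z t0 = x t0" "!!t. t \<in> {a..b} ==> \<bar>t - t0\<bar> < d ==> (z has_vector_derivative F (z t)) (at t within {a..b})"
  for z :: "real => 'e"
 proof -
  have "continuous (at t0 within {a..b}) z"
   by (rule has_vector_derivative_continuous[OF z(2)]) (use t0 d in auto)
  then obtain e where e: "e > 0" "!!t. t \<in> {a..b} ==> dist t t0 < e ==> dist (z t) (z t0) < R"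
   using R(1) unfolding continuous_within_eps_delta by metis
  then show ?thesis by (intro exI[of _ e]) (auto simp: z(1) dist_commute dist_real_def less_imp_le)
 qed
 obtain e1 where e1: "e1 > 0" "!!t. t \<in> {a..b} ==> \<bar>t - t0\<bar> < e1 ==> x t \<in> cball (x t0) R"
  using near[OF refl x] by blast
 obtain e2 where e2: "e2 > 0" "!!t. t \<in> {a..b} ==> \<bar>t - t0\<bar> < e2 ==> y t \<in> cball (x t0) R"
  using near[OF xy(1)[symmetric] y] by blast
 define e where "e = min d (min e1 e2) / 2"
 have e: "e > 0" "e < d" "e < e1" "e < e2" using d e1(1) e2(1) by (auto simp: e_def min_def)
 define a' b' where "a' = max a (t0 - e)" and "b' = min b (t0 + e)"
 have in': "t \<in> {a..b}" "\<bar>t - t0\<bar> <= e" if "t \<in> {a'..b'}" for t using that by (auto simp: a'_def b'_def)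
 have sub: "{a'..b'} \<subseteq> {a..b}" using in' by blast
 have "x t = y t" if "t \<in> {a..b}" "\<bar>t - t0\<bar> < e" for t
 proof (rule ode_unique[of t0 a' b' x y "\<lambda>t. F (x t)" "\<lambda>t. F (y t)" L])
  show "t0 \<in> {a'..b'}" "t \<in> {a'..b'}" using t0 e that by (auto simp: a'_def b'_def)
  fix s assume s: "s \<in> {a'..b'}"
  have s': "s \<in> {a..b}" "\<bar>s - t0\<bar> < d" "\<bar>s - t0\<bar> < e1" "\<bar>s - t0\<bar> < e2" using in'[OF s] e by auto
  show "(x has_vector_derivative F (x s)) (at s within {a'..b'})"
   using has_vector_derivative_within_subset[OF x[OF s'(1,2)] sub] .
  show "(y has_vector_derivative F (y s)) (at s within {a'..b'})"
   using has_vector_derivative_within_subset[OF y[OF s'(1,2)] sub] .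
  show "norm (F (x s) - F (y s)) <= L * norm (x s - y s)"
   by (rule L(2)[OF e2(2)[OF s'(1,4)] e1(2)[OF s'(1,3)]])
 qed (rule xy)
 then show ?thesis using e(1) by blast
qed

locale geodesic_field = geodesic_chart S M' x0 b
 for S :: "('m::{t2_space,second_countable_topology}, 'n::finite, 'u::topological_space, 'r::finite) control_problem"
  and M' :: "'m set" and x0 :: 'm and b :: "'m set \<times> ('u => real^'r)" +
 fixes \<eta> :: "real^'n" and \<tau> r \<rho> :: real and X P :: "real \<times> (real^'n) \<times> (real^'n) => real^'n"
  and A :: "real \<times> (real^'n) \<times> (real^'n) => real" and Y :: "real \<times> (real^'n) \<times> (real^'n) => real^'n"
  and B1 B2 :: "(real \<times> (real^'n) \<times> (real^'n)) set"
 assumes field: "extremal_field Om f l y0 \<eta> \<tau> r \<rho> X P A Y B1 B2"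
begin

sublocale extremal_field Om f l y0 \<eta> \<tau> r \<rho> X P A Y B1 B2 by (rule field)

text \<open>In canonical coordinates the Hamiltonian curve and the central extremal solve the same
  differential equation with the same initial value.\<close>

lemma geodesic_in_chart:
 assumes \<Lambda>: "hamiltonian_curve S \<Lambda>" "\<Lambda> 0 = (x0, \<eta>)"
 shows "\<exists>\<delta>>0. \<delta> <= \<tau> \<and> (\<forall>t. \<bar>t\<bar> < \<delta> --> fst (\<Lambda> t) = cinv c (gam t) \<and>
  maximizer S (fst (\<Lambda> t)) (snd (\<Lambda> t)) = fp (gam t, us (gam t, lam t)))"
proof -
 define q where "q = (\<lambda>s. snd c (fst (\<Lambda> s)))"
 define p where "p = (\<lambda>s. ccomp S c (fst (\<Lambda> s)) (snd (\<Lambda> s)))"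
 have oU: "open (cinv c ` Om)" by (rule open_cinv_image[OF c(1) open_Om]) (use OmD(5) in auto)
 have "isCont (\<lambda>t. fst (\<Lambda> t)) 0"
  using \<Lambda>(1) by (simp add: hamiltonian_curve_def continuous_on_eq_continuous_at)
 moreover have "fst (\<Lambda> 0) \<in> cinv c ` Om" using \<Lambda>(2) y0_in cinv_y0 by force
 ultimately have "\<forall>\<^sub>F t in at 0. fst (\<Lambda> t) \<in> cinv c ` Om"
  unfolding isCont_def using oU topological_tendstoD by blast
 then obtain d where d: "d > 0" "!!t. t \<noteq> 0 ==> \<bar>t\<bar> < d ==> fst (\<Lambda> t) \<in> cinv c ` Om"
  unfolding eventually_at by (auto simp: dist_real_def)
 have inU: "fst (\<Lambda> t) \<in> cinv c ` Om" if "\<bar>t\<bar> < d" for t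
  using d(2)[of t] that \<open>fst (\<Lambda> 0) \<in> cinv c ` Om\<close> by (cases "t = 0") auto
 have q: "q t \<in> Om" "fst (\<Lambda> t) = cinv c (q t)" if "\<bar>t\<bar> < d" for t
  using inU[OF that] OmD(2) by (auto simp: q_def)
 let ?F = "\<lambda>z. (fu z, - Hy z)"
 have D: "((\<lambda>t. (q t, p t)) has_vector_derivative ?F (q t, p t)) (at t)" if t: "\<bar>t\<bar> < d" for t
 proof -
  have x: "fst (\<Lambda> t) \<in> fst c" using q[OF t] OmD(1) by simp
  obtain q' p' where q': "(q has_vector_derivative q') (at t)" "(p has_vector_derivative p') (at t)"
   "!!\<zeta>. frechet_derivative (\<lambda>\<xi>. ham_in_chart S c (q t) \<xi>) (at (p t)) \<zeta> = \<zeta> \<bullet> q'"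
   "!!v. frechet_derivative (\<lambda>y. ham_in_chart S c y (p t)) (at (q t)) v = - (p' \<bullet> v)"
   using \<Lambda>(1) c(1) x unfolding hamiltonian_curve_def Let_def q_def p_def by blast
  have o: "(q t, p t) \<in> Om \<times> UNIV" using q(1)[OF t] by simp
  have "\<zeta> \<bullet> q' = \<zeta> \<bullet> fu (q t, p t)" for \<zeta>
   using q'(3)[of \<zeta>] by (simp add: ham_in_chart_H[OF q(1)[OF t]]
    dd_slice_snd[OF smooth_diffble[OF smooth_H o]] dd_H_covector[OF q(1)[OF t]])
  then have 1: "q' = fu (q t, p t)" by (metis vector_eq_ldot)
  have "- (p' \<bullet> v) = v \<bullet> Hy (q t, p t)" for v
  proof -
   have "dd v (\<lambda>y. ham_in_chart S c y (p t)) (q t) = dd v (\<lambda>y. H (y, p t)) (q t)"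
    by (rule dd_cong[OF open_Om q(1)[OF t]]) (rule ham_in_chart_H)
   then show ?thesis using q'(4)[of v] by (simp add:
    dd_slice_fst[OF smooth_diffble[OF smooth_H o]] dd_H_point[OF q(1)[OF t]])
  qed
  then have "(- p') \<bullet> v = Hy (q t, p t) \<bullet> v" for v by (metis inner_commute inner_minus_left)
  then have 2: "p' = - Hy (q t, p t)" by (metis minus_minus vector_eq_rdot)
  show ?thesis using has_vector_derivative_Pair[OF q'(1,2)] by (simp add: 1 2)
 qed
 have D': "((\<lambda>t. (gam t, lam t)) has_vector_derivative ?F (gam t, lam t)) (at t)" if t: "\<bar>t\<bar> < \<tau>" for t
 proof -
  have "(t, y0, \<eta>) \<in> B1" using base_B1[of t] t by (auto simp: abs_less_iff)
  then show ?thesis unfolding gam_def lam_def by (intro has_vector_derivative_Pair dX dP)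
 qed
 have "\<exists>e>0. \<forall>t\<in>{-1..1}. \<bar>t - 0\<bar> < e --> (q t, p t) = (gam t, lam t)"
 proof (rule ode_unique_near[where A = "Om \<times> UNIV" and F = ?F and d = "min d \<tau>"])
  show "open (Om \<times> UNIV :: ((real^'n) \<times> (real^'n)) set)" by (simp add: open_Om open_Times)
  then show "smooth_on (Om \<times> UNIV) ?F" by (intro smooth_Pair smooth_minus smooth_fu smooth_Hy)
  show "(q 0, p 0) = (gam 0, lam 0)"
   unfolding q_def p_def \<Lambda>(2) fst_conv snd_conv ccomp_x0 gam_0 lam_0 by (simp add: y0_def)
  show "(q 0, p 0) \<in> Om \<times> UNIV" using q(1)[of 0] d(1) by simp
  show "min d \<tau> > 0" using d(1) pos by simp
  fix t :: real assume "\<bar>t - 0\<bar> < min d \<tau>"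
  then have t: "\<bar>t\<bar> < d" "\<bar>t\<bar> < \<tau>" by auto
  show "((\<lambda>t. (q t, p t)) has_vector_derivative ?F (q t, p t)) (at t within {-1..1})"
   by (rule has_vector_derivative_at_within[OF D[OF t(1)]])
  show "((\<lambda>t. (gam t, lam t)) has_vector_derivative ?F (gam t, lam t)) (at t within {-1..1})"
   by (rule has_vector_derivative_at_within[OF D'[OF t(2)]])
 qed simp
 then obtain e where e: "e > 0" "!!t. t \<in> {-1..1} ==> \<bar>t\<bar> < e ==> q t = gam t \<and> p t = lam t" by auto
 have "fst (\<Lambda> t) = cinv c (gam t) \<and> maximizer S (fst (\<Lambda> t)) (snd (\<Lambda> t)) = fp (gam t, us (gam t, lam t))"
  if t: "\<bar>t\<bar> < min (min 1 \<tau>) (min d e)" for t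
 proof -
  have t': "\<bar>t\<bar> < d" "q t = gam t" "p t = lam t" using t e(2)[of t] by (auto simp: abs_less_iff)
  have "maximizer S (cinv c (q t)) (snd (\<Lambda> t)) = fp (q t, us (q t, p t))"
   by (rule ham_H(2)[OF q(1)[OF t'(1)]]) (use ccomp_tcomp[OF q(1)[OF t'(1)]] q(2)[OF t'(1)] in "simp add: p_def")
  then show ?thesis using q(2)[OF t'(1)] t' by simp
 qed
 then have "\<forall>t. \<bar>t\<bar> < min (min 1 \<tau>) (min d e) --> fst (\<Lambda> t) = cinv c (gam t) \<and>
  maximizer S (fst (\<Lambda> t)) (snd (\<Lambda> t)) = fp (gam t, us (gam t, lam t))" by blast
 moreover have "min (min 1 \<tau>) (min d e) > 0" "min (min 1 \<tau>) (min d e) <= \<tau>" using d(1) e(1) pos by auto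
 ultimately show ?thesis by blast
qed

end

section \<open>Admissible curves\<close>

context affine_tonelli
begin

lemma action_integral: "action S s v = integral\<^sup>L (lebesgue_on {0..s}) (\<lambda>t. lag S (v t))"
 by (simp add: action_def set_lebesgue_integral_def integral_restrict_space fmeasurableD)

lemma integrable_lag:
 assumes "admissible S s \<zeta> v"
 shows "integrable (lebesgue_on {0..s}) (\<lambda>t. lag S (v t))"
proof -
 obtain K where K: "compact K" "AE t in lebesgue_on {0..s}. v t \<in> K" and m: "v \<in> measurable (lebesgue_on {0..s}) borel"
  using assms unfolding admissible_def by blast
 have "compact (lag S ` K)" by (rule compact_continuous_image[OF continuous_on_subset[OF continuous_lag] K(1)]) simp
 then obtain B where B: "!!e. e \<in> K ==> norm (lag S e) <= B" by (metis compact_imp_bounded bounded_iff imageI)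
 have "finite_measure (lebesgue_on {0..s})"
  by (rule finite_measure_lebesgue_on) simp
 then show ?thesis
 proof (rule finite_measure.integrable_const_bound)
  show "AE t in lebesgue_on {0..s}. norm (lag S (v t)) <= B" using K(2) by eventually_elim (rule B)
  show "(\<lambda>t. lag S (v t)) \<in> borel_measurable (lebesgue_on {0..s})"
   by (rule measurable_compose[OF m borel_measurable_continuous_onI[OF continuous_lag]])
 qed
qed

text \<open>Fenchel's inequality at covector 0 bounds the Lagrangian from below by
  \<open>- H (y, 0)\<close>, which is continuous in \<open>y\<close>; compactness of
  \<open>Q\<close> makes the bound uniform over its fibres.\<close>

lemma lag_bounded_below:
 assumes Q: "compact Q"
 obtains K where "K \<ge> 0" "!!e. proj S e \<in> Q ==> - K <= lag S e"
proof -
 have "\<exists>U K. open U \<and> x \<in> U \<and> (\<forall>e. proj S e \<in> U --> - K <= lag S e)" for x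
 proof -
  obtain b where b: "b \<in> trivs S" "x \<in> fst b" using triv_exists by blast
  interpret G: geodesic_chart S UNIV x b by unfold_locales (use b in auto)
  have ct: "continuous_on G.Om (\<lambda>y. G.H (y, 0))"
   by (rule continuous_on_compose2[OF smooth_continuous[OF G.smooth_H]]) (auto intro!: continuous_intros)
  define V where "V = G.Om \<inter> (\<lambda>y. G.H (y, 0)) -` {..<G.H (G.y0, 0) + 1}"
  have oV: "open V" unfolding V_def by (rule continuous_open_preimage[OF ct G.open_Om open_lessThan])
  have VO: "V \<subseteq> G.Om" "G.y0 \<in> V" using G.y0_in by (auto simp: V_def)
  have "- (G.H (G.y0, 0) + 1) <= lag S e" if eV: "proj S e \<in> cinv G.c ` V" for e
  proof -
   obtain y where y: "y \<in> V" "proj S e = cinv G.c y" using eV by blast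
   have yO: "y \<in> G.Om" using y VO by blast
   have "- lag S e <= G.H (y, 0)" using G.Fenchel[OF yO, of 0] G.lag_l[OF yO y(2)] by simp
   moreover have "G.H (y, 0) < G.H (G.y0, 0) + 1" using y(1) by (simp add: V_def)
   ultimately show ?thesis by linarith
  qed
  moreover have "open (cinv G.c ` V)" by (rule open_cinv_image[OF G.c(1) oV]) (use VO G.OmD(5) in auto)
  moreover have "x \<in> cinv G.c ` V" using VO(2) G.cinv_y0 by force
  ultimately show ?thesis by blast
 qed
 then obtain U K where U: "!!x. open (U x)" "!!x. x \<in> U x" "!!x e. proj S e \<in> U x ==> - K x <= lag S e"
  by metis
 obtain I where I: "finite I" "Q \<subseteq> (\<Union>x\<in>I. U x)"
  using compactE_image[OF Q, of UNIV U] U(1,2) by (metis UNIV_I UN_iff subsetI)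
 show thesis
 proof (rule that[of "\<Sum>x\<in>I. \<bar>K x\<bar>"])
  fix e assume "proj S e \<in> Q"
  then obtain x where x: "x \<in> I" "proj S e \<in> U x" using I(2) by blast
  have "\<bar>K x\<bar> <= (\<Sum>x\<in>I. \<bar>K x\<bar>)" by (rule member_le_sum[OF x(1)]) (use I(1) in auto)
  with U(3)[OF x(2)] show "- (\<Sum>x\<in>I. \<bar>K x\<bar>) <= lag S e" by linarith
 qed (simp add: sum_nonneg)
qed

lemma lipschitz_in_chart:
 assumes \<zeta>: "lipschitz_curve S s \<zeta>" and c: "c \<in> atlas S" and s': "s' <= s"
  and in': "!!t. t \<in> {0..s'} ==> \<zeta> t \<in> fst c"
 obtains L where "L-lipschitz_on {0..s'} (\<lambda>t. snd c (\<zeta> t))"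
proof -
 let ?z = "\<lambda>t. snd c (\<zeta> t)"
 have "continuous_on {0..s'} \<zeta>"
  using \<zeta> s' continuous_on_subset unfolding lipschitz_curve_def by fastforce
 then have ct: "continuous_on {0..s'} ?z"
  by (rule continuous_on_compose2[OF continuous_chart[OF c]]) (use in' in auto)
 have "local_lipschitz {0::real} {0..s'} (\<lambda>_. ?z)"
 proof (rule local_lipschitzI)
  fix t x :: real assume x: "x \<in> {0..s'}"
  then have "x \<in> {0..s}" using s' by auto
  then obtain \<delta> K where \<delta>: "\<delta> > 0" "K-lipschitz_on ({0..s} \<inter> ball x \<delta>) ?z"
   using \<zeta> c in'[OF x] unfolding lipschitz_curve_def by blast
  have "K-lipschitz_on (cball x (\<delta> / 2) \<inter> {0..s'}) ?z"
   by (rule lipschitz_on_subset[OF \<delta>(2)]) (use s' \<delta>(1) in auto)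
  then show "\<exists>u>0. \<exists>L. \<forall>t\<in>cball t u \<inter> {0}. L-lipschitz_on (cball x u \<inter> {0..s'}) ?z"
   using \<delta>(1) by (intro exI[of _ "\<delta> / 2"] conjI exI[of _ K]) auto
 qed
 then obtain L where "!!t. t \<in> {0::real} ==> L-lipschitz_on {0..s'} ?z"
  by (rule local_lipschitz_compact_implies_lipschitz) auto
 then show thesis using that by blast
qed

end

context geodesic_chart
begin

lemma chart_curve_admissible:
 assumes J: "open J" "{0..s} \<subseteq> J" and z: "smooth_on J z" "!!t. t \<in> J ==> z t \<in> Om"
  and w: "continuous_on J w"
  and dz: "!!t. t \<in> J ==> (z has_vector_derivative f (z t, w t)) (at t)"
 shows "admissible S s (\<lambda>t. cinv c (z t)) (\<lambda>t. fp (z t, w t))"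
proof -
 let ?\<zeta> = "\<lambda>t. cinv c (z t)" and ?v = "\<lambda>t. fp (z t, w t)"
 have zc: "continuous_on J z" by (rule smooth_continuous[OF z(1)])
 have ct: "continuous_on J ?\<zeta>"
  by (rule continuous_on_compose2[OF continuous_cinv[OF c(1)] zc]) (use z(2) OmD(5) in auto)
 have cv: "continuous_on J ?v"
  by (rule continuous_on_compose2[OF continuous_fp continuous_on_Pair[OF zc w]]) (use z(2) in auto)
 have lip: "\<exists>\<delta>>0. \<exists>K. K-lipschitz_on ({0..s} \<inter> ball t \<delta>) (\<lambda>s. snd d (?\<zeta> s))"
  if t: "t \<in> {0..s}" "d \<in> atlas S" "?\<zeta> t \<in> fst d" for t d
 proof -
  define J' where "J' = J \<inter> z -` (snd c ` (fst c \<inter> fst d))"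
  have oJ': "open J'" unfolding J'_def
   by (rule continuous_open_preimage[OF zc J(1) open_chart_image[OF c(1) chart_open[OF t(2)]]])
  have tJ: "t \<in> J" using t(1) J(2) by blast
  have "z t \<in> snd c ` (fst c \<inter> fst d)"
   using image_chart[OF c(1), of "z t" "fst d"] OmD(5)[OF z(2)[OF tJ]] t(3) by simp
  then have "t \<in> J'" using tJ by (simp add: J'_def)
  then obtain \<delta> where \<delta>: "\<delta> > 0" "cball t \<delta> \<subseteq> J'" using oJ' open_contains_cball by blast
  have "smooth_on J' (\<lambda>t. (snd d \<circ> cinv c) (z t))"
   by (rule smooth_compose[OF oJ' open_chart_image[OF c(1) chart_open[OF t(2)]] _ transition_smooth[OF c(1) t(2)]
     smooth_subset[OF z(1)]]) (auto simp: J'_def)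
  then have "Ck_on (Suc 0) J' (\<lambda>t. snd d (?\<zeta> t))" by (simp add: smooth_on_def)
  from C1_bound_Lipschitz[OF oJ' this compact_cball convex_cball \<delta>(2)]
  obtain L where L: "L > 0" "!!a b. a \<in> cball t \<delta> ==> b \<in> cball t \<delta> ==>
    norm (snd d (?\<zeta> b) - snd d (?\<zeta> a)) <= L * norm (b - a)" by metis
  have "L-lipschitz_on ({0..s} \<inter> ball t \<delta>) (\<lambda>s. snd d (?\<zeta> s))"
   by (rule lipschitz_onI) (use L in "auto simp: dist_norm")
  then show ?thesis using \<delta>(1) by blast
 qed
 have vel: "velocity S {0..s} ?\<zeta> t (dyn S (?v t))" if t: "t \<in> {0..s}" for t
 proof (rule velocityI[OF _ _ t c(1)])
  have zt: "z t \<in> Om" using t J(2) z(2) by blast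
  show "?\<zeta> t \<in> fst c" by (rule OmD(1)[OF zt])
  show "continuous (at t within {0..s}) ?\<zeta>"
   using continuous_on_subset[OF ct J(2)] t by (simp add: continuous_on_eq_continuous_within)
  have "(z has_vector_derivative tcomp S c (?\<zeta> t) (dyn S (?v t))) (at t within {0..s})"
   using has_vector_derivative_at_within[OF dz] t J(2) by (auto simp: f_def)
  then show "((\<lambda>s. snd c (?\<zeta> s)) has_vector_derivative tcomp S c (?\<zeta> t) (dyn S (?v t))) (at t within {0..s})"
   by (rule has_vector_derivative_transform[OF t, rotated]) (use J(2) z(2) OmD(2) in auto)
 qed
 have cv': "continuous_on {0..s} ?v" by (rule continuous_on_subset[OF cv J(2)])
 show ?thesis
  unfolding admissible_def lipschitz_curve_def
 proof (intro conjI ballI impI)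
  show "continuous_on {0..s} ?\<zeta>" by (rule continuous_on_subset[OF ct J(2)])
  show "?v \<in> measurable (lebesgue_on {0..s}) borel"
  proof -
   have "?v \<in> measurable (restrict_space borel {0..s}) borel" by (rule borel_measurable_continuous_on_restrict[OF cv'])
   moreover have "(\<lambda>t. t) \<in> measurable (lebesgue_on {0..s}) (restrict_space borel {0..s})"
    by (rule measurable_restrict_space3[OF measurable_completion]) auto
   ultimately show ?thesis using measurable_compose by blast
  qed
  show "\<exists>K. compact K \<and> (AE t in lebesgue_on {0..s}. ?v t \<in> K)"
   by (intro exI[of _ "?v ` {0..s}"] conjI compact_continuous_image cv' AE_I2) (auto simp: space_restrict_space)
  show "AE t in lebesgue_on {0..s}. velocity S {0..s} ?\<zeta> t (dyn S (?v t))"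
   by (rule AE_I2) (use vel in "auto simp: space_restrict_space")
  show "proj S (?v t) = ?\<zeta> t" if "t \<in> {0..s}" for t using that J(2) z(2) fp(1) by blast
 qed (use lip in auto)
qed

end

section \<open>Optimality of the extremals\<close>

context geodesic_chart
begin

text \<open>A function that grows along every velocity \<open>(1, f (y, w))\<close> at rate at most
  \<open>l + k\<close> bounds the action of any competitor from below. The curve is only Lipschitz,
  hence \<open>Lipschitz_increment_le_integral\<close>. The intermediate time \<open>s'\<close>
  serves for curves that leave the chart later.\<close>

lemma calibration:
 assumes adm: "admissible S s \<zeta> v" and s': "0 <= s'" "s' <= s"
  and K: "compact K" "convex K" "K \<subseteq> Om" "!!t. t \<in> {0..s'} ==> \<zeta> t \<in> cinv c ` K"
  and g: "open D" "smooth_on D g" "{0..s'} \<times> K \<subseteq> D"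
  and le: "!!t y w. t \<in> {0..s'} ==> y \<in> K ==> dd (1, f (y, w)) g (t, y) <= l (y, w) + k"
 shows "g (s', snd c (\<zeta> s')) - g (0, snd c (\<zeta> 0)) <= integral\<^sup>L (lebesgue_on {0..s'}) (\<lambda>t. lag S (v t) + k)"
proof -
 define z where "z = (\<lambda>t. snd c (\<zeta> t))"
 have z: "z t \<in> K" "\<zeta> t = cinv c (z t)" "z t \<in> Om" if t: "t \<in> {0..s'}" for t
 proof -
  obtain y where y: "y \<in> K" "\<zeta> t = cinv c y" using K(4)[OF t] by blast
  have "z t = y" using OmD(2)[of y] y K(3) by (auto simp: z_def)
  then show "z t \<in> K" "\<zeta> t = cinv c (z t)" "z t \<in> Om" using y K(3) by auto
 qed
 have lc: "lipschitz_curve S s \<zeta>" using adm by (simp add: admissible_def)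
 have inc: "\<zeta> t \<in> fst c" if "t \<in> {0..s'}" for t using OmD(1)[OF z(3)[OF that]] z(2)[OF that] by simp
 obtain L where L: "L-lipschitz_on {0..s'} z"
  unfolding z_def by (rule lipschitz_in_chart[OF lc c(1) s'(2) inc])
 have "Ck_on (Suc 0) D g" using g(2) by (simp add: smooth_on_def)
 from C1_bound_Lipschitz[OF g(1) this compact_Times[OF compact_Icc K(1)] convex_Times[OF convex_real_interval(5) K(2)] g(3)]
 obtain L' where L': "L' > 0" "!!a b. a \<in> {0..s'} \<times> K ==> b \<in> {0..s'} \<times> K ==> norm (g b - g a) <= L' * norm (b - a)"
  by metis
 define h where "h = (\<lambda>t. g (t, z t))"
 have hL: "(L' * (1 + L))-lipschitz_on {0..s'} h"
 proof (rule lipschitz_onI)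
  fix t t' assume t: "t \<in> {0..s'}" "t' \<in> {0..s'}"
  have "dist (h t) (h t') <= L' * norm ((t, z t) - (t', z t'))"
   using L'(2)[of "(t', z t')" "(t, z t)"] t z(1) by (simp add: h_def dist_norm)
  also have "... <= L' * (norm (t - t') + norm (z t - z t'))"
   using L'(1) norm_Pair_le[of "t - t'" "z t - z t'"] by (intro mult_left_mono) auto
  also have "... <= L' * (norm (t - t') + L * norm (t - t'))"
   using L'(1) lipschitz_onD[OF L t] by (intro mult_left_mono add_left_mono) (auto simp: dist_norm)
  finally show "dist (h t) (h t') <= L' * (1 + L) * dist t t'" by (simp add: dist_norm algebra_simps)
 qed (use L'(1) lipschitz_on_nonneg[OF L] in auto)
 have sub: "{0..s'} \<subseteq> {0..s}" using s' by auto
 have sets: "{0..s} \<in> sets lebesgue" "{0..s'} \<in> sets lebesgue" for s s' :: real by (simp_all add: fmeasurableD)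
 have ae: "AE t in lebesgue_on {0..s'}. velocity S {0..s} \<zeta> t (dyn S (v t))"
 proof -
  have "AE t in lebesgue_on {0..s}. velocity S {0..s} \<zeta> t (dyn S (v t))" using adm by (simp add: admissible_def)
  then have "AE t in lebesgue. t \<in> {0..s} --> velocity S {0..s} \<zeta> t (dyn S (v t))"
   by (subst (asm) AE_restrict_space_iff) (simp_all add: sets)
  then have "AE t in lebesgue. t \<in> {0..s'} --> velocity S {0..s} \<zeta> t (dyn S (v t))"
   by eventually_elim (use sub in auto)
  then show ?thesis by (subst AE_restrict_space_iff) (simp_all add: sets)
 qed
 have "integrable (lebesgue_on {0..s'}) (\<lambda>t. lag S (v t))"
  using integrable_lag[OF adm] sub by (rule integrable_subinterval)
 moreover have "integrable (lebesgue_on {0..s'}) (\<lambda>t. k)"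
  using continuous_imp_integrable_real[of 0 s' "\<lambda>t. k"] by simp
 ultimately have int: "integrable (lebesgue_on {0..s'}) (\<lambda>t. lag S (v t) + k)" by simp
 have "h s' - h 0 <= integral\<^sup>L (lebesgue_on {0..s'}) (\<lambda>t. lag S (v t) + k)"
 proof (rule Lipschitz_increment_le_integral[OF s'(1) hL int])
  show "AE t in lebesgue_on {0..s'}. \<exists>D. (h has_vector_derivative D) (at t within {0..s'}) \<and> D <= lag S (v t) + k"
   using ae AE_space
  proof eventually_elim
   case (elim t)
   then have t: "t \<in> {0..s'}" "t \<in> {0..s}" using sub by (auto simp: space_restrict_space)
   have "continuous_on {0..s} \<zeta>" using lc by (simp add: lipschitz_curve_def)
   then have ct: "continuous (at t within {0..s}) \<zeta>" using t by (simp add: continuous_on_eq_continuous_within)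
   have pv: "proj S (v t) = cinv c (z t)" using adm t z(2)[OF t(1)] by (simp add: admissible_def)
   have "(z has_vector_derivative tcomp S c (\<zeta> t) (dyn S (v t))) (at t within {0..s})"
    unfolding z_def by (rule velocity_chart[OF elim(1) ct t(2) c(1) inc[OF t(1)]])
   then have "(z has_vector_derivative f (z t, snd b (v t))) (at t within {0..s})"
    using tcomp_dyn[OF z(3)[OF t(1)] pv] z(2)[OF t(1)] by simp
   then have dz: "(z has_vector_derivative f (z t, snd b (v t))) (at t within {0..s'})"
    by (rule has_vector_derivative_within_subset) (rule sub)
   have "((\<lambda>t. (t, z t)) has_vector_derivative (1, f (z t, snd b (v t)))) (at t within {0..s'})"
    by (intro has_vector_derivative_Pair dz has_vector_derivative_id)
   moreover have "(t, z t) \<in> D" using g(3) t(1) z(1)[OF t(1)] by blast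
   ultimately have "(h has_vector_derivative dd (1, f (z t, snd b (v t))) g (t, z t)) (at t within {0..s'})"
    using vector_derivative_diff_chain_within has_derivative_at_withinI smooth_deriv[OF g(2)]
    unfolding h_def by (fastforce simp: o_def)
   moreover have "dd (1, f (z t, snd b (v t))) g (t, z t) <= lag S (v t) + k"
    using le[OF t(1) z(1)[OF t(1)], of "snd b (v t)"] lag_l[OF z(3)[OF t(1)] pv] by simp
   ultimately show ?case by blast
  qed
 qed
 then show ?thesis by (simp add: h_def z_def)
qed

text \<open>Comparison with the linear function \<open>y \<mapsto> e \<bullet> y\<close>, where
  \<open>norm e \<le> 1\<close>: Fenchel's inequality bounds \<open>e \<bullet> f\<close> by
  \<open>l + k\<close>, so reaching the boundary of the ball costs at least the distance covered
  minus \<open>k\<close> times the time used. The rest of the curve costs at least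
  \<open>- k\<close> per unit time.\<close>

lemma action_lower_bound_exit:
 assumes cM: "compact (closure M')" and R: "0 < R" "cball y0 R \<subseteq> Om"
 obtains k where "k \<ge> 0" "!!s \<zeta> v x t. admissible S s \<zeta> v ==> \<zeta> ` {0..s} \<subseteq> M' ==> \<zeta> 0 = cinv c x ==>
  x \<in> ball y0 (R / 2) ==> t \<in> {0..s} ==> \<zeta> t \<notin> cinv c ` ball y0 R ==> R / 2 - k * s <= action S s v"
proof -
 have "compact (H ` (cball y0 R \<times> cball 0 1))"
  by (rule compact_continuous_image[OF continuous_on_subset[OF smooth_continuous[OF smooth_H]]])
   (use R(2) in "auto intro!: compact_Times")
 then obtain k1 where k1: "!!y e. y \<in> cball y0 R ==> e \<in> cball 0 1 ==> \<bar>H (y, e)\<bar> <= k1"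
  using compact_imp_bounded[THEN bounded_iff[THEN iffD1]] by (metis (no_types, lifting) SigmaI image_eqI real_norm_def)
 obtain k2 where k2: "k2 \<ge> 0" "!!e. proj S e \<in> closure M' ==> - k2 <= lag S e"
  by (rule lag_bounded_below[OF cM]) (rule that, assumption+)
 define k where "k = max k1 k2"
 let ?U = "cinv c ` ball y0 R"
 have bO: "ball y0 R \<subseteq> Om" using R(2) ball_subset_cball by blast
 have oU: "open ?U" by (rule open_cinv_image[OF c(1) open_ball]) (use bO OmD(5) in blast)
 have cU: "closed (cinv c ` cball y0 R)"
  by (intro compact_imp_closed compact_continuous_image continuous_on_subset[OF continuous_cinv[OF c(1)]] compact_cball)
   (use R(2) OmD(5) in blast)
 show thesis
 proof (rule that[of k])
  show "k \<ge> 0" using k2(1) by (simp add: k_def)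
  fix s \<zeta> v x t
  assume adm: "admissible S s \<zeta> v" and M: "\<zeta> ` {0..s} \<subseteq> M'" and x: "\<zeta> 0 = cinv c x" "x \<in> ball y0 (R / 2)"
   and t: "t \<in> {0..s}" "\<zeta> t \<notin> ?U"
  have ct: "continuous_on {0..s} \<zeta>" using adm by (simp add: admissible_def lipschitz_curve_def)
  define E where "E = {0..s} \<inter> \<zeta> -` (- ?U)"
  have E: "closed E" unfolding E_def by (rule continuous_closed_preimage[OF ct]) (use oU in "auto simp: closed_open")
  \<comment> \<open>The first exit time from the open ball; up to it the curve lies in the closed
    ball.\<close>
  define \<sigma> where "\<sigma> = Inf E"
  have bE: "bdd_below E" by (rule bdd_belowI[of _ 0]) (simp add: E_def)
  have "\<sigma> \<in> E" unfolding \<sigma>_def by (rule closed_contains_Inf[OF _ bE E]) (use t in "auto simp: E_def")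
  then have \<sigma>: "\<sigma> \<in> {0..s}" "\<zeta> \<sigma> \<notin> ?U" by (auto simp: E_def)
  have pre: "\<zeta> t' \<in> ?U" if t': "0 <= t'" "t' < \<sigma>" for t'
  proof (rule ccontr)
   assume "\<zeta> t' \<notin> ?U"
   then have "t' \<in> E" using t' \<sigma>(1) by (simp add: E_def)
   then have "\<sigma> <= t'" unfolding \<sigma>_def by (rule cInf_lower[OF _ bE])
   then show False using t' by simp
  qed
  have xb: "x \<in> ball y0 R" using x(2) R(1) by auto
  then have \<sigma>0: "0 < \<sigma>" using \<sigma> x(1) by (cases "\<sigma> = 0") auto
  have ins: "\<zeta> t' \<in> cinv c ` cball y0 R" if t': "t' \<in> {0..\<sigma>}" for t'
  proof -
   have ct': "continuous_on {0..\<sigma>} \<zeta>" by (rule continuous_on_subset[OF ct]) (use \<sigma> in auto)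
   have "closed ({0..\<sigma>} \<inter> \<zeta> -` (cinv c ` cball y0 R))" by (rule continuous_closed_preimage[OF ct' _ cU]) simp
   moreover have "{0..<\<sigma>} \<subseteq> {0..\<sigma>} \<inter> \<zeta> -` (cinv c ` cball y0 R)" using pre by fastforce
   ultimately have "closure {0..<\<sigma>} \<subseteq> {0..\<sigma>} \<inter> \<zeta> -` (cinv c ` cball y0 R)" by (rule closure_minimal[rotated])
   then show ?thesis using t' \<sigma>0 by auto
  qed
  obtain y1 where y1: "y1 \<in> cball y0 R" "\<zeta> \<sigma> = cinv c y1" using ins[of \<sigma>] \<sigma>0 by auto
  have y1R: "dist y0 y1 = R" using y1 \<sigma>(2) by (cases "y1 \<in> ball y0 R") auto
  have zz: "snd c (\<zeta> \<sigma>) = y1" "snd c (\<zeta> 0) = x"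
   using OmD(2) y1 x(1) xb R(2) bO by auto
  \<comment> \<open>The unit covector pointing from the starting point to the exit point.\<close>
  define e where "e = sgn (y1 - x)"
  have "R / 2 <= norm (y1 - x)"
   using y1R x(2) dist_triangle[of y0 y1 x] by (simp add: dist_norm norm_minus_commute)
  moreover have "e \<bullet> (y1 - x) = norm (y1 - x)"
   by (cases "y1 = x") (simp_all add: e_def sgn_div_norm dot_square_norm power2_eq_square)
  ultimately have e: "R / 2 <= e \<bullet> y1 - e \<bullet> x" by (simp add: inner_diff_right)
  have e1: "e \<in> cball 0 1" using norm_sgn[of "y1 - x"] by (simp add: e_def split: if_splits)
  have "e \<bullet> y1 - e \<bullet> x <= integral\<^sup>L (lebesgue_on {0..\<sigma>}) (\<lambda>t. lag S (v t) + k)"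
  proof (rule calibration[where g = "\<lambda>z. e \<bullet> snd z" and s' = \<sigma> and D = UNIV and K = "cball y0 R", OF adm, unfolded snd_conv zz])
   show "smooth_on UNIV (\<lambda>z :: real \<times> (real^'n). e \<bullet> snd z)"
    by (intro smooth_inner smooth_const smooth_linear bounded_linear_snd) auto
   fix t y w assume ty: "t \<in> {0..\<sigma>}" "y \<in> cball y0 R"
   have "((\<lambda>z :: real \<times> (real^'n). e \<bullet> snd z) has_derivative (\<lambda>h. e \<bullet> snd h)) (at (t, y))"
    by (auto intro!: derivative_eq_intros)
   from dd_eqI[OF this, of "(1, f (y, w))"]
   have "dd (1, f (y, w)) (\<lambda>z :: real \<times> (real^'n). e \<bullet> snd z) (t, y) = e \<bullet> f (y, w)" by simp
   also have "... <= l (y, w) + H (y, e)" using Fenchel[of y e w] ty R(2) by (auto simp: subset_iff)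
   finally show "dd (1, f (y, w)) (\<lambda>z :: real \<times> (real^'n). e \<bullet> snd z) (t, y) <= l (y, w) + k"
    using k1[OF ty(2) e1] by (simp add: k_def)
  qed (use R(2) ins \<sigma> in auto)
  \<comment> \<open>The integrand is nonnegative on all of \<open>{0..s}\<close>, as the curve stays
    in \<open>M'\<close>; so the integral may be extended beyond the exit time.\<close>
  also have "... <= integral\<^sup>L (lebesgue_on {0..s}) (\<lambda>t. lag S (v t) + k)"
  proof -
   have sets: "{0..s} \<in> sets lebesgue" "{0..\<sigma>} \<in> sets lebesgue" by (simp_all add: fmeasurableD)
   have int: "integrable (lebesgue_on {0..s}) (\<lambda>t. lag S (v t) + k)"
    using integrable_lag[OF adm] continuous_imp_integrable_real[of 0 s "\<lambda>t. k"] by simp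
   have nn: "0 <= lag S (v t) + k" if "t \<in> {0..s}" for t
   proof -
    have "proj S (v t) \<in> closure M'" using adm M that closure_subset[of M'] unfolding admissible_def by (metis image_subset_iff subsetD)
    from k2(2)[OF this] show ?thesis by (simp add: k_def)
   qed
   show ?thesis
    using int sets nn \<sigma>(1) by (simp add: integral_restrict_space integrable_restrict_space)
     (rule integral_mono', auto simp: indicator_def)
  qed
  also have "... = action S s v + k * s"
  proof -
   have "integral\<^sup>L (lebesgue_on {0..s}) (\<lambda>t. lag S (v t) + k) = action S s v + integral\<^sup>L (lebesgue_on {0..s}) (\<lambda>t. k)"
    unfolding action_integral
    by (rule Bochner_Integration.integral_add[OF integrable_lag[OF adm] continuous_imp_integrable_real]) simp
   moreover have "integral\<^sup>L (lebesgue_on {0..s}) (\<lambda>t. k) = k * s"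
    using t(1) by (subst lebesgue_integral_eq_integral[OF continuous_imp_integrable_real]) (auto simp: fmeasurableD)
   ultimately show ?thesis by simp
  qed
  finally show "R / 2 - k * s <= action S s v" using e by linarith
 qed
qed

end

context geodesic_field
begin

lemma extremal_admissible:
 assumes C: "(s, p) \<in> C" and s: "0 < s"
 obtains \<zeta> v where "admissible S s \<zeta> v" "\<zeta> 0 = cinv c (Yh (s, p))" "\<zeta> s = cinv c (gam s)" "\<zeta> ` {0..s} \<subseteq> M'"
  "action S s v = ah (s, p) - p \<bullet> Yh (s, p)"
proof -
 define x where "x = Yh (s, p)"
 let ?J = "{+-\<tau>}"
 have sJ: "s \<in> ?J" "p \<in> ball \<eta> \<rho>" using C by (auto simp: C_def)
 have em: "emb (cm (s, p)) = (s, x, p)" by (simp add: emb_def cm_def x_def Yh_def)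
 have "(s, x, p) \<in> B1" using emb_B1[OF cm_B2[OF C]] em by simp
 then have xp: "x \<in> ball y0 r" "p \<in> ball \<eta> r" by (auto simp: B1)
 have B: "(t, x, p) \<in> B1" if "t \<in> ?J" for t using that xp by (simp add: B1)
 have Xs: "X (s, x, p) = gam s" using X_emb[OF cm_B2[OF C]] em by (simp add: cm_def)
 define z where "z = (\<lambda>t. X (t, x, p))"
 define w where "w = (\<lambda>t. us (X (t, x, p), P (t, x, p)))"
 have oJ: "open ?J" by simp
 have sz: "smooth_on ?J z" "smooth_on ?J (\<lambda>t. P (t, x, p))"
  unfolding z_def using B
  by (auto intro!: smooth_compose[OF oJ open_B1 _ X] smooth_compose[OF oJ open_B1 _ P] smooth_Pair smooth_id)
 have zO: "z t \<in> Om" if "t \<in> ?J" for t unfolding z_def by (rule XOm[OF B[OF that]])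
 have "smooth_on ?J w" unfolding w_def
  by (rule smooth_compose[OF oJ open_Times[OF open_Om open_UNIV] _ smooth_us smooth_Pair[OF oJ sz(1)[unfolded z_def] sz(2)]])
   (use zO in "auto simp: z_def")
 then have cw: "continuous_on ?J w" by (rule smooth_continuous)
 have dz: "(z has_vector_derivative f (z t, w t)) (at t)" if "t \<in> ?J" for t
  using dX[OF B[OF that]] by (simp add: z_def w_def fu_def)
 have sub: "{0..s} \<subseteq> ?J" using sJ s by auto
 have adm: "admissible S s (\<lambda>t. cinv c (z t)) (\<lambda>t. fp (z t, w t))"
  by (rule chart_curve_admissible[OF oJ sub sz(1) zO cw dz])
 have lag: "lag S (fp (z t, w t)) = lu (X (t, x, p), P (t, x, p))" for t
  by (simp add: l_def[symmetric] lu_def z_def w_def)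
 have "integral\<^sup>L (lebesgue_on {0..s}) (\<lambda>t. lag S (fp (z t, w t))) = integral {0..s} (\<lambda>t. lag S (fp (z t, w t)))"
  by (rule lebesgue_integral_eq_integral[OF integrable_lag[OF adm]]) (simp add: fmeasurableD)
 also have "... = A (s, x, p) - A (0, x, p)"
 proof (rule integral_unique, rule fundamental_theorem_of_calculus)
  fix t assume "t \<in> {0..s}"
  then have "t \<in> ?J" using sub by blast
  from has_vector_derivative_at_within[OF dA[OF B[OF this]]]
  show "((\<lambda>t. A (t, x, p)) has_vector_derivative lag S (fp (z t, w t))) (at t within {0..s})" by (simp add: lag)
 qed (use s in simp)
 also have "... = ah (s, p) - p \<bullet> x"
  using init(3)[OF xp] em by (simp add: ah_def a_def cm_def x_def Yh_def)
 finally have act: "action S s (\<lambda>t. fp (z t, w t)) = ah (s, p) - p \<bullet> Yh (s, p)" by (simp add: action_integral x_def)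
 show thesis
 proof (rule that[OF adm _ _ _ act])
  show "cinv c (z 0) = cinv c (Yh (s, p))" using init(1)[OF xp] by (simp add: z_def x_def)
  show "cinv c (z s) = cinv c (gam s)" by (simp add: z_def Xs)
  show "(\<lambda>t. cinv c (z t)) ` {0..s} \<subseteq> M'" using zO OmD(4) sub by blast
 qed
qed

lemma ball_Om: "ball y0 \<rho> \<subseteq> Om"
 using x_Om[of "(0, _, \<eta>)"] pos by (auto simp: B2)

text \<open>Calibration by \<open>a\<close> with \<open>p\<close> fixed: the Hamilton-Jacobi
  equation and Fenchel's inequality bound its rate along any velocity by \<open>l\<close>. At time 0
  this function is \<open>p \<bullet> y\<close>, so its increment is exactly the action of the
  extremal.\<close>

lemma action_lower_bound_inside:
 assumes C: "(s, p) \<in> C" and s: "0 < s" and R: "0 < R" "R < \<rho>"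
  and adm: "admissible S s \<zeta> v" and e: "\<zeta> 0 = cinv c (Yh (s, p))" "\<zeta> s = cinv c (gam s)" "Yh (s, p) \<in> Om"
  and ins: "!!t. t \<in> {0..s} ==> \<zeta> t \<in> cinv c ` cball y0 R"
 shows "ah (s, p) - p \<bullet> Yh (s, p) <= action S s v"
proof -
 define E where "E = (\<lambda>z :: real \<times> (real^'n). (fst z, snd z, p))"
 have sJ: "s \<in> {+-\<tau>}" "p \<in> ball \<eta> \<rho>" using C by (auto simp: C_def)
 let ?D = "{+-\<tau>} \<times> ball y0 \<rho>"
 have oD: "open ?D" by (simp add: open_Times)
 have EB: "E z \<in> B2" if "z \<in> ?D" for z using that sJ by (auto simp: E_def B2)
 have sE: "smooth_on ?D E" unfolding E_def
  by (intro smooth_Pair oD smooth_const smooth_linear bounded_linear_fst bounded_linear_snd)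
 have sg: "smooth_on ?D (\<lambda>z. a (E z))"
  by (rule smooth_compose[OF oD open_B2 _ smooth_a sE]) (use EB in auto)
 have Kb: "cball y0 R \<subseteq> ball y0 \<rho>" using R by auto
 have sub: "{0..s} \<times> cball y0 R \<subseteq> ?D" using Kb sJ s by auto
 have "a (E (s, snd c (\<zeta> s))) - a (E (0, snd c (\<zeta> 0))) <= integral\<^sup>L (lebesgue_on {0..s}) (\<lambda>t. lag S (v t) + 0)"
 proof (rule calibration[where g = "\<lambda>z. a (E z)", OF adm _ _ compact_cball convex_cball _ ins oD sg sub])
  show "cball y0 R \<subseteq> Om" using Kb ball_Om by blast
  fix t y w assume ty: "t \<in> {0..s}" "y \<in> cball y0 R"
  have inD: "(t, y) \<in> ?D" using sub ty by blast
  have dE: "(E has_derivative (\<lambda>h. (fst h, snd h, 0))) (at (t, y))" unfolding E_def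
   by (intro has_derivative_Pair has_derivative_const bounded_linear_imp_has_derivative bounded_linear_fst bounded_linear_snd)
  from dd_eqI[OF has_derivative_compose[OF dE smooth_deriv[OF smooth_a EB[OF inD]]], of "(1, f (y, w))"]
  have "dd (1, f (y, w)) (\<lambda>z. a (E z)) (t, y) = Pf (E (t, y)) \<bullet> f (y, w) - H (y, Pf (E (t, y)))"
   using dd_a[OF EB[OF inD], of 1 "f (y, w)" 0] by (simp add: E_def)
  also have "... <= l (y, w)"
   using Fenchel[of y "Pf (E (t, y))" w] ty Kb ball_Om by (simp add: algebra_simps subset_iff)
  finally show "dd (1, f (y, w)) (\<lambda>z. a (E z)) (t, y) <= l (y, w) + 0" by simp
 qed (use s in simp_all)
 moreover have "snd c (\<zeta> 0) = Yh (s, p)" "snd c (\<zeta> s) = gam s"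
  using OmD(2)[OF e(3)] OmD(2)[OF gam_Om[OF sJ(1)]] e(1,2) by simp_all
 moreover have "a (0, y, p) = p \<bullet> y" if "y \<in> ball y0 \<rho>" for y
 proof -
  have B2: "(0, y, p) \<in> B2" using that sJ(2) pos by (simp add: B2)
  have Yr: "Y (0, y, p) \<in> ball y0 r" "p \<in> ball \<eta> r" using YB[OF B2] sJ(2) pos by auto
  have "Y (0, y, p) = y" using XY[OF B2] init(1)[OF Yr] by simp
  then show ?thesis using init(3)[OF Yr] by (simp add: a_def emb_def)
 qed
 moreover have "Yh (s, p) \<in> ball y0 \<rho>"
 proof -
  have "\<zeta> 0 \<in> cinv c ` cball y0 R" using ins s by simp
  then obtain y where y: "y \<in> cball y0 R" "cinv c (Yh (s, p)) = cinv c y" using e(1) by auto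
  then have "Yh (s, p) = y" using OmD(2)[OF e(3)] OmD(2)[of y] Kb ball_Om by (metis subsetD)
  then show ?thesis using y Kb by auto
 qed
 ultimately show ?thesis by (simp add: action_integral E_def ah_def cm_def)
qed

text \<open>The extremal beats the curves that stay in the ball by calibration, and the others
  because its action is below \<open>R / 4\<close> while leaving the ball costs at least
  \<open>R / 2 - k * s\<close>.\<close>

lemma cost_value:
 assumes cM: "compact (closure M')"
 obtains \<delta> \<kappa> where "0 < \<delta>" "\<delta> <= \<tau>" "0 < \<kappa>" "\<kappa> <= \<rho>"
  "!!s p \<gamma>. 0 < s ==> s < \<delta> ==> p \<in> ball \<eta> \<kappa> ==> \<gamma> s = cinv c (gam s) ==>
   cost S M' \<gamma> s (cinv c (Yh (s, p))) = ereal (p \<bullet> Yh (s, p) - ah (s, p))"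
proof -
 define R where "R = \<rho> / 2"
 have R: "0 < R" "R < \<rho>" "cball y0 R \<subseteq> Om" using pos ball_Om by (auto simp: R_def subset_iff)
 obtain k where k: "k \<ge> 0" "!!s \<zeta> v x t. admissible S s \<zeta> v ==> \<zeta> ` {0..s} \<subseteq> M' ==> \<zeta> 0 = cinv c x ==>
  x \<in> ball y0 (R / 2) ==> t \<in> {0..s} ==> \<zeta> t \<notin> cinv c ` ball y0 R ==> R / 2 - k * s <= action S s v"
  by (rule action_lower_bound_exit[OF cM R(1,3)]) (rule that, assumption+)
 define val where "val = (\<lambda>z. ah z - snd z \<bullet> Yh z)"
 have c0: "(0, \<eta>) \<in> C" by (rule center_C[OF zero_in])
 have "\<eta> \<in> ball \<eta> r" "y0 \<in> ball y0 r" using pos by auto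
 then have v0: "val (0, \<eta>) = 0"
  using init(3) Yh_0[of \<eta>] pos by (simp add: val_def ah_def a_def emb_def cm_def Yh_def)
 have "continuous_on C val" unfolding val_def
  by (intro continuous_on_diff continuous_on_inner continuous_on_snd continuous_on_id
    smooth_continuous[OF smooth_ah] smooth_continuous[OF smooth_Yh])
 then have "open (C \<inter> val -` {..<R / 4})" by (rule continuous_open_preimage[OF _ open_C]) simp
 moreover have "open (C \<inter> Yh -` ball y0 (R / 2))"
  by (rule continuous_open_preimage[OF smooth_continuous[OF smooth_Yh] open_C]) simp
 ultimately have "open ((C \<inter> val -` {..<R / 4}) \<inter> (C \<inter> Yh -` ball y0 (R / 2)))" by (rule open_Int)
 moreover have "(0, \<eta>) \<in> (C \<inter> val -` {..<R / 4}) \<inter> (C \<inter> Yh -` ball y0 (R / 2))"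
  using c0 v0 R(1) Yh_0[of \<eta>] pos by simp
 ultimately obtain e where e: "e > 0" "ball (0, \<eta>) e \<subseteq> (C \<inter> val -` {..<R / 4}) \<inter> (C \<inter> Yh -` ball y0 (R / 2))"
  unfolding open_contains_ball by blast
 \<comment> \<open>The last bound gives \<open>k * s \<le> R / 4\<close>; adding 1 to
   \<open>k\<close> avoids division by 0.\<close>
 define \<delta> where "\<delta> = min \<tau> (min (e / 2) (R / (4 * (k + 1))))"
 define \<kappa> where "\<kappa> = min \<rho> (e / 2)"
 show thesis
 proof (rule that[of \<delta> \<kappa>])
  show "0 < \<delta>" "\<delta> <= \<tau>" "0 < \<kappa>" "\<kappa> <= \<rho>" using pos e(1) R(1) k(1) by (auto simp: \<delta>_def \<kappa>_def)
  fix s p \<gamma>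
  assume s: "0 < s" "s < \<delta>" and p: "p \<in> ball \<eta> \<kappa>" and \<gamma>: "\<gamma> s = cinv c (gam s)"
  have "dist (0, \<eta>) (s, p) <= \<bar>s\<bar> + norm (\<eta> - p)"
   using norm_Pair_le[of "0 - s" "\<eta> - p"] by (simp add: dist_norm)
  also have "... < e" using s p by (simp add: \<delta>_def \<kappa>_def dist_norm)
  finally have "(s, p) \<in> ball (0, \<eta>) e" by simp
  then have C: "(s, p) \<in> C" and val: "val (s, p) < R / 4" and yb: "Yh (s, p) \<in> ball y0 (R / 2)" using e(2) by auto
  have yO: "Yh (s, p) \<in> Om" using yb R by (auto simp: subset_iff)
  have ks: "k * s <= R / 4"
  proof -
   have "s <= R / (4 * (k + 1))" using s by (simp add: \<delta>_def)
   then have "s * (4 * (k + 1)) <= R" using k(1) by (simp add: pos_le_divide_eq)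
   then show ?thesis using s(1) by (simp add: algebra_simps)
  qed
  obtain \<zeta>0 v0 where z: "admissible S s \<zeta>0 v0" "\<zeta>0 0 = cinv c (Yh (s, p))" "\<zeta>0 s = cinv c (gam s)" "\<zeta>0 ` {0..s} \<subseteq> M'"
   "action S s v0 = ah (s, p) - p \<bullet> Yh (s, p)"
   by (rule extremal_admissible[OF C s(1)]) (rule that, assumption+)
  have "value_fun S M' s (cinv c (Yh (s, p))) (\<gamma> s) = ereal (val (s, p))"
  proof (rule antisym)
   show "value_fun S M' s (cinv c (Yh (s, p))) (\<gamma> s) <= ereal (val (s, p))"
    unfolding value_fun_def by (rule Inf_lower) (use z \<gamma> in "auto simp: val_def intro!: exI[of _ \<zeta>0] exI[of _ v0]")
   show "ereal (val (s, p)) <= value_fun S M' s (cinv c (Yh (s, p))) (\<gamma> s)"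
    unfolding value_fun_def
   proof (rule Inf_greatest)
    fix r assume "r \<in> {ereal (action S s u) | \<gamma>' u. admissible S s \<gamma>' u \<and>
     \<gamma>' 0 = cinv c (Yh (s, p)) \<and> \<gamma>' s = \<gamma> s \<and> \<gamma>' ` {0..s} \<subseteq> M'}"
    then obtain \<zeta> v where \<zeta>: "r = ereal (action S s v)" "admissible S s \<zeta> v" "\<zeta> 0 = cinv c (Yh (s, p))"
     "\<zeta> s = cinv c (gam s)" "\<zeta> ` {0..s} \<subseteq> M'" using \<gamma> by auto
    have "val (s, p) <= action S s v"
    proof (cases "\<forall>t\<in>{0..s}. \<zeta> t \<in> cinv c ` ball y0 R")
     case True
     have "\<zeta> t \<in> cinv c ` cball y0 R" if "t \<in> {0..s}" for t
      by (rule subsetD[OF image_mono[OF ball_subset_cball] bspec[OF True that]])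
     from action_lower_bound_inside[OF C s(1) R(1,2) \<zeta>(2,3,4) yO this] show ?thesis by (simp add: val_def)
    next
     case False
     then obtain t where t: "t \<in> {0..s}" "\<zeta> t \<notin> cinv c ` ball y0 R" by blast
     show ?thesis using k(2)[OF \<zeta>(2,5,3) yb t] ks val by linarith
    qed
    then show "ereal (val (s, p)) <= r" using \<zeta>(1) by simp
   qed
  qed
  then show "cost S M' \<gamma> s (cinv c (Yh (s, p))) = ereal (p \<bullet> Yh (s, p) - ah (s, p))"
   by (simp add: cost_def val_def)
 qed
qed

end

section \<open>The second differential of the cost rate\<close>

lemma smooth_imp_smooth_curve_on:
 assumes g: "smooth_on J g" "open J" "I \<subseteq> J"
 shows "smooth_curve_on I g"
proof -
 let ?D = "\<lambda>k. ((\<lambda>g. dd 1 g) ^^ k) g"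
 have s: "smooth_on J (?D k)" for k by (induction k) (use g(1) smooth_dd in auto)
 have "(?D k has_vector_derivative ?D (Suc k) t) (at t within I)" if "t \<in> I" for k t
  using has_vector_derivative_at_within[OF smooth_vderiv[OF s]] that g(3) by auto
 then show ?thesis unfolding smooth_curve_on_def by (intro exI[of _ ?D]) auto
qed

context affine_tonelli
begin

text \<open>Near \<open>x\<close> the rate is determined by the cost as a derivative in time, and
  the Hessian depends only on the rate near \<open>x\<close>.\<close>

lemma cost_rate_second_differential_unique:
 assumes "cost_rate_second_differential S M' \<gamma> x t q" "cost_rate_second_differential S M' \<gamma> x t q'"
 shows "q = q'"
proof -
 obtain N g where N: "open N" "x \<in> N" "!!x. x \<in> N ==> ((\<lambda>s. real_of_ereal (cost S M' \<gamma> s x)) has_real_derivative g x) (at t)"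
  "second_differential_at_critical S g x q"
  using assms(1) unfolding cost_rate_second_differential_def by blast
 obtain N' g' where N': "open N'" "x \<in> N'" "!!x. x \<in> N' ==> ((\<lambda>s. real_of_ereal (cost S M' \<gamma> s x)) has_real_derivative g' x) (at t)"
  "second_differential_at_critical S g' x q'"
  using assms(2) unfolding cost_rate_second_differential_def by blast
 define c where "c = chart_at S x"
 have c: "c \<in> atlas S" "x \<in> fst c" by (simp_all add: c_def chart_at)
 define V where "V = snd c ` (fst c \<inter> (N \<inter> N'))"
 have oV: "open V" unfolding V_def by (rule open_chart_image[OF c(1) open_Int[OF N(1) N'(1)]])
 have yV: "snd c x \<in> V" using c N(2) N'(2) by (auto simp: V_def)
 have eq: "(g \<circ> cinv c) y = (g' \<circ> cinv c) y" if "y \<in> V" for y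
 proof -
  have "cinv c y \<in> N \<inter> N'" using that image_chart[OF c(1)] by (simp add: V_def)
  then show ?thesis using DERIV_unique[OF N(3) N'(3)] by auto
 qed
 have "hessian (g \<circ> cinv c) (snd c x) v v = hessian (g' \<circ> cinv c) (snd c x) v v" for v
  unfolding hessian_def by (intro dd_cong[OF oV yV] dd_cong[OF oV] eq)
 then show ?thesis using N(4) N'(4) by (simp add: second_differential_at_critical_def Let_def c_def)
qed

end

context geodesic_chart
begin

lemma G_exists: "v \<in> distribution S x0 ==> \<exists>\<zeta>. v = G \<eta> \<zeta>"
 using range_G[of \<eta>] by auto

lemma ham_inner_bilinear:
 assumes "v \<in> distribution S x0" "v' \<in> distribution S x0" "w \<in> distribution S x0"
 shows "ham_inner S x0 \<eta> (k *\<^sub>R v + k' *\<^sub>R v') w = k * ham_inner S x0 \<eta> v w + k' * ham_inner S x0 \<eta> v' w"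
  and "ham_inner S x0 \<eta> v w = ham_inner S x0 \<eta> w v" and "k *\<^sub>R v + k' *\<^sub>R v' \<in> distribution S x0"
proof -
 obtain \<zeta> \<zeta>' \<xi> where z: "v = G \<eta> \<zeta>" "v' = G \<eta> \<zeta>'" "w = G \<eta> \<xi>" using assms G_exists by meson
 have l: "k *\<^sub>R v + k' *\<^sub>R v' = G \<eta> (k *\<^sub>R \<zeta> + k' *\<^sub>R \<zeta>')"
  by (simp add: z linear_add[OF linear_G] linear_scale[OF linear_G])
 show "ham_inner S x0 \<eta> (k *\<^sub>R v + k' *\<^sub>R v') w = k * ham_inner S x0 \<eta> v w + k' * ham_inner S x0 \<eta> v' w"
  unfolding l unfolding z ham_inner_G by (simp add: inner_add_left)
 show "ham_inner S x0 \<eta> v w = ham_inner S x0 \<eta> w v"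
  unfolding z ham_inner_G using G_sym by (simp add: inner_commute)
 show "k *\<^sub>R v + k' *\<^sub>R v' \<in> distribution S x0" unfolding l range_G[of \<eta>, symmetric] by blast
qed

text \<open>Equal quadratic forms have equal polarizations, and the inner product is definite. This
  makes the choice in \<open>cost_operator\<close> harmless on the distribution.\<close>

lemma cost_operator_unique:
 assumes A: "is_cost_operator S N \<gamma> x0 \<eta> t A" and A': "is_cost_operator S N \<gamma> x0 \<eta> t A'"
  and v: "v \<in> distribution S x0"
 shows "A v = A' v"
proof -
 let ?I = "ham_inner S x0 \<eta>" and ?D = "distribution S x0"
 obtain q where q: "cost_rate_second_differential S N \<gamma> x0 t q" "!!v. v \<in> ?D ==> q v = ?I (A v) v"
  using A by (auto simp: is_cost_operator_def)
 obtain q' where q': "cost_rate_second_differential S N \<gamma> x0 t q'" "!!v. v \<in> ?D ==> q' v = ?I (A' v) v"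
  using A' by (auto simp: is_cost_operator_def)
 have eq: "?I (A v) v = ?I (A' v) v" if "v \<in> ?D" for v
  using cost_rate_second_differential_unique[OF q(1) q'(1)] q(2) q'(2) that by metis
 have s: "symmetric_operator S x0 \<eta> A" "symmetric_operator S x0 \<eta> A'" using A A' by (auto simp: is_cost_operator_def)
 have polar: "?I (B (v + w)) (v + w) = ?I (B v) v + 2 * ?I (B v) w + ?I (B w) w"
  if B: "symmetric_operator S x0 \<eta> B" and vw: "v \<in> ?D" "w \<in> ?D" for B v w
 proof -
  have BD: "B v \<in> ?D" "B w \<in> ?D" using B vw by (auto simp: symmetric_operator_def)
  have D: "v + w \<in> ?D" using ham_inner_bilinear(3)[OF vw vw(1), of 1 1] by simp
  have "B (1 *\<^sub>R v + 1 *\<^sub>R w) = 1 *\<^sub>R B v + 1 *\<^sub>R B w" using B vw unfolding symmetric_operator_def by blast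
  then have "B (v + w) = B v + B w" by simp
  then have "?I (B (v + w)) (v + w) = ?I (B v) (v + w) + ?I (B w) (v + w)"
   using ham_inner_bilinear(1)[OF BD D, of \<eta> 1 1] by simp
  also have "... = ?I (v + w) (B v) + ?I (v + w) (B w)"
   using ham_inner_bilinear(2)[OF BD(1) BD(1) D] ham_inner_bilinear(2)[OF BD(2) BD(2) D] by simp
  also have "... = (?I v (B v) + ?I w (B v)) + (?I v (B w) + ?I w (B w))"
   using ham_inner_bilinear(1)[OF vw BD(1), of \<eta> 1 1] ham_inner_bilinear(1)[OF vw BD(2), of \<eta> 1 1] by simp
  also have "... = ?I (B v) v + 2 * ?I (B v) w + ?I (B w) w"
  proof -
   have "?I v (B v) = ?I (B v) v" "?I w (B v) = ?I (B v) w" "?I v (B w) = ?I (B v) w" "?I w (B w) = ?I (B w) w"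
    using B vw unfolding symmetric_operator_def
    by (metis ham_inner_bilinear(2) BD)+
   then show ?thesis by simp
  qed
  finally show ?thesis .
 qed
 have full: "?I (A v) w = ?I (A' v) w" if "v \<in> ?D" "w \<in> ?D" for v w
 proof -
  have "v + w \<in> ?D" using ham_inner_bilinear(3)[OF that that(1), of 1 1] by simp
  with polar[OF s(1) that] polar[OF s(2) that] eq that show ?thesis by simp
 qed
 have AD: "A v \<in> ?D" "A' v \<in> ?D" using s v by (auto simp: symmetric_operator_def)
 define w where "w = A v - A' v"
 have w: "w \<in> ?D" using ham_inner_bilinear(3)[OF AD AD(1), of 1 "-1"] by (simp add: w_def)
 have "?I w w = 0" using ham_inner_bilinear(1)[OF AD w, of \<eta> 1 "-1"] full[OF v w] by (simp add: w_def)
 then show ?thesis using ham_inner_pos[OF w, of \<eta>] by (cases "w = 0") (auto simp: w_def)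
qed

text \<open>A symmetric form on covectors that vanishes on the kernel of \<open>G\<close> descends
  to the distribution. Its matrix maps into the range of \<open>G\<close>, because that range is the
  orthogonal complement of the kernel; so \<open>Q\<close> itself gives the operator.\<close>

lemma operator_of_form:
 fixes Q :: "real^'n^'n"
 assumes sym: "!!\<xi> \<zeta>. \<xi> \<bullet> (Q *v \<zeta>) = \<zeta> \<bullet> (Q *v \<xi>)" and ker: "!!\<xi> \<zeta>. G \<eta> \<zeta> = 0 ==> \<xi> \<bullet> (Q *v \<zeta>) = 0"
  and A: "A = (\<lambda>v. Q *v (SOME \<zeta>. v = G \<eta> \<zeta>))"
 shows "symmetric_operator S x0 \<eta> A" and "A (G \<eta> \<zeta>) = Q *v \<zeta>" and "ham_inner S x0 \<eta> (A (G \<eta> \<zeta>)) (G \<eta> \<xi>) = \<xi> \<bullet> (Q *v \<zeta>)"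
proof -
 have wd: "Q *v \<zeta> = Q *v \<zeta>'" if "G \<eta> \<zeta> = G \<eta> \<zeta>'" for \<zeta> \<zeta>'
 proof -
  have "G \<eta> (\<zeta> - \<zeta>') = 0" using that by (simp add: linear_diff[OF linear_G])
  then have "x \<bullet> (Q *v (\<zeta> - \<zeta>')) = 0" for x by (rule ker)
  then have "Q *v (\<zeta> - \<zeta>') = 0" by (metis inner_eq_zero_iff)
  then show ?thesis by (simp add: matrix_vector_mult_diff_distrib)
 qed
 have AG: "A (G \<eta> \<zeta>) = Q *v \<zeta>" for \<zeta>
  unfolding A by (rule wd) (rule someI2[of "\<lambda>\<zeta>'. G \<eta> \<zeta> = G \<eta> \<zeta>'"], auto)
 show "A (G \<eta> \<zeta>) = Q *v \<zeta>" by (rule AG)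
 have range: "Q *v \<zeta> \<in> range (G \<eta>)" for \<zeta>
 proof (rule ccontr)
  have sub: "subspace (range (G \<eta>))" using linear_subspace_image[OF linear_G subspace_UNIV] .
  assume "Q *v \<zeta> \<notin> range (G \<eta>)"
  moreover obtain y z where yz: "y \<in> span (range (G \<eta>))" "!!w. w \<in> span (range (G \<eta>)) ==> orthogonal z w" "Q *v \<zeta> = y + z"
   using orthogonal_subspace_decomp_exists by metis
  ultimately have "z \<noteq> 0" using sub by (auto simp: span_eq_iff[THEN iffD2])
  have "G \<eta> z \<bullet> w = 0" for w
   using yz(2)[of "G \<eta> w"] G_sym[of z \<eta> w] by (simp add: orthogonal_def span_base)
  then have "G \<eta> z = 0" by (metis inner_eq_zero_iff)
  then have "z \<bullet> (Q *v \<zeta>) = 0" using ker[of z \<zeta>] sym[of z \<zeta>] by simp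
  moreover have "z \<bullet> y = 0" using yz(2)[OF yz(1)] by (simp add: orthogonal_def)
  ultimately show False using yz(3) \<open>z \<noteq> 0\<close> by (simp add: inner_add_right)
 qed
 have hi: "ham_inner S x0 \<eta> (A (G \<eta> \<zeta>)) (G \<eta> \<xi>) = \<xi> \<bullet> (Q *v \<zeta>)" for \<zeta> \<xi>
 proof -
  obtain \<mu> where \<mu>: "Q *v \<zeta> = G \<eta> \<mu>" using range by blast
  show ?thesis unfolding AG \<mu> ham_inner_G using G_sym[of \<mu> \<eta> \<xi>] by (simp add: inner_commute)
 qed
 show "ham_inner S x0 \<eta> (A (G \<eta> \<zeta>)) (G \<eta> \<xi>) = \<xi> \<bullet> (Q *v \<zeta>)" by (rule hi)
 show "symmetric_operator S x0 \<eta> A"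
  unfolding symmetric_operator_def range_G[of \<eta>, symmetric]
 proof (intro conjI ballI allI)
  fix v assume "v \<in> range (G \<eta>)"
  then show "A v \<in> range (G \<eta>)" using AG range by auto
 next
  fix v w a b assume vw: "v \<in> range (G \<eta>)" "w \<in> range (G \<eta>)"
  then obtain \<zeta> \<xi> where z: "v = G \<eta> \<zeta>" "w = G \<eta> \<xi>" by blast
  have "a *\<^sub>R v + b *\<^sub>R w = G \<eta> (a *\<^sub>R \<zeta> + b *\<^sub>R \<xi>)"
   by (simp add: z linear_add[OF linear_G] linear_scale[OF linear_G])
  then show "A (a *\<^sub>R v + b *\<^sub>R w) = a *\<^sub>R A v + b *\<^sub>R A w"
   by (simp add: AG z matrix_vector_right_distrib scaleR_matrix_vector_assoc matrix_vector_mult_scaleR)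
 next
  fix v w assume vw: "v \<in> range (G \<eta>)" "w \<in> range (G \<eta>)"
  then obtain \<zeta> \<xi> where z: "v = G \<eta> \<zeta>" "w = G \<eta> \<xi>" by blast
  have AD: "A w \<in> distribution S x0" "v \<in> distribution S x0" using vw AG range z unfolding range_G[of \<eta>, symmetric] by auto
  have "ham_inner S x0 \<eta> v (A w) = ham_inner S x0 \<eta> (A w) v" by (rule ham_inner_bilinear(2)[OF AD(2) AD(2) AD(1)])
  then show "ham_inner S x0 \<eta> (A v) w = ham_inner S x0 \<eta> v (A w)" unfolding z hi using sym by simp
 qed
qed

end

context geodesic_field
begin

text \<open>Near \<open>(t, y0)\<close> the formula of \<open>cost_value\<close>, evaluated at the
  connecting covector \<open>pt\<close>, makes the cost smooth; its rate is \<open>hh\<close> at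
  \<open>pt\<close>, whose Hessian is given by \<open>value_rate_hessian\<close>.\<close>

lemma cost_rate_exists:
 assumes cM: "compact (closure M')" and \<gamma>: "\<delta>0 > 0" "!!t. 0 < t ==> t < \<delta>0 ==> \<gamma> t = cinv c (gam t)"
 obtains \<delta> where "0 < \<delta>" "\<delta> <= \<tau>" "\<delta> <= \<delta>0"
  "!!t. 0 < t ==> t < \<delta> ==> \<forall>v. (\<forall>w. Wf t v w = 0) --> v = 0 ==>
   \<exists>q. cost_rate_second_differential S M' \<gamma> x0 t q \<and>
    (\<forall>v. \<exists>v'. (\<forall>u. Wf t v' u = - (u \<bullet> v)) \<and> q v = Hpp (gam t, lam t) (qf t v') (qf t v'))"
proof -
 obtain \<delta>1 \<kappa> where d: "0 < \<delta>1" "\<delta>1 <= \<tau>" "0 < \<kappa>" "\<kappa> <= \<rho>"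
  "!!s p \<gamma>. 0 < s ==> s < \<delta>1 ==> p \<in> ball \<eta> \<kappa> ==> \<gamma> s = cinv c (gam s) ==>
   cost S M' \<gamma> s (cinv c (Yh (s, p))) = ereal (p \<bullet> Yh (s, p) - ah (s, p))"
  by (rule cost_value[OF cM]) (rule that, assumption+)
 show thesis
 proof (rule that[of "min \<delta>1 \<delta>0"])
  show "0 < min \<delta>1 \<delta>0" "min \<delta>1 \<delta>0 <= \<tau>" "min \<delta>1 \<delta>0 <= \<delta>0" using d \<gamma>(1) by auto
  fix t assume t: "0 < t" "t < min \<delta>1 \<delta>0" and nd': "\<forall>v. (\<forall>w. Wf t v w = 0) --> v = 0"
  then have nd: "!!v. (!!w. Wf t v w = 0) ==> v = 0" by blast
  have tt: "t \<in> {+-\<tau>}" using t d(2) by auto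
  obtain T and pt :: "real \<times> (real^'n) => real^'n" where T: "open T" "(t, y0) \<in> T" "smooth_on T pt" "pt (t, y0) = \<eta>"
   "!!s x. (s, x) \<in> T ==> (s, pt (s, x)) \<in> C" "!!s x. (s, x) \<in> T ==> Yh (s, pt (s, x)) = x"
   by (rule connecting_covector[OF tt nd]) (assumption, rule that, assumption+)
  have "open (T \<inter> pt -` ball \<eta> \<kappa>)"
   by (rule continuous_open_preimage[OF smooth_continuous[OF T(3)] T(1)]) simp
  moreover have "(t, y0) \<in> T \<inter> pt -` ball \<eta> \<kappa>" using T(2,4) d(3) by simp
  \<comment> \<open>A product neighbourhood, since at each fixed point near \<open>x0\<close> the
    cost must be known for all times near \<open>t\<close> before it can be differentiated in
    time.\<close>
  ultimately obtain I V0 where IV: "open I" "open V0" "t \<in> I" "y0 \<in> V0" "I \<times> V0 \<subseteq> T \<inter> pt -` ball \<eta> \<kappa>"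
   using open_prod_elim by (metis mem_Sigma_iff)
  define V where "V = V0 \<inter> Om"
  define J where "J = I \<inter> {0<..<min \<delta>1 \<delta>0}"
  have V: "open V" "y0 \<in> V" "V \<subseteq> Om" using IV open_Om y0_in by (auto simp: V_def)
  have J: "open J" "t \<in> J" using IV t by (auto simp: J_def)
  have inT: "(s, y) \<in> T" "pt (s, y) \<in> ball \<eta> \<kappa>" if "s \<in> J" "y \<in> V" for s y
   using that IV(5) by (auto simp: J_def V_def)
  have cost: "cost S M' \<gamma> s (cinv c y) = ereal (pt (s, y) \<bullet> y - ah (s, pt (s, y)))" if "s \<in> J" "y \<in> V" for s y
   using d(5)[of s "pt (s, y)" \<gamma>] \<gamma>(2)[of s] inT[OF that] T(6)[of s y] that by (simp add: J_def)
  let ?h = "\<lambda>y. hh (t, pt (t, y))"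
  note hess = value_rate_hessian[OF T(1,3,5,6) tt V(1,2) inT(1)[OF J(2)] T(4)]
  have "cost_rate_second_differential S M' \<gamma> x0 t (\<lambda>v. dd v (dd v ?h) y0)"
   unfolding cost_rate_second_differential_def
  proof (intro exI[of _ "cinv c ` V"] exI[of _ "\<lambda>x. ?h (snd c x)"] conjI ballI)
   show "open (cinv c ` V)" by (rule open_cinv_image[OF c(1) V(1)]) (use V(3) OmD(5) in blast)
   show "x0 \<in> cinv c ` V" using V(2) cinv_y0 by force
   fix x assume "x \<in> cinv c ` V"
   then obtain y where y: "y \<in> V" "x = cinv c y" by blast
   have xy: "snd c x = y" using OmD(2)[of y] y V(3) by auto
   have "\<forall>\<^sub>F s in nhds t. s \<in> J" by (rule eventually_nhds_in_open[OF J])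
   then show "\<forall>\<^sub>F s in nhds t. \<bar>cost S M' \<gamma> s x\<bar> \<noteq> \<infinity>"
    by eventually_elim (simp add: y(2) cost[OF _ y(1)])
   have "((\<lambda>s. ah (s, pt (s, y)) - pt (s, y) \<bullet> y) has_vector_derivative - hh (t, pt (t, y))) (at t)"
    by (rule value_time_derivative[OF T(1,3,5,6) inT(1)[OF J(2) y(1)]])
   from has_vector_derivative_minus[OF this]
   have D: "((\<lambda>s. pt (s, y) \<bullet> y - ah (s, pt (s, y))) has_vector_derivative hh (t, pt (t, y))) (at t)" by simp
   have "((\<lambda>s. real_of_ereal (cost S M' \<gamma> s x)) has_vector_derivative hh (t, pt (t, y))) (at t)"
    by (rule has_vector_derivative_transform_within_open[OF D J]) (simp add: y(2) cost[OF _ y(1)])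
   then show "((\<lambda>s. real_of_ereal (cost S M' \<gamma> s x)) has_real_derivative ?h (snd c x)) (at t)"
    by (simp add: has_real_derivative_iff_has_vector_derivative xy)
  next
   have comp: "((\<lambda>x. ?h (snd c x)) \<circ> cinv c) y = ?h y" if "y \<in> V" for y
    using OmD(2)[of y] that V(3) by auto
   have sm: "smooth_on V ((\<lambda>x. ?h (snd c x)) \<circ> cinv c)"
    by (rule smooth_cong[OF V(1) hess(1)]) (use comp in auto)
   have dz: "dd v ((\<lambda>x. ?h (snd c x)) \<circ> cinv c) z = dd v ?h z" if "z \<in> V" for z v
    by (rule dd_cong[OF V(1) that comp])
   have hs: "hessian ((\<lambda>x. ?h (snd c x)) \<circ> cinv c) y0 v v = dd v (dd v ?h) y0" for v
    unfolding hessian_def by (rule dd_cong[OF V(1,2) dz])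
   show "second_differential_at_critical S (\<lambda>x. ?h (snd c x)) x0 (\<lambda>v. dd v (dd v ?h) y0)"
    unfolding second_differential_at_critical_def Let_def c_def[symmetric] y0_def[symmetric]
   proof (intro conjI exI[of _ V])
    show "V \<subseteq> snd c ` fst c" using V(3) OmD(5) by blast
    show "frechet_derivative ((\<lambda>x. ?h (snd c x)) \<circ> cinv c) (at y0) = (\<lambda>v. 0)"
     by (rule ext) (simp add: dz[OF V(2)] hess(2))
   qed (use V sm hs in auto)
  qed
  moreover have "\<forall>v. \<exists>v'. (\<forall>u. Wf t v' u = - (u \<bullet> v)) \<and> dd v (dd v ?h) y0 = Hpp (gam t, lam t) (qf t v') (qf t v')"
  proof
   fix v
   obtain v' w' where vw: "\<forall>u. Wf t v' u = - (u \<bullet> v)" "\<forall>u. Wf t w' u = - (u \<bullet> v)"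
    "dd v (dd v ?h) y0 = Hpp (gam t, lam t) (qf t v') (qf t w')" using hess(3)[of v v] by blast
   have "Wf t (v' - w') u = 0" for u using vw(1,2) by (simp add: linear_diff[OF linear_Wf[OF tt]])
   then have "v' = w'" using nd[of "v' - w'"] by simp
   then show "\<exists>v'. (\<forall>u. Wf t v' u = - (u \<bullet> v)) \<and> dd v (dd v ?h) y0 = Hpp (gam t, lam t) (qf t v') (qf t v')"
    using vw by blast
  qed
  ultimately show "\<exists>q. cost_rate_second_differential S M' \<gamma> x0 t q \<and>
    (\<forall>v. \<exists>v'. (\<forall>u. Wf t v' u = - (u \<bullet> v)) \<and> q v = Hpp (gam t, lam t) (qf t v') (qf t v'))" by blast
 qed
qed

section \<open>The second variation as a matrix\<close>

definition Wm :: "real => real^'n^'n" where "Wm t = (\<chi> i j. Wf t (axis j 1) (axis i 1))"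

lemma Wm_form: "t \<in> {+-\<tau>} ==> p \<bullet> (Wm t *v q) = Wf t q p"
proof -
 assume t: "t \<in> {+-\<tau>}"
 have l: "Wf t q w = (\<Sum>j\<in>UNIV. q $ j * Wf t (axis j 1) w)" for q w
 proof -
  have "Wf t (\<Sum>j\<in>UNIV. q $ j *\<^sub>R axis j 1) w = (\<Sum>j\<in>UNIV. q $ j * Wf t (axis j 1) w)"
   by (simp add: linear_sum[OF linear_Wf[OF t]] linear_scale[OF linear_Wf[OF t]])
  moreover have "(\<Sum>j\<in>UNIV. q $ j *\<^sub>R axis j 1) = q" by (metis basis_expansion scalar_mult_eq_scaleR)
  ultimately show ?thesis by simp
 qed
 have "Wf t (axis j 1) p = (\<Sum>i\<in>UNIV. p $ i * Wf t (axis j 1) (axis i 1))" for j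
  unfolding Wf_sym[OF t, of "axis j 1" p] l[of p]
  by (intro sum.cong refl arg_cong2[of _ _ _ _ "(*)"] Wf_sym[OF t])
 then have "Wf t q p = (\<Sum>j\<in>UNIV. q $ j * (\<Sum>i\<in>UNIV. p $ i * Wf t (axis j 1) (axis i 1)))"
  unfolding l[of q p] by simp
 also have "... = (\<Sum>i\<in>UNIV. \<Sum>j\<in>UNIV. p $ i * (Wf t (axis j 1) (axis i 1) * q $ j))"
  by (subst sum.swap) (simp add: sum_distrib_left mult.commute mult.left_commute)
 finally show ?thesis
  by (simp add: Wm_def inner_vec_def matrix_vector_mult_def sum_distrib_left)
qed

lemma smooth_Wm: "smooth_on {+-\<tau>} Wm"
proof (rule smooth_componentwise)
 fix i :: "real^'n^'n" assume "i \<in> Basis"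
 then obtain a b where i: "i = axis a (axis b 1)" by (auto simp: Basis_vec_def)
 show "smooth_on {+-\<tau>} (\<lambda>t. Wm t \<bullet> i)" by (simp add: i inner_axis Wm_def smooth_Wf)
qed simp

lemma Wm_rate: "t \<in> {+-\<tau>} ==> p \<bullet> (dd 1 Wm t *v q) = Hpp (gam t, lam t) (qf t q) (qf t p)"
proof -
 assume t: "t \<in> {+-\<tau>}"
 have "((\<lambda>t. p \<bullet> (Wm t *v q)) has_vector_derivative p \<bullet> (dd 1 Wm t *v q)) (at t)"
  using bounded_linear.has_vector_derivative[OF bounded_linear_inner_right
    bounded_linear.has_vector_derivative[OF bounded_bilinear.bounded_linear_left[OF bilinear_matrix_vector]
    smooth_vderiv[OF smooth_Wm t]]] .
 moreover have "((\<lambda>t. p \<bullet> (Wm t *v q)) has_vector_derivative Hpp (gam t, lam t) (qf t q) (qf t p)) (at t)"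
  by (rule has_vector_derivative_transform_within_open[OF dd_Wf[OF t], of "{+-\<tau>}"])
   (use t Wm_form in auto)
 ultimately show ?thesis by (rule vector_derivative_unique_at)
qed

lemma Wm_rate_0: "dd 1 Wm 0 *v q = G \<eta> q"
proof -
 have "p \<bullet> (dd 1 Wm 0 *v q) = p \<bullet> G \<eta> q" for p
  using Wm_rate[OF zero_in] Hpp_sym[OF y0_in] by (simp add: qf_0 gam_0 lam_0 G_inner)
 then show ?thesis by (metis vector_eq_ldot)
qed

lemma Wm_nonflat:
 assumes "!!p. flat_at_0 (\<lambda>t. Wf t p p) ==> p = 0" "flat_at_0 (\<lambda>t. p \<bullet> (Wm t *v p))"
 shows "p = 0"
 by (rule assms(1), rule flat_at_0_bound[OF assms(2) pos(1), where B = 1]) (use pos in "auto simp: Wm_form")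

end

context geodesic_field
begin

text \<open>For \<open>v = G \<eta> \<xi>\<close> the vector \<open>v'\<close> of
  \<open>cost_rate_exists\<close> satisfies \<open>Wm t *v v' = G \<eta> (- \<xi>)\<close>. So
  \<open>inverse_form_rate\<close> turns \<open>t\<^sup>2\<close> times the second differential at
  \<open>v\<close> into \<open>\<xi> \<bullet> (M t *v \<xi>)\<close>, and \<open>R t\<close> is the
  operator of this form.\<close>

theorem cost_operator_asymptotics:
 assumes cM: "compact (closure M')" and \<gamma>: "\<delta>0 > 0" "!!t. 0 < t ==> t < \<delta>0 ==> \<gamma> t = cinv c (gam t)"
  and nonflat: "!!p. flat_at_0 (\<lambda>t. Wf t p p) ==> p = 0" and T: "0 < T"
 shows "\<exists>\<epsilon> R. 0 < \<epsilon> \<and> \<epsilon> <= T \<and>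
  (\<forall>t\<in>{0<..<\<epsilon>}. is_cost_operator S M' \<gamma> x0 \<eta> t (cost_operator S M' \<gamma> x0 \<eta> t)) \<and>
  (\<forall>t\<in>{0<..<\<epsilon>}. \<forall>v\<in>distribution S x0. R t v = t\<^sup>2 *\<^sub>R cost_operator S M' \<gamma> x0 \<eta> t v) \<and>
  (\<forall>v\<in>distribution S x0. smooth_curve_on {0..<\<epsilon>} (\<lambda>t. R t v)) \<and>
  (\<forall>t\<in>{0..<\<epsilon>}. symmetric_operator S x0 \<eta> (R t)) \<and>
  (\<forall>v\<in>distribution S x0.
    ((\<lambda>t. t\<^sup>2 *\<^sub>R cost_operator S M' \<gamma> x0 \<eta> t v) \<longlongrightarrow> R 0 v) (at_right 0) \<and>
    ham_inner S x0 \<eta> (R 0 v) v \<ge> ham_inner S x0 \<eta> v v \<and>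
    (v \<noteq> 0 --> ham_inner S x0 \<eta> v v > 0) \<and>
    ((\<lambda>t. R t v) has_vector_derivative 0) (at 0 within {0..<\<epsilon>}))"
proof -
 have W0: "Wm 0 = 0" by (simp add: Wm_def Wf_0 vec_eq_iff)
 have Wsym: "p \<bullet> (Wm t *v q) = q \<bullet> (Wm t *v p)" if "t \<in> {+-\<tau>}" for t p q
  by (simp add: Wm_form[OF that] Wf_sym[OF that, of q p])
 have Wpos: "0 <= p \<bullet> (dd 1 Wm t *v p)" if "0 <= t" "t < \<tau>" for t p
 proof -
  have t: "t \<in> {+-\<tau>}" using that pos by auto
  show ?thesis unfolding Wm_rate[OF t] by (rule Hpp_nonneg[OF gam_Om[OF t]])
 qed
 obtain \<delta> and M :: "real => real^'n^'n" where \<delta>: "0 < \<delta>" "\<delta> < \<tau>"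
  "!!t p. 0 < t ==> t < \<delta> ==> Wm t *v p = 0 ==> p = 0" "smooth_on {+-\<delta>} M" "dd 1 M 0 = 0"
  and form': "!!t \<xi> \<zeta> p q. 0 < t ==> t < \<delta> ==> Wm t *v p = dd 1 Wm 0 *v \<xi> ==> Wm t *v q = dd 1 Wm 0 *v \<zeta> ==>
   t\<^sup>2 * (p \<bullet> (dd 1 Wm t *v q)) = \<xi> \<bullet> (M t *v \<zeta>)"
  and M0': "!!\<zeta>. \<zeta> \<bullet> (dd 1 Wm 0 *v \<zeta>) <= \<zeta> \<bullet> (M 0 *v \<zeta>)"
  by (rule inverse_form_rate[OF pos(1) smooth_Wm W0 Wsym Wpos Wm_nonflat[OF nonflat]])
   (assumption, assumption, assumption, assumption, assumption, rule that, assumption+)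
 note form = form'[unfolded Wm_rate_0] and M0 = M0'[unfolded Wm_rate_0]
 obtain \<delta>1 where \<delta>1: "0 < \<delta>1" "\<delta>1 <= \<tau>" "\<delta>1 <= \<delta>0"
  "!!t. 0 < t ==> t < \<delta>1 ==> \<forall>v. (\<forall>w. Wf t v w = 0) --> v = 0 ==>
   \<exists>q. cost_rate_second_differential S M' \<gamma> x0 t q \<and>
    (\<forall>v. \<exists>v'. (\<forall>u. Wf t v' u = - (u \<bullet> v)) \<and> q v = Hpp (gam t, lam t) (qf t v') (qf t v'))"
  by (rule cost_rate_exists[OF cM \<gamma>]) (assumption, assumption, rule that, assumption+)
 define \<epsilon> where "\<epsilon> = min (min \<delta> \<delta>1) T"
 have \<epsilon>: "0 < \<epsilon>" "\<epsilon> <= T" "\<epsilon> <= \<delta>" "\<epsilon> <= \<delta>1" using \<delta> \<delta>1 T by (auto simp: \<epsilon>_def)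
 define sg where "sg = (\<lambda>v. SOME \<zeta>. v = G \<eta> \<zeta>)"
 define R where "R = (\<lambda>t v. M t *v sg v)"
 have tI: "t \<in> {+-\<tau>}" "t < \<delta>" "t < \<delta>1" if "0 < t" "t < \<epsilon>" for t using that \<epsilon> \<delta> by auto
 have sol: "\<exists>p. Wm t *v p = G \<eta> \<xi>" if t: "0 < t" "t < \<epsilon>" for t \<xi>
 proof -
  have l: "linear ((*v) (Wm t))" by simp
  have "inj ((*v) (Wm t))" unfolding linear_injective_0[OF l] using \<delta>(3)[OF t(1) tI(2)[OF t]] by blast
  then have "surj ((*v) (Wm t))" by (rule linear_injective_imp_surjective[OF l _ refl])
  then show ?thesis by (metis surjD)
 qed
 have Msym: "\<xi> \<bullet> (M t *v \<zeta>) = \<zeta> \<bullet> (M t *v \<xi>)" if t: "0 < t" "t < \<epsilon>" for t \<xi> \<zeta>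
 proof -
  obtain p q where pq: "Wm t *v p = G \<eta> \<xi>" "Wm t *v q = G \<eta> \<zeta>" using sol[OF t] by meson
  have "p \<bullet> (dd 1 Wm t *v q) = q \<bullet> (dd 1 Wm t *v p)"
   unfolding Wm_rate[OF tI(1)[OF t]] by (rule Hpp_sym[OF gam_Om[OF tI(1)[OF t]]])
  then show ?thesis using form[OF t(1) tI(2)[OF t] pq] form[OF t(1) tI(2)[OF t] pq(2,1)] by simp
 qed
 have Mker: "\<xi> \<bullet> (M t *v \<zeta>) = 0" if t: "0 < t" "t < \<epsilon>" and z: "G \<eta> \<zeta> = 0" for t \<xi> \<zeta>
 proof -
  obtain p where p: "Wm t *v p = G \<eta> \<xi>" using sol[OF t] by blast
  show ?thesis using form[OF t(1) tI(2)[OF t] p, of 0 \<zeta>] z by simp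
 qed
 have Mlim: "((\<lambda>t. \<xi> \<bullet> (M t *v \<zeta>)) \<longlongrightarrow> \<xi> \<bullet> (M 0 *v \<zeta>)) (at_right 0)" for \<xi> \<zeta>
 proof -
  have "(M \<longlongrightarrow> M 0) (at 0)" using smooth_isCont[OF \<delta>(4), of 0] \<delta>(1) by (simp add: isCont_def)
  then have "(M \<longlongrightarrow> M 0) (at_right 0)" by (rule filterlim_mono) (auto simp: at_within_le_at)
  then show ?thesis
   by (intro tendsto_inner tendsto_const bounded_bilinear.tendsto[OF bilinear_matrix_vector])
 qed
 have small: "\<forall>\<^sub>F t in at_right 0. 0 < t \<and> t < \<epsilon>"
  using eventually_at_right_less[of 0] order_tendstoD(2)[OF tendsto_ident_at \<epsilon>(1)] by eventually_elim simp
 \<comment> \<open>For positive times symmetry and kernel come from the second variation; at 0 they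
   hold by continuity of \<open>M\<close>.\<close>
 have M0sym: "\<xi> \<bullet> (M 0 *v \<zeta>) = \<zeta> \<bullet> (M 0 *v \<xi>)" for \<xi> \<zeta>
 proof (rule tendsto_unique[OF _ _ Mlim])
  show "((\<lambda>t. \<zeta> \<bullet> (M t *v \<xi>)) \<longlongrightarrow> \<xi> \<bullet> (M 0 *v \<zeta>)) (at_right 0)"
   by (rule Lim_transform_eventually[OF Mlim]) (use small in "eventually_elim, simp add: Msym")
 qed simp
 have M0ker: "\<xi> \<bullet> (M 0 *v \<zeta>) = 0" if z: "G \<eta> \<zeta> = 0" for \<xi> \<zeta>
 proof (rule tendsto_unique[OF _ Mlim])
  show "((\<lambda>t. \<xi> \<bullet> (M t *v \<zeta>)) \<longlongrightarrow> 0) (at_right 0)"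
   by (rule Lim_transform_eventually[OF tendsto_const]) (use small in "eventually_elim, simp add: Mker[OF _ _ z]")
 qed simp
 have MM: "\<xi> \<bullet> (M t *v \<zeta>) = \<zeta> \<bullet> (M t *v \<xi>)" "G \<eta> \<zeta> = 0 ==> \<xi> \<bullet> (M t *v \<zeta>) = 0" if "t \<in> {0..<\<epsilon>}" for t \<xi> \<zeta>
 proof -
  have t: "t = 0 \<or> 0 < t \<and> t < \<epsilon>" using that by auto
  show "\<xi> \<bullet> (M t *v \<zeta>) = \<zeta> \<bullet> (M t *v \<xi>)" using t Msym M0sym by metis
  show "G \<eta> \<zeta> = 0 ==> \<xi> \<bullet> (M t *v \<zeta>) = 0" using t Mker M0ker by metis
 qed
 have RR: "R t = (\<lambda>v. M t *v (SOME \<zeta>. v = G \<eta> \<zeta>))" for t by (simp add: R_def sg_def)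
 have Rop: "symmetric_operator S x0 \<eta> (R t)" "ham_inner S x0 \<eta> (R t (G \<eta> \<zeta>)) (G \<eta> \<xi>) = \<xi> \<bullet> (M t *v \<zeta>)"
  if t: "t \<in> {0..<\<epsilon>}" for t \<zeta> \<xi>
  using operator_of_form[OF MM(1)[OF t] MM(2)[OF t] RR] by blast+
 have cost: "is_cost_operator S M' \<gamma> x0 \<eta> t (\<lambda>v. (1 / t\<^sup>2) *\<^sub>R R t v)" if t: "0 < t" "t < \<epsilon>" for t
 proof -
  let ?Q = "(1 / t\<^sup>2) *\<^sub>R M t"
  have Q: "(\<lambda>v. (1 / t\<^sup>2) *\<^sub>R R t v) = (\<lambda>v. ?Q *v (SOME \<zeta>. v = G \<eta> \<zeta>))"
   by (simp add: RR scaleR_matrix_vector_assoc)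
  have Qv: "\<xi> \<bullet> (?Q *v \<zeta>) = (1 / t\<^sup>2) * (\<xi> \<bullet> (M t *v \<zeta>))" for \<xi> \<zeta>
   by (simp add: scaleR_matrix_vector_assoc[symmetric])
  have Qs: "\<xi> \<bullet> (?Q *v \<zeta>) = \<zeta> \<bullet> (?Q *v \<xi>)" "G \<eta> \<zeta> = 0 ==> \<xi> \<bullet> (?Q *v \<zeta>) = 0" for \<xi> \<zeta>
   unfolding Qv using Msym[OF t, of \<xi> \<zeta>] Mker[OF t] by auto
  note op = operator_of_form[OF Qs Q]
  have nd: "v = 0" if "!!w. Wf t v w = 0" for v
  proof (rule \<delta>(3)[OF t(1) tI(2)[OF t]])
   have "x \<bullet> (Wm t *v v) = 0" for x using that by (simp add: Wm_form[OF tI(1)[OF t]])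
   then show "Wm t *v v = 0" by (metis inner_eq_zero_iff)
  qed
  obtain q where q: "cost_rate_second_differential S M' \<gamma> x0 t q"
   "!!v. \<exists>v'. (\<forall>u. Wf t v' u = - (u \<bullet> v)) \<and> q v = Hpp (gam t, lam t) (qf t v') (qf t v')"
   using \<delta>1(4)[OF t(1) tI(3)[OF t]] nd by blast
  have "q v = ham_inner S x0 \<eta> ((1 / t\<^sup>2) *\<^sub>R R t v) v" if v: "v \<in> distribution S x0" for v
  proof -
   obtain \<xi> where \<xi>: "v = G \<eta> \<xi>" using G_exists[OF v] by blast
   obtain v' where v': "!!u. Wf t v' u = - (u \<bullet> v)" "q v = Hpp (gam t, lam t) (qf t v') (qf t v')"
    using q(2) by blast
   have "u \<bullet> (Wm t *v v') = u \<bullet> G \<eta> (- \<xi>)" for u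
    by (simp add: Wm_form[OF tI(1)[OF t]] v'(1) \<xi> linear_neg[OF linear_G])
   then have W: "Wm t *v v' = G \<eta> (- \<xi>)" by (metis vector_eq_ldot)
   have "t\<^sup>2 * q v = (- \<xi>) \<bullet> (M t *v (- \<xi>))"
    using form[OF t(1) tI(2)[OF t] W W] by (simp add: v'(2) Wm_rate[OF tI(1)[OF t]])
   also have "M t *v (- \<xi>) = - (M t *v \<xi>)" using matrix_vector_mult_scaleR[of "M t" "-1" \<xi>] by simp
   finally have "t\<^sup>2 * q v = \<xi> \<bullet> (M t *v \<xi>)" by simp
   then have "q v = \<xi> \<bullet> (?Q *v \<xi>)" using t(1) unfolding Qv by (simp add: field_simps)
   then show ?thesis using op(3)[of \<xi> \<xi>] by (simp add: \<xi>)
  qed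
  then show ?thesis using op(1) q(1) by (auto simp: is_cost_operator_def)
 qed
 have ex: "is_cost_operator S M' \<gamma> x0 \<eta> t (cost_operator S M' \<gamma> x0 \<eta> t)" if "0 < t" "t < \<epsilon>" for t
  unfolding cost_operator_def by (rule someI[of "is_cost_operator S M' \<gamma> x0 \<eta> t", OF cost[OF that]])
 have eq: "R t v = t\<^sup>2 *\<^sub>R cost_operator S M' \<gamma> x0 \<eta> t v" if t: "0 < t" "t < \<epsilon>" and v: "v \<in> distribution S x0" for t v
  using t(1) by (simp flip: cost_operator_unique[OF cost[OF t] ex[OF t] v])
 have smR: "smooth_on {+-\<delta>} (\<lambda>t. R t v)" for v
  unfolding R_def by (rule smooth_linear_compose[OF _ bounded_bilinear.bounded_linear_left[OF bilinear_matrix_vector] \<delta>(4)]) simp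
 have in0: "(0::real) \<in> {+-\<delta>}" using \<delta>(1) by simp
 have dR: "((\<lambda>t. R t v) has_vector_derivative 0) (at 0 within {0..<\<epsilon>})" for v
  using has_vector_derivative_at_within[OF bounded_linear.has_vector_derivative[OF
    bounded_bilinear.bounded_linear_left[OF bilinear_matrix_vector]
    smooth_vderiv[OF \<delta>(4) in0]]] \<delta>(5) by (simp add: R_def)
 have limR: "((\<lambda>t. t\<^sup>2 *\<^sub>R cost_operator S M' \<gamma> x0 \<eta> t v) \<longlongrightarrow> R 0 v) (at_right 0)" if v: "v \<in> distribution S x0" for v
 proof -
  have "((\<lambda>t. R t v) \<longlongrightarrow> R 0 v) (at 0)" using smooth_isCont[OF smR in0] by (simp add: isCont_def)
  then have "((\<lambda>t. R t v) \<longlongrightarrow> R 0 v) (at_right 0)" by (rule filterlim_mono) (auto simp: at_within_le_at)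
  then show ?thesis by (rule Lim_transform_eventually) (use small in "eventually_elim, simp add: eq v")
 qed
 have ineq: "ham_inner S x0 \<eta> (R 0 v) v \<ge> ham_inner S x0 \<eta> v v" if v: "v \<in> distribution S x0" for v
 proof -
  obtain \<xi> where \<xi>: "v = G \<eta> \<xi>" using G_exists[OF v] by blast
  have "0 \<in> {0..<\<epsilon>}" using \<epsilon>(1) by simp
  from Rop(2)[OF this, of \<xi> \<xi>] show ?thesis using M0[of \<xi>] by (simp add: \<xi> ham_inner_G)
 qed
 have "{0..<\<epsilon>} \<subseteq> {+-\<delta>}" using \<epsilon>(3) \<delta>(1) by auto
 then have scR: "smooth_curve_on {0..<\<epsilon>} (\<lambda>t. R t v)" for v
  using smooth_imp_smooth_curve_on[OF smR] by simp
 show ?thesis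
  by (intro exI[of _ \<epsilon>] exI[of _ R] conjI ballI impI)
   (use \<epsilon> ex eq limR ineq dR ham_inner_pos Rop(1) scR in auto)
qed

end

section \<open>Ample geodesics\<close>

text \<open>The inverse function theorem for \<open>(t, v) \<mapsto> (t, A (t, v))\<close> near a
  solution at time 0. Since the map is linear in \<open>v\<close>, its local injectivity at nearby
  times is injectivity on the whole space.\<close>

lemma smooth_linear_solve:
 fixes A :: "real \<times> 'a::euclidean_space => 'a"
 assumes \<epsilon>: "\<epsilon> > 0" and A: "smooth_on ({+-\<epsilon>} \<times> UNIV) A"
  and lin: "!!t. \<bar>t\<bar> < \<epsilon> ==> linear (\<lambda>v. A (t, v))"
  and inj: "!!v. A (0, v) = 0 ==> v = 0" and g: "smooth_on {+-\<epsilon>} g"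
 obtains \<delta> h where "0 < \<delta>" "\<delta> <= \<epsilon>" "smooth_on {+-\<delta>} h" "!!t. \<bar>t\<bar> < \<delta> ==> A (t, h t) = g t"
  "!!t v. \<bar>t\<bar> < \<delta> ==> A (t, v) = 0 ==> v = 0"
proof -
 let ?D = "{+-\<epsilon>} \<times> (UNIV :: 'a set)"
 have oD: "open ?D" by (simp add: open_Times)
 have l0: "linear (\<lambda>v. A (0, v))" using lin[of 0] \<epsilon> by simp
 have "inj (\<lambda>v. A (0, v))" unfolding linear_injective_0[OF l0] using inj by blast
 then have "surj (\<lambda>v. A (0, v))" by (rule linear_injective_imp_surjective[OF l0 _ refl])
 then obtain v0 where v0: "A (0, v0) = g 0" by (metis surjD)
 define K where "K = (\<lambda>z. (fst z, A z))"
 have sK: "smooth_on ?D K"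
  unfolding K_def by (intro smooth_Pair A oD smooth_linear bounded_linear_fst)
 have z0: "(0, v0) \<in> ?D" using \<epsilon> by simp
 obtain U' V k where k: "open U'" "U' \<subseteq> ?D" "(0, v0) \<in> U'" "open V" "K (0, v0) \<in> V" "homeomorphism U' V K k" "smooth_on V k"
 proof (rule smooth_inverse_function[OF oD sK z0])
  fix h :: "real \<times> 'a" assume h: "dd h K (0, v0) = 0"
  obtain \<sigma> v where hh: "h = (\<sigma>, v)" by (cases h) auto
  have "(K has_derivative (\<lambda>h. (fst h, dd h A (0, v0)))) (at (0, v0))"
   unfolding K_def
   by (intro has_derivative_Pair smooth_deriv[OF A z0] bounded_linear_imp_has_derivative bounded_linear_fst)
  from dd_eqI[OF this, of h] h have 0: "\<sigma> = 0" "dd (0, v) A (0, v0) = 0" by (auto simp: hh zero_prod_def)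
  have "dd (0, v) A (0, v0) = dd v (\<lambda>v. A (0, v)) v0"
   by (rule dd_slice_snd[OF smooth_diffble[OF A z0], symmetric])
  also have "... = A (0, v)" by (rule dd_eqI[OF linear_imp_has_derivative[OF l0]])
  finally show "h = 0" using 0 inj hh by (simp add: zero_prod_def)
 next
  fix U' V k
  assume "open U'" "U' \<subseteq> ?D" "(0, v0) \<in> U'" "open V" "K (0, v0) \<in> V" "homeomorphism U' V K k" "smooth_on V k"
  then show thesis by (rule that)
 qed
 have K0: "K (0, v0) = (0, g 0)" by (simp add: K_def v0)
 have sg: "smooth_on {+-\<epsilon>} (\<lambda>t. (t, g t))" by (intro smooth_Pair smooth_id g) simp_all
 have "open ({+-\<epsilon>} \<inter> (\<lambda>t. (t, g t)) -` V)"
  by (rule continuous_open_preimage[OF smooth_continuous[OF sg] _ k(4)]) simp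
 moreover have "0 \<in> {+-\<epsilon>} \<inter> (\<lambda>t. (t, g t)) -` V" using \<epsilon> k(5) K0 by simp
 ultimately obtain \<delta> where \<delta>: "\<delta> > 0" "ball 0 \<delta> \<subseteq> {+-\<epsilon>} \<inter> (\<lambda>t. (t, g t)) -` V"
  unfolding open_contains_ball by blast
 have in\<delta>: "\<bar>t\<bar> < \<epsilon>" "(t, g t) \<in> V" if "\<bar>t\<bar> < \<delta>" for t
  using \<delta>(2) that by (auto simp: subset_iff abs_less_iff)
 define h where "h = (\<lambda>t. snd (k (t, g t)))"
 have Kh: "k (t, g t) = (t, h t)" "(t, h t) \<in> U'" "A (t, h t) = g t" if "\<bar>t\<bar> < \<delta>" for t
 proof -
  have K: "K (k (t, g t)) = (t, g t)" and U: "k (t, g t) \<in> U'" using k(6) in\<delta>(2)[OF that] by (auto simp: homeomorphism_def)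
  show e: "k (t, g t) = (t, h t)" using K by (simp add: K_def h_def prod_eq_iff)
  show "(t, h t) \<in> U'" "A (t, h t) = g t" using U K by (simp_all add: e K_def)
 qed
 show thesis
 proof (rule that[of "min \<delta> \<epsilon>" h])
  show "0 < min \<delta> \<epsilon>" "min \<delta> \<epsilon> <= \<epsilon>" using \<delta>(1) \<epsilon> by auto
  show "smooth_on {- min \<delta> \<epsilon><..<min \<delta> \<epsilon>} h"
   unfolding h_def
   by (intro smooth_snd smooth_compose[OF _ k(4) _ k(7) smooth_subset[OF sg]]) (use in\<delta> in "auto simp: abs_less_iff")
  show "\<bar>t\<bar> < min \<delta> \<epsilon> ==> A (t, h t) = g t" for t using Kh(3) by simp
  fix t v assume t: "\<bar>t\<bar> < min \<delta> \<epsilon>" and v: "A (t, v) = 0"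
  have "open ((\<lambda>s. (t, h t + s *\<^sub>R v)) -` U')"
   by (rule open_vimage[OF k(1)]) (intro continuous_intros)
  moreover have "0 \<in> (\<lambda>s. (t, h t + s *\<^sub>R v)) -` U'" using Kh(2)[of t] t by simp
  ultimately obtain e where e: "e > 0" "ball 0 e \<subseteq> (\<lambda>s. (t, h t + s *\<^sub>R v)) -` U'"
   unfolding open_contains_ball by blast
  have "(t, h t + (e / 2) *\<^sub>R v) \<in> U'" using e by (auto simp: subset_iff)
  moreover have "K (t, h t + (e / 2) *\<^sub>R v) = K (t, h t)"
   using linear_add[OF lin[of t], of "h t" "(e / 2) *\<^sub>R v"] linear_scale[OF lin[of t], of "e / 2" v] t v
   by (simp add: K_def)
  ultimately have "(t, h t + (e / 2) *\<^sub>R v) = (t, h t)"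
   using k(6) Kh(2)[of t] t unfolding homeomorphism_def by (metis min_less_iff_conj)
  then show "v = 0" using e(1) by simp
 qed
qed

lemma flat_at_0_derivatives_eq_0:
 fixes g :: "real => 'b::euclidean_space"
 assumes \<epsilon>: "\<epsilon> > 0" and g: "smooth_on {+-\<epsilon>} g" and f: "flat_at_0 (\<lambda>s. p \<bullet> g s)"
 shows "p \<bullet> ((\<lambda>g. dd 1 g) ^^ j) g 0 = 0"
proof -
 let ?D = "\<lambda>j. ((\<lambda>g. dd 1 g) ^^ j) g"
 have s: "smooth_on {+-\<epsilon>} (?D j)" for j by (induction j) (use g smooth_dd in auto)
 have sp: "smooth_on {+-\<epsilon>} (\<lambda>s. p \<bullet> ?D j s)" for j by (intro smooth_inner smooth_const s) simp
 have fl: "flat_at_0 (\<lambda>s. p \<bullet> ?D j s)" for j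
 proof (induction j)
  case (Suc j)
  show ?case
  proof (rule flat_at_0_bound[OF flat_at_0_derivative[OF sp \<epsilon> Suc] \<epsilon>, of _ 1])
   fix t assume t: "0 < t" "t < \<epsilon>"
   have "dd 1 (\<lambda>s. p \<bullet> ?D j s) t = p \<bullet> ?D (Suc j) t"
    by (rule dd_eqI[THEN trans, OF has_derivative_inner_right[OF smooth_deriv[OF s]]]) (use t in simp_all)
   then show "norm (p \<bullet> ?D (Suc j) t) <= 1 * norm (dd 1 (\<lambda>s. p \<bullet> ?D j s) t)" by simp
  qed simp
 qed (use f in simp)
 show ?thesis by (rule flat_at_0_eq_0[OF fl smooth_isCont[OF sp]]) (use \<epsilon> in simp)
qed

text \<open>The flag uses derivatives within \<open>{0..T}\<close>, which are one-sided at 0; for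
  the restriction of a function that is smooth on both sides of 0 they are the ordinary
  ones.\<close>

lemma iterated_vector_derivative:
 fixes g :: "real => 'b::euclidean_space"
 assumes \<delta>: "0 < \<delta>" "\<delta> <= T" and g: "smooth_on {+-\<delta>} g" and h: "!!t. 0 <= t ==> t < \<delta> ==> h t = g t"
  and t: "0 <= t" "t < \<delta>"
 shows "((\<lambda>g s. vector_derivative g (at s within {0..T})) ^^ j) h t = ((\<lambda>g. dd 1 g) ^^ j) g t"
 using t
proof (induction j arbitrary: t)
 case (Suc j)
 let ?h = "((\<lambda>g s. vector_derivative g (at s within {0..T})) ^^ j) h" and ?g = "((\<lambda>g. dd 1 g) ^^ j) g"
 have s: "smooth_on {+-\<delta>} (((\<lambda>g. dd 1 g) ^^ j) g)" for j by (induction j) (use g smooth_dd in auto)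
 have t: "t \<in> {+-\<delta>}" "t \<in> {0..T}" using Suc.prems \<delta> by auto
 have "(?g has_vector_derivative dd 1 ?g t) (at t within {0..T})"
  by (rule has_vector_derivative_at_within[OF smooth_vderiv[OF s t(1)]])
 then have "(?h has_vector_derivative dd 1 ?g t) (at t within {0..T})"
 proof (rule has_vector_derivative_transform_within)
  show "0 < \<delta> - t" using Suc.prems by simp
  fix t' assume "t' \<in> {0..T}" "dist t' t < \<delta> - t"
  then have "0 <= t'" "t' < \<delta>" by (auto simp: dist_real_def)
  then show "?g t' = ?h t'" using Suc.IH by simp
 qed (use t in simp)
 then have "vector_derivative ?h (at t within {0..T}) = dd 1 ?g t"
  using t(2) \<delta> by (intro vector_derivative_within_cbox[of 0 T, unfolded cbox_interval]) auto
 then show ?case by simp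
qed (use h in simp)

locale framed_geodesic = geodesic_field +
 fixes T :: real and \<gamma> u Wd E Q and \<delta>0 :: real
 assumes \<delta>0: "0 < \<delta>0" "\<delta>0 <= \<tau>" "\<delta>0 <= T"
  and \<gamma>: "!!t. 0 <= t ==> t < \<delta>0 ==> \<gamma> t = cinv c (gam t)"
  and u: "!!t. 0 <= t ==> t < \<delta>0 ==> u t = fp (gam t, us (gam t, lam t))"
  and frame: "frame_along S T \<gamma> Wd E"
  and flow: "local_flow S T (\<gamma> 0) Wd (control_field S \<gamma> u E) Q"
begin

section \<open>The frame along the geodesic in coordinates\<close>

definition Mf where "Mf t y w = snd b (E t (cinv c y) w)"
definition Wc where "Wc = {z. snd z \<in> Om \<and> (fst z, cinv c (snd z)) \<in> Wd}"
text \<open>\<open>Mf\<close> extended linearly from \<open>Basis\<close>: the smoothness of a frame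
  is stated for fixed \<open>w\<close>, and this form gives joint smoothness in all
  variables.\<close>

definition Mx where "Mx z = (\<Sum>i\<in>Basis. (snd (snd z) \<bullet> i) *\<^sub>R Mf (fst z) (fst (snd z)) i)"
definition W3 where "W3 = {z. (fst z, fst (snd z)) \<in> Wc}"

lemma open_Wc: "open Wc"
proof -
 have "continuous_on (UNIV \<times> Om) (\<lambda>z. (fst z :: real, cinv c (snd z)))"
  by (intro continuous_on_Pair continuous_on_fst continuous_on_id
    continuous_on_compose2[OF continuous_cinv[OF c(1)] continuous_on_snd[OF continuous_on_id]]) (use OmD(5) in auto)
 then have "open (UNIV \<times> Om \<inter> (\<lambda>z. (fst z, cinv c (snd z))) -` Wd)"
  by (rule continuous_open_preimage) (use frame open_Om in "auto simp: frame_along_def open_Times")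
 moreover have "UNIV \<times> Om \<inter> (\<lambda>z. (fst z, cinv c (snd z))) -` Wd = Wc" by (auto simp: Wc_def)
 ultimately show ?thesis by simp
qed

lemma open_W3: "open W3"
 unfolding W3_def using open_vimage[OF open_Wc, of "\<lambda>z. (fst z, fst (snd z))"]
 by (simp add: vimage_def continuous_on_Pair continuous_on_fst continuous_on_snd)

lemma frame_proj: "z \<in> Wc ==> proj S (E (fst z) (cinv c (snd z)) w) = cinv c (snd z)"
 using frame by (auto simp: frame_along_def Wc_def)

lemma frame_linear:
 assumes "z \<in> Wc"
 shows "linear (Mf (fst z) (snd z))" and "bij (Mf (fst z) (snd z))"
proof -
 have z: "(fst z, cinv c (snd z)) \<in> Wd" "cinv c (snd z) \<in> fst b" using assms OmD(3) by (auto simp: Wc_def)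
 have "\<forall>(t, x)\<in>Wd. \<forall>b\<in>trivs S. x \<in> fst b --> linear (\<lambda>w. snd b (E t x w)) \<and> bij (\<lambda>w. snd b (E t x w))"
  by (rule frame[unfolded frame_along_def, THEN conjunct2, THEN conjunct2, THEN conjunct2, THEN conjunct1])
 then have "linear (\<lambda>w. snd b (E (fst z) (cinv c (snd z)) w)) \<and> bij (\<lambda>w. snd b (E (fst z) (cinv c (snd z)) w))"
  using z b(1) by fast
 then show "linear (Mf (fst z) (snd z))" "bij (Mf (fst z) (snd z))" by (simp_all add: Mf_def[abs_def])
qed

lemma smooth_Mf: "smooth_on Wc (\<lambda>z. Mf (fst z) (snd z) w)"
proof -
 have "smooth_on {(t, y). y \<in> snd c ` (fst c \<inter> fst b) \<and> (t, cinv c y) \<in> Wd} (\<lambda>(t, y). snd b (E t (cinv c y) w))"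
  using frame[unfolded frame_along_def, THEN conjunct2, THEN conjunct2, THEN conjunct2, THEN conjunct2] c(1) b(1) by blast
 moreover have "Wc \<subseteq> {(t, y). y \<in> snd c ` (fst c \<inter> fst b) \<and> (t, cinv c y) \<in> Wd}"
  using Om_sub by (auto simp: Wc_def)
 ultimately have "smooth_on Wc (\<lambda>(t, y). snd b (E t (cinv c y) w))" by (rule smooth_subset)
 then show ?thesis by (simp add: Mf_def case_prod_beta')
qed

lemma smooth_Mx: "smooth_on W3 Mx"
 unfolding Mx_def
proof (intro smooth_sum smooth_scaleR smooth_inner smooth_const open_W3)
 have s: "smooth_on W3 (\<lambda>z. (fst z, fst (snd z)))" "smooth_on W3 (\<lambda>z. snd (snd z))"
  by (intro smooth_Pair smooth_fst smooth_snd smooth_id open_W3)+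
 show "smooth_on W3 (\<lambda>z. snd (snd z))" by (rule s(2))
 show "smooth_on W3 (\<lambda>z. Mf (fst z) (fst (snd z)) i)" for i
  using smooth_compose[OF open_W3 open_Wc _ smooth_Mf s(1), of i] by (auto simp: W3_def)
qed

lemma Mx_eq: "(t, y) \<in> Wc ==> Mx (t, y, w) = Mf t y w"
proof -
 assume "(t, y) \<in> Wc"
 from frame_linear(1)[OF this] have l: "linear (Mf t y)" by simp
 have "Mf t y w = Mf t y (\<Sum>i\<in>Basis. (w \<bullet> i) *\<^sub>R i)" by (simp add: euclidean_representation)
 also have "... = Mx (t, y, w)" by (simp add: Mx_def linear_sum[OF l] linear_scale[OF l])
 finally show ?thesis by simp
qed

lemma E_fp: "(t, y) \<in> Wc ==> E t (cinv c y) w = fp (y, Mx (t, y, w))"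
 using fp(3)[of y "E t (cinv c y) w"] frame_proj[of "(t, y)" w] by (simp add: Mx_eq Mf_def Wc_def)

lemma start_Wc: "(0, y0) \<in> Wc"
proof -
 have "(0, \<gamma> 0) \<in> Wd" using frame \<delta>0 unfolding frame_along_def by (meson atLeastAtMost_iff dual_order.strict_implies_order less_le_trans order_refl)
 then show ?thesis using \<gamma>[of 0] \<delta>0(1) y0_in by (simp add: Wc_def gam_0)
qed

text \<open>The coordinates of the control in the frame solve a linear equation with smooth
  coefficients that is invertible along the geodesic.\<close>

lemma control_coordinates:
 obtains \<delta> w where "0 < \<delta>" "\<delta> <= \<delta>0" "smooth_on {+-\<delta>} w" "!!t. \<bar>t\<bar> < \<delta> ==> (t, gam t) \<in> Wc"
  "!!t. \<bar>t\<bar> < \<delta> ==> Mx (t, gam t, w t) = us (gam t, lam t)"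
  "!!t v. \<bar>t\<bar> < \<delta> ==> Mx (t, gam t, v) = 0 ==> v = 0"
proof -
 have sg: "smooth_on {+-\<tau>} (\<lambda>t. (t, gam t))" by (intro smooth_Pair smooth_id smooth_gam) simp_all
 have "open ({+-\<tau>} \<inter> (\<lambda>t. (t, gam t)) -` Wc)"
  by (rule continuous_open_preimage[OF smooth_continuous[OF sg] _ open_Wc]) simp
 moreover have "0 \<in> {+-\<tau>} \<inter> (\<lambda>t. (t, gam t)) -` Wc" using start_Wc pos by (simp add: gam_0)
 ultimately obtain e where e: "e > 0" "ball 0 e \<subseteq> {+-\<tau>} \<inter> (\<lambda>t. (t, gam t)) -` Wc"
  unfolding open_contains_ball by blast
 define \<epsilon> where "\<epsilon> = min e \<delta>0"
 have \<epsilon>: "\<epsilon> > 0" "\<epsilon> <= \<delta>0" using e \<delta>0 by (auto simp: \<epsilon>_def)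
 have inW: "(t, gam t) \<in> Wc" "t \<in> {+-\<tau>}" if "\<bar>t\<bar> < \<epsilon>" for t
  using that e(2) by (auto simp: \<epsilon>_def subset_iff)
 let ?A = "\<lambda>z. Mx (fst z, gam (fst z), snd z)"
 let ?D = "{+-\<epsilon>} \<times> UNIV"
 have oD: "open ?D" by (simp add: open_Times)
 have ab: "\<bar>t\<bar> < \<epsilon>" if "t \<in> {+-\<epsilon>}" for t using that by (auto simp: abs_less_iff)
 have sgf: "smooth_on ?D (\<lambda>z. gam (fst z))"
  by (rule smooth_compose[OF oD _ _ smooth_gam smooth_fst[OF oD smooth_id[OF oD]]]) (use inW(2) in auto)
 have sA: "smooth_on ?D ?A"
  by (rule smooth_compose[OF oD open_W3 _ smooth_Mx])
   (use inW(1) in "auto simp: W3_def intro!: smooth_Pair sgf smooth_fst smooth_snd smooth_id oD")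
 have lA: "linear (\<lambda>v. ?A (t, v))" if "\<bar>t\<bar> < \<epsilon>" for t
  using frame_linear(1)[OF inW(1)[OF that]] by (simp add: Mx_eq[OF inW(1)[OF that]])
 have iA: "v = 0" if "\<bar>t\<bar> < \<epsilon>" "?A (t, v) = 0" for t v
 proof -
  note bij_is_inj[OF frame_linear(2)[OF inW(1)[OF that(1)]]]
  then have "inj (Mf t (gam t))" by simp
  moreover have "Mf t (gam t) v = Mf t (gam t) 0"
   using that(2) Mx_eq[OF inW(1)[OF that(1)]] linear_0[OF frame_linear(1)[OF inW(1)[OF that(1)]]] by simp
  ultimately show ?thesis by (rule injD)
 qed
 have iA0: "!!v. ?A (0, v) = 0 ==> v = 0" using iA[of 0] \<epsilon>(1) by simp
 have sl: "smooth_on {+-\<epsilon>} (\<lambda>t. (gam t, lam t))"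
  by (rule smooth_subset[OF smooth_Pair[OF _ smooth_gam smooth_lam]]) (use inW(2) ab in auto)
 have su: "smooth_on {+-\<epsilon>} (\<lambda>t. us (gam t, lam t))"
  by (rule smooth_compose[OF _ open_Times[OF open_Om open_UNIV] _ smooth_us sl]) (use gam_Om inW(2) ab in auto)
 obtain \<delta> w where w: "0 < \<delta>" "\<delta> <= \<epsilon>" "smooth_on {+-\<delta>} w" "!!t. \<bar>t\<bar> < \<delta> ==> ?A (t, w t) = us (gam t, lam t)"
  "!!t v. \<bar>t\<bar> < \<delta> ==> ?A (t, v) = 0 ==> v = 0"
  by (rule smooth_linear_solve[OF \<epsilon>(1) sA lA iA0 su]) (assumption, assumption, rule that, assumption+)
 show thesis by (rule that[OF w(1) _ w(3)]) (use w \<epsilon> inW in auto)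
qed

lemma control_field_chart:
 assumes t: "0 <= t" "t < \<delta>0" "(t, gam t) \<in> Wc" and w: "Mx (t, gam t, w) = us (gam t, lam t)"
  "!!v. Mx (t, gam t, v) = 0 ==> v = 0" and y: "(t, y) \<in> Wc"
 shows "tcomp S c (cinv c y) (control_field S \<gamma> u E t (cinv c y)) = f (y, Mx (t, y, w))"
proof -
 have g: "gam t \<in> Om" using t(3) by (simp add: Wc_def)
 have "(THE w. E t (\<gamma> t) w = u t) = w"
 proof (rule the_equality)
  show "E t (\<gamma> t) w = u t" unfolding \<gamma>[OF t(1,2)] u[OF t(1,2)] E_fp[OF t(3)] w ..
  fix v assume "E t (\<gamma> t) v = u t"
  then have "fp (gam t, Mx (t, gam t, v)) = fp (gam t, Mx (t, gam t, w))"
   unfolding \<gamma>[OF t(1,2)] u[OF t(1,2)] E_fp[OF t(3)] w .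
  then have "Mx (t, gam t, v) = Mx (t, gam t, w)" using fp(2)[OF g] by metis
  then have "Mx (t, gam t, v - w) = 0"
   using linear_diff[OF frame_linear(1)[OF t(3)], of v w] by (simp add: Mx_eq[OF t(3)])
  then show "v = w" using w(2) by force
 qed
 then show ?thesis
  unfolding control_field_def f_def fst_conv by (simp add: E_fp[OF y])
qed

end

lemma Hausdorff_space_euclidean_t2: "Hausdorff_space (euclidean :: 'a::t2_space topology)"
 unfolding Hausdorff_space_def using hausdorff by (auto simp: disjnt_def)

context framed_geodesic
begin

text \<open>The given flow satisfies its differential equation trajectory by trajectory. A smooth
  solution \<open>\<Phi>\<close> comes from the flow theorem for the autonomous system with time as
  additional variable; local uniqueness and connectedness of \<open>{0..s}\<close> identify it with
  \<open>Q\<close> at nonnegative times.\<close>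

lemma flow_in_chart:
 assumes \<delta>: "0 < \<delta>" "\<delta> <= \<delta>0" and w: "smooth_on {+-\<delta>} w" "!!t. \<bar>t\<bar> < \<delta> ==> (t, gam t) \<in> Wc"
  "!!t. \<bar>t\<bar> < \<delta> ==> Mx (t, gam t, w t) = us (gam t, lam t)"
  "!!t v. \<bar>t\<bar> < \<delta> ==> Mx (t, gam t, v) = 0 ==> v = 0"
 obtains \<delta>' d \<Phi> where "0 < \<delta>'" "\<delta>' <= \<delta>" "0 < d" "smooth_on ({+-\<delta>'} \<times> ball y0 d) \<Phi>"
  "!!z. z \<in> {+-\<delta>'} \<times> ball y0 d ==> \<Phi> z \<in> ball y0 \<rho> \<and> (fst z, \<Phi> z) \<in> Wc"
  "!!x. x \<in> ball y0 d ==> \<Phi> (0, x) = x"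
  "!!s x. (s, x) \<in> {+-\<delta>'} \<times> ball y0 d ==>
   ((\<lambda>s. \<Phi> (s, x)) has_vector_derivative f (\<Phi> (s, x), Mx (s, \<Phi> (s, x), w s))) (at s)"
  "!!s. \<bar>s\<bar> < \<delta>' ==> \<Phi> (s, y0) = gam s"
  "!!s x. 0 <= s ==> s < \<delta>' ==> x \<in> ball y0 d ==> Q s (cinv c x) = cinv c (\<Phi> (s, x))"
proof -
 define A0 where "A0 = Wc \<inter> ({+-\<delta>} \<times> UNIV)"
 define F where "F = (\<lambda>z. (1 :: real, f (snd z, Mx (fst z, snd z, w (fst z)))))"
 have oA: "open A0" unfolding A0_def by (intro open_Int open_Wc open_Times) auto
 have sw: "smooth_on A0 (\<lambda>z. w (fst z))"
  by (rule smooth_compose[OF oA _ _ w(1) smooth_fst[OF oA smooth_id[OF oA]]]) (auto simp: A0_def)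
 have sM: "smooth_on A0 (\<lambda>z. Mx (fst z, snd z, w (fst z)))"
  by (rule smooth_compose[OF oA open_W3 _ smooth_Mx smooth_Pair[OF oA smooth_fst[OF oA smooth_id[OF oA]]
     smooth_Pair[OF oA smooth_snd[OF oA smooth_id[OF oA]] sw]]]) (auto simp: A0_def W3_def)
 have sf: "smooth_on A0 (\<lambda>z. f (snd z, Mx (fst z, snd z, w (fst z))))"
  by (rule smooth_compose[OF oA open_Times[OF open_Om open_UNIV] _ f
     smooth_Pair[OF oA smooth_snd[OF oA smooth_id[OF oA]] sM]]) (auto simp: A0_def Wc_def)
 have sF: "smooth_on A0 F" unfolding F_def by (intro smooth_Pair oA smooth_const sf)
 have z0: "(0, y0) \<in> A0" using start_Wc \<delta> by (simp add: A0_def)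
 obtain \<tau>1 r1 \<phi> where \<phi>: "\<tau>1 > 0" "r1 > 0" "smooth_on ({+-\<tau>1} \<times> ball (0, y0) r1) \<phi>"
  "!!z. z \<in> ball (0, y0) r1 ==> \<phi> (0, z) = z"
  "!!s z. \<bar>s\<bar> < \<tau>1 ==> z \<in> ball (0, y0) r1 ==> \<phi> (s, z) \<in> A0"
  "!!s z. \<bar>s\<bar> < \<tau>1 ==> z \<in> ball (0, y0) r1 ==> ((\<lambda>s. \<phi> (s, z)) has_vector_derivative F (\<phi> (s, z))) (at s)"
  using smooth_local_flow[OF oA sF z0] by metis
 define \<Phi> where "\<Phi> = (\<lambda>z. snd (\<phi> (fst z, (0, snd z))))"
 have b0: "(0, x) \<in> ball (0, y0) r1" if "x \<in> ball y0 r1" for x using that by (simp add: dist_Pair_Pair)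
 have fst\<phi>: "fst (\<phi> (s, (0, x))) = s" if s: "\<bar>s\<bar> < \<tau>1" and x: "x \<in> ball y0 r1" for s x
 proof -
  have "((\<lambda>s. fst (\<phi> (s, (0, x))) - s) has_vector_derivative 0) (at t within {+-\<tau>1})" if "t \<in> {+-\<tau>1}" for t
  proof -
   have "\<bar>t\<bar> < \<tau>1" using that by auto
   from bounded_linear.has_vector_derivative[OF bounded_linear_fst \<phi>(6)[OF this b0[OF x]]]
   have "((\<lambda>s. fst (\<phi> (s, (0, x))) - s) has_vector_derivative fst (F (\<phi> (t, (0, x)))) - 1) (at t)"
    by (intro has_vector_derivative_diff has_vector_derivative_id)
   then show ?thesis by (simp add: F_def has_vector_derivative_at_within)
  qed
  from has_vector_derivative_zero_constant[OF convex_real_interval(8) this]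
  obtain k where k: "!!t. t \<in> {+-\<tau>1} ==> fst (\<phi> (t, (0, x))) - t = k" by blast
  have "k = 0" using k[of 0] \<phi>(1) \<phi>(4)[OF b0[OF x]] by simp
  then show ?thesis using k[of s] s by (simp add: abs_less_iff)
 qed
 have \<phi>\<Phi>: "\<phi> (s, (0, x)) = (s, \<Phi> (s, x))" if "\<bar>s\<bar> < \<tau>1" "x \<in> ball y0 r1" for s x
  using fst\<phi>[OF that] by (simp add: \<Phi>_def prod_eq_iff)
 let ?D = "{+-\<tau>1} \<times> ball y0 r1"
 have oD: "open ?D" by (simp add: open_Times)
 have s\<Phi>: "smooth_on ?D \<Phi>" unfolding \<Phi>_def
  by (intro smooth_snd oD smooth_compose[OF oD _ _ \<phi>(3)])
   (use b0 in "auto intro!: open_Times smooth_Pair smooth_fst smooth_snd smooth_id oD")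
 \<comment> \<open>The geodesic is itself a trajectory of this field, because on it the frame
   coordinates \<open>w\<close> give the maximizing control.\<close>
 obtain e where e: "e > 0" "!!t. t \<in> {-1..1} ==> \<bar>t - 0\<bar> < e ==> \<phi> (t, (0, y0)) = (t, gam t)"
 proof -
  have "\<exists>e>0. \<forall>t\<in>{-1..1}. \<bar>t - 0\<bar> < e --> \<phi> (t, (0, y0)) = (t, gam t)"
  proof (rule ode_unique_near[OF oA sF, where d = "min \<tau>1 \<delta>"])
   show "\<phi> (0, 0, y0) = (0, gam 0)" "\<phi> (0, 0, y0) \<in> A0" using \<phi>(4)[OF b0] \<phi>(2) z0 by (simp_all add: gam_0)
   show "min \<tau>1 \<delta> > 0" using \<phi>(1) \<delta> by simp
   fix t :: real assume t: "\<bar>t - 0\<bar> < min \<tau>1 \<delta>"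
   show "((\<lambda>t. \<phi> (t, 0, y0)) has_vector_derivative F (\<phi> (t, 0, y0))) (at t within {-1..1})"
    by (rule has_vector_derivative_at_within[OF \<phi>(6)]) (use t b0 \<phi>(2) in auto)
   have tt: "t \<in> {+-\<tau>}" "\<bar>t\<bar> < \<delta>" using t \<delta> \<delta>0 by auto
   have "((\<lambda>t. (t, gam t)) has_vector_derivative (1, fu (gam t, lam t))) (at t)"
    by (intro has_vector_derivative_Pair has_vector_derivative_id gam_derivative tt)
   then show "((\<lambda>t. (t, gam t)) has_vector_derivative F (t, gam t)) (at t within {-1..1})"
    using w(3)[OF tt(2)] by (simp add: F_def fu_def has_vector_derivative_at_within)
  qed simp
  then show thesis using that by blast
 qed
 obtain Nx where Nx: "open Nx" "\<gamma> 0 \<in> Nx" "!!x. x \<in> Nx ==> Q 0 x = x" "!!x. x \<in> Nx ==> continuous_on {0..T} (\<lambda>t. Q t x)"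
  "!!x t. x \<in> Nx ==> t \<in> {0..T} ==> (t, Q t x) \<in> Wd \<and> velocity S {0..T} (\<lambda>s. Q s x) t (control_field S \<gamma> u E t (Q t x))"
  using flow unfolding local_flow_def by metis
 define V where "V = snd c ` (fst c \<inter> Nx)"
 have oV: "open V" unfolding V_def by (rule open_chart_image[OF c(1) Nx(1)])
 have yV: "y0 \<in> V" unfolding V_def y0_def using c(2) Nx(2) \<gamma>[of 0] \<delta>0(1) cinv_y0 by (simp add: gam_0)
 have "open (?D \<inter> \<Phi> -` ball y0 \<rho>)" by (rule continuous_open_preimage[OF smooth_continuous[OF s\<Phi>] oD]) simp
 moreover have "(0, y0) \<in> ?D \<inter> \<Phi> -` ball y0 \<rho>"
  using \<phi>(1,2) \<phi>(4)[OF b0] pos by (simp add: \<Phi>_def)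
 ultimately obtain I V0 where IV: "open I" "open V0" "0 \<in> I" "y0 \<in> V0" "I \<times> V0 \<subseteq> ?D \<inter> \<Phi> -` ball y0 \<rho>"
  using open_prod_elim by (metis mem_Sigma_iff)
 obtain e1 where e1: "e1 > 0" "ball 0 e1 \<subseteq> I" using IV(1,3) open_contains_ball by blast
 obtain d where d: "d > 0" "ball y0 d \<subseteq> V0 \<inter> V"
  using open_contains_ball[of "V0 \<inter> V"] IV(2,4) oV yV by blast
 define \<delta>' where "\<delta>' = min (min 1 \<delta>) (min e e1)"
 have \<delta>': "0 < \<delta>'" "\<delta>' <= \<delta>" "\<delta>' <= 1" "\<delta>' <= e" "\<delta>' <= e1" using \<delta> e(1) e1(1) by (auto simp: \<delta>'_def)
 have N: "\<bar>s\<bar> < \<tau>1" "x \<in> ball y0 r1" "\<Phi> (s, x) \<in> ball y0 \<rho>" if "s \<in> {+-\<delta>'}" "x \<in> ball y0 d" for s x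
 proof -
  have "s \<in> ball 0 e1" using that(1) \<delta>'(5) by auto
  then have "(s, x) \<in> ?D \<inter> \<Phi> -` ball y0 \<rho>" using that e1(2) d(2) IV(5) by blast
  then show "\<bar>s\<bar> < \<tau>1" "x \<in> ball y0 r1" "\<Phi> (s, x) \<in> ball y0 \<rho>" by auto
 qed
 have A0: "(s, \<Phi> (s, x)) \<in> A0" if "s \<in> {+-\<delta>'}" "x \<in> ball y0 d" for s x
  using \<phi>(5)[OF N(1)[OF that] b0[OF N(2)[OF that]]] \<phi>\<Phi>[OF N(1,2)[OF that]] by simp
 have d\<Phi>: "((\<lambda>s. \<Phi> (s, x)) has_vector_derivative f (\<Phi> (s, x), Mx (s, \<Phi> (s, x), w s))) (at s)"
  if "s \<in> {+-\<delta>'}" "x \<in> ball y0 d" for s x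
  using bounded_linear.has_vector_derivative[OF bounded_linear_snd \<phi>(6)[OF N(1)[OF that] b0[OF N(2)[OF that]]]]
  by (simp add: \<phi>\<Phi>[OF N(1,2)[OF that]] F_def) (simp add: \<Phi>_def)
 have \<Phi>0: "\<Phi> (0, x) = x" if "x \<in> ball y0 d" for x
  using \<phi>(4)[OF b0[OF N(2)[OF _ that]], of 0] \<delta>'(1) by (simp add: \<Phi>_def)
 have Q: "Q s (cinv c x) = cinv c (\<Phi> (s, x))" if s: "0 <= s" "s < \<delta>'" and x: "x \<in> ball y0 d" for s x
 proof -
  have sT: "{0..s} \<subseteq> {0..T}" using s \<delta>' \<delta> \<delta>0 by auto
  have xN: "cinv c x \<in> Nx" using x d(2) image_chart[OF c(1), of x Nx] by (auto simp: V_def)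
  have in\<delta>: "\<sigma> \<in> {+-\<delta>'}" if "\<sigma> \<in> {0..s}" for \<sigma> using that s by auto
  have \<Phi>O: "\<Phi> (\<sigma>, x) \<in> Om" if "\<sigma> \<in> {0..s}" for \<sigma> using A0[OF in\<delta>[OF that] x] by (simp add: A0_def Wc_def)
  have cQ: "continuous_on {0..s} (\<lambda>\<sigma>. Q \<sigma> (cinv c x))" by (rule continuous_on_subset[OF Nx(4)[OF xN] sT])
  have xD: "(\<sigma>, x) \<in> ?D" if "\<sigma> \<in> {0..s}" for \<sigma>
   using N(1,2)[OF in\<delta>[OF that] x] by (simp add: abs_less_iff)
  have "continuous_on {0..s} (\<lambda>\<sigma>. \<Phi> (\<sigma>, x))"
   by (rule continuous_on_compose2[OF smooth_continuous[OF s\<Phi>]])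
    (intro continuous_intros, use xD in blast)
  then have c\<Phi>: "continuous_on {0..s} (\<lambda>\<sigma>. cinv c (\<Phi> (\<sigma>, x)))"
   by (rule continuous_on_compose2[OF continuous_cinv[OF c(1)]]) (use \<Phi>O OmD(5) in auto)
  \<comment> \<open>The set of agreement is closed since the manifold is Hausdorff, and open by
    local uniqueness in the chart. This also shows that \<open>Q\<close> does not leave the chart,
    which is not known beforehand.\<close>
  define Z where "Z = {\<sigma> \<in> {0..s}. Q \<sigma> (cinv c x) = cinv c (\<Phi> (\<sigma>, x))}"
  have "closedin (top_of_set {0..s}) Z"
   using closedin_continuous_maps_eq[of euclidean "top_of_set {0..s}" "\<lambda>\<sigma>. Q \<sigma> (cinv c x)" "\<lambda>\<sigma>. cinv c (\<Phi> (\<sigma>, x))"] cQ c\<Phi>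
   by (simp add: Z_def Hausdorff_space_euclidean_t2)
  moreover have "openin (top_of_set {0..s}) Z"
   unfolding openin_contains_ball
  proof (intro conjI ballI)
   show "Z \<subseteq> {0..s}" by (auto simp: Z_def)
   fix \<sigma>0 assume "\<sigma>0 \<in> Z"
   then have \<sigma>0: "\<sigma>0 \<in> {0..s}" "Q \<sigma>0 (cinv c x) = cinv c (\<Phi> (\<sigma>0, x))" by (auto simp: Z_def)
   define q where "q = (\<lambda>\<sigma>. snd c (Q \<sigma> (cinv c x)))"
   have oU: "open (cinv c ` Om)" by (rule open_cinv_image[OF c(1) open_Om]) (use OmD(5) in auto)
   have "((\<lambda>\<sigma>. Q \<sigma> (cinv c x)) \<longlongrightarrow> Q \<sigma>0 (cinv c x)) (at \<sigma>0 within {0..s})"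
    using cQ \<sigma>0(1) by (simp add: continuous_on_def)
   moreover have U0: "Q \<sigma>0 (cinv c x) \<in> cinv c ` Om" using \<sigma>0(2) \<Phi>O[OF \<sigma>0(1)] by simp
   ultimately have "\<forall>\<^sub>F \<sigma> in at \<sigma>0 within {0..s}. Q \<sigma> (cinv c x) \<in> cinv c ` Om"
    using oU topological_tendstoD by blast
   then obtain d1 where d1: "d1 > 0" "!!\<sigma>. \<sigma> \<in> {0..s} ==> \<sigma> \<noteq> \<sigma>0 ==> \<bar>\<sigma> - \<sigma>0\<bar> < d1 ==> Q \<sigma> (cinv c x) \<in> cinv c ` Om"
    unfolding eventually_at by (auto simp: dist_real_def)
   have q: "q \<sigma> \<in> Om" "Q \<sigma> (cinv c x) = cinv c (q \<sigma>)" if "\<sigma> \<in> {0..s}" "\<bar>\<sigma> - \<sigma>0\<bar> < d1" for \<sigma>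
   proof -
    have "Q \<sigma> (cinv c x) \<in> cinv c ` Om" using d1(2)[OF that(1) _ that(2)] U0 by (cases "\<sigma> = \<sigma>0") auto
    then show "q \<sigma> \<in> Om" "Q \<sigma> (cinv c x) = cinv c (q \<sigma>)" using OmD(2) by (auto simp: q_def)
   qed
   have "\<exists>e>0. \<forall>\<sigma>\<in>{0..s}. \<bar>\<sigma> - \<sigma>0\<bar> < e --> (\<sigma>, q \<sigma>) = \<phi> (\<sigma>, (0, x))"
   proof (rule ode_unique_near[OF oA sF \<sigma>0(1) _ _ d1(1)])
    show "(\<sigma>0, q \<sigma>0) = \<phi> (\<sigma>0, 0, x)" "(\<sigma>0, q \<sigma>0) \<in> A0"
     using \<phi>\<Phi>[OF N(1,2)[OF in\<delta>[OF \<sigma>0(1)] x]] A0[OF in\<delta>[OF \<sigma>0(1)] x] OmD(2)[OF \<Phi>O[OF \<sigma>0(1)]]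
     by (simp_all add: q_def \<sigma>0(2))
    fix \<sigma> assume \<sigma>: "\<sigma> \<in> {0..s}" "\<bar>\<sigma> - \<sigma>0\<bar> < d1"
    show "((\<lambda>\<sigma>. \<phi> (\<sigma>, 0, x)) has_vector_derivative F (\<phi> (\<sigma>, 0, x))) (at \<sigma> within {0..s})"
     by (rule has_vector_derivative_at_within[OF \<phi>(6)[OF N(1)[OF in\<delta>[OF \<sigma>(1)] x] b0[OF N(2)[OF in\<delta>[OF \<sigma>(1)] x]]]])
    have \<sigma>T: "\<sigma> \<in> {0..T}" using \<sigma>(1) sT by blast
    have \<sigma>\<delta>: "0 <= \<sigma>" "\<sigma> < \<delta>0" "\<bar>\<sigma>\<bar> < \<delta>" using \<sigma>(1) s \<delta>' \<delta> by auto
    note vel = Nx(5)[OF xN \<sigma>T]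
    have qW: "(\<sigma>, q \<sigma>) \<in> Wc" using vel q[OF \<sigma>] by (simp add: Wc_def)
    have cf: "tcomp S c (cinv c (q \<sigma>)) (control_field S \<gamma> u E \<sigma> (cinv c (q \<sigma>))) = f (q \<sigma>, Mx (\<sigma>, q \<sigma>, w \<sigma>))"
     by (rule control_field_chart[OF \<sigma>\<delta>(1,2) w(2,3)[OF \<sigma>\<delta>(3)] _ qW]) (rule w(4)[OF \<sigma>\<delta>(3)])
    have ct: "continuous (at \<sigma> within {0..T}) (\<lambda>\<sigma>. Q \<sigma> (cinv c x))"
     using Nx(4)[OF xN] \<sigma>T by (simp add: continuous_on_eq_continuous_within)
    have "(q has_vector_derivative tcomp S c (Q \<sigma> (cinv c x)) (control_field S \<gamma> u E \<sigma> (Q \<sigma> (cinv c x)))) (at \<sigma> within {0..T})"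
     unfolding q_def
     by (rule velocity_chart[OF _ ct \<sigma>T c(1)]) (use vel q[OF \<sigma>] OmD(1) in auto)
    then have "(q has_vector_derivative f (q \<sigma>, Mx (\<sigma>, q \<sigma>, w \<sigma>))) (at \<sigma> within {0..T})"
     unfolding q(2)[OF \<sigma>] cf .
    then have "(q has_vector_derivative f (q \<sigma>, Mx (\<sigma>, q \<sigma>, w \<sigma>))) (at \<sigma> within {0..s})"
     by (rule has_vector_derivative_within_subset[OF _ sT])
    then show "((\<lambda>\<sigma>. (\<sigma>, q \<sigma>)) has_vector_derivative F (\<sigma>, q \<sigma>)) (at \<sigma> within {0..s})"
     unfolding F_def fst_conv snd_conv by (intro has_vector_derivative_Pair has_vector_derivative_id)
   qed
   then obtain e where e: "e > 0" "!!\<sigma>. \<sigma> \<in> {0..s} ==> \<bar>\<sigma> - \<sigma>0\<bar> < e ==> (\<sigma>, q \<sigma>) = \<phi> (\<sigma>, (0, x))" by blast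
   have "ball \<sigma>0 (min e d1) \<inter> {0..s} \<subseteq> Z"
   proof
    fix \<sigma> assume "\<sigma> \<in> ball \<sigma>0 (min e d1) \<inter> {0..s}"
    then have \<sigma>: "\<sigma> \<in> {0..s}" "\<bar>\<sigma> - \<sigma>0\<bar> < d1" "\<bar>\<sigma> - \<sigma>0\<bar> < e" by (auto simp: dist_real_def)
    have "q \<sigma> = \<Phi> (\<sigma>, x)" using e(2)[OF \<sigma>(1,3)] by (simp add: \<Phi>_def prod_eq_iff)
    then show "\<sigma> \<in> Z" using q(2)[OF \<sigma>(1,2)] \<sigma>(1) by (simp add: Z_def)
   qed
   then show "\<exists>e>0. ball \<sigma>0 e \<inter> {0..s} \<subseteq> Z" using e(1) d1(1) by (intro exI[of _ "min e d1"]) auto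
  qed
  moreover have "0 \<in> Z" using s Nx(3)[OF xN] \<Phi>0[OF x] by (simp add: Z_def)
  ultimately have "Z = {0..s}"
   using connected_Icc[of 0 s, unfolded connected_clopen, rule_format, of Z] by auto
  moreover have "s \<in> {0..s}" using s(1) by simp
  ultimately show ?thesis unfolding Z_def by blast
 qed
 show thesis
 proof (rule that[OF \<delta>'(1,2) d(1)])
  show "smooth_on ({+-\<delta>'} \<times> ball y0 d) \<Phi>"
  proof (rule smooth_subset[OF s\<Phi>], rule subsetI)
   fix z assume "z \<in> {+-\<delta>'} \<times> ball y0 d"
   then obtain s x where z: "z = (s, x)" "s \<in> {+-\<delta>'}" "x \<in> ball y0 d" by blast
   show "z \<in> ?D" using N(1,2)[OF z(2,3)] by (simp add: z(1) abs_less_iff)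
  qed
  show "\<Phi> z \<in> ball y0 \<rho> \<and> (fst z, \<Phi> z) \<in> Wc" if zN: "z \<in> {+-\<delta>'} \<times> ball y0 d" for z
  proof -
   obtain s x where z: "z = (s, x)" "s \<in> {+-\<delta>'}" "x \<in> ball y0 d" using zN by blast
   show ?thesis using N(3)[OF z(2,3)] A0[OF z(2,3)] by (simp add: z(1) A0_def)
  qed
  show "\<Phi> (s, y0) = gam s" if "\<bar>s\<bar> < \<delta>'" for s
   using e(2)[of s] that \<delta>' by (simp add: \<Phi>_def abs_less_iff)
 qed (use \<Phi>0 d\<Phi> Q in auto)
qed

end

context framed_geodesic
begin

text \<open>In coordinates the tangent map of the flow is the derivative of \<open>\<Phi>\<close>
  followed by a change of charts at the end point; injectivity turns the inverse in
  \<open>pulled_back_frame\<close> into the solution \<open>v\<close> of a linear equation.\<close>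

lemma pulled_back_frame_chart:
 assumes t: "0 <= t" "t < \<delta>0" "(t, gam t) \<in> Wc" and d: "d > 0"
  and \<Phi>: "\<Phi> differentiable at (t, y0)" "\<Phi> (t, y0) = gam t"
  "!!x. x \<in> ball y0 d ==> Q t (cinv c x) = cinv c (\<Phi> (t, x))"
  and v: "dd (0, v) \<Phi> (t, y0) = Fl (gam t) (Mx (t, gam t, axis k 1))"
  and inj: "!!v. dd (0, v) \<Phi> (t, y0) = 0 ==> v = 0"
 shows "pulled_back_frame S \<gamma> E Q k t = v"
proof -
 define x where "x = cinv c (gam t)"
 define ct where "ct = chart_at S x"
 have gO: "gam t \<in> Om" using t(3) by (simp add: Wc_def)
 have x: "x \<in> fst c" "snd c x = gam t" "ct \<in> atlas S" "x \<in> fst ct"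
  using OmD[OF gO] chart_at[of x] by (simp_all add: x_def ct_def)
 have \<gamma>0: "\<gamma> 0 = x0" using \<gamma>[of 0] \<delta>0(1) cinv_y0 by (simp add: gam_0)
 have Qt: "Q t x0 = x" using \<Phi>(3)[of y0] d cinv_y0 by (simp add: \<Phi>(2) x_def)
 define TM where "TM = tangent_map S (Q t) (\<gamma> 0)"
 have D1: "((\<lambda>y. \<Phi> (t, y)) has_derivative (\<lambda>v. dd (0, v) \<Phi> (t, y0))) (at y0)"
  by (rule has_derivative_slice_snd[OF dd_has_derivative[OF \<Phi>(1)]])
 have D2: "(snd ct \<circ> cinv c has_derivative trans c ct x) (at (\<Phi> (t, y0)))"
  using transition_derivative[OF c(1) x(3,1,4)] by (simp add: x(2) \<Phi>(2))
 have "((\<lambda>y. (snd ct \<circ> cinv c) (\<Phi> (t, y))) has_derivative (\<lambda>v. trans c ct x (dd (0, v) \<Phi> (t, y0)))) (at y0)"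
  by (rule has_derivative_compose[OF D1 D2])
 then have "(snd ct \<circ> Q t \<circ> cinv c has_derivative (\<lambda>v. trans c ct x (dd (0, v) \<Phi> (t, y0)))) (at y0)"
  by (rule has_derivative_transform_within_open[OF _ open_ball[of y0 d]]) (use d \<Phi>(3) in auto)
 then have TM: "TM v = trans c ct x (dd (0, v) \<Phi> (t, y0))" for v
  unfolding TM_def tangent_map_def \<gamma>0 Qt ct_def[symmetric] c_def[symmetric] y0_def[symmetric]
  by (rule dd_eqI)
 have l\<Phi>: "linear (\<lambda>v. dd (0, v) \<Phi> (t, y0))" by (rule linear_dd_snd[OF \<Phi>(1)])
 have "inj TM"
 proof (rule injI)
  fix v w assume "TM v = TM w"
  then have "dd (0, v) \<Phi> (t, y0) = dd (0, w) \<Phi> (t, y0)"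
   unfolding TM using trans_inverse[OF c(1) x(3,1,4)] by metis
  then show "v = w" using inj[of "v - w"] linear_diff[OF l\<Phi>, of v w] by simp
 qed
 moreover have "lin_dyn S (E t (\<gamma> t) (axis k 1)) = TM v"
 proof -
  let ?e = "fp (gam t, Mx (t, gam t, axis k 1))"
  have "tcomp S c x (lin_dyn S ?e) = dd (0, v) \<Phi> (t, y0)"
   using tcomp_lin_dyn[OF gO fp(1)[OF gO]] fp(2)[OF gO] by (simp add: x_def v)
  then have "TM v = trans c ct x (tcomp S c x (lin_dyn S ?e))" by (simp add: TM)
  also have "... = lin_dyn S ?e" unfolding tcomp_trans ct_def[symmetric] by (rule trans_inverse[OF x(3) c(1) x(4,1)])
  finally show ?thesis using \<gamma>[OF t(1,2)] E_fp[OF t(3)] by simp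
 qed
 ultimately show ?thesis unfolding pulled_back_frame_def TM_def[symmetric] by simp
qed

text \<open>The pulled back fields are smooth near 0 and have flat pairing with \<open>p\<close> by
  \<open>flat_second_variation\<close>, applied to the feedback whose frame coordinates
  \<open>w s\<close> do not depend on the point. So all their derivatives at 0 are orthogonal to
  \<open>p\<close>.\<close>

lemma flag_orthogonal:
 assumes flat: "flat_at_0 (\<lambda>t. Wf t p p)"
 shows "p \<bullet> ((\<lambda>g s. vector_derivative g (at s within {0..T})) ^^ j) (pulled_back_frame S \<gamma> E Q k) 0 = 0"
proof -
 obtain \<delta> w where w: "0 < \<delta>" "\<delta> <= \<delta>0" "smooth_on {+-\<delta>} w" "!!t. \<bar>t\<bar> < \<delta> ==> (t, gam t) \<in> Wc"
  "!!t. \<bar>t\<bar> < \<delta> ==> Mx (t, gam t, w t) = us (gam t, lam t)"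
  "!!t v. \<bar>t\<bar> < \<delta> ==> Mx (t, gam t, v) = 0 ==> v = 0"
  by (rule control_coordinates) (rule that, assumption+)
 obtain \<delta>' d \<Phi> where \<Phi>: "0 < \<delta>'" "\<delta>' <= \<delta>" "0 < d" "smooth_on ({+-\<delta>'} \<times> ball y0 d) \<Phi>"
  "!!z. z \<in> {+-\<delta>'} \<times> ball y0 d ==> \<Phi> z \<in> ball y0 \<rho> \<and> (fst z, \<Phi> z) \<in> Wc"
  "!!x. x \<in> ball y0 d ==> \<Phi> (0, x) = x"
  "!!s x. (s, x) \<in> {+-\<delta>'} \<times> ball y0 d ==>
   ((\<lambda>s. \<Phi> (s, x)) has_vector_derivative f (\<Phi> (s, x), Mx (s, \<Phi> (s, x), w s))) (at s)"
  "!!s. \<bar>s\<bar> < \<delta>' ==> \<Phi> (s, y0) = gam s"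
  "!!s x. 0 <= s ==> s < \<delta>' ==> x \<in> ball y0 d ==> Q s (cinv c x) = cinv c (\<Phi> (s, x))"
  by (rule flow_in_chart[OF w(1-5)]) (assumption, assumption, rule w(6), assumption, assumption, rule that, assumption+)
 let ?I = "{+-\<delta>'}"
 let ?N = "?I \<times> ball y0 d"
 have oN: "open ?N" by (simp add: open_Times)
 have y0N: "(t, y0) \<in> ?N" if "\<bar>t\<bar> < \<delta>'" for t using that \<Phi>(3) by (auto simp: abs_less_iff)
 let ?A = "\<lambda>z. dd (0, snd z) \<Phi> (fst z, y0)"
 have oI: "open (?I \<times> UNIV)" by (simp add: open_Times)
 have sA: "smooth_on (?I \<times> UNIV) ?A"
  by (rule smooth_dd_var[OF oI oN _ \<Phi>(4)])
   (use \<Phi>(3) oI in "auto intro!: smooth_Pair smooth_fst smooth_snd smooth_id")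
 have d\<Phi>: "\<Phi> differentiable at (t, y0)" if "\<bar>t\<bar> < \<delta>'" for t
  by (rule smooth_diffble[OF \<Phi>(4) y0N[OF that]])
 have lA: "linear (\<lambda>v. ?A (t, v))" if "\<bar>t\<bar> < \<delta>'" for t
  using linear_dd_snd[OF d\<Phi>[OF that]] by simp
 have A0: "v = 0" if "?A (0, v) = 0" for v
 proof -
  have "dd (0, v) \<Phi> (0, y0) = dd v (\<lambda>x. \<Phi> (0, x)) y0"
   by (rule dd_slice_snd[OF d\<Phi>, symmetric]) (use \<Phi>(1) in simp)
  also have "... = dd v (\<lambda>x. x) y0" by (rule dd_cong[OF open_ball[of y0 d]]) (use \<Phi>(3,6) in auto)
  also have "... = v" by (rule dd_eqI[OF has_derivative_ident])
  finally show ?thesis using that by simp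
 qed
 have ab: "\<bar>t\<bar> < \<delta>'" "\<bar>t\<bar> < \<delta>" if "t \<in> ?I" for t using that \<Phi>(2) by auto
 have tI: "t \<in> {+-\<tau>}" if "t \<in> ?I" for t using that \<Phi>(2) w(2) \<delta>0(2) by auto
 define ee where "ee = (\<lambda>t. Mx (t, gam t, axis k 1))"
 have sg: "smooth_on ?I gam" by (rule smooth_subset[OF smooth_gam]) (use tI in blast)
 have se: "smooth_on ?I ee" unfolding ee_def
  by (rule smooth_compose[OF _ open_W3 _ smooth_Mx])
   (use w(4) ab in "auto simp: W3_def intro!: smooth_Pair smooth_id sg")
 have sF: "smooth_on ?I (\<lambda>t. Fl (gam t) (ee t))"
  unfolding Fl_def
  by (intro smooth_diff smooth_compose[OF _ open_Times[OF open_Om open_UNIV] _ f] smooth_Pair sg se smooth_const)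
   (use gam_Om tI in auto)
 obtain \<delta>1 h where h: "0 < \<delta>1" "\<delta>1 <= \<delta>'" "smooth_on {+-\<delta>1} h" "!!t. \<bar>t\<bar> < \<delta>1 ==> ?A (t, h t) = Fl (gam t) (ee t)"
  "!!t v. \<bar>t\<bar> < \<delta>1 ==> ?A (t, v) = 0 ==> v = 0"
  by (rule smooth_linear_solve[OF \<Phi>(1) sA lA A0 sF]) (assumption, assumption, rule that, assumption+)
 have pf: "pulled_back_frame S \<gamma> E Q k t = h t" if t: "0 <= t" "t < \<delta>1" for t
 proof (rule pulled_back_frame_chart[where \<Phi> = \<Phi>, OF t(1) _ _ \<Phi>(3)])
  have t': "\<bar>t\<bar> < \<delta>'" "\<bar>t\<bar> < \<delta>1" using t h(2) by auto
  show "t < \<delta>0" "(t, gam t) \<in> Wc" using t' \<Phi>(2) w(2) by (auto intro!: w(4))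
  show "\<Phi> differentiable at (t, y0)" "\<Phi> (t, y0) = gam t" using d\<Phi>[OF t'(1)] \<Phi>(8)[OF t'(1)] by auto
  show "Q t (cinv c x) = cinv c (\<Phi> (t, x))" if "x \<in> ball y0 d" for x
   by (rule \<Phi>(9)[OF t(1) _ that]) (use t' in simp)
  show "dd (0, h t) \<Phi> (t, y0) = Fl (gam t) (Mx (t, gam t, axis k 1))" using h(4)[OF t'(2)] by (simp add: ee_def)
  show "v = 0" if "dd (0, v) \<Phi> (t, y0) = 0" for v by (rule h(5)[OF t'(2)]) (use that in simp)
 qed
 have sub: "{+-\<delta>1} \<times> ball y0 d \<subseteq> ?N" using h(2) by auto
 have sw: "smooth_on ?N (\<lambda>z. w (fst z))"
  by (rule smooth_compose[OF oN _ _ w(3) smooth_fst[OF oN smooth_id[OF oN]]]) (use \<Phi>(2) in auto)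
 have "smooth_on ?N (\<lambda>z. Mx (fst z, \<Phi> z, w (fst z)))"
  by (rule smooth_compose[OF oN open_W3 _ smooth_Mx smooth_Pair[OF oN smooth_fst[OF oN smooth_id[OF oN]]
     smooth_Pair[OF oN \<Phi>(4) sw]]]) (use \<Phi>(5) in "auto simp: W3_def")
 then have sG: "smooth_on ({+-\<delta>1} \<times> ball y0 d) (\<lambda>z. Mx (fst z, \<Phi> z, w (fst z)))"
  by (rule smooth_subset[OF _ sub])
 have "flat_at_0 (\<lambda>s. p \<bullet> h s)"
 proof (rule flat_second_variation[OF h(1) _ \<Phi>(3) refl smooth_subset[OF \<Phi>(4) sub] sG _ \<Phi>(6) _ _ _ flat])
  show "\<delta>1 <= \<tau>" using h(2) \<Phi>(2) w(2) \<delta>0(2) by simp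
  show "\<Phi> z \<in> ball y0 \<rho>" if "z \<in> {+-\<delta>1} \<times> ball y0 d" for z using \<Phi>(5) that sub by blast
  show "((\<lambda>s. \<Phi> (s, x)) has_vector_derivative f (\<Phi> (s, x), Mx (fst (s, x), \<Phi> (s, x), w (fst (s, x))))) (at s)"
   if "(s, x) \<in> {+-\<delta>1} \<times> ball y0 d" for s x using \<Phi>(7)[OF subsetD[OF sub that]] by simp
  show "\<Phi> (s, y0) = gam s" if "\<bar>s\<bar> < \<delta>1" for s using \<Phi>(8) that h(2) by simp
  then show "Mx (fst (s, y0), \<Phi> (s, y0), w (fst (s, y0))) = us (gam s, lam s)" if "\<bar>s\<bar> < \<delta>1" for s
   using w(5)[of s] that h(2) \<Phi>(2) by simp
  show "dd (0, h s) \<Phi> (s, y0) = Fl (gam s) (ee s)" if "0 < s" "s < \<delta>1" for s using h(4)[of s] that by simp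
  show "smooth_on {+-\<delta>1} h" by (rule h(3))
  show "smooth_on {+-\<delta>1} ee" by (rule smooth_subset[OF se]) (use h(2) in auto)
 qed
 then have "p \<bullet> ((\<lambda>g. dd 1 g) ^^ j) h 0 = 0" by (rule flat_at_0_derivatives_eq_0[OF h(1,3)])
 moreover have "((\<lambda>g s. vector_derivative g (at s within {0..T})) ^^ j) (pulled_back_frame S \<gamma> E Q k) 0 = ((\<lambda>g. dd 1 g) ^^ j) h 0"
  by (rule iterated_vector_derivative[OF h(1) _ h(3) pf]) (use h \<Phi>(2) w(2) \<delta>0(3) in auto)
 ultimately show ?thesis by simp
qed

text \<open>A flat direction is orthogonal to the whole flag at time 0, hence to itself.\<close>

theorem ample_imp_not_flat:
 assumes "flag S T \<gamma> E Q m 0 = UNIV" and "flat_at_0 (\<lambda>t. Wf t p p)"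
 shows "p = 0"
proof -
 have "flag S T \<gamma> E Q m 0 \<subseteq> {x. p \<bullet> x = 0}"
  unfolding flag_def
 proof (rule span_minimal[OF _ subspace_hyperplane], rule subsetI)
  fix x assume "x \<in> {((\<lambda>g s. vector_derivative g (at s within {0..T})) ^^ j) (pulled_back_frame S \<gamma> E Q l) 0 | j l. j < m}"
  then obtain j l where "x = ((\<lambda>g s. vector_derivative g (at s within {0..T})) ^^ j) (pulled_back_frame S \<gamma> E Q l) 0" by blast
  then show "x \<in> {x. p \<bullet> x = 0}" using flag_orthogonal[OF assms(2)] by simp
 qed
 then have "p \<bullet> p = 0" using assms(1) by blast
 then show ?thesis by simp
qed

end

theorem theorem1:
  fixes S :: "('m::{t2_space,second_countable_topology}, 'n::finite, 'u::topological_space, 'r::finite)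
      control_problem"
    and T :: real and x\<^sub>0 :: 'm and \<eta> :: "real^'n" and \<gamma> :: "real \<Rightarrow> 'm" and u :: "real \<Rightarrow> 'u"
    and M' :: "'m set"
  assumes "affine_control_problem S"
    and "bracket_generating S"
    and "tonelli S"
    and "complete_hamiltonian_field S"
    and "0 < T"
    and "geodesic S T x\<^sub>0 \<eta> \<gamma> u"
    and "ample S T \<gamma> u"
    and "open M'" and "compact (closure M')" and "\<gamma> ` {0..T} \<subseteq> M'"
  shows "\<exists>\<epsilon> R. 0 < \<epsilon> \<and> \<epsilon> \<le> T \<and>
    (\<forall>t\<in>{0<..<\<epsilon>}. is_cost_operator S M' \<gamma> x\<^sub>0 \<eta> t (cost_operator S M' \<gamma> x\<^sub>0 \<eta> t)) \<and>
    (\<forall>t\<in>{0<..<\<epsilon>}. \<forall>v\<in>distribution S x\<^sub>0. R t v = t\<^sup>2 *\<^sub>R cost_operator S M' \<gamma> x\<^sub>0 \<eta> t v) \<and>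
    (\<forall>v\<in>distribution S x\<^sub>0. smooth_curve_on {0..<\<epsilon>} (\<lambda>t. R t v)) \<and>
    (\<forall>t\<in>{0..<\<epsilon>}. symmetric_operator S x\<^sub>0 \<eta> (R t)) \<and>
    (\<forall>v\<in>distribution S x\<^sub>0.
       ((\<lambda>t. t\<^sup>2 *\<^sub>R cost_operator S M' \<gamma> x\<^sub>0 \<eta> t v) \<longlongrightarrow> R 0 v) (at_right 0) \<and>
       ham_inner S x\<^sub>0 \<eta> (R 0 v) v \<ge> ham_inner S x\<^sub>0 \<eta> v v \<and>
       (v \<noteq> 0 \<longrightarrow> ham_inner S x\<^sub>0 \<eta> v v > 0) \<and>
       ((\<lambda>t. R t v) has_vector_derivative 0) (at 0 within {0..<\<epsilon>}))"
proof -
  interpret affine_tonelli S by unfold_locales (rule assms)+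
  obtain \<Lambda> where \<Lambda>: "hamiltonian_curve S \<Lambda>" "\<Lambda> 0 = (x\<^sub>0, \<eta>)"
    "\<And>t. t \<in> {0..T} \<Longrightarrow> \<gamma> t = fst (\<Lambda> t) \<and> u t = maximizer S (fst (\<Lambda> t)) (snd (\<Lambda> t))"
    using assms(6) unfolding geodesic_def by blast
  have \<gamma>0: "\<gamma> 0 = x\<^sub>0" using \<Lambda>(2) \<Lambda>(3)[of 0] assms(5) by simp
  then have xM: "x\<^sub>0 \<in> M'" using assms(5,10) by force
  obtain b where b: "b \<in> trivs S" "x\<^sub>0 \<in> fst b" using triv_exists by blast
  interpret geodesic_chart S M' x\<^sub>0 b by unfold_locales (use assms(8) xM b in auto)
  obtain \<tau> r \<rho> X P A Y B1 B2 where ef: "extremal_field Om f l y0 \<eta> \<tau> r \<rho> X P A Y B1 B2"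
    by (rule extremal_field_exists[OF y0_in])
  interpret geodesic_field S M' x\<^sub>0 b \<eta> \<tau> r \<rho> X P A Y B1 B2
    by (rule geodesic_field.intro[OF geodesic_chart_axioms geodesic_field_axioms.intro[OF ef]])
  obtain \<delta> where \<delta>: "\<delta> > 0" "\<delta> \<le> \<tau>" "\<And>t. \<bar>t\<bar> < \<delta> \<Longrightarrow> fst (\<Lambda> t) = cinv c (gam t) \<and>
      maximizer S (fst (\<Lambda> t)) (snd (\<Lambda> t)) = fp (gam t, us (gam t, lam t))"
    using geodesic_in_chart[OF \<Lambda>(1,2)] by blast
  define \<delta>0 where "\<delta>0 = min \<delta> T"
  have \<delta>0: "0 < \<delta>0" "\<delta>0 \<le> \<tau>" "\<delta>0 \<le> T" using \<delta> assms(5) by (auto simp: \<delta>0_def)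
  have \<gamma>u: "\<gamma> t = cinv c (gam t)" "u t = fp (gam t, us (gam t, lam t))" if "0 \<le> t" "t < \<delta>0" for t
    using \<Lambda>(3)[of t] \<delta>(3)[of t] that by (auto simp: \<delta>0_def)
  obtain Wd E Q where W: "frame_along S T \<gamma> Wd E" "local_flow S T (\<gamma> 0) Wd (control_field S \<gamma> u E) Q"
    "\<forall>t\<in>{0..T}. \<exists>m. flag S T \<gamma> E Q m t = UNIV"
    using assms(7) unfolding ample_def by blast
  obtain m where m: "flag S T \<gamma> E Q m 0 = UNIV" using W(3) assms(5) by (metis atLeastAtMost_iff less_imp_le order_refl)
  interpret framed_geodesic S M' x\<^sub>0 b \<eta> \<tau> r \<rho> X P A Y B1 B2 T \<gamma> u Wd E Q \<delta>0
    by unfold_locales (use \<delta>0 \<gamma>u W in auto)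
  show ?thesis
    by (rule cost_operator_asymptotics[OF assms(9) \<delta>0(1) \<gamma>(1) ample_imp_not_flat[OF m] assms(5)]) simp_all
qed

end
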